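(* Let $\mathcal C$ be a cyclic $A_\infty$-category of dimension $d$ and $s$ a splitting of its non-commutative Hodge filtration, and let $\mathcal K_m=\mathcal K_s^m$ ($m\ge1$) be the associated graph-sum maps. For $m>1$, $x_1,\dots,x_m\in\mathcal F^c(\mathcal C)[6-2d]$ and $1\le i\neq j\le m$ one has $$(-1)^*\mathcal K_{m-1}\big((x_i\cdot x_j)\odot x_1\odot\cdots\hat{x_i}\cdots\hat{x_j}\cdots\odot x_m\big)=\gamma\,\mathcal K_m(x_1\odot\cdots\odot x_m)+\sum_{\substack{L_1\sqcup L_2=\{1,\dots,m\}\\ i\in L_1,\ j\in L_2}}(-1)^{\#}\,\mathcal K_{|L_1|}\Big(\bigodot_{l\in L_1}x_l\Big)\cdot\mathcal K_{|L_2|}\Big(\bigodot_{l\in L_2}x_l\Big),$$ where $(-1)^*$ is the Koszul sign of the permutation bringing $x_1,\dots,x_m$ into the order $x_i,x_j,x_1,\dots,\hat{x_i},\dots,\hat{x_j},\dots,x_m$, and $(-1)^{\#}$ is the Koszul sign of the shuffle bringing $x_1,\dots,x_m$ into the order given by the elements of $L_1$ (increasing) followed by those of $L_2$ (increasing).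
   Context: **Conventions.** $k$ is a field of characteristic $0$. Signs written $\pm$ are Koszul signs. $V[n]$ denotes the shift with $V[n]^i=V^{i+n}$ in cohomological grading. All shifts by $6-2d$ are even and do not affect signs; $x\cdot y$ is the product of the algebra $Sym(\mathcal H)\llbracket\gamma\rrbracket$ below, $\odot$ is the product of the outer symmetric (co)algebra. **Categories.** $A_\infty$-categories over $k$ are strictly unital, with compositions $m^n$. A cyclic $A_\infty$-category of dimension $d$ is an $A_\infty$-category with finite-dimensional Hom spaces together with symmetric non-degenerate chain maps $\langle\_,\_\rangle: Hom(\mu,\lambda)\otimes Hom(\lambda,\mu)\to k[-d]$ such that $\langle m^n(a_1,\dots,a_n),a_{n+1}\rangle$ is (graded) cyclically invariant for all $n$. $CH_*(\mathcal C)$ is the (reduced) Hochschild chain complex, homologically graded, with differential $d_{Hoch}$ and Connes operator $B$ of degree $+1$; $u$ has homological degree $-2$. The Mukai pairing is the degree $0$ pairing $$\langle a_0[a_1|\dots|a_p],b_0[b_1|\dots|b_q]\rangle_M=\sum\pm\, \mathrm{str}\big(c\mapsto m(a_j,\dots,a_p,a_0,\dots,a_i,m(a_{i+1},\dots,a_{j-1},c,b_l,\dots,b_q,b_0,\dots,b_t),b_{t+1},\dots,b_{l-1})\big),$$ where $c$ runs over the Hom spaces for which the expression is composable, $\mathrm{str}$ is the supertrace, and the sum is over all $i<j$, $t<l$. **Splitting.** A splitting of the non-commutative Hodge filtration is a chain map $s:(CH_*(\mathcal C),d_{Hoch})\to(CH_*(\mathcal C)\llbracket u\rrbracket,d_{Hoch}+uB)$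 with $\pi\circ s=id$, where $\pi$ is the projection $u\mapsto 0$. Write its $u$-linear extension as $R=\sum_{n\ge0}R_nu^n$ ($R_0=id$) and its inverse as $T=\sum_{n\ge0}T_nu^n$. **The algebra.** $\mathcal H:=(CH_*(\mathcal C)[u^{-1}][d-2])^{-*}$, where $-*$ means reversing the grading, so $xu^{-i}$ with $x$ of homological degree $n$ has degree $2-d-n-2i$. As a graded algebra $\mathcal F^c(\mathcal C)=Sym(\mathcal H)\llbracket\gamma\rrbracket$, $|\gamma|=6-2d$; so is $\mathcal F^c(\mathcal C)^{triv}$. Let $\Delta_c$ be the second order operator on $Sym(\mathcal H)$ vanishing on $Sym^{\le1}$ with $\Delta_c(x\cdot y)=\pm\langle Bx_0,y_0\rangle_M$ for $x=\sum_i x_iu^{-i}$, $y=\sum_i y_iu^{-i}$. **The form $H_s^{sym}$.** This is the graded symmetric bilinear form on $\mathcal H$ of (even) degree $2d-6$ obtained by graded symmetrization of $$H(\alpha u^{-i},\beta u^{-j})=\pm(-1)^j\Big\langle \sum_{l=0}^{j}R_lT_{i+j+1-l}\,\alpha,\ \beta\Big\rangle_M,$$ signs normalized so that $\Delta_c(x\cdot y)=-\big(H^{sym}_s(Dx,y)+(-1)^{|x|}H^{sym}_s(x,Dy)\big)$ with $D=d_{Hoch}+uB$. **Graphs.** A labeled graph is a finite graph $G$, possibly with leaves, loops and multiple edges, with a label $g(v)\in\mathbb Z_{\ge0}$ on every vertex $v$. $h_v$ is the set of half-edges (including leaves) at $v$. The betti number is $g(G)=\sum_vg(v)+\mathrm{rank}\,H_1(G)$.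 A marking of a graph with $m$ vertices is a bijection $f:\{1,\dots,m\}\to V_G$; isomorphisms of marked labeled graphs preserve labels and markings (leaves and half-edges may be permuted). $\widetilde{\Gamma(g,n)}_m$ is the set of isomorphism classes of connected marked labeled graphs with betti number $g$, $n\ge0$ leaves and $m$ vertices. **The maps $\mathcal K_s^m$.** They are the degree $0$ maps $Sym^m(\mathcal F^c(\mathcal C)[6-2d])\to\mathcal F^c(\mathcal C)^{triv}[6-2d]$, $$\mathcal K^m_s=\sum_{g,n}\ \sum_{(G,f)\in\widetilde{\Gamma(g,n)}_m}\frac1{|Aut(G,f)|}K_{(G,f)}.$$ With $g_i=g(f(i))$, $n_i=|h_{f(i)}|$, $K_{(G,f)}$ is nonzero only on tensors $y_1\gamma^{g_1}\otimes\cdots\otimes y_m\gamma^{g_m}$ with $y_i\in Sym^{n_i}(\mathcal H)$, where $K_{(G,f)}(y_1\gamma^{g_1},\dots,y_m\gamma^{g_m})=Z\gamma^g$ and $Z\in Sym^n(\mathcal H)$ is computed as follows: decorate the half-edges at the vertex $f(i)$ by the desymmetrization $\widetilde{y_i}=\sum_{\sigma\in\Sigma_{n_i}}\pm x_{\sigma(1)}\otimes\cdots\otimes x_{\sigma(n_i)}$ of $y_i=x_1\cdots x_{n_i}$; tensor over all vertices in the order given by $f$; for each internal edge contract the two corresponding tensor factors with $H_s^{sym}$ (with Koszul signs from moving them to the front); project the remaining factors, which correspond to the leaves, to $Sym^n(\mathcal H)$. *)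

theory Defs
  imports Complex_Main "HOL-Library.Poly_Mapping" "HOL-Library.FuncSet" "HOL-Algebra.Module"
begin

section \<open>Free vector spaces and signs\<close>

abbreviation (input) keys where "keys \<equiv> Poly_Mapping.keys"
abbreviation (input) lookup where "lookup \<equiv> Poly_Mapping.lookup"
abbreviation (input) single where "single \<equiv> Poly_Mapping.single"

definition psign :: "int \<Rightarrow> 'a::ring_1" where
  "psign n = (if even n then 1 else -1)"

definition smul :: "'k::field \<Rightarrow> ('x \<Rightarrow>\<^sub>0 'k) \<Rightarrow> ('x \<Rightarrow>\<^sub>0 'k)" where
  "smul c p = Poly_Mapping.map ((*) c) p"

lemma lookup_smul: "lookup (smul c p) x = c * lookup p x"
  by (cases "lookup p x = 0") (simp_all add: smul_def Poly_Mapping.map.rep_eq when_def)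

lemma vector_space_smul: "vector_space (smul :: 'k::field \<Rightarrow> ('x \<Rightarrow>\<^sub>0 'k) \<Rightarrow> ('x \<Rightarrow>\<^sub>0 'k))"
  by unfold_locales (auto intro!: poly_mapping_eqI simp: lookup_smul lookup_add algebra_simps)

definition lin_ext :: "('x \<Rightarrow> ('y \<Rightarrow>\<^sub>0 'k::field)) \<Rightarrow> ('x \<Rightarrow>\<^sub>0 'k) \<Rightarrow> ('y \<Rightarrow>\<^sub>0 'k)" where
  "lin_ext f p = (\<Sum>x\<in>keys p. smul (lookup p x) (f x))"

definition bilin_ext :: "('x \<Rightarrow> 'y \<Rightarrow> 'k::field) \<Rightarrow> ('x \<Rightarrow>\<^sub>0 'k) \<Rightarrow> ('y \<Rightarrow>\<^sub>0 'k) \<Rightarrow> 'k" where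
  "bilin_ext f p q = (\<Sum>x\<in>keys p. \<Sum>y\<in>keys q. lookup p x * lookup q y * f x y)"

text \<open>The Koszul sign of bringing items \<open>0, 1, 2, \<dots>\<close> of degrees \<open>D 0, D 1, D 2, \<dots>\<close> from
  increasing order into the order given by the (distinct) list \<open>ps\<close>.\<close>

definition koszul :: "(nat \<Rightarrow> int) \<Rightarrow> nat list \<Rightarrow> 'k::comm_ring_1" where
  "koszul D ps = (\<Prod>(r, s)\<in>{(r, s). r < s \<and> s < length ps \<and> ps ! s < ps ! r}.
     psign (D (ps ! r) * D (ps ! s)))"


section \<open>Cyclic A-infinity categories\<close>

text \<open>A homogeneous morphism records its source, its (cohomological) degree and the underlying
  vector; the target is supplied by the context (the source of the next morphism).  A graded Hom
  space is a family of subspaces \<open>Hom C \<kappa> \<mu> e\<close> of an ambient vector space, one for each degree \<open>e\<close>.\<close>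

datatype ('o, 'v) hmor = Mor (src: 'o) (dg: int) (vct: 'v)

text \<open>In \<open>op_of C [a\<^sub>1, \<dots>, a\<^sub>n] \<tau>\<close> the morphisms are written in path order,
  \<open>a\<^sub>i \<in> Hom(\<kappa>\<^sub>i\<^sub>-\<^sub>1, \<kappa>\<^sub>i)\<close> with \<open>\<kappa>\<^sub>n = \<tau>\<close>.\<close>

record ('k, 'o, 'v) ainf =
  scl :: "'k \<Rightarrow> 'v \<Rightarrow> 'v"
  Obj :: "'o set"
  Hom :: "'o \<Rightarrow> 'o \<Rightarrow> int \<Rightarrow> 'v set"
  op_of :: "('o, 'v) hmor list \<Rightarrow> 'o \<Rightarrow> 'v"
  ident :: "'o \<Rightarrow> 'v"

definition mpath :: "('k, 'o, 'v) ainf \<Rightarrow> ('o, 'v) hmor list \<Rightarrow> 'o \<Rightarrow> bool" where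
  "mpath C as \<tau> \<longleftrightarrow> as \<noteq> [] \<and> \<tau> \<in> Obj C \<and> (\<forall>r<length as. src (as ! r) \<in> Obj C \<and>
     vct (as ! r) \<in> Hom C (src (as ! r)) ((map src as @ [\<tau>]) ! Suc r) (dg (as ! r)))"

text \<open>Total shifted degree \<open>|a\<^sub>1|' + \<dots> + |a\<^sub>n|'\<close>, where \<open>|a|' = |a| - 1\<close>.\<close>

definition sdeg :: "('o, 'v) hmor list \<Rightarrow> int" where
  "sdeg as = (\<Sum>a\<leftarrow>as. dg a - 1)"

text \<open>\<open>m\<^sup>n(a\<^sub>1, \<dots>, a\<^sub>n)\<close>, an operation of degree \<open>1\<close> in shifted degrees.  All signs below are the Koszul
  signs for shifted degrees.\<close>

definition mop :: "('k, 'o, 'v) ainf \<Rightarrow> ('o, 'v) hmor list \<Rightarrow> 'o \<Rightarrow> ('o, 'v) hmor" where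
  "mop C as \<tau> = Mor (src (hd as)) (sdeg as + 2) (op_of C as \<tau>)"

definition ident_mor :: "('k, 'o, 'v) ainf \<Rightarrow> 'o \<Rightarrow> ('o, 'v) hmor" where
  "ident_mor C \<kappa> = Mor \<kappa> 0 (ident C \<kappa>)"

definition A_infinity_category :: "('k::field, 'o, 'v::ab_group_add) ainf \<Rightarrow> bool" where
  "A_infinity_category C \<longleftrightarrow>
     vector_space (scl C) \<and>
     (\<forall>\<kappa>\<in>Obj C. \<forall>\<mu>\<in>Obj C. \<forall>e. module.subspace (scl C) (Hom C \<kappa> \<mu> e)) \<and>
     (\<forall>as \<tau>. mpath C as \<tau> \<longrightarrow> op_of C as \<tau> \<in> Hom C (src (hd as)) \<tau> (sdeg as + 2)) \<and>
     (\<forall>us vs \<kappa> e x y \<tau>. mpath C (us @ Mor \<kappa> e x # vs) \<tau> \<longrightarrow> mpath C (us @ Mor \<kappa> e y # vs) \<tau> \<longrightarrow>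
        op_of C (us @ Mor \<kappa> e (x + y) # vs) \<tau> =
        op_of C (us @ Mor \<kappa> e x # vs) \<tau> + op_of C (us @ Mor \<kappa> e y # vs) \<tau>) \<and>
     (\<forall>us vs \<kappa> e c x \<tau>. mpath C (us @ Mor \<kappa> e x # vs) \<tau> \<longrightarrow>
        op_of C (us @ Mor \<kappa> e (scl C c x) # vs) \<tau> = scl C c (op_of C (us @ Mor \<kappa> e x # vs) \<tau>)) \<and>
     (\<forall>as \<tau>. mpath C as \<tau> \<longrightarrow>
        (\<Sum>(i, j)\<in>{(i, j). i < j \<and> j \<le> length as}.
           scl C (psign (sdeg (take i as)))
             (op_of C (take i as
                @ [mop C (drop i (take j as)) ((map src as @ [\<tau>]) ! j)] @ drop j as) \<tau>)) = 0) \<and>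
     (\<forall>\<kappa>\<in>Obj C. ident C \<kappa> \<in> Hom C \<kappa> \<kappa> 0 \<and> op_of C [ident_mor C \<kappa>] \<kappa> = 0) \<and>
     (\<forall>a \<tau>. mpath C [a] \<tau> \<longrightarrow>
        op_of C [ident_mor C (src a), a] \<tau> = vct a \<and>
        op_of C [a, ident_mor C \<tau>] \<tau> = scl C (psign (dg a)) (vct a)) \<and>
     (\<forall>us vs \<kappa> \<tau>. mpath C (us @ ident_mor C \<kappa> # vs) \<tau> \<longrightarrow> length us + length vs \<ge> 2 \<longrightarrow>
        op_of C (us @ ident_mor C \<kappa> # vs) \<tau> = 0)"

text \<open>The pairing is symmetric for the unshifted degrees.  Cyclic invariance is graded by the shifted
  degrees and therefore involves the form \<open>(-1)\<^sup>|\<^sup>x\<^sup>| \<langle>x, y\<rangle>\<close>; for \<open>m\<^sup>2(a, b) = (-1)\<^sup>|\<^sup>a\<^sup>| a b\<close> this is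
  \<open>\<langle>a b, c\<rangle> = \<langle>a, b c\<rangle>\<close>.\<close>

definition cyclic_A_infinity_category ::
  "('k::field, 'o, 'v::ab_group_add) ainf \<Rightarrow> (('o, 'v) hmor \<Rightarrow> ('o, 'v) hmor \<Rightarrow> 'k) \<Rightarrow> int \<Rightarrow> bool"
where
  "cyclic_A_infinity_category C pr d \<longleftrightarrow>
     A_infinity_category C \<and>
     (\<forall>\<kappa>\<in>Obj C. \<forall>\<mu>\<in>Obj C. finite {e. Hom C \<kappa> \<mu> e \<noteq> {0}} \<and>
        (\<forall>e. \<exists>S. finite S \<and> module.span (scl C) S = Hom C \<kappa> \<mu> e)) \<and>
     (\<forall>\<kappa> e x y b. mpath C [Mor \<kappa> e x, b] \<kappa> \<longrightarrow> mpath C [Mor \<kappa> e y, b] \<kappa> \<longrightarrow>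
        pr (Mor \<kappa> e (x + y)) b = pr (Mor \<kappa> e x) b + pr (Mor \<kappa> e y) b) \<and>
     (\<forall>\<kappa> e c x b. mpath C [Mor \<kappa> e x, b] \<kappa> \<longrightarrow>
        pr (Mor \<kappa> e (scl C c x)) b = c * pr (Mor \<kappa> e x) b) \<and>
     (\<forall>a b. mpath C [a, b] (src a) \<longrightarrow>
        (dg a + dg b \<noteq> d \<longrightarrow> pr a b = 0) \<and>
        pr a b = psign (dg a * dg b) * pr b a \<and>
        pr (mop C [a] (src b)) b + psign (dg a) * pr a (mop C [b] (src a)) = 0) \<and>
     (\<forall>\<kappa>\<in>Obj C. \<forall>\<mu>\<in>Obj C. \<forall>e. \<forall>x\<in>Hom C \<kappa> \<mu> e. x \<noteq> 0 \<longrightarrow>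
        (\<exists>f. \<exists>y\<in>Hom C \<mu> \<kappa> f. pr (Mor \<kappa> e x) (Mor \<mu> f y) \<noteq> 0)) \<and>
     (\<forall>as. length as \<ge> 2 \<longrightarrow> mpath C as (src (hd as)) \<longrightarrow>
        (let x = mop C (butlast as) (src (last as)); y = mop C (tl as) (src (hd as)) in
           psign (dg x) * pr x (last as) =
           psign ((dg (hd as) - 1) * sdeg (tl as)) * (psign (dg y) * pr y (hd as))))"


section \<open>Reduced Hochschild chains\<close>

text \<open>The list \<open>[a\<^sub>0, \<dots>, a\<^sub>p]\<close> stands for \<open>a\<^sub>0[a\<^sub>1|\<dots>|a\<^sub>p]\<close>.  \<open>CH\<^sub>*(C)\<close> is the quotient of \<open>hoch_chains C\<close>, the
  span of these words, by the subspace \<open>null_chains C\<close> of multilinearity relations and of words with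
  an identity morphism in a position \<open>\<ge> 1\<close>.  Linear maps on \<open>CH\<^sub>*(C)\<close> are given by lifts to chains
  which preserve \<open>null_chains C\<close>.\<close>

definition hwords :: "('k, 'o, 'v) ainf \<Rightarrow> ('o, 'v) hmor list set" where
  "hwords C = {w. mpath C w (src (hd w))}"

definition hoch_chains :: "('k::field, 'o, 'v) ainf \<Rightarrow> (('o, 'v) hmor list \<Rightarrow>\<^sub>0 'k) set" where
  "hoch_chains C = {c. keys c \<subseteq> hwords C}"

definition null_chains ::
  "('k::field, 'o, 'v::ab_group_add) ainf \<Rightarrow> (('o, 'v) hmor list \<Rightarrow>\<^sub>0 'k) set" where
  "null_chains C = module.span smul
     ({single (us @ Mor \<kappa> e (x + y) # vs) 1 - single (us @ Mor \<kappa> e x # vs) 1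
         - single (us @ Mor \<kappa> e y # vs) 1 | us vs \<kappa> e x y.
         us @ Mor \<kappa> e x # vs \<in> hwords C \<and> us @ Mor \<kappa> e y # vs \<in> hwords C} \<union>
      {single (us @ Mor \<kappa> e (scl C c x) # vs) 1 - single (us @ Mor \<kappa> e x # vs) c | us vs \<kappa> e c x.
         us @ Mor \<kappa> e x # vs \<in> hwords C} \<union>
      {single (us @ ident_mor C \<kappa> # vs) 1 | us vs \<kappa>.
         us \<noteq> [] \<and> us @ ident_mor C \<kappa> # vs \<in> hwords C})"

text \<open>The homological degree is the negative of the cohomological degree
  \<open>|a\<^sub>0| + |a\<^sub>1|' + \<dots> + |a\<^sub>p|'\<close>, in which \<open>a\<^sub>0\<close> is not shifted.\<close>

definition hdeg :: "('o, 'v) hmor list \<Rightarrow> int" where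
  "hdeg w = - (sdeg w + 1)"

text \<open>Koszul sign of the rotation \<open>a\<^sub>0 \<dots> a\<^sub>p \<leadsto> a\<^sub>j \<dots> a\<^sub>p a\<^sub>0 \<dots> a\<^sub>j\<^sub>-\<^sub>1\<close> (as an exponent).\<close>

definition rot_exp :: "nat \<Rightarrow> ('o, 'v) hmor list \<Rightarrow> int" where
  "rot_exp j w = sdeg (drop j w) * sdeg (take j w)"

definition hoch_word ::
  "('k::field, 'o, 'v) ainf \<Rightarrow> ('o, 'v) hmor list \<Rightarrow> (('o, 'v) hmor list \<Rightarrow>\<^sub>0 'k)" where
  "hoch_word C w =
     (\<Sum>(i, j)\<in>{(i, j). i < j \<and> j \<le> length w}.
        single (mop C (drop j w @ take (Suc i) w) (src (w ! (Suc i mod length w)))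
                # drop (Suc i) (take j w)) (psign (rot_exp j w))) +
     (\<Sum>(i, j)\<in>{(i, j). 1 \<le> i \<and> i < j \<and> j \<le> length w}.
        single (take i w @ mop C (drop i (take j w)) (src (w ! (j mod length w))) # drop j w)
          (psign (sdeg (take i w))))"

definition d_Hoch ::
  "('k::field, 'o, 'v) ainf \<Rightarrow> (('o, 'v) hmor list \<Rightarrow>\<^sub>0 'k) \<Rightarrow> (('o, 'v) hmor list \<Rightarrow>\<^sub>0 'k)" where
  "d_Hoch C = lin_ext (hoch_word C)"

definition connes_B ::
  "('k::field, 'o, 'v) ainf \<Rightarrow> (('o, 'v) hmor list \<Rightarrow>\<^sub>0 'k) \<Rightarrow> (('o, 'v) hmor list \<Rightarrow>\<^sub>0 'k)" where
  "connes_B C = lin_ext (\<lambda>w. \<Sum>i<length w.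
     single (ident_mor C (src (w ! i)) # drop i w @ take i w) (psign (rot_exp i w)))"


section \<open>The Mukai pairing\<close>

definition trace_on :: "('k::field \<Rightarrow> 'v::ab_group_add \<Rightarrow> 'v) \<Rightarrow> 'v set \<Rightarrow> ('v \<Rightarrow> 'v) \<Rightarrow> 'k" where
  "trace_on scale V f =
     (let E = (SOME E. \<not> module.dependent scale E \<and> module.span scale E = V)
      in \<Sum>b\<in>E. module.representation scale E (f b) b)"

text \<open>Supertrace over \<open>Hom(\<kappa>, \<mu>)\<close>; only the degree preserving part of the operator contributes.\<close>

definition supertrace :: "('k::field, 'o, 'v::ab_group_add) ainf \<Rightarrow> 'o \<Rightarrow> 'o \<Rightarrow>
    (('o, 'v) hmor \<Rightarrow> ('o, 'v) hmor) \<Rightarrow> 'k" where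
  "supertrace C \<kappa> \<mu> P =
     (\<Sum>e\<in>{e. Hom C \<kappa> \<mu> e \<noteq> {0}}. psign e * trace_on (scl C) (Hom C \<kappa> \<mu> e)
        (\<lambda>x. if dg (P (Mor \<kappa> e x)) = e then vct (P (Mor \<kappa> e x)) else 0))"

text \<open>The sign is the Koszul sign of rotating \<open>a\<^sub>0 \<dots> a\<^sub>p\<close> and \<open>b\<^sub>0 \<dots> b\<^sub>q\<close>, of moving the inner operation past
  \<open>a\<^sub>j, \<dots>, a\<^sub>i\<close> and of moving \<open>c\<close> past all \<open>a\<close>'s, normalized so that \<open>\<langle>1, 1\<rangle> = 1\<close> for the category with
  one object and \<open>Hom = k\<close>.  With it \<open>\<langle>d \<alpha>, \<beta>\<rangle> + (-1)\<^sup>|\<^sup>\<alpha>\<^sup>| \<langle>\<alpha>, d \<beta>\<rangle> = 0\<close>, \<open>\<langle>B \<alpha>, \<beta>\<rangle> = (-1)\<^sup>|\<^sup>\<alpha>\<^sup>| \<langle>\<alpha>, B \<beta>\<rangle>\<close> and,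
  in the cyclic case of dimension \<open>d\<close>, \<open>\<langle>\<alpha>, \<beta>\<rangle> = (-1)\<^bsup>d + |\<alpha>||\<beta>|\<^esup> \<langle>\<beta>, \<alpha>\<rangle>\<close>.\<close>

definition mukai_word :: "('k::field, 'o, 'v::ab_group_add) ainf \<Rightarrow>
    ('o, 'v) hmor list \<Rightarrow> ('o, 'v) hmor list \<Rightarrow> 'k" where
  "mukai_word C a b =
     (\<Sum>(i, j)\<in>{(i, j). i < j \<and> j \<le> length a}. \<Sum>(t, l)\<in>{(t, l). t < l \<and> l \<le> length b}.
        let \<kappa> = src (a ! (j mod length a)); \<mu> = src (b ! (l mod length b)) in
        psign (rot_exp j a + rot_exp l b + sdeg (drop j a @ take (Suc i) a) + 1) *
        supertrace C \<kappa> \<mu> (\<lambda>c.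
          let inner = mop C (drop (Suc i) (take j a) @ [c] @ drop l b @ take (Suc t) b)
                        (src (b ! (Suc t mod length b)));
              outer = mop C (drop j a @ take (Suc i) a @ [inner] @ drop (Suc t) (take l b)) \<mu>
          in Mor (src outer) (dg outer) (scl C (psign (dg c * sdeg a)) (vct outer))))"

definition mukai :: "('k::field, 'o, 'v::ab_group_add) ainf \<Rightarrow>
    (('o, 'v) hmor list \<Rightarrow>\<^sub>0 'k) \<Rightarrow> (('o, 'v) hmor list \<Rightarrow>\<^sub>0 'k) \<Rightarrow> 'k" where
  "mukai C = bilin_ext (mukai_word C)"


section \<open>Splittings\<close>

text \<open>\<open>s n\<close> is (a lift to chains of) the coefficient \<open>R\<^sub>n\<close> of \<open>u\<^sup>n\<close> in the splitting; since \<open>u\<close> has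
  homological degree \<open>-2\<close>, it raises the homological degree by \<open>2n\<close>.  Degree preserving maps on the
  quotient have lifts which preserve degrees on the nose.\<close>

definition splitting :: "('k::field, 'o, 'v::ab_group_add) ainf \<Rightarrow>
    (nat \<Rightarrow> (('o, 'v) hmor list \<Rightarrow>\<^sub>0 'k) \<Rightarrow> (('o, 'v) hmor list \<Rightarrow>\<^sub>0 'k)) \<Rightarrow> bool" where
  "splitting C s \<longleftrightarrow>
     (\<forall>n. Vector_Spaces.linear smul smul (s n)) \<and>
     (\<forall>n. \<forall>c\<in>null_chains C. s n c \<in> null_chains C) \<and>
     (\<forall>n. \<forall>w\<in>hwords C. \<forall>w'\<in>keys (s n (single w 1)).
        w' \<in> hwords C \<and> hdeg w' = hdeg w + 2 * int n) \<and>
     (\<forall>c\<in>hoch_chains C. s 0 c - c \<in> null_chains C) \<and>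
     (\<forall>n. \<forall>c\<in>hoch_chains C. d_Hoch C (s n c) + (if n = 0 then 0 else connes_B C (s (n - 1) c))
        - s n (d_Hoch C c) \<in> null_chains C)"

text \<open>Coefficients \<open>T\<^sub>n\<close> of the inverse power series of \<open>\<Sum>\<^sub>n R\<^sub>n u\<^sup>n\<close>, where \<open>R\<^sub>0 = id\<close>.\<close>

fun inv_coeff :: "(nat \<Rightarrow> ('x \<Rightarrow>\<^sub>0 'k::field) \<Rightarrow> ('x \<Rightarrow>\<^sub>0 'k)) \<Rightarrow> nat \<Rightarrow> ('x \<Rightarrow>\<^sub>0 'k) \<Rightarrow> ('x \<Rightarrow>\<^sub>0 'k)" where
  "inv_coeff R 0 c = c"
| "inv_coeff R (Suc n) c = - (\<Sum>l\<in>{1..Suc n}. R l (inv_coeff R (Suc n - l) c))"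


section \<open>Graded vector spaces given by generators and relations\<close>

record (overloaded) ('k, 'x) pres =
  gens :: "'x set"
  gdeg :: "'x \<Rightarrow> int"
  rels :: "('x \<Rightarrow>\<^sub>0 'k) set"

text \<open>For a graded vector space \<open>V\<close>, the free graded commutative algebra \<open>Sym V\<close> is spanned by words
  in the generators, modulo the relations of \<open>V\<close> in every factor and graded commutativity.\<close>

definition sym_null :: "('k::field, 'x) pres \<Rightarrow> ('x list \<Rightarrow>\<^sub>0 'k) set" where
  "sym_null V = module.span smul
     ({lin_ext (\<lambda>x. single (us @ x # vs) 1) r | us vs r.
         us \<in> lists (gens V) \<and> vs \<in> lists (gens V) \<and> r \<in> rels V} \<union>
      {single (us @ x # y # vs) 1 - single (us @ y # x # vs) (psign (gdeg V x * gdeg V y))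
         | us vs x y. us \<in> lists (gens V) \<and> vs \<in> lists (gens V) \<and> x \<in> gens V \<and> y \<in> gens V})"

text \<open>\<open>Sym V[[\<gamma_elt>]]\<close>: a series is represented by the family of its coefficients.\<close>

definition series :: "('k::field, 'x) pres \<Rightarrow> (nat \<Rightarrow> ('x list \<Rightarrow>\<^sub>0 'k)) set" where
  "series V = {y. \<forall>g. keys (y g) \<subseteq> lists (gens V)}"

definition series_rel ::
  "('k::field, 'x) pres \<Rightarrow> ((nat \<Rightarrow> ('x list \<Rightarrow>\<^sub>0 'k)) \<times> (nat \<Rightarrow> ('x list \<Rightarrow>\<^sub>0 'k))) set" where
  "series_rel V = {(y, z). y \<in> series V \<and> z \<in> series V \<and> (\<forall>g. y g - z g \<in> sym_null V)}"

definition cls ::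
  "('k::field, 'x) pres \<Rightarrow> (nat \<Rightarrow> ('x list \<Rightarrow>\<^sub>0 'k)) \<Rightarrow> (nat \<Rightarrow> ('x list \<Rightarrow>\<^sub>0 'k)) set" where
  "cls V y = series_rel V `` {y}"

definition concat_mult :: "('x list \<Rightarrow>\<^sub>0 'k::field) \<Rightarrow> ('x list \<Rightarrow>\<^sub>0 'k) \<Rightarrow> ('x list \<Rightarrow>\<^sub>0 'k)" where
  "concat_mult p q = (\<Sum>u\<in>keys p. \<Sum>v\<in>keys q. single (u @ v) (lookup p u * lookup q v))"

definition series_mult ::
  "(nat \<Rightarrow> ('x list \<Rightarrow>\<^sub>0 'k::field)) \<Rightarrow> (nat \<Rightarrow> ('x list \<Rightarrow>\<^sub>0 'k)) \<Rightarrow> nat \<Rightarrow> ('x list \<Rightarrow>\<^sub>0 'k)" where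
  "series_mult y z g = (\<Sum>i\<le>g. concat_mult (y i) (z (g - i)))"

definition sym_series ::
  "('k::field, 'x) pres \<Rightarrow> ('k, (nat \<Rightarrow> ('x list \<Rightarrow>\<^sub>0 'k)) set) module" where
  "sym_series V = \<lparr>
     carrier = series V // series_rel V,
     monoid.mult = (\<lambda>Y Z. \<Union>y\<in>Y. \<Union>z\<in>Z. cls V (series_mult y z)),
     one = cls V (\<lambda>g. if g = 0 then single [] 1 else 0),
     zero = cls V (\<lambda>g. 0),
     add = (\<lambda>Y Z. \<Union>y\<in>Y. \<Union>z\<in>Z. cls V (\<lambda>g. y g + z g)),
     smult = (\<lambda>c Y. \<Union>y\<in>Y. cls V (\<lambda>g. smul c (y g)))\<rparr>"


section \<open>Labeled graphs\<close>

text \<open>A graph is given by its half-edges, the vertex \<open>vertex_of a\<close> of each half-edge \<open>a\<close> and an involution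
  \<open>flip\<close> whose fixed points are the leaves and whose two-element orbits are the internal edges.\<close>

record lgraph =
  verts :: "nat set"
  halves :: "nat set"
  vertex_of :: "nat \<Rightarrow> nat"
  flip :: "nat \<Rightarrow> nat"
  genus :: "nat \<Rightarrow> nat"

definition labeled_graph :: "lgraph \<Rightarrow> bool" where
  "labeled_graph G \<longleftrightarrow> finite (verts G) \<and> finite (halves G) \<and> vertex_of G ` halves G \<subseteq> verts G \<and>
     (\<forall>a\<in>halves G. flip G a \<in> halves G \<and> flip G (flip G a) = a)"

definition halves_at :: "lgraph \<Rightarrow> nat \<Rightarrow> nat set" where
  "halves_at G v = {a \<in> halves G. vertex_of G a = v}"

definition leaves :: "lgraph \<Rightarrow> nat set" where
  "leaves G = {a \<in> halves G. flip G a = a}"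

text \<open>An internal edge is represented by its smaller half-edge and oriented accordingly.\<close>

definition internal_edges :: "lgraph \<Rightarrow> nat set" where
  "internal_edges G = {a \<in> halves G. a < flip G a}"

definition connected_graph :: "lgraph \<Rightarrow> bool" where
  "connected_graph G \<longleftrightarrow> verts G \<noteq> {} \<and>
     (\<forall>u\<in>verts G. \<forall>v\<in>verts G. (u, v) \<in> {(vertex_of G a, vertex_of G (flip G a)) | a. a \<in> halves G}\<^sup>*)"

definition edge_boundary :: "lgraph \<Rightarrow> (nat \<Rightarrow>\<^sub>0 rat) \<Rightarrow> (nat \<Rightarrow>\<^sub>0 rat)" where
  "edge_boundary G = lin_ext (\<lambda>a. single (vertex_of G (flip G a)) 1 - single (vertex_of G a) 1)"

definition rank_H1 :: "lgraph \<Rightarrow> nat" where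
  "rank_H1 G = vector_space.dim (smul :: rat \<Rightarrow> _) {c. keys c \<subseteq> internal_edges G \<and> edge_boundary G c = 0}"

definition betti :: "lgraph \<Rightarrow> nat" where
  "betti G = (\<Sum>v\<in>verts G. genus G v) + rank_H1 G"

definition marked_graphs :: "nat \<Rightarrow> nat \<Rightarrow> nat \<Rightarrow> (lgraph \<times> (nat \<Rightarrow> nat)) set" where
  "marked_graphs g n m = {(G, f). labeled_graph G \<and> connected_graph G \<and> betti G = g \<and>
     card (leaves G) = n \<and> card (verts G) = m \<and> bij_betw f {1..m} (verts G)}"

definition graph_isos ::
  "nat \<Rightarrow> lgraph \<times> (nat \<Rightarrow> nat) \<Rightarrow> lgraph \<times> (nat \<Rightarrow> nat) \<Rightarrow> ((nat \<Rightarrow> nat) \<times> (nat \<Rightarrow> nat)) set" where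
  "graph_isos m = (\<lambda>(G, f) (G', f'). {(\<alpha>, \<psi>).
     \<alpha> \<in> extensional (verts G) \<and> bij_betw \<alpha> (verts G) (verts G') \<and>
     \<psi> \<in> extensional (halves G) \<and> bij_betw \<psi> (halves G) (halves G') \<and>
     (\<forall>a\<in>halves G. vertex_of G' (\<psi> a) = \<alpha> (vertex_of G a) \<and> flip G' (\<psi> a) = \<psi> (flip G a)) \<and>
     (\<forall>v\<in>verts G. genus G' (\<alpha> v) = genus G v) \<and>
     (\<forall>i\<in>{1..m}. \<alpha> (f i) = f' i)})"

definition graph_classes :: "nat \<Rightarrow> nat \<Rightarrow> nat \<Rightarrow> (lgraph \<times> (nat \<Rightarrow> nat)) set set" where
  "graph_classes g n m = marked_graphs g n m //
     {(X, Y). X \<in> marked_graphs g n m \<and> Y \<in> marked_graphs g n m \<and> graph_isos m X Y \<noteq> {}}"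


section \<open>Graph sums\<close>

text \<open>\<open>ws = [y\<^sub>1, \<dots>, y\<^sub>m]\<close> are monomials with \<open>y\<^sub>i\<close> placed at the vertex \<open>f i\<close>.  A decoration matches
  the half-edges at each \<open>f i\<close> with the factors of \<open>y\<^sub>i\<close>, the latter being given by their positions
  in the concatenation of \<open>ws\<close>; summing over decorations is the desymmetrization.\<close>

definition decorations :: "lgraph \<Rightarrow> (nat \<Rightarrow> nat) \<Rightarrow> 'x list list \<Rightarrow> (nat \<Rightarrow> nat) set" where
  "decorations G f ws = {\<phi> \<in> extensional (halves G). \<forall>r<length ws.
     bij_betw \<phi> (halves_at G (f (Suc r)))
       {length (concat (take r ws)) ..< length (concat (take (Suc r) ws))}}"

text \<open>For a decoration, the sign of the desymmetrization and that of moving the pairs of factors at the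
  internal edges to the front combine to the Koszul sign of the permutation from the original order
  of the factors to the order: internal edges, leaves.\<close>

definition contraction :: "('x \<Rightarrow> int) \<Rightarrow> ('x \<Rightarrow> 'x \<Rightarrow> 'k::field) \<Rightarrow>
    lgraph \<Rightarrow> (nat \<Rightarrow> nat) \<Rightarrow> 'x list list \<Rightarrow> ('x list \<Rightarrow>\<^sub>0 'k)" where
  "contraction D h G f ws =
     (let W = concat ws;
          es = sorted_list_of_set (internal_edges G);
          ls = sorted_list_of_set (leaves G)
      in \<Sum>\<phi>\<in>decorations G f ws.
           single (map (\<lambda>a. W ! \<phi> a) ls)
             (koszul (\<lambda>r. D (W ! r)) (map \<phi> (concat (map (\<lambda>a. [a, flip G a]) es) @ ls)) *
              (\<Prod>a\<in>internal_edges G. h (W ! \<phi> a) (W ! \<phi> (flip G a)))))"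

text \<open>The coefficient of \<open>\<gamma_elt>\<^sup>g\<close>, \<open>g = betti G\<close>, of \<open>K\<^bsub>(G,f)\<^esub>(y\<^sub>1, \<dots>, y\<^sub>m)\<close> for arbitrary series, by
  multilinear extension.\<close>

definition graph_term :: "('x \<Rightarrow> int) \<Rightarrow> ('x \<Rightarrow> 'x \<Rightarrow> 'k::field) \<Rightarrow>
    lgraph \<times> (nat \<Rightarrow> nat) \<Rightarrow> (nat \<Rightarrow> ('x list \<Rightarrow>\<^sub>0 'k)) list \<Rightarrow> ('x list \<Rightarrow>\<^sub>0 'k)" where
  "graph_term D h = (\<lambda>(G, f) ys.
     let y = (\<lambda>r. (ys ! r) (genus G (f (Suc r)))) in
     \<Sum>ws\<in>listset (map (\<lambda>r. {w \<in> keys (y r). length w = card (halves_at G (f (Suc r)))})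
                    [0..<length ys]).
       smul (\<Prod>r<length ys. lookup (y r) (ws ! r)) (contraction D h G f ws))"

definition graph_sum :: "('x \<Rightarrow> int) \<Rightarrow> ('x \<Rightarrow> 'x \<Rightarrow> 'k::field_char_0) \<Rightarrow>
    (nat \<Rightarrow> ('x list \<Rightarrow>\<^sub>0 'k)) list \<Rightarrow> nat \<Rightarrow> ('x list \<Rightarrow>\<^sub>0 'k)" where
  "graph_sum D h ys g = Sum_any (\<lambda>n. \<Sum>\<Gamma>\<in>graph_classes g n (length ys).
     let X = (SOME X. X \<in> \<Gamma>) in
     smul (1 / of_nat (card (graph_isos (length ys) X X))) (graph_term D h X ys))"


section \<open>The algebra of a cyclic category and the graph sum maps\<close>

text \<open>\<open>\<H>\<close> is generated by the elements \<open>\<alpha> u\<^bsup>-i\<^esup>\<close>, written \<open>(\<alpha>, i)\<close>, for Hochschild words \<open>\<alpha>\<close>.\<close>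

definition H_space :: "('k::field, 'o, 'v::ab_group_add) ainf \<Rightarrow> int \<Rightarrow>
    ('k, ('o, 'v) hmor list \<times> nat) pres" where
  "H_space C d = \<lparr>
     gens = hwords C \<times> UNIV,
     gdeg = (\<lambda>(w, i). 2 - d - hdeg w - 2 * int i),
     rels = {lin_ext (\<lambda>w. single (w, i) 1) c | c i. c \<in> null_chains C}\<rparr>"

definition Fock :: "('k::field, 'o, 'v::ab_group_add) ainf \<Rightarrow> int \<Rightarrow>
    ('k, (nat \<Rightarrow> (('o, 'v) hmor list \<times> nat) list \<Rightarrow>\<^sub>0 'k) set) module" where
  "Fock C d = sym_series (H_space C d)"

definition gamma_elt :: "('k::field, 'o, 'v::ab_group_add) ainf \<Rightarrow> int \<Rightarrow>
    (nat \<Rightarrow> (('o, 'v) hmor list \<times> nat) list \<Rightarrow>\<^sub>0 'k) set" where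
  "gamma_elt C d = cls (H_space C d) (\<lambda>g. if g = 1 then single [] 1 else 0)"

text \<open>Elements whose degree is congruent to \<open>p\<close> modulo \<open>2\<close>; in particular the homogeneous elements of
  degree \<open>p\<close>.  Here \<open>\<gamma_elt>\<close> has degree \<open>6 - 2d\<close>.\<close>

definition Fock_parity :: "('k::field, 'o, 'v::ab_group_add) ainf \<Rightarrow> int \<Rightarrow> int \<Rightarrow>
    (nat \<Rightarrow> (('o, 'v) hmor list \<times> nat) list \<Rightarrow>\<^sub>0 'k) set set" where
  "Fock_parity C d p = {Y \<in> carrier (Fock C d). \<exists>y\<in>Y. \<forall>g. \<forall>w\<in>keys (y g).
     even ((\<Sum>x\<leftarrow>w. gdeg (H_space C d) x) + int g * (6 - 2 * d) - p)}"

text \<open>The signs in \<open>H\<close> and the factor \<open>1/2\<close> in the symmetrization are such that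
  \<open>\<Delta>\<^sub>c(x y) = - (H\<^sup>s\<^sup>y\<^sup>m(D x, y) + (-1)\<^sup>|\<^sup>x\<^sup>| H\<^sup>s\<^sup>y\<^sup>m(x, D y))\<close> with \<open>D = d_Hoch + u B\<close> and
  \<open>\<Delta>\<^sub>c(x y) = (-1)\<^bsup>d (|x\<^sub>0| + 1)\<^esup> \<langle>B x\<^sub>0, y\<^sub>0\<rangle>\<close>, \<open>|x\<^sub>0|\<close> being the degree in \<open>CH\<^sub>*(C)\<close>.  This uses the
  three properties of the Mukai pairing recorded above.\<close>

definition H_form :: "('k::field, 'o, 'v::ab_group_add) ainf \<Rightarrow> int \<Rightarrow>
    (nat \<Rightarrow> (('o, 'v) hmor list \<Rightarrow>\<^sub>0 'k) \<Rightarrow> (('o, 'v) hmor list \<Rightarrow>\<^sub>0 'k)) \<Rightarrow>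
    ('o, 'v) hmor list \<times> nat \<Rightarrow> ('o, 'v) hmor list \<times> nat \<Rightarrow> 'k" where
  "H_form C d s = (\<lambda>(\<alpha>, i) (\<beta>, j). psign (d * hdeg \<alpha> + int j) *
     mukai C (\<Sum>l\<le>j. s l (inv_coeff s (i + j + 1 - l) (single \<alpha> 1))) (single \<beta> 1))"

definition H_sym :: "('k::field, 'o, 'v::ab_group_add) ainf \<Rightarrow> int \<Rightarrow>
    (nat \<Rightarrow> (('o, 'v) hmor list \<Rightarrow>\<^sub>0 'k) \<Rightarrow> (('o, 'v) hmor list \<Rightarrow>\<^sub>0 'k)) \<Rightarrow>
    ('o, 'v) hmor list \<times> nat \<Rightarrow> ('o, 'v) hmor list \<times> nat \<Rightarrow> 'k" where
  "H_sym C d s x y = (H_form C d s x y +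
     psign (gdeg (H_space C d) x * gdeg (H_space C d) y) * H_form C d s y x) / 2"

text \<open>\<open>K_map C d s [X\<^sub>1, \<dots>, X\<^sub>m]\<close> is the value of \<open>K\<^sup>m\<^sub>s\<close> at the product of \<open>X\<^sub>1, \<dots>, X\<^sub>m\<close> in
  the outer symmetric power.\<close>

definition K_map :: "('k::field_char_0, 'o, 'v::ab_group_add) ainf \<Rightarrow> int \<Rightarrow>
    (nat \<Rightarrow> (('o, 'v) hmor list \<Rightarrow>\<^sub>0 'k) \<Rightarrow> (('o, 'v) hmor list \<Rightarrow>\<^sub>0 'k)) \<Rightarrow>
    (nat \<Rightarrow> (('o, 'v) hmor list \<times> nat) list \<Rightarrow>\<^sub>0 'k) set list \<Rightarrow>
    (nat \<Rightarrow> (('o, 'v) hmor list \<times> nat) list \<Rightarrow>\<^sub>0 'k) set" where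
  "K_map C d s Xs = (\<Union>ys\<in>listset Xs.
     cls (H_space C d) (graph_sum (gdeg (H_space C d)) (H_sym C d s) ys))"

end

theory Submission
  imports Defs
begin

text \<open>A decoration of a marked graph by the factors of \<open>y\<^sub>1, \<dots>, y\<^sub>m\<close> transports the involution of its half-edges
  to the letters of these words, and the automorphisms of the graph act freely on its decorations.  By
  orbit counting the weights \<open>1 / |Aut|\<close> therefore disappear: \<open>\<K>\<^sup>m\<close> is the sum over all involutions of the letters
  (paired letters are contracted, fixed letters survive) for which the induced graph on \<open>{1, \<dots>, m}\<close> is
  connected.  Now \<open>x\<^sub>i \<cdot> x\<^sub>j\<close> is the concatenation of two words, so the left hand side runs over the same
  involutions, subject to connectedness after \<open>i\<close> and \<open>j\<close> are identified.  Either the graph is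
  connected before the identification, which lowers its Betti number by one and gives the term with
  \<open>\<gamma>\<close>, or it has exactly two components, one containing \<open>i\<close> and one containing \<open>j\<close>, which gives the
  products.  Signs are compatible because contracted letters have the same parity.  That \<open>H\<^sup>s\<^sup>y\<^sup>m\<close> is well defined
  on \<open>\<H>\<close> comes down to multilinearity and unitality of the operations in the Mukai pairing.\<close>


section \<open>Koszul signs\<close>

text \<open>A contraction can only be written down after choosing an order of the edges, an
  orientation of each edge and an order of the leaves, so two contractions agree only modulo graded
  commutativity. This is why identities are stated as congruences between representatives and become
  equations between classes only at the end. The Betti number enters through |E| - |V| + 1, a linear
  equation in the number of two-cycles of an involution, hence additive over components. A fixed
  coefficient of gamma sees only vertex genera up to a bound \<open>B\<close>, which keeps all sums
  finite and may be enlarged freely. The delicate point of well-definedness is that substituting a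
  relation for one letter produces terms with a common Koszul sign only if all letters of the
  relation have the same parity; relations are therefore split by parity first.\<close>

lemma psign_add: "psign (a + b) = psign a * (psign b :: 'a::ring_1)"
  by (auto simp: psign_def)

lemma psign_0 [simp]: "psign 0 = 1"
  by (simp add: psign_def)

lemma psign_square [simp]: "psign a * psign a = (1 :: 'a::ring_1)"
  by (simp add: psign_def)

lemma psign_even: "even a \<Longrightarrow> psign a = 1"
  by (simp add: psign_def)

lemma psign_cong: "even a = even b \<Longrightarrow> psign a = psign b"
  by (simp add: psign_def)

lemma psign_sum: "psign (\<Sum>a\<in>A. f a) = (\<Prod>a\<in>A. psign (f a) :: 'a::comm_ring_1)"
  by (induction A rule: infinite_finite_induct) (simp_all add: psign_add)

text \<open>Positions serve as linear orders: two arrangements of the same letters are compared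
  through the functions \<open>pos L\<close> and \<open>pos L'\<close>.\<close>

fun pos :: "'i list \<Rightarrow> 'i \<Rightarrow> nat" where
  "pos [] a = 0"
| "pos (x # xs) a = (if x = a then 0 else Suc (pos xs a))"

lemma pos_less: "a \<in> set L \<Longrightarrow> pos L a < length L"
  by (induction L) auto

lemma nth_pos: "a \<in> set L \<Longrightarrow> L ! pos L a = a"
  by (induction L) auto

lemma pos_nth: "distinct L \<Longrightarrow> r < length L \<Longrightarrow> pos L (L ! r) = r"
  by (metis distinct_conv_nth nth_mem nth_pos pos_less)

lemma inj_pos: "inj_on (pos L) (set L)"
  by (metis inj_onI nth_pos)

lemma pos_eq_iff: "a \<in> set L \<Longrightarrow> b \<in> set L \<Longrightarrow> pos L a = pos L b \<longleftrightarrow> a = b"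
  by (rule inj_on_eq_iff [OF inj_pos])

lemma pos_append: "pos (xs @ ys) a = (if a \<in> set xs then pos xs a else length xs + pos ys a)"
  by (induction xs) auto

lemma pos_map: "inj_on f (insert a (set L)) \<Longrightarrow> pos (map f L) (f a) = pos L a"
  by (induction L) (auto simp: inj_on_def)

section \<open>Signs relative to two orders, as products over unordered pairs\<close>

definition pairs :: "'i set \<Rightarrow> 'i set set" where
  "pairs A = {S. S \<subseteq> A \<and> card S = 2}"

text \<open>The one-sided implication suffices: on a pair on which \<open>f\<close> and
  \<open>g\<close> are both injective it already says that they order its two elements
  alike.\<close>

definition agree :: "('i \<Rightarrow> nat) \<Rightarrow> ('i \<Rightarrow> nat) \<Rightarrow> 'i set \<Rightarrow> bool" where
  "agree f g S \<longleftrightarrow> (\<forall>a\<in>S. \<forall>b\<in>S. f a < f b \<longrightarrow> g a < g b)"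

text \<open>The Koszul sign of passing from the order on \<open>A\<close> given by \<open>f\<close> to that given by \<open>g\<close>.
  A product over unordered pairs makes the cocycle property immediate.\<close>

definition rsign :: "('i \<Rightarrow> int) \<Rightarrow> 'i set \<Rightarrow> ('i \<Rightarrow> nat) \<Rightarrow> ('i \<Rightarrow> nat) \<Rightarrow> 'k::comm_ring_1" where
  "rsign D A f g = (\<Prod>S\<in>pairs A. if agree f g S then 1 else psign (\<Prod>a\<in>S. D a))"

lemma agree_pair:
  assumes "f a \<noteq> f b" "g a \<noteq> g b"
  shows "agree f g {a, b} \<longleftrightarrow> (f a < f b \<longleftrightarrow> g a < g b)"
  using assms unfolding agree_def by (simp, linarith)

lemma finite_pairs: "finite A \<Longrightarrow> finite (pairs A)"
  unfolding pairs_def by auto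

lemma pairsE:
  assumes "S \<in> pairs A" obtains a b where "S = {a, b}" "a \<noteq> b" "a \<in> A" "b \<in> A"
  using assms unfolding pairs_def by (auto simp: card_2_iff)

text \<open>Pair by pair: two reversals compose to none, and the repeated factor
  \<open>psign\<close> squares to one.\<close>

lemma rsign_trans:
  assumes "inj_on f A" "inj_on g A" "inj_on h A"
  shows "rsign D A f g * rsign D A g h = (rsign D A f h :: 'k::comm_ring_1)"
  unfolding rsign_def prod.distrib [symmetric]
proof (rule prod.cong [OF refl])
  fix S assume "S \<in> pairs A"
  then obtain a b where S: "S = {a, b}" "a \<noteq> b" "a \<in> A" "b \<in> A" by (rule pairsE)
  with assms have "f a \<noteq> f b" "g a \<noteq> g b" "h a \<noteq> h b" by (auto dest: inj_onD)
  then show "(if agree f g S then 1 else psign (prod D S)) * (if agree g h S then 1 else psign (prod D S))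
      = (if agree f h S then 1 else psign (prod D S) :: 'k)"
    unfolding S(1) agree_def by auto
qed

lemma rsign_cong:
  assumes "\<And>a b. a \<in> A \<Longrightarrow> b \<in> A \<Longrightarrow> f a < f b \<longleftrightarrow> f' a < f' b"
    "\<And>a b. a \<in> A \<Longrightarrow> b \<in> A \<Longrightarrow> g a < g b \<longleftrightarrow> g' a < g' b"
    "\<And>a. a \<in> A \<Longrightarrow> even (D a) = even (D' a)"
  shows "rsign D A f g = (rsign D' A f' g' :: 'k::comm_ring_1)"
  unfolding rsign_def
proof (rule prod.cong [OF refl])
  fix S assume "S \<in> pairs A"
  then obtain a b where S: "S = {a, b}" "a \<noteq> b" "a \<in> A" "b \<in> A" by (rule pairsE)
  have "agree f g S = agree f' g' S" using S assms unfolding agree_def by auto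
  moreover have "psign (prod D S) = (psign (prod D' S) :: 'k)"
    using S assms(3) by (intro psign_cong) auto
  ultimately show "(if agree f g S then 1 else psign (prod D S))
      = (if agree f' g' S then 1 else psign (prod D' S) :: 'k)" by simp
qed

lemma rsign_refl: "rsign D A f f = 1"
  unfolding rsign_def agree_def by simp

lemma rsign_image:
  assumes inj: "inj_on \<pi> A"
  shows "rsign D (\<pi> ` A) f g = rsign (\<lambda>a. D (\<pi> a)) A (\<lambda>a. f (\<pi> a)) (\<lambda>a. g (\<pi> a))"
proof -
  have P: "pairs (\<pi> ` A) = (`) \<pi> ` pairs A"
  proof (rule Set.set_eqI)
    fix S
    show "S \<in> pairs (\<pi> ` A) \<longleftrightarrow> S \<in> (`) \<pi> ` pairs A"
      using inj unfolding pairs_def subset_image_iff image_iff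
      by (auto simp: card_image inj_on_subset)
  qed
  have I: "inj_on ((`) \<pi>) (pairs A)"
    using inj by (auto simp: pairs_def inj_on_def) (metis inj inj_on_image_eq_iff)+
  show ?thesis
    unfolding rsign_def P prod.reindex [OF I]
  proof (rule prod.cong [OF refl])
    fix S assume "S \<in> pairs A"
    then have "inj_on \<pi> S" using inj by (auto simp: pairs_def intro: inj_on_subset)
    moreover have "agree f g (\<pi> ` S) = agree (\<lambda>a. f (\<pi> a)) (\<lambda>a. g (\<pi> a)) S"
      by (simp add: agree_def)
    ultimately show "((\<lambda>S. if agree f g S then 1 else psign (prod D S)) \<circ> (`) \<pi>) S =
      (if agree (\<lambda>a. f (\<pi> a)) (\<lambda>a. g (\<pi> a)) S then 1 else psign (\<Prod>a\<in>S. D (\<pi> a)))"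
      by (simp add: prod.reindex)
  qed
qed

text \<open>Dropping the trivial factors leaves a product over inversions, the shape in which
  \<open>koszul\<close> is defined.\<close>

lemma rsign_disagree:
  assumes "finite A"
  shows "rsign D A f g = (\<Prod>S\<in>{S \<in> pairs A. \<not> agree f g S}. psign (\<Prod>a\<in>S. D a))"
proof -
  have "(\<Prod>S\<in>{S \<in> pairs A. \<not> agree f g S}. psign (\<Prod>a\<in>S. D a)) = rsign D A f g"
    unfolding rsign_def using finite_pairs [OF assms]
    by (intro prod.mono_neutral_cong_left) auto
  then show ?thesis ..
qed

text \<open>Meant for duplicate-free lists with the same elements. Unlike in \<open>koszul\<close>,
  neither arrangement has to be the increasing one, so rearrangements can be composed.\<close>

definition lsign :: "('i \<Rightarrow> int) \<Rightarrow> 'i list \<Rightarrow> 'i list \<Rightarrow> 'k::comm_ring_1" where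
  "lsign D L L' = rsign D (set L) (pos L) (pos L')"

lemma lsign_refl [simp]: "lsign D L L = 1"
  unfolding lsign_def by (rule rsign_refl)

lemma lsign_trans:
  assumes "set L = set L'" "set L' = set L''"
  shows "lsign D L L' * lsign D L' L'' = lsign D L L''"
  unfolding lsign_def using assms by (metis inj_pos rsign_trans)

lemma lsign_sym:
  assumes "set L = set L'"
  shows "lsign D L L' = (lsign D L' L :: 'k::comm_ring_1)"
  unfolding lsign_def rsign_def assms
proof (rule prod.cong [OF refl])
  fix S assume "S \<in> pairs (set L')"
  then obtain a b where S: "S = {a, b}" "a \<noteq> b" "a \<in> set L'" "b \<in> set L'" by (rule pairsE)
  have "pos L a \<noteq> pos L b" "pos L' a \<noteq> pos L' b"
    using S(2-4) by (simp_all add: pos_eq_iff assms)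
  then show "(if agree (pos L) (pos L') S then 1 else psign (prod D S))
      = (if agree (pos L') (pos L) S then 1 else psign (prod D S) :: 'k)"
    unfolding S(1) by (simp add: agree_pair eq_commute)
qed

lemma lsign_square:
  assumes "set L = set L'"
  shows "lsign D L L' * lsign D L L' = (1 :: 'k::comm_ring_1)"
  using lsign_trans [OF assms assms [symmetric], of D]
  by (simp add: lsign_sym [OF assms [symmetric], of D])

lemma lsign_map:
  assumes "inj_on f (set L)" "set L = set L'"
  shows "lsign D (map f L) (map f L') = lsign (\<lambda>a. D (f a)) L L'"
  unfolding lsign_def list.set_map rsign_image [OF assms(1)]
  by (rule rsign_cong) (use assms in \<open>simp_all add: pos_map insert_absorb\<close>)

lemma lsign_cong:
  assumes "\<And>a. a \<in> set L \<Longrightarrow> even (D a) = even (D' a)"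
  shows "lsign D L L' = lsign D' L L'"
  unfolding lsign_def using assms by (intro rsign_cong) auto

lemma pairs_Un:
  assumes "A \<inter> B = {}"
  shows "pairs (A \<union> B) = pairs A \<union> pairs B \<union> (\<lambda>(a, b). {a, b}) ` (A \<times> B)"
proof
  show "pairs (A \<union> B) \<subseteq> pairs A \<union> pairs B \<union> (\<lambda>(a, b). {a, b}) ` (A \<times> B)"
  proof
    fix S assume "S \<in> pairs (A \<union> B)"
    then obtain a b where S: "S = {a, b}" "a \<noteq> b" "a \<in> A \<union> B" "b \<in> A \<union> B" by (rule pairsE)
    then consider "a \<in> A" "b \<in> A" | "a \<in> B" "b \<in> B" | "(a, b) \<in> A \<times> B" | "(b, a) \<in> A \<times> B"
      by auto
    then show "S \<in> pairs A \<union> pairs B \<union> (\<lambda>(a, b). {a, b}) ` (A \<times> B)"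
    proof cases
      case 4
      then show ?thesis unfolding S(1) by (auto simp: image_iff intro!: bexI [of _ "(b, a)"])
    qed (use S in \<open>auto simp: pairs_def\<close>)
  qed
qed (use assms in \<open>auto simp: pairs_def card_insert_if\<close>)

text \<open>A mixed pair keeps its order, since both concatenations put the letters of the first
  block in front; only pairs inside one block contribute.\<close>

lemma lsign_append:
  assumes "set A = set A'" "set B = set B'" "set A \<inter> set B = {}" "distinct A" "distinct A'"
  shows "lsign D (A @ B) (A' @ B') = lsign D A A' * (lsign D B B' :: 'k::comm_ring_1)"
proof -
  let ?F = "\<lambda>S. if agree (pos (A @ B)) (pos (A' @ B')) S then 1 else psign (prod D S) :: 'k"
  let ?M = "(\<lambda>(a, b). {a, b}) ` (set A \<times> set B)"
  have len: "length A = length A'" using assms by (metis distinct_card)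
  have mixed: "?F S = 1" if "S \<in> ?M" for S
  proof -
    from that obtain a b where S: "S = {a, b}" "a \<in> set A" "b \<in> set B" by auto
    then have "b \<notin> set A" "b \<notin> set A'" "a \<in> set A'" using assms by auto
    then have "agree (pos (A @ B)) (pos (A' @ B')) S"
      using pos_less [of a A] pos_less [of a A'] S len unfolding agree_def by (simp add: pos_append)
    then show ?thesis by simp
  qed
  have disj: "(pairs (set A) \<union> pairs (set B)) \<inter> ?M = {}" "pairs (set A) \<inter> pairs (set B) = {}"
    using assms(3) by (fastforce simp: pairs_def card_2_iff)+
  have fin: "finite (pairs (set A))" "finite (pairs (set B))" "finite ?M" by (simp_all add: finite_pairs)
  have "lsign D (A @ B) (A' @ B') = prod ?F (pairs (set A) \<union> pairs (set B) \<union> ?M)"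
    unfolding lsign_def rsign_def set_append pairs_Un [OF assms(3)] by simp
  also have "\<dots> = prod ?F (pairs (set A)) * prod ?F (pairs (set B)) * prod ?F ?M"
    using disj fin by (simp only: prod.union_disjoint finite_UnI)
  also have "prod ?F ?M = 1" using mixed by (rule prod.neutral [rule_format])
  also have "prod ?F (pairs (set A)) = lsign D A A'"
    unfolding lsign_def rsign_def
  proof (rule prod.cong [OF refl])
    fix S assume "S \<in> pairs (set A)"
    then obtain a b where S: "S = {a, b}" "a \<in> set A" "b \<in> set A" by (rule pairsE)
    then show "?F S = (if agree (pos A) (pos A') S then 1 else psign (prod D S))"
      using assms unfolding agree_def S(1) by (simp add: pos_append)
  qed
  also have "prod ?F (pairs (set B)) = lsign D B B'"
    unfolding lsign_def rsign_def
  proof (rule prod.cong [OF refl])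
    fix S assume "S \<in> pairs (set B)"
    then obtain a b where S: "S = {a, b}" "a \<in> set B" "b \<in> set B" by (rule pairsE)
    then have "a \<notin> set A" "b \<notin> set A" "a \<notin> set A'" "b \<notin> set A'" using assms by auto
    then show "?F S = (if agree (pos B) (pos B') S then 1 else psign (prod D S))"
      unfolding agree_def S(1) by (simp add: pos_append)
  qed
  finally show ?thesis by simp
qed

text \<open>Exactly the mixed pairs are reversed. The product of their signs over the rectangle of
  pairs is the sign of the product of the two total degrees.\<close>

lemma lsign_swap:
  assumes "distinct (us @ vs)"
  shows "lsign D (us @ vs) (vs @ us) =
    (psign (sum_list (map D us) * sum_list (map D vs)) :: 'k::comm_ring_1)"
proof -
  let ?F = "\<lambda>S. if agree (pos (us @ vs)) (pos (vs @ us)) S then 1 else psign (prod D S) :: 'k"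
  let ?m = "\<lambda>(a, b). {a, b}"
  let ?M = "?m ` (set us \<times> set vs)"
  have ds: "set us \<inter> set vs = {}" using assms by simp
  have disj: "(pairs (set us) \<union> pairs (set vs)) \<inter> ?M = {}" "pairs (set us) \<inter> pairs (set vs) = {}"
    using ds by (fastforce simp: pairs_def card_2_iff)+
  have fin: "finite (pairs (set us))" "finite (pairs (set vs))" "finite ?M" by (simp_all add: finite_pairs)
  have nus: "a \<notin> set vs" if "a \<in> set us" for a using ds that by auto
  have nvs: "a \<notin> set us" if "a \<in> set vs" for a using ds that by auto
  have "lsign D (us @ vs) (vs @ us) = prod ?F (pairs (set us) \<union> pairs (set vs) \<union> ?M)"
    unfolding lsign_def rsign_def set_append pairs_Un [OF ds] by simp
  also have "\<dots> = prod ?F (pairs (set us)) * prod ?F (pairs (set vs)) * prod ?F ?M"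
    using disj fin by (simp only: prod.union_disjoint finite_UnI)
  also have "prod ?F (pairs (set us)) = 1"
    by (rule prod.neutral, auto elim!: pairsE simp: agree_def pos_append nus)
  also have "prod ?F (pairs (set vs)) = 1"
    by (rule prod.neutral, auto elim!: pairsE simp: agree_def pos_append nvs)
  also have "prod ?F ?M = (\<Prod>(a, b)\<in>set us \<times> set vs. psign (D a * D b))"
  proof -
    have inj: "inj_on ?m (set us \<times> set vs)" using ds by (auto simp: inj_on_def doubleton_eq_iff)
    show ?thesis unfolding prod.reindex [OF inj]
    proof (rule prod.cong [OF refl])
      fix S assume "S \<in> set us \<times> set vs"
      then obtain a b where ab: "S = (a, b)" "a \<in> set us" "b \<in> set vs" by auto
      then have "\<not> agree (pos (us @ vs)) (pos (vs @ us)) {a, b}"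
        using pos_less [of a us] pos_less [of b vs] nus nvs by (auto simp: agree_def pos_append)
      moreover have "a \<noteq> b" using ab ds by auto
      ultimately show "(?F \<circ> ?m) S = (case S of (a, b) \<Rightarrow> psign (D a * D b))"
        using ab(1) by simp
    qed
  qed
  also have "\<dots> = psign (\<Sum>(a, b)\<in>set us \<times> set vs. D a * D b)"
    by (simp add: psign_sum case_prod_unfold)
  also have "(\<Sum>(a, b)\<in>set us \<times> set vs. D a * D b) = sum_list (map D us) * sum_list (map D vs)"
    using assms by (simp add: sum_product sum.cartesian_product sum_list_distinct_conv_sum_set)
  finally show ?thesis by simp
qed

lemma lsign_block_swap:
  assumes "distinct (xs @ us @ vs @ ys)"
  shows "lsign D (xs @ us @ vs @ ys) (xs @ vs @ us @ ys) =
    (psign (sum_list (map D us) * sum_list (map D vs)) :: 'k::comm_ring_1)"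
proof -
  have "lsign D (xs @ (us @ vs) @ ys) (xs @ (vs @ us) @ ys) = (lsign D (us @ vs) (vs @ us) :: 'k)"
  proof -
    have "lsign D (xs @ (us @ vs) @ ys) (xs @ (vs @ us) @ ys) =
        (lsign D xs xs * lsign D ((us @ vs) @ ys) ((vs @ us) @ ys) :: 'k)"
      using assms by (intro lsign_append) auto
    also have "lsign D ((us @ vs) @ ys) ((vs @ us) @ ys) =
        (lsign D (us @ vs) (vs @ us) * lsign D ys ys :: 'k)"
      using assms by (intro lsign_append) auto
    finally show ?thesis by simp
  qed
  moreover have "distinct (us @ vs)" using assms by auto
  ultimately show ?thesis by (simp only: append_assoc lsign_swap)
qed

text \<open>The inductive step of the later sign computations, which peel off the head of the target
  arrangement: a block is fetched from the middle, and the remaining letters are then arranged among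
  themselves.\<close>

lemma lsign_move_front:
  assumes "distinct (us @ xs @ vs)" "set W = set us \<union> set vs"
  shows "lsign D (us @ xs @ vs) (xs @ W) =
    psign (sum_list (map D us) * sum_list (map D xs)) * (lsign D (us @ vs) W :: 'k::comm_ring_1)"
proof -
  have "lsign D (us @ xs @ vs) (xs @ us @ vs) * lsign D (xs @ us @ vs) (xs @ W)
     = (lsign D (us @ xs @ vs) (xs @ W) :: 'k)"
    using assms by (intro lsign_trans) auto
  moreover have "lsign D (us @ xs @ vs) (xs @ us @ vs) =
      (psign (sum_list (map D us) * sum_list (map D xs)) :: 'k)"
    using lsign_block_swap [of "[]" us xs vs D] assms by simp
  moreover have "lsign D (xs @ (us @ vs)) (xs @ W) = (lsign D (us @ vs) W :: 'k)"
    using assms by (subst lsign_append) auto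
  ultimately show ?thesis by simp
qed

text \<open>The index pairs counted by \<open>koszul\<close> correspond bijectively to the
  two-element sets on which the natural order and the order of the list disagree.\<close>

lemma koszul_eq_rsign:
  assumes "distinct ps"
  shows "koszul D ps = (rsign D (set ps) id (pos ps) :: 'k::comm_ring_1)"
proof -
  let ?I = "{(r, s). r < s \<and> s < length ps \<and> ps ! s < ps ! r}"
  let ?m = "\<lambda>(r, s). {ps ! r, ps ! s}"
  have inj: "inj_on ?m ?I"
  proof (rule inj_onI)
    fix p q assume pq: "p \<in> ?I" "q \<in> ?I" "?m p = ?m q"
    obtain r s r' s' where rs: "p = (r, s)" "q = (r', s')" by fastforce
    have "ps ! r = ps ! r' \<and> ps ! s = ps ! s'"
      using pq unfolding rs by (auto simp: doubleton_eq_iff)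
    then show "p = q"
      using pq nth_eq_iff_index_eq [OF assms, of r r'] nth_eq_iff_index_eq [OF assms, of s s']
      unfolding rs by simp
  qed
  have im: "?m ` ?I = {S \<in> pairs (set ps). \<not> agree id (pos ps) S}"
  proof (intro Set.set_eqI iffI)
    fix S assume "S \<in> ?m ` ?I"
    then obtain r s where rs: "r < s" "s < length ps" "ps ! s < ps ! r" "S = {ps ! r, ps ! s}" by auto
    then have "pos ps (ps ! r) = r" "pos ps (ps ! s) = s" using assms by (simp_all add: pos_nth)
    then have "\<not> agree id (pos ps) S" unfolding agree_def rs(4) using rs by simp
    then show "S \<in> {S \<in> pairs (set ps). \<not> agree id (pos ps) S}"
      using rs by (simp add: pairs_def)
  next
    fix S assume S: "S \<in> {S \<in> pairs (set ps). \<not> agree id (pos ps) S}"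
    then obtain a b where ab: "a \<in> S" "b \<in> S" "a < b" "\<not> pos ps a < pos ps b"
      by (auto simp: agree_def)
    have "S \<in> pairs (set ps)" using S by simp
    then obtain c e where "S = {c, e}" "c \<in> set ps" "e \<in> set ps" by (rule pairsE)
    then have S2: "S = {a, b}" and mem: "a \<in> set ps" "b \<in> set ps"
      using ab by auto
    have "pos ps a \<noteq> pos ps b"
      using ab(3) mem by (simp add: pos_eq_iff)
    then have "pos ps b < pos ps a" using ab(4) by simp
    then have "(pos ps b, pos ps a) \<in> ?I" "S = ?m (pos ps b, pos ps a)"
      using ab(3) mem S2 by (simp_all add: nth_pos pos_less insert_commute)
    then show "S \<in> ?m ` ?I" by blast
  qed
  have "koszul D ps = (\<Prod>(r, s)\<in>?I. psign (\<Prod>a\<in>{ps ! r, ps ! s}. D a) :: 'k)"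
    unfolding koszul_def by (rule prod.cong [OF refl]) auto
  also have "\<dots> = (\<Prod>S\<in>?m ` ?I. psign (\<Prod>a\<in>S. D a))"
    unfolding prod.reindex [OF inj] by (rule prod.cong [OF refl]) auto
  also have "\<dots> = (\<Prod>S\<in>{S \<in> pairs (set ps). \<not> agree id (pos ps) S}. psign (\<Prod>a\<in>S. D a))"
    by (rule prod.cong [OF im refl])
  also have "\<dots> = rsign D (set ps) id (pos ps)"
    by (rule rsign_disagree [OF finite_set, symmetric])
  finally show ?thesis .
qed

lemma pos_strict_sorted:
  assumes "sorted_wrt (<) L" "a \<in> set L" "b \<in> set L"
  shows "pos L a < pos L b \<longleftrightarrow> a < (b :: nat)"
  using assms by (induction L) auto

lemma koszul_eq_lsign:
  assumes "distinct ps" "sorted_wrt (<) L" "set L = set ps"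
  shows "koszul D ps = lsign D L ps"
  unfolding koszul_eq_rsign [OF assms(1)] lsign_def assms(3)
  by (rule rsign_cong) (simp_all add: pos_strict_sorted assms)


section \<open>Wick contractions of words\<close>

interpretation pm: vector_space "smul :: 'k::field \<Rightarrow> ('a \<Rightarrow>\<^sub>0 'k) \<Rightarrow> ('a \<Rightarrow>\<^sub>0 'k)"
  by (rule vector_space_smul)

lemma smul_single [simp]: "smul c (single x a) = single x (c * a)"
  by (rule poly_mapping_eqI) (simp add: lookup_smul lookup_single when_def)

lemma keys_smul: "keys (smul c p) \<subseteq> keys p"
  by (auto simp: in_keys_iff lookup_smul)

lemma lin_ext_superset:
  assumes "finite A" "keys p \<subseteq> A"
  shows "lin_ext f p = (\<Sum>x\<in>A. smul (lookup p x) (f x))"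
  unfolding lin_ext_def using assms
  by (intro sum.mono_neutral_left) (auto simp: in_keys_iff)

lemma lin_ext_0 [simp]: "lin_ext f 0 = 0"
  by (simp add: lin_ext_def)

lemma lin_ext_single [simp]: "lin_ext f (single x c) = smul c (f x)"
  by (subst lin_ext_superset [of "{x}"]) (auto simp: lookup_single)

lemma lin_ext_add: "lin_ext f (p + q) = lin_ext f p + lin_ext f q"
proof -
  have "keys (p + q) \<subseteq> keys p \<union> keys q" by (rule Poly_Mapping.keys_add)
  then show ?thesis
    by (simp add: lin_ext_superset [of "keys p \<union> keys q"] lookup_add pm.scale_left_distrib sum.distrib)
qed

lemma lin_ext_smul: "lin_ext f (smul c p) = smul c (lin_ext f p)"
  unfolding lin_ext_superset [OF finite_keys keys_smul]
  by (simp add: lookup_smul lin_ext_def [of f p] pm.scale_sum_right)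

lemma linear_lin_ext: "Vector_Spaces.linear smul smul (lin_ext f)"
  by (simp add: Vector_Spaces.linear_iff vector_space_smul lin_ext_add lin_ext_smul)

lemma lin_ext_sum: "lin_ext f (\<Sum>i\<in>A. p i) = (\<Sum>i\<in>A. lin_ext f (p i))"
  by (induction A rule: infinite_finite_induct) (simp_all add: lin_ext_add)

lemma lin_ext_diff: "lin_ext f (p - q) = lin_ext f p - lin_ext f q"
  by (metis add_diff_cancel diff_add_cancel lin_ext_add)

lemma lin_ext_fun_add: "lin_ext (\<lambda>x. f x + g x) p = lin_ext f p + lin_ext g p"
  by (simp add: lin_ext_def pm.scale_right_distrib sum.distrib)

lemma lin_ext_fun_smul: "lin_ext (\<lambda>x. smul c (f x)) p = smul c (lin_ext f p)"
  by (simp add: lin_ext_def pm.scale_sum_right mult.commute)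

lemma lin_ext_fun_sum: "lin_ext (\<lambda>x. \<Sum>i\<in>A. f i x) p = (\<Sum>i\<in>A. lin_ext (f i) p)"
  unfolding lin_ext_def pm.scale_sum_right by (rule sum.swap)

lemma lin_ext_cong: "(\<And>x. x \<in> keys p \<Longrightarrow> f x = g x) \<Longrightarrow> lin_ext f p = lin_ext g p"
  unfolding lin_ext_def by (intro sum.cong) auto

lemma lin_ext_comp: "lin_ext f (lin_ext g p) = lin_ext (\<lambda>x. lin_ext f (g x)) p"
  unfolding lin_ext_def [of g] lin_ext_sum lin_ext_smul by (simp add: lin_ext_def [of _ p])

lemma lin_ext_ident: "lin_ext (\<lambda>x. single x 1) p = p"
proof (rule poly_mapping_eqI)
  fix x
  have "lookup (lin_ext (\<lambda>x. single x 1) p) x = (\<Sum>y\<in>keys p. if y = x then lookup p y else 0)"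
    unfolding lin_ext_def lookup_sum by (intro sum.cong) (auto simp: lookup_single when_def)
  also have "\<dots> = lookup p x" by (simp add: in_keys_iff)
  finally show "lookup (lin_ext (\<lambda>x. single x 1) p) x = lookup p x" .
qed

lemma keys_lin_ext: "keys (lin_ext f p) \<subseteq> (\<Union>x\<in>keys p. keys (f x))"
  unfolding lin_ext_def by (rule order_trans [OF keys_sum]) (use keys_smul in fastforce)

lemma keys_sum_subset: "(\<And>i. i \<in> A \<Longrightarrow> keys (p i) \<subseteq> K) \<Longrightarrow> keys (\<Sum>i\<in>A. p i) \<subseteq> K"
  using keys_sum [of p A] by blast

lemma concat_mult_lin_ext:
  "concat_mult p q = lin_ext (\<lambda>u. lin_ext (\<lambda>v. single (u @ v) 1) q) p"
  unfolding concat_mult_def lin_ext_def pm.scale_sum_right by simp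

lemma concat_mult_lin_ext':
  "concat_mult p q = lin_ext (\<lambda>v. lin_ext (\<lambda>u. single (u @ v) 1) p) q"
  unfolding concat_mult_lin_ext lin_ext_def pm.scale_sum_right
  by (subst sum.swap) (simp add: mult.commute)

lemma concat_mult_single [simp]: "concat_mult (single u a) (single v b) = single (u @ v) (a * b)"
  by (simp add: concat_mult_lin_ext)

lemma concat_mult_0 [simp]: "concat_mult 0 q = 0" "concat_mult p 0 = 0"
  by (simp_all add: concat_mult_lin_ext) (simp add: lin_ext_def)

lemma concat_mult_add:
  "concat_mult (p + p') q = concat_mult p q + concat_mult p' q"
  "concat_mult p (q + q') = concat_mult p q + concat_mult p q'"
  by (simp_all add: concat_mult_lin_ext lin_ext_add lin_ext_fun_add)

lemma concat_mult_smul: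
  "concat_mult (smul c p) q = smul c (concat_mult p q)"
  "concat_mult p (smul c q) = smul c (concat_mult p q)"
  by (simp_all add: concat_mult_lin_ext lin_ext_smul lin_ext_fun_smul)

lemma concat_mult_diff:
  "concat_mult (p - p') q = concat_mult p q - concat_mult p' q"
  "concat_mult p (q - q') = concat_mult p q - concat_mult p q'"
  by (simp_all add: eq_diff_eq flip: concat_mult_add)

lemma concat_mult_sum:
  "concat_mult (\<Sum>i\<in>A. f i) q = (\<Sum>i\<in>A. concat_mult (f i) q)"
  "concat_mult p (\<Sum>i\<in>A. f i) = (\<Sum>i\<in>A. concat_mult p (f i))"
  by (induction A rule: infinite_finite_induct) (simp_all add: concat_mult_add)

lemma concat_mult_one [simp]: "concat_mult (single [] 1) q = q" "concat_mult p (single [] 1) = p"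
  by (simp_all add: concat_mult_lin_ext lin_ext_ident)

lemma keys_concat_mult: "keys (concat_mult p q) \<subseteq> {u @ v | u v. u \<in> keys p \<and> v \<in> keys q}"
  unfolding concat_mult_def
  by (intro keys_sum_subset) (auto simp: in_keys_iff lookup_single when_def split: if_splits)

section \<open>The congruence that defines the free graded commutative algebra\<close>

locale presentation =
  fixes V :: "('k::field_char_0, 'x) pres"
begin

abbreviation "deg \<equiv> gdeg V"

abbreviation words :: "'x list set" where "words \<equiv> lists (gens V)"

text \<open>Equality in the symmetric algebra, phrased for representatives so that contractions can
  be compared without entering the quotient.\<close>

definition scong :: "('x list \<Rightarrow>\<^sub>0 'k) \<Rightarrow> ('x list \<Rightarrow>\<^sub>0 'k) \<Rightarrow> bool" (infix \<open>\<simeq>\<close> 50) where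
  "p \<simeq> q \<longleftrightarrow> p - q \<in> sym_null V"

lemma sym_null_0 [simp]: "0 \<in> sym_null V"
  unfolding sym_null_def by (rule pm.span_zero)

lemma sym_null_add: "p \<in> sym_null V \<Longrightarrow> q \<in> sym_null V \<Longrightarrow> p + q \<in> sym_null V"
  unfolding sym_null_def by (rule pm.span_add)

lemma sym_null_diff: "p \<in> sym_null V \<Longrightarrow> q \<in> sym_null V \<Longrightarrow> p - q \<in> sym_null V"
  unfolding sym_null_def by (rule pm.span_diff)

lemma sym_null_smul: "p \<in> sym_null V \<Longrightarrow> smul c p \<in> sym_null V"
  unfolding sym_null_def by (rule pm.span_scale)

lemma sym_null_sum: "(\<And>i. i \<in> A \<Longrightarrow> p i \<in> sym_null V) \<Longrightarrow> (\<Sum>i\<in>A. p i) \<in> sym_null V"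
  unfolding sym_null_def by (rule pm.span_sum)

lemma sym_null_rel:
  "us \<in> words \<Longrightarrow> vs \<in> words \<Longrightarrow> r \<in> rels V \<Longrightarrow> lin_ext (\<lambda>x. single (us @ x # vs) 1) r \<in> sym_null V"
  unfolding sym_null_def by (intro pm.span_base UnI1) blast

lemma scong_refl [simp]: "p \<simeq> p" by (simp add: scong_def)

lemma scong_sym: "p \<simeq> q \<Longrightarrow> q \<simeq> p"
  unfolding scong_def using sym_null_diff [OF sym_null_0] by force

lemma scong_trans [trans]: "p \<simeq> q \<Longrightarrow> q \<simeq> r \<Longrightarrow> p \<simeq> r"
  unfolding scong_def using sym_null_add [of "p - q" "q - r"] by simp

lemma eq_scong_trans [trans]: "p = q \<Longrightarrow> q \<simeq> r \<Longrightarrow> p \<simeq> r" by simp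
lemma scong_eq_trans [trans]: "p \<simeq> q \<Longrightarrow> q = r \<Longrightarrow> p \<simeq> r" by simp

lemma scong_add: "p \<simeq> q \<Longrightarrow> p' \<simeq> q' \<Longrightarrow> p + p' \<simeq> q + q'"
  unfolding scong_def using sym_null_add [of "p - q" "p' - q'"] by (simp add: algebra_simps)

lemma scong_smul: "p \<simeq> q \<Longrightarrow> smul c p \<simeq> smul c q"
  unfolding scong_def using sym_null_smul [of "p - q" c] by (simp add: pm.scale_right_diff_distrib)

lemma scong_sum: "(\<And>i. i \<in> A \<Longrightarrow> p i \<simeq> q i) \<Longrightarrow> (\<Sum>i\<in>A. p i) \<simeq> (\<Sum>i\<in>A. q i)"
  unfolding scong_def sum_subtractf [symmetric] by (rule sym_null_sum)

lemma scong_swap: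
  assumes "us \<in> words" "vs \<in> words" "x \<in> gens V" "y \<in> gens V"
  shows "single (us @ x # y # vs) c \<simeq> single (us @ y # x # vs) (c * psign (deg x * deg y))"
proof -
  have "single (us @ x # y # vs) 1 - single (us @ y # x # vs) (psign (deg x * deg y)) \<in> sym_null V"
    unfolding sym_null_def using assms by (intro pm.span_base UnI2) blast
  then show ?thesis
    unfolding scong_def using sym_null_smul [of _ c] by (force simp: pm.scale_right_diff_distrib)
qed

lemma scong_move:
  assumes "us \<in> words" "xs \<in> words" "vs \<in> words" "x \<in> gens V"
  shows "single (us @ xs @ x # vs) c \<simeq>
    single (us @ x # xs @ vs) (c * psign (sum_list (map deg xs) * deg x))"
  using assms
proof (induction xs arbitrary: us)
  case (Cons y ys)
  have "single (us @ (y # ys) @ x # vs) c = single ((us @ [y]) @ ys @ x # vs) c" by simp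
  also have "\<dots> \<simeq> single ((us @ [y]) @ x # ys @ vs) (c * psign (sum_list (map deg ys) * deg x))"
    using Cons.prems by (intro Cons.IH) auto
  also have "\<dots> = single (us @ y # x # ys @ vs) (c * psign (sum_list (map deg ys) * deg x))" by simp
  also have "\<dots> \<simeq> single (us @ x # y # ys @ vs)
      (c * psign (sum_list (map deg ys) * deg x) * psign (deg y * deg x))"
    using Cons.prems by (intro scong_swap) auto
  finally show ?case by (simp add: psign_add algebra_simps)
qed simp

text \<open>Graded commutativity for arbitrary permutations, obtained by selection sort: the head of
  the target list is moved to its place and then absorbed by the fixed prefix \<open>us\<close>,
  while \<open>lsign_move_front\<close> keeps track of the sign.\<close>

lemma scong_perm:
  assumes "distinct ls" "distinct ls'" "set ls = set ls'" "us \<in> words" "W ` set ls \<subseteq> gens V"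
  shows "single (us @ map W ls) c \<simeq> single (us @ map W ls') (c * lsign (\<lambda>a. deg (W a)) ls ls')"
  using assms
proof (induction ls' arbitrary: ls us c)
  case (Cons a ls')
  then obtain xs ys where ls: "ls = xs @ a # ys" by (metis list.set_intros(1) split_list)
  let ?D = "\<lambda>a. deg (W a)"
  have W: "set xs \<union> set ys = set ls'" "map W xs \<in> words" "map W ys \<in> words" "W a \<in> gens V"
  proof -
    show "set xs \<union> set ys = set ls'" using Cons.prems(1-3) unfolding ls by auto
    have "set xs \<subseteq> set ls" "set ys \<subseteq> set ls" "a \<in> set ls" by (auto simp: ls)
    then show "map W xs \<in> words" "map W ys \<in> words" "W a \<in> gens V"
      using Cons.prems(5) by (auto simp: subset_iff image_subset_iff)
  qed
  have "single (us @ map W ls) c \<simeq>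
      single (us @ W a # map W xs @ map W ys) (c * psign (sum_list (map deg (map W xs)) * deg (W a)))"
    unfolding ls map_append list.map using Cons.prems W by (intro scong_move) auto
  also have "\<dots> = single ((us @ [W a]) @ map W (xs @ ys))
      (c * psign (sum_list (map ?D xs) * deg (W a)))" by (simp add: o_def)
  also have "\<dots> \<simeq> single ((us @ [W a]) @ map W ls')
      (c * psign (sum_list (map ?D xs) * deg (W a)) * lsign ?D (xs @ ys) ls')"
    using Cons.prems W ls by (intro Cons.IH) auto
  also have "lsign ?D ls (a # ls') =
      (psign (sum_list (map ?D xs) * deg (W a)) * lsign ?D (xs @ ys) ls' :: 'k)"
    using lsign_move_front [of xs "[a]" ys ls' ?D] Cons.prems(1,2) W ls by simp
  then have "single ((us @ [W a]) @ map W ls')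
      (c * psign (sum_list (map ?D xs) * deg (W a)) * lsign ?D (xs @ ys) ls') =
    single (us @ map W (a # ls')) (c * lsign ?D ls (a # ls'))"
    by (simp add: mult.assoc)
  finally show ?case .
qed simp

text \<open>Both families of generators are stable under appending a word. Together with the mirror
  image below, this makes \<open>sym_null\<close> behave as a two-sided ideal, so that the product
  descends to the quotient.\<close>

lemma sym_null_concat_right:
  assumes "p \<in> sym_null V" "keys q \<subseteq> words"
  shows "concat_mult p q \<in> sym_null V"
  using assms(1) unfolding sym_null_def
proof (induction rule: pm.span_induct_alt)
  case base
  then show ?case using sym_null_0 by (simp add: sym_null_def)
next
  case (step c b p)
  have "concat_mult b (single w 1) \<in> sym_null V" if "w \<in> words" for w
    using step(1)
  proof
    assume "b \<in> {lin_ext (\<lambda>x. single (us @ x # vs) 1) r | us vs r. us \<in> words \<and> vs \<in> words \<and> r \<in> rels V}"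
    then obtain us vs r where b: "b = lin_ext (\<lambda>x. single (us @ x # vs) 1) r"
      "us \<in> words" "vs \<in> words" "r \<in> rels V" by blast
    have "concat_mult b (single w 1) = lin_ext (\<lambda>x. single (us @ x # (vs @ w)) 1) r"
      by (simp add: b(1) concat_mult_lin_ext lin_ext_comp)
    then show ?thesis using b that by (simp add: sym_null_rel)
  next
    assume "b \<in> {single (us @ x # y # vs) 1 - single (us @ y # x # vs) (psign (deg x * deg y))
       | us vs x y. us \<in> words \<and> vs \<in> words \<and> x \<in> gens V \<and> y \<in> gens V}"
    then obtain us vs x y where b: "b = single (us @ x # y # vs) 1 - single (us @ y # x # vs) (psign (deg x * deg y))"
      "us \<in> words" "vs \<in> words" "x \<in> gens V" "y \<in> gens V" by blast
    have "concat_mult b (single w 1) =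
      single (us @ x # y # (vs @ w)) 1 - single (us @ y # x # (vs @ w)) (psign (deg x * deg y))"
      by (simp add: b(1) concat_mult_diff)
    then show ?thesis using scong_swap [of us "vs @ w" x y 1] b that by (simp add: scong_def)
  qed
  then have "concat_mult b q \<in> sym_null V"
    using assms(2) unfolding concat_mult_lin_ext' [of b q] lin_ext_def [of _ q]
    by (intro sym_null_sum sym_null_smul) (auto simp: concat_mult_lin_ext')
  then show ?case using step(2) unfolding sym_null_def [symmetric]
    by (simp add: concat_mult_add concat_mult_smul sym_null_add sym_null_smul)
qed

lemma sym_null_concat_left:
  assumes "p \<in> sym_null V" "keys q \<subseteq> words"
  shows "concat_mult q p \<in> sym_null V"
  using assms(1) unfolding sym_null_def
proof (induction rule: pm.span_induct_alt)
  case base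
  then show ?case using sym_null_0 by (simp add: sym_null_def)
next
  case (step c b p)
  have "concat_mult (single w 1) b \<in> sym_null V" if "w \<in> words" for w
    using step(1)
  proof
    assume "b \<in> {lin_ext (\<lambda>x. single (us @ x # vs) 1) r | us vs r. us \<in> words \<and> vs \<in> words \<and> r \<in> rels V}"
    then obtain us vs r where b: "b = lin_ext (\<lambda>x. single (us @ x # vs) 1) r"
      "us \<in> words" "vs \<in> words" "r \<in> rels V" by blast
    have "concat_mult (single w 1) b = lin_ext (\<lambda>x. single ((w @ us) @ x # vs) 1) r"
      by (simp add: b(1) concat_mult_lin_ext lin_ext_comp)
    then show ?thesis using b that sym_null_rel [of "w @ us" vs r] by simp
  next
    assume "b \<in> {single (us @ x # y # vs) 1 - single (us @ y # x # vs) (psign (deg x * deg y))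
       | us vs x y. us \<in> words \<and> vs \<in> words \<and> x \<in> gens V \<and> y \<in> gens V}"
    then obtain us vs x y where b: "b = single (us @ x # y # vs) 1 - single (us @ y # x # vs) (psign (deg x * deg y))"
      "us \<in> words" "vs \<in> words" "x \<in> gens V" "y \<in> gens V" by blast
    have "concat_mult (single w 1) b =
      single ((w @ us) @ x # y # vs) 1 - single ((w @ us) @ y # x # vs) (psign (deg x * deg y))"
      by (simp add: b(1) concat_mult_diff)
    then show ?thesis using scong_swap [of "w @ us" vs x y 1] b that by (simp add: scong_def)
  qed
  then have "concat_mult q b \<in> sym_null V"
    using assms(2) unfolding concat_mult_lin_ext [of q b] lin_ext_def [of _ q]
    by (intro sym_null_sum sym_null_smul) (auto simp: concat_mult_lin_ext)
  then show ?case using step(2) unfolding sym_null_def [symmetric]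
    by (simp add: concat_mult_add concat_mult_smul sym_null_add sym_null_smul)
qed

text \<open>The factors are replaced one after the other through the intermediate product of
  \<open>p'\<close> and \<open>q\<close>; these two are therefore the ones that have to consist of
  words.\<close>

lemma scong_concat_mult:
  assumes "p \<simeq> p'" "q \<simeq> q'" "keys p' \<subseteq> words" "keys q \<subseteq> words"
  shows "concat_mult p q \<simeq> concat_mult p' q'"
proof (rule scong_trans)
  show "concat_mult p q \<simeq> concat_mult p' q" "concat_mult p' q \<simeq> concat_mult p' q'"
    using assms by (simp_all add: scong_def sym_null_concat_left sym_null_concat_right
        flip: concat_mult_diff)
qed

end

section \<open>Involutions, their two-cycles and their fixed points\<close>

definition flat :: "('i \<times> 'i) list \<Rightarrow> 'i list" where
  "flat es = concat (map (\<lambda>(a, b). [a, b]) es)"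

lemma flat_simps [simp]:
  "flat [] = []" "flat ((a, b) # es) = a # b # flat es" "flat (es @ es') = flat es @ flat es'"
  by (simp_all add: flat_def)

lemma set_flat: "set (flat es) = fst ` set es \<union> snd ` set es"
  by (simp add: flat_def case_prod_unfold) blast

text \<open>Distinctness forces the two ends of a pair to differ, so \<open>es\<close> lists every
  two-element orbit exactly once, with an arbitrary orientation and in an arbitrary order, and
  \<open>ls\<close> lists the fixed points.\<close>

definition enumerates :: "'i list \<Rightarrow> ('i \<Rightarrow> 'i) \<Rightarrow> ('i \<times> 'i) list \<Rightarrow> 'i list \<Rightarrow> bool" where
  "enumerates L \<tau> es ls \<longleftrightarrow> distinct (flat es @ ls) \<and> set (flat es @ ls) = set L \<and>
     (\<forall>(a, b)\<in>set es. \<tau> a = b \<and> \<tau> b = a) \<and> (\<forall>a\<in>set ls. \<tau> a = a)"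

definition edge_list :: "'i list \<Rightarrow> ('i \<Rightarrow> 'i) \<Rightarrow> ('i \<times> 'i) list" where
  "edge_list L \<tau> = map (\<lambda>a. (a, \<tau> a)) (filter (\<lambda>a. pos L a < pos L (\<tau> a)) L)"

text \<open>The functions are extensional: an involution is determined by its values on
  \<open>A\<close>, and a finite \<open>A\<close> has only finitely many.\<close>

definition invols :: "'i set \<Rightarrow> ('i \<Rightarrow> 'i) set" where
  "invols A = {\<tau> \<in> A \<rightarrow>\<^sub>E A. \<forall>a\<in>A. \<tau> (\<tau> a) = a}"

lemma invols_mem: "\<tau> \<in> invols A \<Longrightarrow> a \<in> A \<Longrightarrow> \<tau> a \<in> A"
  and invols_invol: "\<tau> \<in> invols A \<Longrightarrow> a \<in> A \<Longrightarrow> \<tau> (\<tau> a) = a"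
  by (auto simp: invols_def)

lemma finite_invols: "finite A \<Longrightarrow> finite (invols A)"
  unfolding invols_def by (rule finite_subset [of _ "A \<rightarrow>\<^sub>E A"]) (auto intro: finite_PiE)

lemma distinct_flat_map:
  assumes "distinct xs" "inj_on \<tau> (set xs)" "set xs \<inter> \<tau> ` set xs = {}"
  shows "distinct (flat (map (\<lambda>a. (a, \<tau> a)) xs))"
  using assms by (induction xs) (auto simp: set_flat image_iff)

text \<open>A moved letter either precedes its partner or is the partner of a letter that does, and
  never both.\<close>

lemma enumerates_edge_list:
  assumes L: "distinct L" and \<tau>: "\<tau> \<in> invols (set L)"
  shows "enumerates L \<tau> (edge_list L \<tau>) (filter (\<lambda>a. \<tau> a = a) L)"
proof -
  let ?X = "{a \<in> set L. pos L a < pos L (\<tau> a)}"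
  have inv: "\<tau> a \<in> set L" "\<tau> (\<tau> a) = a" if "a \<in> set L" for a
    using \<tau> that by (auto dest: invols_mem invols_invol)
  have inj: "inj_on \<tau> (set L)" by (metis inj_onI inv(2))
  have fl: "set (flat (edge_list L \<tau>)) = ?X \<union> \<tau> ` ?X"
    by (force simp: edge_list_def set_flat image_iff)
  have pos: "pos L (\<tau> a) < pos L a" if "a \<in> set L" "\<not> pos L a < pos L (\<tau> a)" "\<tau> a \<noteq> a" for a
    using that inv inj_onD [OF inj_pos [of L], of a "\<tau> a"] by force
  have "distinct (flat (edge_list L \<tau>))"
    unfolding edge_list_def
  proof (rule distinct_flat_map)
    show "set (filter (\<lambda>a. pos L a < pos L (\<tau> a)) L) \<inter> \<tau> ` set (filter (\<lambda>a. pos L a < pos L (\<tau> a)) L) = {}"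
      using inv by fastforce
  qed (use L inj in \<open>auto intro: inj_on_subset\<close>)
  moreover have "?X \<union> \<tau> ` ?X \<union> {a \<in> set L. \<tau> a = a} = set L"
  proof -
    have "a \<in> ?X \<union> \<tau> ` ?X" if a: "a \<in> set L" "\<tau> a \<noteq> a" for a
    proof (cases "pos L a < pos L (\<tau> a)")
      case False
      then have "\<tau> a \<in> ?X" using a inv pos by simp
      then have "\<tau> (\<tau> a) \<in> \<tau> ` ?X" by (rule imageI)
      then show ?thesis using inv a by simp
    qed (use a in simp)
    then show ?thesis using inv by auto
  qed
  moreover have "(?X \<union> \<tau> ` ?X) \<inter> {a \<in> set L. \<tau> a = a} = {}"
    using inv by fastforce
  ultimately show ?thesis
    unfolding enumerates_def fl set_append distinct_append
    using L inv by (auto simp: edge_list_def)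
qed

text \<open>What a form needs in order to be contracted in \<open>Sym V\<close>. By
  \<open>h_even\<close> a contracted pair has even total degree and moves past other letters without
  a sign; \<open>h_rel\<close> together with the symmetry makes the form descend to both arguments;
  \<open>rels_parity\<close> reduces every relation to relations whose letters share a parity, for
  which Koszul signs are constant.\<close>

locale even_form = presentation V for V :: "('k::field_char_0, 'x) pres" +
  fixes h :: "'x \<Rightarrow> 'x \<Rightarrow> 'k"
  assumes h_sym: "h x y = psign (gdeg V x * gdeg V y) * h y x"
    and h_even: "x \<in> gens V \<Longrightarrow> y \<in> gens V \<Longrightarrow> h x y \<noteq> 0 \<Longrightarrow> even (gdeg V x + gdeg V y)"
    and h_rel: "r \<in> rels V \<Longrightarrow> y \<in> gens V \<Longrightarrow> (\<Sum>x\<in>keys r. lookup r x * h x y) = 0"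
    and rels_gens: "r \<in> rels V \<Longrightarrow> keys r \<subseteq> gens V"
    and rels_parity: "r \<in> rels V \<Longrightarrow> \<exists>r0\<in>rels V. \<exists>r1\<in>rels V. r = r0 + r1 \<and>
      (\<forall>x\<in>keys r0. even (gdeg V x)) \<and> (\<forall>x\<in>keys r1. odd (gdeg V x))"
begin

section \<open>Contractions with respect to an even form\<close>

definition hprod :: "('i \<Rightarrow> 'x) \<Rightarrow> ('i \<times> 'i) list \<Rightarrow> 'k" where
  "hprod W es = (\<Prod>(a, b)\<leftarrow>es. h (W a) (W b))"

lemma hprod_simps [simp]:
  "hprod W [] = 1" "hprod W ((a, b) # es) = h (W a) (W b) * hprod W es"
  "hprod W (es @ es') = hprod W es * hprod W es'"
  by (simp_all add: hprod_def)

text \<open>Contraction for an explicit enumeration. As in \<open>contraction\<close>, a single sign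
  takes the given arrangement to edges first and leaves last.\<close>

definition ev :: "'i list \<Rightarrow> ('i \<Rightarrow> 'x) \<Rightarrow> ('i \<times> 'i) list \<Rightarrow> 'i list \<Rightarrow> ('x list \<Rightarrow>\<^sub>0 'k)" where
  "ev L W es ls = single (map W ls) (lsign (\<lambda>a. deg (W a)) L (flat es @ ls) * hprod W es)"

definition wick :: "'i list \<Rightarrow> ('i \<Rightarrow> 'x) \<Rightarrow> ('i \<Rightarrow> 'i) \<Rightarrow> ('x list \<Rightarrow>\<^sub>0 'k)" where
  "wick L W \<tau> = ev L W (edge_list L \<tau>) (filter (\<lambda>a. \<tau> a = a) L)"

text \<open>Independence of the enumeration, by induction on the second list of edges. Its first
  edge occurs in the first list, possibly reversed. If the form vanishes on it, both sides are zero.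
  Otherwise the pair is even and comes to the front without a sign, and the sign of a reversal is
  compensated by the graded symmetry of \<open>h\<close>. With no edges left, the claim is the
  permutation of leaves in \<open>scong_perm\<close>.\<close>

lemma ev_invariance:
  assumes "distinct (flat es @ ls)" "distinct (flat es' @ ls')" "set (flat es @ ls) = set (flat es' @ ls')"
    "\<forall>(a, b)\<in>set es. \<tau> a = b \<and> \<tau> b = a" "\<forall>(a, b)\<in>set es'. \<tau> a = b \<and> \<tau> b = a"
    "\<forall>a\<in>set ls. \<tau> a = a" "\<forall>a\<in>set ls'. \<tau> a = a" "W ` set (flat es @ ls) \<subseteq> gens V"
  shows "single (map W ls) (hprod W es) \<simeq>
    single (map W ls') (lsign (\<lambda>a. deg (W a)) (flat es @ ls) (flat es' @ ls') * hprod W es')"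
  using assms
proof (induction es' arbitrary: es)
  case Nil
  \<comment> \<open>An edge in \<open>es\<close> would have its ends in \<open>ls'\<close>, whose
    members are fixed by the involution.\<close>
  have "es = []"
  proof (cases es)
    case (Cons e es1)
    obtain a b where e: "e = (a, b)" by fastforce
    then have "a \<in> set ls'" "a \<noteq> b" "\<tau> a = b" using Nil.prems Cons by auto
    then show ?thesis using Nil.prems by auto
  qed
  then show ?case using Nil.prems scong_perm [of ls ls' "[]" W 1] by simp
next
  case (Cons e es')
  let ?D = "\<lambda>a. deg (W a)"
  obtain a b where e: "e = (a, b)" by fastforce
  have ab: "\<tau> a = b" "\<tau> b = a" "a \<noteq> b" using Cons.prems e by auto
  then have "a \<notin> set ls" using Cons.prems by force
  moreover have "a \<in> set (flat es @ ls)" unfolding Cons.prems(3) e by simp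
  ultimately have "a \<in> set (flat es)" by simp
  then obtain c d where cd: "(c, d) \<in> set es" "a = c \<or> a = d" by (auto simp: set_flat)
  then have "\<tau> c = d" "\<tau> d = c" using Cons.prems(4) by auto
  with cd ab have or: "(c, d) = (a, b) \<or> (c, d) = (b, a)" by auto
  obtain us vs where es: "es = us @ (c, d) # vs" using cd(1) by (meson split_list)
  have gens: "W a \<in> gens V" "W b \<in> gens V" "W c \<in> gens V" "W d \<in> gens V"
    using Cons.prems(8) or unfolding es by auto
  show ?case
  proof (cases "h (W a) (W b) = 0")
    case True
    then have "h (W c) (W d) = 0" using or h_sym [of "W b" "W a"] by auto
    then show ?thesis using True by (simp add: e es)
  next
    case False
    then have even: "even (?D a + ?D b)" using h_even gens by blast
    then have even': "even (?D c + ?D d)" using or by auto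
    have set: "set (flat (us @ vs) @ ls) = set (flat es' @ ls')"
    proof -
      have "{c, d} = {a, b}" "c \<noteq> d" using or ab by auto
      moreover have "set (flat es @ ls) = {c, d} \<union> set (flat (us @ vs) @ ls)"
        "{c, d} \<inter> set (flat (us @ vs) @ ls) = {}"
        "set (flat (e # es') @ ls') = {a, b} \<union> set (flat es' @ ls')"
        "{a, b} \<inter> set (flat es' @ ls') = {}"
        using Cons.prems(1,2) unfolding es e by auto
      ultimately show ?thesis using Cons.prems(3) by blast
    qed
    have IH: "single (map W ls) (hprod W (us @ vs)) \<simeq> single (map W ls')
      (lsign ?D (flat (us @ vs) @ ls) (flat es' @ ls') * hprod W es')"
      using Cons.prems set unfolding es e by (intro Cons.IH) auto
    have "lsign ?D (flat us @ [c, d] @ flat vs @ ls) ([c, d] @ flat es' @ ls') =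
      (lsign ?D (flat us @ flat vs @ ls) (flat es' @ ls') :: 'k)"
      using Cons.prems(1) set even' unfolding es
      by (subst lsign_move_front) (auto simp: psign_even)
    moreover have "lsign ?D ([c, d] @ flat es' @ ls') ([a, b] @ flat es' @ ls') * h (W c) (W d) = h (W a) (W b)"
    proof (cases "c = a")
      case True
      then show ?thesis using or by auto
    next
      case False
      then have cd: "c = b" "d = a" using or by auto
      have "lsign ?D ([] @ [b] @ [a] @ (flat es' @ ls')) ([] @ [a] @ [b] @ (flat es' @ ls')) =
        (psign (sum_list (map ?D [b]) * sum_list (map ?D [a])) :: 'k)"
        using Cons.prems(2) e by (intro lsign_block_swap) auto
      then show ?thesis using cd h_sym [of "W a" "W b"] by (simp add: mult.commute)
    qed
    moreover have "lsign ?D (flat es @ ls) ([c, d] @ flat es' @ ls') *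
        lsign ?D ([c, d] @ flat es' @ ls') ([a, b] @ flat es' @ ls') =
        (lsign ?D (flat es @ ls) ([a, b] @ flat es' @ ls') :: 'k)"
      using Cons.prems(3) or unfolding e by (intro lsign_trans) auto
    ultimately have "lsign ?D (flat es @ ls) (flat (e # es') @ ls') * hprod W (e # es') =
      lsign ?D (flat (us @ vs) @ ls) (flat es' @ ls') * hprod W es' * h (W c) (W d)"
    proof -
      assume a1: "lsign ?D (flat us @ [c, d] @ flat vs @ ls) ([c, d] @ flat es' @ ls') =
          (lsign ?D (flat us @ flat vs @ ls) (flat es' @ ls') :: 'k)"
        and a2: "lsign ?D ([c, d] @ flat es' @ ls') ([a, b] @ flat es' @ ls') * h (W c) (W d) = h (W a) (W b)"
        and a3: "lsign ?D (flat es @ ls) ([c, d] @ flat es' @ ls') *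
        lsign ?D ([c, d] @ flat es' @ ls') ([a, b] @ flat es' @ ls') =
        (lsign ?D (flat es @ ls) ([a, b] @ flat es' @ ls') :: 'k)"
      \<comment> \<open>Since the reversal sign squares to one it may be inserted twice: one copy
        changes the arrangement, the other turns the value of \<open>h\<close> on (c, d) into that
        on (a, b).\<close>
      have sq: "lsign ?D ([c, d] @ flat es' @ ls') ([a, b] @ flat es' @ ls') *
          lsign ?D ([c, d] @ flat es' @ ls') ([a, b] @ flat es' @ ls') = (1 :: 'k)"
        using or by (intro lsign_square) auto
      have "lsign ?D (flat es @ ls) (flat (e # es') @ ls') * hprod W (e # es') =
        lsign ?D (flat es @ ls) ([a, b] @ flat es' @ ls') * (h (W a) (W b) * hprod W es')"
        by (simp add: e)
      also have "\<dots> = lsign ?D (flat es @ ls) ([c, d] @ flat es' @ ls') *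
        (lsign ?D ([c, d] @ flat es' @ ls') ([a, b] @ flat es' @ ls') *
          lsign ?D ([c, d] @ flat es' @ ls') ([a, b] @ flat es' @ ls')) * h (W c) (W d) * hprod W es'"
        unfolding a3 [symmetric] a2 [symmetric] by (simp add: mult_ac)
      also have "\<dots> = lsign ?D (flat es @ ls) ([c, d] @ flat es' @ ls') * h (W c) (W d) * hprod W es'"
        unfolding sq by simp
      also have "lsign ?D (flat es @ ls) ([c, d] @ flat es' @ ls') =
         (lsign ?D (flat (us @ vs) @ ls) (flat es' @ ls') :: 'k)"
        using a1 by (simp add: es)
      finally show ?thesis by (simp add: mult_ac)
    qed
    then show ?thesis using scong_smul [OF IH, of "h (W c) (W d)"] by (simp add: es mult_ac)
  qed
qed

lemma ev_scong:
  assumes "enumerates L \<tau> es ls" "enumerates L \<tau> es' ls'" "W ` set L \<subseteq> gens V"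
  shows "ev L W es ls \<simeq> ev L W es' ls'"
proof -
  let ?D = "\<lambda>a. deg (W a)" and ?F = "flat es @ ls" and ?F' = "flat es' @ ls'"
  have sets: "set ?F = set L" "set ?F' = set L" using assms unfolding enumerates_def by auto
  have "single (map W ls) (hprod W es) \<simeq> single (map W ls') (lsign ?D ?F ?F' * hprod W es')"
    using assms unfolding enumerates_def by (intro ev_invariance [where \<tau> = \<tau>]) auto
  from scong_smul [OF this, of "lsign ?D L ?F"]
  have "ev L W es ls \<simeq> single (map W ls') (lsign ?D L ?F * lsign ?D ?F ?F' * hprod W es')"
    by (simp add: ev_def mult.assoc)
  also have "lsign ?D L ?F * lsign ?D ?F ?F' = (lsign ?D L ?F' :: 'k)"
    by (intro lsign_trans) (simp_all only: sets)
  finally show ?thesis by (simp add: ev_def)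
qed

lemma wick_scong_ev:
  assumes "distinct L" "\<tau> \<in> invols (set L)" "W ` set L \<subseteq> gens V" "enumerates L \<tau> es ls"
  shows "wick L W \<tau> \<simeq> ev L W es ls"
  unfolding wick_def using assms ev_scong [OF enumerates_edge_list] by blast

text \<open>An enumeration of the involution does not refer to the order of \<open>L\<close>, so the
  same one serves both arrangements; what differs is the sign in \<open>ev\<close>, and there the
  cocycle rule applies.\<close>

lemma wick_reorder:
  assumes "distinct L" "distinct L'" "set L = set L'" "\<tau> \<in> invols (set L)" "W ` set L \<subseteq> gens V"
  shows "wick L W \<tau> \<simeq> smul (lsign (\<lambda>a. deg (W a)) L L') (wick L' W \<tau>)"
proof -
  let ?D = "\<lambda>a. deg (W a)" and ?es = "edge_list L' \<tau>" and ?ls = "filter (\<lambda>a. \<tau> a = a) L'"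
  have en: "enumerates L' \<tau> ?es ?ls" using assms by (intro enumerates_edge_list) auto
  then have "wick L W \<tau> \<simeq> ev L W ?es ?ls"
    using assms by (intro wick_scong_ev) (auto simp: enumerates_def)
  also have "lsign ?D L (flat ?es @ ?ls) = (lsign ?D L L' * lsign ?D L' (flat ?es @ ?ls) :: 'k)"
    using en assms by (intro lsign_trans [symmetric]) (auto simp: enumerates_def)
  then have "ev L W ?es ?ls = smul (lsign ?D L L') (wick L' W \<tau>)"
    by (simp add: ev_def wick_def mult.assoc)
  finally show ?thesis .
qed

text \<open>This is an equality and not just a congruence: the canonical enumeration depends only on
  positions, and these are unchanged by relabelling.\<close>

lemma wick_map:
  assumes "inj_on \<pi> (set L)" "\<And>a. a \<in> set L \<Longrightarrow> \<tau> a \<in> set L \<and> \<tau>' (\<pi> a) = \<pi> (\<tau> a)"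
  shows "wick (map \<pi> L) W \<tau>' = wick L (\<lambda>a. W (\<pi> a)) \<tau>"
proof -
  have pos: "pos (map \<pi> L) (\<pi> a) = pos L a" if "a \<in> set L" for a
    using assms(1) that by (simp add: pos_map insert_absorb)
  have eq: "edge_list (map \<pi> L) \<tau>' = map (map_prod \<pi> \<pi>) (edge_list L \<tau>)"
  proof -
    have "filter ((\<lambda>a. pos (map \<pi> L) a < pos (map \<pi> L) (\<tau>' a)) \<circ> \<pi>) L =
        filter (\<lambda>a. pos L a < pos L (\<tau> a)) L"
      by (rule filter_cong) (simp_all add: pos assms(2))
    then show ?thesis
      unfolding edge_list_def filter_map map_map by (auto simp: assms(2))
  qed
  have fl: "filter (\<lambda>a. \<tau>' a = a) (map \<pi> L) = map \<pi> (filter (\<lambda>a. \<tau> a = a) L)"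
  proof -
    have "filter ((\<lambda>a. \<tau>' a = a) \<circ> \<pi>) L = filter (\<lambda>a. \<tau> a = a) L"
      by (rule filter_cong) (simp_all add: assms(2) inj_on_eq_iff [OF assms(1)])
    then show ?thesis by (simp add: filter_map)
  qed
  have hp: "hprod W (map (map_prod \<pi> \<pi>) es) = hprod (\<lambda>a. W (\<pi> a)) es" for es
    by (induction es) auto
  have ff: "flat (map (map_prod \<pi> \<pi>) es) = map \<pi> (flat es)" for es
    by (induction es) auto
  have sub: "set (flat (edge_list L \<tau>) @ filter (\<lambda>a. \<tau> a = a) L) \<subseteq> set L"
    using assms(2) by (auto simp: set_flat edge_list_def)
  define Z where "Z = flat (edge_list L \<tau>) @ filter (\<lambda>a. \<tau> a = a) L"
  have posZ: "pos (map \<pi> Z) (\<pi> a) = pos Z a" if "a \<in> set L" for a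
    by (intro pos_map inj_on_subset [OF assms(1)]) (use that sub in \<open>auto simp: Z_def\<close>)
  have "lsign (\<lambda>a. deg (W a)) (map \<pi> L) (map \<pi> Z) = (lsign (\<lambda>a. deg (W (\<pi> a))) L Z :: 'k)"
    unfolding lsign_def list.set_map rsign_image [OF assms(1)]
    by (rule rsign_cong) (simp_all add: pos posZ)
  then show ?thesis unfolding wick_def ev_def eq fl hp ff by (simp add: o_def Z_def)
qed

text \<open>Disjoint contractions multiply. Listing all edges before all leaves makes the edges of
  the second block cross the leaves of the first. This is free of sign because contracted pairs are
  even, and if the form vanishes on some edge of the second block both sides are zero.\<close>

lemma wick_append:
  assumes "distinct L1" "distinct L2" "set L1 \<inter> set L2 = {}"
    "\<tau>1 \<in> invols (set L1)" "\<tau>2 \<in> invols (set L2)" "\<tau> \<in> invols (set L1 \<union> set L2)"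
    "\<And>a. a \<in> set L1 \<Longrightarrow> \<tau> a = \<tau>1 a" "\<And>a. a \<in> set L2 \<Longrightarrow> \<tau> a = \<tau>2 a"
    "W ` (set L1 \<union> set L2) \<subseteq> gens V"
  shows "wick (L1 @ L2) W \<tau> \<simeq> concat_mult (wick L1 W \<tau>1) (wick L2 W \<tau>2)"
proof -
  let ?D = "\<lambda>a. deg (W a)"
  let ?e1 = "edge_list L1 \<tau>1" and ?l1 = "filter (\<lambda>a. \<tau>1 a = a) L1"
  let ?e2 = "edge_list L2 \<tau>2" and ?l2 = "filter (\<lambda>a. \<tau>2 a = a) L2"
  have en1: "enumerates L1 \<tau>1 ?e1 ?l1" and en2: "enumerates L2 \<tau>2 ?e2 ?l2"
    using assms by (auto intro: enumerates_edge_list)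
  have sub: "set (flat ?e1 @ ?l1) = set L1" "set (flat ?e2 @ ?l2) = set L2"
    using en1 en2 by (auto simp: enumerates_def)
  have inv1: "\<tau> a = b \<and> \<tau> b = a" if "(a, b) \<in> set ?e1" for a b
  proof -
    have "a \<in> set L1" "b \<in> set L1" using that sub(1) by (force simp: set_flat)+
    then show ?thesis using en1 that assms(7) by (auto simp: enumerates_def)
  qed
  have inv2: "\<tau> a = b \<and> \<tau> b = a" if "(a, b) \<in> set ?e2" for a b
  proof -
    have "a \<in> set L2" "b \<in> set L2" using that sub(2) by (force simp: set_flat)+
    then show ?thesis using en2 that assms(8) by (auto simp: enumerates_def)
  qed
  have sets: "set (flat ?e1) \<union> set ?l1 = set L1" "set (flat ?e2) \<union> set ?l2 = set L2"
    "set (flat ?e1) \<inter> set ?l1 = {}" "set (flat ?e2) \<inter> set ?l2 = {}"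
    using en1 en2 by (auto simp: enumerates_def)
  have dist: "distinct ((flat ?e1) @ ?l1)" "distinct ((flat ?e2) @ ?l2)"
    using en1 en2 by (auto simp: enumerates_def)
  have en: "enumerates (L1 @ L2) \<tau> (?e1 @ ?e2) (?l1 @ ?l2)"
    unfolding enumerates_def
  proof (intro conjI)
    show "distinct (flat (?e1 @ ?e2) @ ?l1 @ ?l2)"
      using dist sets assms(3) by (simp add: set_eq_iff) blast
    show "set (flat (?e1 @ ?e2) @ ?l1 @ ?l2) = set (L1 @ L2)"
      using sets by auto
    show "\<forall>(a, b)\<in>set (?e1 @ ?e2). \<tau> a = b \<and> \<tau> b = a" using inv1 inv2 by auto
    show "\<forall>a\<in>set (?l1 @ ?l2). \<tau> a = a" using assms(7,8) by auto
  qed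
  have "wick (L1 @ L2) W \<tau> \<simeq> ev (L1 @ L2) W (?e1 @ ?e2) (?l1 @ ?l2)"
    using assms en by (intro wick_scong_ev) auto
  also have "ev (L1 @ L2) W (?e1 @ ?e2) (?l1 @ ?l2) = concat_mult (wick L1 W \<tau>1) (wick L2 W \<tau>2)"
  proof (cases "hprod W ?e2 = 0")
    case False
    have ev2: "even (sum_list (map ?D (flat es)))" if "hprod W es \<noteq> 0" "W ` set (flat es) \<subseteq> gens V" for es :: "('a \<times> 'a) list"
      using that
    proof (induction es)
      case (Cons e es)
      then show ?case using h_even by (cases e) (auto simp: add.assoc [symmetric])
    qed simp
    have "even (sum_list (map ?D (flat ?e2)))" using False assms(9) sets by (intro ev2) auto
    then have 1: "lsign ?D (flat ?e1 @ ?l1 @ flat ?e2 @ ?l2) (flat ?e1 @ flat ?e2 @ ?l1 @ ?l2) = (1 :: 'k)"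
      using dist sets assms(3)
      by (subst lsign_block_swap) (auto simp: psign_even)
    have "lsign ?D (L1 @ L2) ((flat ?e1 @ ?l1) @ (flat ?e2 @ ?l2)) =
      (lsign ?D L1 (flat ?e1 @ ?l1) * lsign ?D L2 (flat ?e2 @ ?l2) :: 'k)"
      using assms(1-3) sets dist by (intro lsign_append) auto
    moreover have "lsign ?D (L1 @ L2) ((flat ?e1 @ ?l1) @ (flat ?e2 @ ?l2)) *
        lsign ?D ((flat ?e1 @ ?l1) @ (flat ?e2 @ ?l2)) (flat ?e1 @ flat ?e2 @ ?l1 @ ?l2) =
      (lsign ?D (L1 @ L2) (flat ?e1 @ flat ?e2 @ ?l1 @ ?l2) :: 'k)"
      using sets by (intro lsign_trans) auto
    ultimately show ?thesis using 1 by (simp add: wick_def ev_def mult_ac)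
  qed (simp add: wick_def ev_def)
  finally show ?thesis .
qed

lemma keys_wick:
  assumes "W ` set L \<subseteq> gens V"
  shows "keys (wick L W \<tau>) \<subseteq> words"
  using assms unfolding wick_def ev_def by (auto simp: in_keys_iff lookup_single when_def image_subset_iff split: if_splits)

text \<open>Substitution of a relation for one letter. If the letter is a leaf, the result is a
  multiple of a generating relation of \<open>sym_null\<close>; if it is contracted, the sum
  vanishes by \<open>h_rel\<close>. Both arguments need a sign independent of the substituted
  letter, hence the reduction to relations of constant parity.\<close>

lemma wick_rel:
  assumes L: "distinct L" and \<tau>: "\<tau> \<in> invols (set L)" and W: "W ` set L \<subseteq> gens V"
    and a: "a \<in> set L" and r: "r \<in> rels V"
  shows "lin_ext (\<lambda>x. wick L (W(a := x)) \<tau>) r \<in> sym_null V"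
proof -
  let ?es = "edge_list L \<tau>" and ?ls = "filter (\<lambda>a. \<tau> a = a) L"
  have en: "enumerates L \<tau> ?es ?ls" using L \<tau> by (rule enumerates_edge_list)
  have *: "lin_ext (\<lambda>x. wick L (W(a := x)) \<tau>) r \<in> sym_null V"
    if r: "r \<in> rels V" and par: "\<And>x y. x \<in> keys r \<Longrightarrow> y \<in> keys r \<Longrightarrow> even (deg x) = even (deg y)" for r
  proof (cases "r = 0")
    case False
    then obtain x0 where x0: "x0 \<in> keys r" by (metis ex_in_conv keys_eq_empty)
    \<comment> \<open>The sign is computed at one letter \<open>x0\<close> of the relation and is
      valid for all of them, as they share its parity.\<close>
    define s :: 'k where "s = lsign (\<lambda>b. deg ((W(a := x0)) b)) L (flat ?es @ ?ls)"
    have s: "lsign (\<lambda>b. deg ((W(a := x)) b)) L (flat ?es @ ?ls) = s" if "x \<in> keys r" for x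
      unfolding s_def using par [OF that x0] by (intro lsign_cong) auto
    have "a \<in> set (flat ?es @ ?ls)" using en a by (simp add: enumerates_def)
    then consider "a \<in> set ?ls" | "a \<in> set (flat ?es)" by auto
    then show ?thesis
    proof cases
      case 1
      then obtain us vs where ls: "?ls = us @ a # vs" by (meson split_list)
      have nin: "a \<notin> set us" "a \<notin> set vs" "a \<notin> set (flat ?es)"
        using en 1 unfolding enumerates_def ls by auto
      have "hprod (W(a := x)) es = hprod W es" if "a \<notin> set (flat es)" for x es
        using that by (induction es) auto
      then have "wick L (W(a := x)) \<tau> = smul (s * hprod W ?es) (single (map W us @ x # map W vs) 1)"
        if "x \<in> keys r" for x
        unfolding wick_def ev_def s [OF that] using nin by (simp add: ls map_fun_upd)
      then have "lin_ext (\<lambda>x. wick L (W(a := x)) \<tau>) r =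
          smul (s * hprod W ?es) (lin_ext (\<lambda>x. single (map W us @ x # map W vs) 1) r)"
        unfolding lin_ext_fun_smul [symmetric] by (rule lin_ext_cong)
      moreover have "set us \<union> set vs \<subseteq> set L" using arg_cong [OF ls, of set] by auto
      ultimately show ?thesis
        using r W by (auto intro!: sym_null_smul sym_null_rel simp: subset_iff image_subset_iff)
    next
      case 2
      then obtain c d where cd: "(c, d) \<in> set ?es" "a = c \<or> a = d" by (auto simp: set_flat)
      obtain us vs where es: "?es = us @ (c, d) # vs" using cd(1) by (meson split_list)
      have dis: "distinct (flat ?es @ ?ls)" using en by (simp add: enumerates_def)
      define b where "b = (if a = c then d else c)"
      have nin: "a \<notin> set (flat us)" "a \<notin> set (flat vs)" "a \<notin> set ?ls" "a \<noteq> b" "c \<noteq> d"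
        using dis cd(2) unfolding es b_def by auto
      have "set (flat ?es) \<subseteq> set L" using en by (auto simp: enumerates_def)
      then have bL: "b \<in> set L" unfolding es b_def by auto
      have hp: "hprod (W(a := x)) es = hprod W es" if "a \<notin> set (flat es)" for x es
        using that by (induction es) auto
      \<comment> \<open>The sign of turning the edge around when the substituted letter is its
        second end, so that \<open>h_rel\<close> can be applied in the first argument.\<close>
      define e :: 'k where "e = psign (deg x0 * deg (W b))"
      have "h ((W(a := x)) c) ((W(a := x)) d) = (if a = c then 1 else e) * h x (W b)"
        if "x \<in> keys r" for x
      proof (cases "a = c")
        case False
        then have "h ((W(a := x)) c) ((W(a := x)) d) = h (W b) x" using cd(2) by (simp add: b_def)
        also have "\<dots> = psign (deg x * deg (W b)) * h x (W b)" using h_sym [of "W b" x] by (simp add: mult.commute)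
        also have "psign (deg x * deg (W b)) = e"
          unfolding e_def using par [OF that x0] by (intro psign_cong) auto
        finally show ?thesis using False by simp
      qed (use nin in \<open>simp add: b_def\<close>)
      then have "wick L (W(a := x)) \<tau> =
          smul (h x (W b)) (single (map W ?ls) (s * (if a = c then 1 else e) * hprod W us * hprod W vs))"
        if "x \<in> keys r" for x
        unfolding wick_def ev_def s [OF that] using nin(3) that
        by (simp add: es map_fun_upd hp [OF nin(1)] hp [OF nin(2)] mult_ac del: fun_upd_apply)
      then have "lin_ext (\<lambda>x. wick L (W(a := x)) \<tau>) r = (\<Sum>x\<in>keys r. smul (lookup r x * h x (W b))
          (single (map W ?ls) (s * (if a = c then 1 else e) * hprod W us * hprod W vs)))"
        unfolding lin_ext_def by (intro sum.cong refl) (simp add: mult.assoc)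
      also have "\<dots> = smul (\<Sum>x\<in>keys r. lookup r x * h x (W b))
          (single (map W ?ls) (s * (if a = c then 1 else e) * hprod W us * hprod W vs))"
        unfolding pm.scale_sum_left ..
      also have "(\<Sum>x\<in>keys r. lookup r x * h x (W b)) = 0" using r W bL by (intro h_rel) auto
      finally show ?thesis by (simp only: pm.scale_zero_left sym_null_0)
    qed
  qed simp
  obtain r0 r1 where "r0 \<in> rels V" "r1 \<in> rels V" "r = r0 + r1"
    "\<forall>x\<in>keys r0. even (deg x)" "\<forall>x\<in>keys r1. odd (deg x)"
    using rels_parity [OF r] by blast
  then show ?thesis by (auto simp: lin_ext_add intro!: sym_null_add *)
qed

end


section \<open>Sums over connected involutions\<close>

text \<open>A letter is addressed by its vertex and its place in the word there, not by its place in
  the concatenation. Reordering or selecting vertices then does not rename letters, and the vertex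
  of a letter is simply \<open>fst\<close>.\<close>

definition idx :: "'l list \<Rightarrow> ('l \<Rightarrow> 'x list) \<Rightarrow> ('l \<times> nat) list" where
  "idx ls w = concat (map (\<lambda>l. map (Pair l) [0..<length (w l)]) ls)"

definition letter :: "('l \<Rightarrow> 'x list) \<Rightarrow> 'l \<times> nat \<Rightarrow> 'x" where
  "letter w = (\<lambda>(l, k). w l ! k)"

lemma idx_simps [simp]:
  "idx [] w = []" "idx (l # ls) w = map (Pair l) [0..<length (w l)] @ idx ls w"
  "idx (ls @ ls') w = idx ls w @ idx ls' w"
  by (simp_all add: idx_def)

lemma set_idx: "set (idx ls w) = (SIGMA l:set ls. {..<length (w l)})"
proof -
  have "set (map (Pair l) [0..<n]) = {l} \<times> {..<n}" for l :: 'a and n by auto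
  then show ?thesis by (induction ls) (simp_all del: set_map, blast)
qed

lemma distinct_idx: "distinct ls \<Longrightarrow> distinct (idx ls w)"
  by (induction ls) (auto simp: distinct_map inj_on_def set_idx)

lemma idx_cong: "(\<And>l. l \<in> set ls \<Longrightarrow> length (w l) = length (w' l)) \<Longrightarrow> idx ls w = idx ls w'"
  by (induction ls) auto

lemma map_letter_block: "map (letter w) (map (Pair l) [0..<length (w l)]) = w l"
  by (simp add: letter_def o_def map_nth)

lemma map_letter_idx: "map (letter w) (idx ls w) = concat (map w ls)"
  by (induction ls) (simp_all only: idx_simps map_append map_letter_block list.map concat.simps)

lemma letter_gens:
  assumes "\<And>l. l \<in> set ls \<Longrightarrow> w l \<in> lists X"
  shows "letter w ` set (idx ls w) \<subseteq> X"
  using assms by (fastforce simp: set_idx letter_def)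

text \<open>The condition in \<open>connected_graph\<close>, with half-edges \<open>A\<close>
  attached by \<open>v\<close> and vertex set \<open>U\<close>. Keeping \<open>v\<close> as a
  parameter allows two vertices to be identified without touching the letters.\<close>

definition connected_via :: "('i \<Rightarrow> 'v) \<Rightarrow> ('i \<Rightarrow> 'i) \<Rightarrow> 'i set \<Rightarrow> 'v set \<Rightarrow> bool" where
  "connected_via v \<tau> A U \<longleftrightarrow> U \<noteq> {} \<and>
     (\<forall>a\<in>U. \<forall>b\<in>U. (a, b) \<in> {(v a, v (\<tau> a)) | a. a \<in> A}\<^sup>*)"

definition nedges :: "('i \<Rightarrow> 'i) \<Rightarrow> 'i set \<Rightarrow> nat" where
  "nedges \<tau> A = card {a \<in> A. \<tau> a \<noteq> a} div 2"

definition conj_invol :: "('i \<Rightarrow> 'j) \<Rightarrow> 'i set \<Rightarrow> ('i \<Rightarrow> 'i) \<Rightarrow> ('j \<Rightarrow> 'j)" where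
  "conj_invol \<pi> A \<tau> = restrict (\<lambda>b. \<pi> (\<tau> (inv_into A \<pi> b))) (\<pi> ` A)"

lemma conj_invol_apply: "inj_on \<pi> A \<Longrightarrow> a \<in> A \<Longrightarrow> conj_invol \<pi> A \<tau> (\<pi> a) = \<pi> (\<tau> a)"
  by (simp add: conj_invol_def)

lemma bij_conj_invol:
  assumes inj: "inj_on \<pi> A"
  shows "bij_betw (conj_invol \<pi> A) (invols A) (invols (\<pi> ` A))"
  unfolding bij_betw_def
proof
  show "inj_on (conj_invol \<pi> A) (invols A)"
  proof (rule inj_onI)
    fix \<tau> \<tau>' assume t: "\<tau> \<in> invols A" "\<tau>' \<in> invols A" "conj_invol \<pi> A \<tau> = conj_invol \<pi> A \<tau>'"
    have "\<tau> a = \<tau>' a" if "a \<in> A" for a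
    proof -
      have "\<pi> (\<tau> a) = \<pi> (\<tau>' a)" using t(3) that by (metis conj_invol_apply inj)
      then show ?thesis using inj t that by (auto dest: inj_onD invols_mem)
    qed
    then show "\<tau> = \<tau>'" using t(1,2) unfolding invols_def by (auto intro: PiE_ext)
  qed
  show "conj_invol \<pi> A ` invols A = invols (\<pi> ` A)"
  proof (intro equalityI subsetI)
    fix \<sigma> assume "\<sigma> \<in> conj_invol \<pi> A ` invols A"
    then obtain \<tau> where \<tau>: "\<tau> \<in> invols A" and \<sigma>: "\<sigma> = conj_invol \<pi> A \<tau>" by auto
    have ap: "\<sigma> (\<pi> a) = \<pi> (\<tau> a)" if "a \<in> A" for a
      using that inj by (simp add: \<sigma> conj_invol_apply)
    have "\<sigma> \<in> \<pi> ` A \<rightarrow>\<^sub>E \<pi> ` A"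
      using ap invols_mem [OF \<tau>] by (intro PiE_I) (auto simp: \<sigma> conj_invol_def)
    moreover have "\<sigma> (\<sigma> (\<pi> a)) = \<pi> a" if "a \<in> A" for a
      using that invols_mem [OF \<tau>] invols_invol [OF \<tau>] by (simp add: ap)
    ultimately show "\<sigma> \<in> invols (\<pi> ` A)"
      unfolding invols_def by blast
  next
    fix \<sigma> assume s: "\<sigma> \<in> invols (\<pi> ` A)"
    define \<tau> where "\<tau> = restrict (\<lambda>a. inv_into A \<pi> (\<sigma> (\<pi> a))) A"
    have \<tau>: "\<tau> a \<in> A" "\<pi> (\<tau> a) = \<sigma> (\<pi> a)" if "a \<in> A" for a
      using invols_mem [OF s, of "\<pi> a"] that inj
      by (auto simp: \<tau>_def inv_into_into f_inv_into_f)
    have "\<tau> (\<tau> a) = a" if "a \<in> A" for a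
      using \<tau> that invols_invol [OF s] inj by (metis image_eqI inj_onD)
    then have "\<tau> \<in> invols A" using \<tau> by (auto simp: invols_def \<tau>_def)
    moreover have "conj_invol \<pi> A \<tau> = \<sigma>"
    proof
      fix b show "conj_invol \<pi> A \<tau> b = \<sigma> b"
      proof (cases "b \<in> \<pi> ` A")
        case True
        then show ?thesis using \<tau> by (auto simp: conj_invol_apply [OF inj])
      next
        case False
        then show ?thesis using s by (auto simp: conj_invol_def invols_def PiE_def extensional_def)
      qed
    qed
    ultimately show "\<sigma> \<in> conj_invol \<pi> A ` invols A" by blast
  qed
qed

lemma connected_via_conj:
  assumes "inj_on \<pi> A"
  shows "connected_via v (conj_invol \<pi> A \<tau>) (\<pi> ` A) U \<longleftrightarrow> connected_via (\<lambda>a. v (\<pi> a)) \<tau> A U"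
proof -
  have "{(v a, v (conj_invol \<pi> A \<tau> a)) | a. a \<in> \<pi> ` A} = {(v (\<pi> a), v (\<pi> (\<tau> a))) | a. a \<in> A}"
    using assms by (auto simp: conj_invol_apply; metis conj_invol_apply imageI)
  then show ?thesis by (simp add: connected_via_def)
qed

lemma nedges_conj:
  assumes "inj_on \<pi> A" "\<tau> \<in> invols A"
  shows "nedges (conj_invol \<pi> A \<tau>) (\<pi> ` A) = nedges \<tau> A"
proof -
  have "{b \<in> \<pi> ` A. conj_invol \<pi> A \<tau> b \<noteq> b} = \<pi> ` {a \<in> A. \<tau> a \<noteq> a}"
    using assms by (auto simp: conj_invol_apply inj_on_eq_iff [OF assms(1)] invols_mem)
  moreover have "inj_on \<pi> {a \<in> A. \<tau> a \<noteq> a}" using assms(1) by (rule inj_on_subset) auto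
  ultimately show ?thesis by (simp add: nedges_def card_image)
qed

lemma connected_via_cong:
  assumes "\<And>a. a \<in> A \<Longrightarrow> v a = v' a" "\<And>a. a \<in> A \<Longrightarrow> v (\<tau> a) = v' (\<tau>' a)"
  shows "connected_via v \<tau> A U = connected_via v' \<tau>' A U"
proof -
  have "{(v a, v (\<tau> a)) | a. a \<in> A} = {(v' a, v' (\<tau>' a)) | a. a \<in> A}" using assms by metis
  then show ?thesis by (simp add: connected_via_def)
qed

lemma sum_Sigma_pair:
  assumes "finite A" "\<And>a. a \<in> A \<Longrightarrow> finite (B a)"
  shows "(\<Sum>t\<in>Sigma A B. f t) = (\<Sum>a\<in>A. \<Sum>b\<in>B a. f (a, b))"
  using assms by (subst sum.Sigma) auto

lemma sum_PiE_insert: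
  assumes "l \<notin> S"
  shows "(\<Sum>z\<in>PiE (insert l S) T. F z) = (\<Sum>t\<in>T l. \<Sum>z\<in>PiE S T. F (z(l := t)))"
proof -
  have "(\<Sum>z\<in>PiE (insert l S) T. F z) = (\<Sum>(t, z)\<in>T l \<times> PiE S T. F (z(l := t)))"
    unfolding PiE_insert_eq
    by (subst sum.reindex [OF inj_combinator [OF assms]]) (simp add: case_prod_unfold)
  then show ?thesis by (simp add: sum.cartesian_product)
qed

text \<open>\<open>z l = (a, w)\<close> says that the vertex \<open>l\<close> has genus \<open>a\<close> and carries the word \<open>w\<close>.  The involutions below
  are those whose graph is connected of betti number \<open>g\<close>, as \<open>rank H\<^sub>1 = |E| - |V| + 1\<close>.\<close>

definition matchings :: "'l list \<Rightarrow> ('l \<Rightarrow> nat \<times> 'x list) \<Rightarrow> nat \<Rightarrow> ('l \<times> nat \<Rightarrow> 'l \<times> nat) set" where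
  "matchings ls z g = {\<tau> \<in> invols (set (idx ls (\<lambda>l. snd (z l)))).
     connected_via fst \<tau> (set (idx ls (\<lambda>l. snd (z l)))) (set ls) \<and>
     (\<Sum>l\<in>set ls. fst (z l)) + nedges \<tau> (set (idx ls (\<lambda>l. snd (z l)))) + 1 = g + length ls}"

text \<open>The bound \<open>B\<close> on the genera makes the set finite although a series has
  infinitely many coefficients.\<close>

definition choices :: "nat \<Rightarrow> 'l list \<Rightarrow> ('l \<Rightarrow> nat \<Rightarrow> ('x list \<Rightarrow>\<^sub>0 'k::zero)) \<Rightarrow> ('l \<Rightarrow> nat \<times> 'x list) set" where
  "choices B ls y = (\<Pi>\<^sub>E l\<in>set ls. SIGMA a:{..B}. keys (y l a))"

lemma finite_choices: "finite (choices B ls y)"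
  unfolding choices_def by (intro finite_PiE) auto

lemma finite_matchings: "finite (matchings ls z g)"
  unfolding matchings_def by (rule finite_subset [OF _ finite_invols [OF finite_set]]) blast

lemma matchings_cong:
  assumes "\<And>l. l \<in> set ls \<Longrightarrow> fst (z l) = fst (z' l) \<and> length (snd (z l)) = length (snd (z' l))"
  shows "matchings ls z g = matchings ls z' g"
proof -
  have "idx ls (\<lambda>l. snd (z l)) = idx ls (\<lambda>l. snd (z' l))" using assms by (intro idx_cong) auto
  moreover have "(\<Sum>l\<in>set ls. fst (z l)) = (\<Sum>l\<in>set ls. fst (z' l))" using assms by (intro sum.cong) auto
  ultimately show ?thesis by (simp add: matchings_def)
qed

lemma matchings_bound:
  assumes "l \<in> set ls" "\<tau> \<in> matchings ls z g"
  shows "fst (z l) \<le> g + length ls"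
  using assms member_le_sum [of l "set ls" "\<lambda>l. fst (z l)"] by (auto simp: matchings_def)

section \<open>Sums over matchings and their independence of representatives\<close>

context even_form
begin

lemma wick_cong:
  assumes "\<tau> \<in> invols (set L)" "\<And>a. a \<in> set L \<Longrightarrow> W a = W' a" "distinct L"
  shows "wick L W \<tau> = wick L W' \<tau>"
proof -
  let ?es = "edge_list L \<tau>" and ?ls = "filter (\<lambda>a. \<tau> a = a) L"
  have sub: "set (flat ?es @ ?ls) = set L"
    using enumerates_edge_list [OF assms(3,1)] by (simp add: enumerates_def)
  have "hprod W es = hprod W' es" if "set (flat es) \<subseteq> set L" for es
    using that assms(2) by (induction es) auto
  then have "hprod W ?es = hprod W' ?es" using sub by auto
  moreover have "map W ?ls = map W' ?ls" using assms(2) by auto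
  moreover have "lsign (\<lambda>a. deg (W a)) L (flat ?es @ ?ls) = (lsign (\<lambda>a. deg (W' a)) L (flat ?es @ ?ls) :: 'k)"
    using assms(2) by (intro lsign_cong) auto
  ultimately show ?thesis unfolding wick_def ev_def by (simp only:)
qed

definition wick_sum :: "'l list \<Rightarrow> ('l \<Rightarrow> nat \<times> 'x list) \<Rightarrow> nat \<Rightarrow> ('x list \<Rightarrow>\<^sub>0 'k)" where
  "wick_sum ls z g =
     (\<Sum>\<tau>\<in>matchings ls z g. wick (idx ls (\<lambda>l. snd (z l))) (letter (\<lambda>l. snd (z l))) \<tau>)"

definition coeff_of :: "'l set \<Rightarrow> ('l \<Rightarrow> nat \<Rightarrow> ('x list \<Rightarrow>\<^sub>0 'k)) \<Rightarrow> ('l \<Rightarrow> nat \<times> 'x list) \<Rightarrow> 'k" where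
  "coeff_of S y z = (\<Prod>l\<in>S. lookup (y l (fst (z l))) (snd (z l)))"

definition total_sum :: "nat \<Rightarrow> 'l list \<Rightarrow> ('l \<Rightarrow> nat \<Rightarrow> ('x list \<Rightarrow>\<^sub>0 'k)) \<Rightarrow> nat \<Rightarrow> ('x list \<Rightarrow>\<^sub>0 'k)" where
  "total_sum B ls y g = (\<Sum>z\<in>choices B ls y. smul (coeff_of (set ls) y z) (wick_sum ls z g))"

text \<open>A genus above \<open>g + length ls\<close> at some vertex violates the Betti equation,
  so the additional choices have no matchings.\<close>

lemma total_sum_bound:
  assumes "g + length ls \<le> B" "g + length ls \<le> B'"
  shows "total_sum B ls y g = total_sum B' ls y g"
proof -
  have *: "total_sum B ls y g = total_sum (g + length ls) ls y g" if "g + length ls \<le> B" for B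
    unfolding total_sum_def
  proof (rule sum.mono_neutral_right [OF finite_choices])
    show "choices (g + length ls) ls y \<subseteq> choices B ls y"
      unfolding choices_def by (rule PiE_mono) (use that in auto)
    show "\<forall>z\<in>choices B ls y - choices (g + length ls) ls y.
        smul (coeff_of (set ls) y z) (wick_sum ls z g) = 0"
    proof
      fix z assume z: "z \<in> choices B ls y - choices (g + length ls) ls y"
      then obtain l where l: "l \<in> set ls" "\<not> fst (z l) \<le> g + length ls"
        by (fastforce simp: choices_def PiE_def Pi_def)
      then have "matchings ls z g = {}" using matchings_bound [OF l(1)] by blast
      then show "smul (coeff_of (set ls) y z) (wick_sum ls z g) = 0" by (simp add: wick_sum_def)
    qed
  qed
  show ?thesis using * assms by metis
qed

text \<open>The contribution of the word \<open>u\<close> with genus \<open>a\<close> at the vertex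
  \<open>l\<close>, all other vertices being summed out. It isolates the linear dependence on one
  argument.\<close>

definition slot :: "nat \<Rightarrow> 'l list \<Rightarrow> ('l \<Rightarrow> nat \<Rightarrow> ('x list \<Rightarrow>\<^sub>0 'k)) \<Rightarrow> nat \<Rightarrow> 'l \<Rightarrow> nat \<Rightarrow> 'x list \<Rightarrow> ('x list \<Rightarrow>\<^sub>0 'k)" where
  "slot B ls y g l a u = (\<Sum>z\<in>(\<Pi>\<^sub>E l'\<in>set ls - {l}. SIGMA a:{..B}. keys (y l' a)).
     smul (coeff_of (set ls - {l}) y z) (wick_sum ls (z(l := (a, u))) g))"

lemma total_sum_slot:
  assumes "l \<in> set ls"
  shows "total_sum B ls y g = (\<Sum>a\<le>B. lin_ext (slot B ls y g l a) (y l a))"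
proof -
  define S where "S = set ls - {l}"
  have S: "set ls = insert l S" "l \<notin> S" using assms by (auto simp: S_def)
  have co: "coeff_of (set ls) y (z(l := (a, u))) = lookup (y l a) u * coeff_of S y z" for z a u
  proof -
    have "coeff_of (set ls) y (z(l := (a, u))) = lookup (y l a) u * coeff_of S y (z(l := (a, u)))"
      unfolding coeff_of_def S(1) using S(2) by (subst prod.insert) (simp_all add: S_def)
    also have "coeff_of S y (z(l := (a, u))) = coeff_of S y z"
      unfolding coeff_of_def using S(2) by (intro prod.cong) auto
    finally show ?thesis .
  qed
  have "total_sum B ls y g = (\<Sum>t\<in>(SIGMA a:{..B}. keys (y l a)).
     \<Sum>z\<in>(\<Pi>\<^sub>E l'\<in>S. SIGMA a:{..B}. keys (y l' a)).
     smul (coeff_of (set ls) y (z(l := t))) (wick_sum ls (z(l := t)) g))"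
    unfolding total_sum_def choices_def S(1) by (rule sum_PiE_insert [OF S(2)])
  also have "\<dots> = (\<Sum>a\<le>B. \<Sum>u\<in>keys (y l a).
     \<Sum>z\<in>(\<Pi>\<^sub>E l'\<in>S. SIGMA a:{..B}. keys (y l' a)).
     smul (coeff_of (set ls) y (z(l := (a, u)))) (wick_sum ls (z(l := (a, u))) g))"
    by (rule sum_Sigma_pair) auto
  also have "\<dots> = (\<Sum>a\<le>B. lin_ext (slot B ls y g l a) (y l a))"
    unfolding lin_ext_def slot_def pm.scale_sum_right co by (simp add: S_def)
  finally show ?thesis .
qed

lemma keys_wick_sum:
  assumes "\<And>l. l \<in> set ls \<Longrightarrow> snd (z l) \<in> words"
  shows "keys (wick_sum ls z g) \<subseteq> words"
  unfolding wick_sum_def using assms by (intro keys_sum_subset keys_wick letter_gens) auto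

lemma keys_total_sum:
  assumes "\<And>l. l \<in> set ls \<Longrightarrow> y l \<in> series V"
  shows "keys (total_sum B ls y g) \<subseteq> words"
  unfolding total_sum_def
proof (intro keys_sum_subset order_trans [OF keys_smul] keys_wick_sum)
  fix z l assume "z \<in> choices B ls y" "l \<in> set ls"
  then show "snd (z l) \<in> words"
    using assms [of l] by (fastforce simp: choices_def series_def PiE_def Pi_def)
qed

text \<open>Exchanging one letter changes neither the lengths of the words nor the genera. The
  letters and matchings are thus the same for all terms of the relation, and \<open>wick_rel\<close>
  applies to each matching at the address \<open>(l, length us)\<close>.\<close>

lemma wick_sum_rel:
  assumes "distinct ls" "l \<in> set ls" "\<And>l'. l' \<in> set ls - {l} \<Longrightarrow> snd (z l') \<in> words"
    "us \<in> words" "vs \<in> words" "r \<in> rels V"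
  shows "lin_ext (\<lambda>x. wick_sum ls (z(l := (a, us @ x # vs))) g) r \<in> sym_null V"
proof (cases "r = 0")
  case False
  then obtain x0 where x0: "x0 \<in> keys r" by (metis ex_in_conv keys_eq_empty)
  define Z where "Z = (\<lambda>x. z(l := (a, us @ x # vs)))"
  define W where "W = (\<lambda>x. letter (\<lambda>l. snd (Z x l)))"
  define L where "L = idx ls (\<lambda>l. snd (Z x0 l))"
  have L: "idx ls (\<lambda>l. snd (Z x l)) = L" for x
    unfolding L_def by (intro idx_cong) (simp add: Z_def)
  define M where "M = matchings ls (Z x0) g"
  have M: "matchings ls (Z x) g = M" for x
    unfolding M_def by (rule matchings_cong) (simp add: Z_def)
  have W: "W x = (W x0)((l, length us) := x)" for x
    by (auto simp: W_def Z_def letter_def fun_eq_iff nth_append nth_Cons split: nat.splits)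
  have "snd (Z x0 l') \<in> words" if "l' \<in> set ls" for l'
    using that assms x0 rels_gens [OF assms(6)] by (auto simp: Z_def)
  then have Wg: "W x0 ` set L \<subseteq> gens V"
    unfolding W_def L_def by (rule letter_gens)
  have "lin_ext (\<lambda>x. wick_sum ls (Z x) g) r =
    (\<Sum>\<tau>\<in>M. lin_ext (\<lambda>x. wick L ((W x0)((l, length us) := x)) \<tau>) r)"
    unfolding W [symmetric] by (simp add: wick_sum_def L M lin_ext_fun_sum W_def)
  also have "\<dots> \<in> sym_null V"
  proof (rule sym_null_sum)
    fix \<tau> assume "\<tau> \<in> M"
    then have "\<tau> \<in> invols (set L)" by (simp add: M_def matchings_def L_def)
    then show "lin_ext (\<lambda>x. wick L ((W x0)((l, length us) := x)) \<tau>) r \<in> sym_null V"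
      using Wg assms by (intro wick_rel) (auto simp: L_def distinct_idx set_idx Z_def)
  qed
  finally show ?thesis by (simp add: Z_def)
qed simp

text \<open>Transport of a sum of contractions along a renaming of letters. Conjugation by
  \<open>\<pi>\<close> matches the involutions, and the only trace of the renaming is the sign
  between the image of \<open>L\<close> and \<open>L'\<close>. It is applied to the exchange of two
  letters and to the merging of two vertices.\<close>

lemma wick_sum_transport:
  assumes inj: "inj_on \<pi> A" and A: "set L = A" "set L' = \<pi> ` A" and dist: "distinct L" "distinct L'"
    and W: "\<And>a. a \<in> A \<Longrightarrow> W' (\<pi> a) = W a" "W ` A \<subseteq> gens V"
    and P: "\<And>\<tau>. \<tau> \<in> invols A \<Longrightarrow> P \<tau> = P' (conj_invol \<pi> A \<tau>)"
  shows "(\<Sum>\<tau>\<in>{\<tau> \<in> invols A. P \<tau>}. wick L W \<tau>) \<simeq>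
    smul (lsign (\<lambda>a. deg (W' a)) (map \<pi> L) L') (\<Sum>\<tau>\<in>{\<tau> \<in> invols (\<pi> ` A). P' \<tau>}. wick L' W' \<tau>)"
proof -
  let ?c = "conj_invol \<pi> A"
  have W'g: "W' ` \<pi> ` A \<subseteq> gens V" using W by (auto simp: image_subset_iff)
  have "(\<Sum>\<tau>\<in>{\<tau> \<in> invols A. P \<tau>}. wick L W \<tau>) =
      (\<Sum>\<tau>\<in>{\<tau> \<in> invols A. P \<tau>}. wick (map \<pi> L) W' (?c \<tau>))"
  proof (rule sum.cong [OF refl])
    fix \<tau> assume t: "\<tau> \<in> {\<tau> \<in> invols A. P \<tau>}"
    then have "wick (map \<pi> L) W' (?c \<tau>) = wick L (\<lambda>a. W' (\<pi> a)) \<tau>"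
      using inj A by (intro wick_map) (auto simp: conj_invol_apply dest: invols_mem)
    also have "\<dots> = wick L W \<tau>" using t A W dist by (intro wick_cong) auto
    finally show "wick L W \<tau> = wick (map \<pi> L) W' (?c \<tau>)" ..
  qed
  also have "\<dots> = (\<Sum>\<tau>\<in>{\<tau> \<in> invols (\<pi> ` A). P' \<tau>}. wick (map \<pi> L) W' \<tau>)"
  proof (rule sum.reindex_bij_betw)
    show "bij_betw ?c {\<tau> \<in> invols A. P \<tau>} {\<tau> \<in> invols (\<pi> ` A). P' \<tau>}"
      by (rule bij_betw_Collect [OF bij_conj_invol [OF inj]]) (simp add: P)
  qed
  also have "\<dots> \<simeq> (\<Sum>\<tau>\<in>{\<tau> \<in> invols (\<pi> ` A). P' \<tau>}.
      smul (lsign (\<lambda>a. deg (W' a)) (map \<pi> L) L') (wick L' W' \<tau>))"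
    using A W'g dist inj by (intro scong_sum wick_reorder) (auto simp: distinct_map)
  finally show ?thesis by (simp add: pm.scale_sum_right)
qed

text \<open>Exchanging two neighbouring addresses at one vertex does not move letters between
  vertices, so connectedness and the number of edges are preserved. The sign is that of swapping two
  adjacent letters.\<close>

lemma wick_sum_swap:
  assumes "distinct ls" "l \<in> set ls" "\<And>l'. l' \<in> set ls - {l} \<Longrightarrow> snd (z l') \<in> words"
    "us \<in> words" "vs \<in> words" "x \<in> gens V" "y \<in> gens V"
  shows "wick_sum ls (z(l := (a, us @ x # y # vs))) g \<simeq>
    smul (psign (deg x * deg y)) (wick_sum ls (z(l := (a, us @ y # x # vs))) g)"
proof -
  let ?n = "length us"
  define z1 where "z1 = z(l := (a, us @ x # y # vs))"
  define z2 where "z2 = z(l := (a, us @ y # x # vs))"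
  define w1 where "w1 = (\<lambda>l. snd (z1 l))"
  define w2 where "w2 = (\<lambda>l. snd (z2 l))"
  define L where "L = idx ls w1"
  have L2: "idx ls w2 = L" unfolding L_def w1_def w2_def by (intro idx_cong) (simp add: z1_def z2_def)
  \<comment> \<open>The transposition of the two addresses that carry \<open>x\<close> and
    \<open>y\<close>.\<close>
  define \<pi> where "\<pi> = (\<lambda>p. if p = (l, ?n) then (l, Suc ?n) else if p = (l, Suc ?n) then (l, ?n) else p)"
  have inv: "\<pi> (\<pi> p) = p" for p by (auto simp: \<pi>_def)
  have inj: "inj_on \<pi> X" for X by (metis inj_onI inv)
  have mem: "(l, ?n) \<in> set L" "(l, Suc ?n) \<in> set L"
    using assms(2) by (auto simp: L_def set_idx w1_def z1_def)
  have im: "\<pi> ` set L = set L"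
  proof -
    have "\<pi> p \<in> set L" if "p \<in> set L" for p using mem that by (auto simp: \<pi>_def)
    then show ?thesis by (metis (no_types, opaque_lifting) equalityI image_eqI image_subsetI inv subsetI)
  qed
  have dist: "distinct L" using assms(1) by (simp add: L_def distinct_idx)
  have W: "letter w2 (\<pi> p) = letter w1 p" for p
    by (cases p) (auto simp: \<pi>_def letter_def w1_def w2_def z1_def z2_def nth_append nth_Cons split: nat.splits)
  have "snd (z1 l') \<in> words" if "l' \<in> set ls" for l'
    using that assms by (auto simp: z1_def)
  then have Wg: "letter w1 ` set L \<subseteq> gens V"
    unfolding w1_def L_def by (rule letter_gens)
  have fst: "fst (\<pi> p) = fst p" for p by (auto simp: \<pi>_def)
  have "(\<Sum>\<tau>\<in>{\<tau> \<in> invols (set L). connected_via fst \<tau> (set L) (set ls) \<and>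
        (\<Sum>l\<in>set ls. fst (z1 l)) + nedges \<tau> (set L) + 1 = g + length ls}. wick L (letter w1) \<tau>) \<simeq>
    smul (lsign (\<lambda>a. deg (letter w2 a)) (map \<pi> L) L)
     (\<Sum>\<tau>\<in>{\<tau> \<in> invols (\<pi> ` set L). connected_via fst \<tau> (\<pi> ` set L) (set ls) \<and>
        (\<Sum>l\<in>set ls. fst (z1 l)) + nedges \<tau> (\<pi> ` set L) + 1 = g + length ls}. wick L (letter w2) \<tau>)"
  proof (rule wick_sum_transport)
    fix \<tau> assume "\<tau> \<in> invols (set L)"
    then show "(connected_via fst \<tau> (set L) (set ls) \<and>
        (\<Sum>l\<in>set ls. fst (z1 l)) + nedges \<tau> (set L) + 1 = g + length ls) =
      (connected_via fst (conj_invol \<pi> (set L) \<tau>) (\<pi> ` set L) (set ls) \<and>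
        (\<Sum>l\<in>set ls. fst (z1 l)) + nedges (conj_invol \<pi> (set L) \<tau>) (\<pi> ` set L) + 1 = g + length ls)"
      unfolding connected_via_conj [OF inj] fst by (simp only: nedges_conj [OF inj])
  qed (use Wg dist inj W im in auto)
  moreover have "wick_sum ls z1 g = (\<Sum>\<tau>\<in>{\<tau> \<in> invols (set L). connected_via fst \<tau> (set L) (set ls) \<and>
        (\<Sum>l\<in>set ls. fst (z1 l)) + nedges \<tau> (set L) + 1 = g + length ls}. wick L (letter w1) \<tau>)"
    by (simp add: wick_sum_def matchings_def L_def w1_def)
  moreover have "wick_sum ls z2 g = (\<Sum>\<tau>\<in>{\<tau> \<in> invols (set L). connected_via fst \<tau> (set L) (set ls) \<and>
        (\<Sum>l\<in>set ls. fst (z1 l)) + nedges \<tau> (set L) + 1 = g + length ls}. wick L (letter w2) \<tau>)"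
  proof -
    have "(\<Sum>l\<in>set ls. fst (z1 l)) = (\<Sum>l\<in>set ls. fst (z2 l))" by (intro sum.cong) (auto simp: z1_def z2_def)
    then show ?thesis by (simp add: wick_sum_def matchings_def L2 [unfolded w2_def] w2_def)
  qed
  moreover have "lsign (\<lambda>a. deg (letter w2 a)) (map \<pi> L) L = (psign (deg x * deg y) :: 'k)"
  proof -
    \<comment> \<open>The list of letters is written out around the two addresses, so that the
      rearrangement becomes a swap of two adjacent one-letter blocks.\<close>
    obtain l1 l2 where ls: "ls = l1 @ l # l2" using assms(2) by (meson split_list)
    define X where "X = idx l1 w1 @ map (Pair l) [0..<?n]"
    define N where "N = Suc (Suc (?n + length vs))"
    define Y where "Y = map (Pair l) [Suc (Suc ?n)..<N] @ idx l2 w1"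
    have "[0..<N] = [0..<?n] @ [?n..<N]" using upt_add_eq_append [of 0 ?n "2 + length vs"] by (simp add: N_def)
    moreover have "[?n..<N] = ?n # [Suc ?n..<N]" by (rule upt_conv_Cons) (simp add: N_def)
    moreover have "[Suc ?n..<N] = Suc ?n # [Suc (Suc ?n)..<N]" by (rule upt_conv_Cons) (simp add: N_def)
    ultimately have "[0..<N] = [0..<?n] @ [?n, Suc ?n] @ [Suc (Suc ?n)..<N]" by simp
    moreover have "length (w1 l) = N" by (simp add: N_def w1_def z1_def)
    ultimately have LX: "L = X @ [(l, ?n)] @ [(l, Suc ?n)] @ Y"
      unfolding L_def ls X_def Y_def by simp
    have nin: "l \<notin> set l1" "l \<notin> set l2" using assms(1) ls by auto
    have "map \<pi> X = X" "map \<pi> Y = Y"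
      using nin by (auto simp: X_def Y_def \<pi>_def set_idx intro!: map_idI)
    then have "map \<pi> L = X @ [(l, Suc ?n)] @ [(l, ?n)] @ Y"
      unfolding LX by (simp add: \<pi>_def)
    then have "lsign (\<lambda>a. deg (letter w2 a)) (map \<pi> L) L =
      (psign (sum_list (map (\<lambda>a. deg (letter w2 a)) [(l, Suc ?n)]) *
        sum_list (map (\<lambda>a. deg (letter w2 a)) [(l, ?n)])) :: 'k)"
      unfolding LX using dist LX by (simp only:) (rule lsign_block_swap, auto)
    also have "\<dots> = psign (deg x * deg y)"
      by (simp add: letter_def w2_def z2_def nth_append)
    finally show ?thesis .
  qed
  ultimately show ?thesis by (simp add: im z1_def z2_def)
qed

text \<open>Two kinds of relations generate \<open>sym_null\<close>: those of \<open>V\<close> in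
  one letter, treated by \<open>wick_sum_rel\<close>, and the exchange of neighbours, treated by
  \<open>wick_sum_swap\<close>.\<close>

lemma slot_sym_null:
  assumes "distinct ls" "l \<in> set ls" "\<And>l'. l' \<in> set ls - {l} \<Longrightarrow> y l' \<in> series V" "p \<in> sym_null V"
  shows "lin_ext (slot B ls y g l a) p \<in> sym_null V"
  using assms(4) unfolding sym_null_def
proof (induction rule: pm.span_induct_alt)
  case base
  then show ?case using sym_null_0 by (simp add: sym_null_def)
next
  case (step c b p)
  let ?Z = "\<Pi>\<^sub>E l'\<in>set ls - {l}. SIGMA a:{..B}. keys (y l' a)"
  have zw: "snd (z l') \<in> words" if "z \<in> ?Z" "l' \<in> set ls - {l}" for z l'
    using assms(3) [OF that(2)] that by (fastforce simp: series_def PiE_def Pi_def)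
  have "lin_ext (slot B ls y g l a) b \<in> sym_null V"
    using step(1)
  proof
    assume "b \<in> {lin_ext (\<lambda>x. single (us @ x # vs) 1) r | us vs r. us \<in> words \<and> vs \<in> words \<and> r \<in> rels V}"
    then obtain us vs r where b: "b = lin_ext (\<lambda>x. single (us @ x # vs) 1) r"
      "us \<in> words" "vs \<in> words" "r \<in> rels V" by blast
    have "lin_ext (slot B ls y g l a) b = (\<Sum>z\<in>?Z. smul (coeff_of (set ls - {l}) y z)
        (lin_ext (\<lambda>x. wick_sum ls (z(l := (a, us @ x # vs))) g) r))"
      unfolding b(1) by (simp add: lin_ext_comp slot_def lin_ext_fun_sum lin_ext_fun_smul)
    also have "\<dots> \<in> sym_null V"
      using assms zw b by (intro sym_null_sum sym_null_smul wick_sum_rel) auto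
    finally show ?thesis .
  next
    assume "b \<in> {single (us @ x # y # vs) 1 - single (us @ y # x # vs) (psign (deg x * deg y))
       | us vs x y. us \<in> words \<and> vs \<in> words \<and> x \<in> gens V \<and> y \<in> gens V}"
    then obtain us vs x' y' where b: "b = single (us @ x' # y' # vs) 1 - single (us @ y' # x' # vs) (psign (deg x' * deg y'))"
      "us \<in> words" "vs \<in> words" "x' \<in> gens V" "y' \<in> gens V" by blast
    have "slot B ls y g l a (us @ x' # y' # vs) \<simeq> (\<Sum>z\<in>?Z. smul (coeff_of (set ls - {l}) y z)
        (smul (psign (deg x' * deg y')) (wick_sum ls (z(l := (a, us @ y' # x' # vs))) g)))"
      unfolding slot_def using assms zw b by (intro scong_sum scong_smul wick_sum_swap) auto
    also have "\<dots> = smul (psign (deg x' * deg y')) (slot B ls y g l a (us @ y' # x' # vs))"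
      by (simp add: slot_def pm.scale_sum_right mult.commute)
    finally show ?thesis by (simp add: b(1) lin_ext_diff scong_def)
  qed
  then show ?case using step(2) unfolding sym_null_def [symmetric]
    by (simp add: lin_ext_add lin_ext_smul sym_null_add sym_null_smul)
qed

lemma total_sum_upd:
  assumes "distinct ls" "l \<in> set ls" "\<And>l'. l' \<in> set ls \<Longrightarrow> y l' \<in> series V"
    "\<And>a. y l a \<simeq> s a"
  shows "total_sum B ls y g \<simeq> total_sum B ls (y(l := s)) g"
proof -
  have sl: "slot B ls (y(l := s)) g l a = slot B ls y g l a" for a
  proof
    fix u
    have "(\<Pi>\<^sub>E l'\<in>set ls - {l}. SIGMA a:{..B}. keys ((y(l := s)) l' a)) =
        (\<Pi>\<^sub>E l'\<in>set ls - {l}. SIGMA a:{..B}. keys (y l' a))" by (intro PiE_cong) auto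
    moreover have "coeff_of (set ls - {l}) (y(l := s)) = coeff_of (set ls - {l}) y"
      unfolding coeff_of_def by (intro ext prod.cong) auto
    ultimately show "slot B ls (y(l := s)) g l a u = slot B ls y g l a u" by (simp add: slot_def)
  qed
  have "(\<Sum>a\<le>B. lin_ext (slot B ls y g l a) (y l a)) \<simeq> (\<Sum>a\<le>B. lin_ext (slot B ls y g l a) (s a))"
    using assms by (intro scong_sum) (simp add: scong_def flip: lin_ext_diff, intro slot_sym_null, auto)
  then show ?thesis using assms(2) by (simp add: total_sum_slot [of l] sl)
qed

lemma total_sum_cong:
  assumes "\<And>l. l \<in> set ls \<Longrightarrow> y l = y' l"
  shows "total_sum B ls y g = total_sum B ls y' g"
proof -
  have "choices B ls y = choices B ls y'" unfolding choices_def using assms by (intro PiE_cong) auto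
  moreover have "coeff_of (set ls) y = coeff_of (set ls) y'"
    unfolding coeff_of_def using assms by (intro ext prod.cong) auto
  ultimately show ?thesis by (simp add: total_sum_def)
qed

text \<open>The sum is multilinear, so the arguments are replaced one vertex at a time; the
  induction runs over the set of vertices already replaced.\<close>

lemma total_sum_scong:
  assumes "distinct ls" "\<And>l. l \<in> set ls \<Longrightarrow> (y l, y' l) \<in> series_rel V"
  shows "total_sum B ls y g \<simeq> total_sum B ls y' g"
proof -
  have *: "total_sum B ls y g \<simeq> total_sum B ls (\<lambda>l. if l \<in> S then y' l else y l) g"
    if "finite S" "S \<subseteq> set ls" for S
    using that
  proof (induction S)
    case (insert l S)
    have "(\<lambda>l'. if l' \<in> insert l S then y' l' else y l') = (\<lambda>l. if l \<in> S then y' l else y l)(l := y' l)"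
      by auto
    moreover have "total_sum B ls (\<lambda>l. if l \<in> S then y' l else y l) g \<simeq>
        total_sum B ls ((\<lambda>l. if l \<in> S then y' l else y l)(l := y' l)) g"
      using assms insert by (intro total_sum_upd) (auto simp: series_rel_def scong_def)
    ultimately show ?case using insert scong_trans by auto
  qed simp
  have "total_sum B ls y g \<simeq> total_sum B ls (\<lambda>l. if l \<in> set ls then y' l else y l) g"
    by (rule *) auto
  also have "\<dots> = total_sum B ls y' g" by (rule total_sum_cong) simp
  finally show ?thesis .
qed

end


section \<open>The first Betti number of a connected graph\<close>

text \<open>A basis \<open>B\<close> of the kernel is extended to a basis \<open>B'\<close> of the
  whole span. The added vectors \<open>C\<close> map injectively to a basis of the image: a
  combination of them in the kernel lies in the span of \<open>B\<close>, so its coefficients vanish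
  by independence of \<open>B'\<close>.\<close>

lemma rank_nullity:
  fixes f :: "('a \<Rightarrow>\<^sub>0 'k::field) \<Rightarrow> ('b \<Rightarrow>\<^sub>0 'k)"
  assumes f: "Vector_Spaces.linear smul smul f" and S: "finite S" "\<not> pm.dependent S"
  shows "pm.dim {x \<in> pm.span S. f x = 0} + pm.dim (f ` pm.span S) = card S"
proof -
  interpret f: Vector_Spaces.linear smul smul f by (rule f)
  define K where "K = {x \<in> pm.span S. f x = 0}"
  obtain B where B: "B \<subseteq> K" "\<not> pm.dependent B" "K \<subseteq> pm.span B" "card B = pm.dim K"
    by (rule pm.basis_exists)
  have "B \<subseteq> pm.span S" using B(1) by (auto simp: K_def)
  then obtain B' where B': "B \<subseteq> B'" "B' \<subseteq> pm.span S" "\<not> pm.dependent B'" "pm.span S \<subseteq> pm.span B'"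
    using pm.maximal_independent_subset_extend B(2) by meson
  have fin: "finite B'" "card B' \<le> card S"
    using pm.independent_span_bound [OF S(1) B'(3,2)] by auto
  have "S \<subseteq> pm.span B'" using B'(4) pm.span_superset by blast
  then have card: "card B' = card S"
    using pm.independent_span_bound [OF fin(1) S(2)] fin(2) by auto
  have finB: "finite B" using fin B'(1) by (metis finite_subset)
  define C where "C = B' - B"
  have C: "finite C" "B' = B \<union> C" "B \<inter> C = {}" using fin B'(1) by (auto simp: C_def)
  have key: "u c = 0" if u: "f (\<Sum>c\<in>C. smul (u c) c) = 0" and c: "c \<in> C" for u c
  proof -
    have "(\<Sum>c\<in>C. smul (u c) c) \<in> pm.span S"
      using B'(2) C(2) by (intro pm.span_sum pm.span_scale) auto
    then have "(\<Sum>c\<in>C. smul (u c) c) \<in> pm.span B" using u B(3) by (auto simp: K_def)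
    then obtain w where w: "(\<Sum>c\<in>C. smul (u c) c) = (\<Sum>b\<in>B. smul (w b) b)"
      using pm.span_finite [OF finB] by auto
    have "(\<Sum>b\<in>B'. smul (if b \<in> C then u b else - w b) b) =
        (\<Sum>b\<in>B. smul (if b \<in> C then u b else - w b) b) + (\<Sum>b\<in>C. smul (if b \<in> C then u b else - w b) b)"
      unfolding C(2) using finB C by (intro sum.union_disjoint) auto
    also have "(\<Sum>b\<in>B. smul (if b \<in> C then u b else - w b) b) = (\<Sum>b\<in>B. - smul (w b) b)"
      using C(3) by (intro sum.cong) auto
    also have "(\<Sum>b\<in>C. smul (if b \<in> C then u b else - w b) b) = (\<Sum>b\<in>C. smul (u b) b)"
      by (intro sum.cong) auto
    finally have "(\<Sum>b\<in>B'. smul (if b \<in> C then u b else - w b) b) = 0"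
      by (simp add: w sum_negf)
    from pm.independentD [OF B'(3) fin(1) order_refl this, of c] show ?thesis
      using c C(2) by auto
  qed
  have inj: "inj_on f C"
  proof (rule inj_onI, rule ccontr)
    fix c c' assume cc: "c \<in> C" "c' \<in> C" "f c = f c'" "c \<noteq> c'"
    \<comment> \<open>The coefficients of the combination \<open>c - c'\<close>, which lies in the
      kernel.\<close>
    define u :: "('a \<Rightarrow>\<^sub>0 'k) \<Rightarrow> 'k" where "u = (\<lambda>x. if x = c then 1 else if x = c' then - 1 else 0)"
    have "(\<Sum>x\<in>C. smul (u x) x) = (\<Sum>x\<in>{c, c'}. smul (u x) x)"
      using cc C(1) by (intro sum.mono_neutral_right) (auto simp: u_def)
    also have "\<dots> = c - c'" using cc by (simp add: u_def)
    finally have "f (\<Sum>x\<in>C. smul (u x) x) = 0" using cc by (simp add: f.diff)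
    from key [OF this cc(1)] show False by (simp add: u_def)
  qed
  have ind: "\<not> pm.dependent (f ` C)"
  proof
    assume "pm.dependent (f ` C)"
    then obtain u c where u: "(\<Sum>v\<in>f ` C. smul (u v) v) = 0" "c \<in> C" "u (f c) \<noteq> 0"
      using pm.dependent_finite [of "f ` C"] C(1) by auto
    have "f (\<Sum>c\<in>C. smul (u (f c)) c) = 0"
      using u(1) by (simp add: f.sum f.scale sum.reindex [OF inj])
    from key [OF this u(2)] u(3) show False by simp
  qed
  have "f ` pm.span S = f ` pm.span B'"
    using B'(2,4) by (metis pm.span_minimal pm.subspace_span subset_antisym)
  also have "\<dots> = pm.span (f ` B')" by (rule f.span_image [symmetric])
  also have "\<dots> = pm.span (f ` C)"
  proof -
    have "f ` B \<subseteq> {0}" using B(1) by (auto simp: K_def)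
    then have "f ` B \<subseteq> pm.span (f ` C)" using pm.span_zero [of "f ` C"] by auto
    then have "f ` B' \<subseteq> pm.span (f ` C)"
      unfolding C(2) image_Un by (rule Un_least) (rule pm.span_superset)
    moreover have "f ` C \<subseteq> f ` B'" using C(2) by auto
    ultimately show ?thesis by (metis pm.span_minimal pm.subspace_span pm.span_mono subset_antisym)
  qed
  finally have "pm.dim (f ` pm.span S) = card C"
    using pm.dim_span_eq_card_independent [OF ind] card_image [OF inj] by simp
  moreover have "card B' = card B + card C"
    unfolding C(2) using finB C by (intro card_Un_disjoint) auto
  ultimately show ?thesis using card B(4) by (simp add: K_def)
qed

lemma span_singles: "pm.span ((\<lambda>e. single e (1 :: 'k::field)) ` E) = {c. keys c \<subseteq> E}"
proof (intro equalityI subsetI)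
  fix c :: "'a \<Rightarrow>\<^sub>0 'k" assume "c \<in> pm.span ((\<lambda>e. single e 1) ` E)"
  moreover have "pm.subspace {c :: 'a \<Rightarrow>\<^sub>0 'k. keys c \<subseteq> E}"
    by (auto simp: pm.subspace_def dest!: subsetD [OF Poly_Mapping.keys_add] subsetD [OF keys_smul])
  moreover have "(\<lambda>e. single e (1 :: 'k)) ` E \<subseteq> {c. keys c \<subseteq> E}" by auto
  ultimately show "c \<in> {c. keys c \<subseteq> E}" using pm.span_minimal by blast
next
  fix c :: "'a \<Rightarrow>\<^sub>0 'k" assume c: "c \<in> {c. keys c \<subseteq> E}"
  have "c = (\<Sum>e\<in>keys c. smul (lookup c e) (single e 1))"
    using lin_ext_ident [of c] by (simp add: lin_ext_def)
  moreover have "(\<Sum>e\<in>keys c. smul (lookup c e) (single e 1)) \<in> pm.span ((\<lambda>e. single e (1 :: 'k)) ` E)"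
    using c by (intro pm.span_sum pm.span_scale pm.span_base) auto
  ultimately show "c \<in> pm.span ((\<lambda>e. single e 1) ` E)" by simp
qed

lemma inj_single_one: "inj_on (\<lambda>e. single e (1 :: 'k::field)) E"
  by (rule inj_onI) (metis keys_single singleton_inject zero_neq_one)

lemma independent_singles:
  assumes "finite E"
  shows "\<not> pm.dependent ((\<lambda>e. single e (1 :: 'k::field)) ` E)"
proof
  assume "pm.dependent ((\<lambda>e. single e (1 :: 'k)) ` E)"
  then obtain u e where u: "(\<Sum>v\<in>(\<lambda>e. single e (1 :: 'k)) ` E. smul (u v) v) = 0" "e \<in> E" "u (single e 1) \<noteq> 0"
    using pm.dependent_finite [of "(\<lambda>e. single e (1 :: 'k)) ` E"] assms by auto
  have "0 = lookup (\<Sum>e\<in>E. smul (u (single e 1)) (single e 1)) e"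
    using u(1) by (simp add: sum.reindex [OF inj_single_one])
  also have "\<dots> = (\<Sum>e'\<in>E. if e' = e then u (single e' 1) else 0)"
    unfolding lookup_sum by (intro sum.cong) (auto simp: lookup_single when_def)
  also have "\<dots> = u (single e 1)" using assms u(2) by simp
  finally show False using u(3) by simp
qed

text \<open>With a base vertex \<open>v0\<close>, the image of the boundary map is spanned by the
  differences of vertices with \<open>v0\<close>, hence of dimension |V| - 1. Every edge boundary is
  a difference of two such vectors, and conversely each of them telescopes along a path from
  \<open>v0\<close>. Rank-nullity then gives |E| - |V| + 1.\<close>

lemma rank_H1_connected:
  assumes G: "labeled_graph G" and con: "connected_graph G"
  shows "rank_H1 G + card (verts G) = card (internal_edges G) + 1"
proof -
  let ?E = "internal_edges G"
  let ?f = "\<lambda>a. single (vertex_of G (flip G a)) 1 - single (vertex_of G a) (1 :: rat)"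
  have finE: "finite ?E" using G by (simp add: internal_edges_def labeled_graph_def)
  obtain v0 where v0: "v0 \<in> verts G" using con by (auto simp: connected_graph_def)
  let ?V = "verts G - {v0}"
  have finV: "finite (verts G)" using G by (simp add: labeled_graph_def)
  define t where "t = (\<lambda>v. single v 1 - single v0 (1 :: rat))"
  have lt: "lookup (t v) w = (if v = w then 1 else 0)" if "w \<in> ?V" for v w
    using that by (auto simp: t_def lookup_minus lookup_single when_def)
  have inj: "inj_on t ?V"
  proof (rule inj_onI)
    fix v w assume "v \<in> ?V" "w \<in> ?V" "t v = t w"
    then show "v = w" using lt [of w w] lt [of w v] by (simp split: if_splits)
  qed
  have ind: "\<not> pm.dependent (t ` ?V)"
  proof
    assume "pm.dependent (t ` ?V)"
    then obtain u w where u: "(\<Sum>v\<in>t ` ?V. smul (u v) v) = 0" "w \<in> ?V" "u (t w) \<noteq> 0"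
      using pm.dependent_finite [of "t ` ?V"] finV by auto
    have "0 = lookup (\<Sum>v\<in>?V. smul (u (t v)) (t v)) w"
      using u(1) by (simp add: sum.reindex [OF inj])
    also have "\<dots> = (\<Sum>v\<in>?V. if v = w then u (t v) else 0)"
      unfolding lookup_sum using u(2) by (intro sum.cong) (auto simp: lookup_smul lt)
    also have "\<dots> = u (t w)" using finV u(2) by simp
    finally show False using u(3) by simp
  qed
  let ?S = "(\<lambda>e. single e (1 :: rat)) ` ?E"
  have "edge_boundary G ` pm.span ?S = pm.span (edge_boundary G ` ?S)"
    unfolding edge_boundary_def
    by (rule module_hom.span_image
        [OF linear_lin_ext [unfolded Vector_Spaces.linear_def, THEN conjunct2, THEN conjunct2], symmetric])
  also have "edge_boundary G ` ?S = ?f ` ?E"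
    by (simp add: edge_boundary_def image_image)
  also have "pm.span (?f ` ?E) = pm.span (t ` ?V)"
  proof (rule subset_antisym; rule pm.span_minimal [OF _ pm.subspace_span])
    have tv: "t v \<in> pm.span (t ` ?V)" if "v \<in> verts G" for v
    proof (cases "v = v0")
      case True
      then show ?thesis by (simp add: t_def pm.span_zero)
    qed (use that in \<open>auto intro: pm.span_base\<close>)
    show "?f ` ?E \<subseteq> pm.span (t ` ?V)"
    proof
      fix c assume "c \<in> ?f ` ?E"
      then obtain a where a: "a \<in> ?E" "c = ?f a" by auto
      then have "vertex_of G a \<in> verts G" "vertex_of G (flip G a) \<in> verts G"
        using G by (auto simp: labeled_graph_def internal_edges_def)
      then have "t (vertex_of G (flip G a)) - t (vertex_of G a) \<in> pm.span (t ` ?V)"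
        by (intro pm.span_diff tv)
      then show "c \<in> pm.span (t ` ?V)" by (simp add: t_def a(2))
    qed
    show "t ` ?V \<subseteq> pm.span (?f ` ?E)"
    proof
      fix c assume "c \<in> t ` ?V"
      then obtain v where v: "v \<in> verts G" "c = t v" by auto
      have "(v0, v) \<in> {(vertex_of G a, vertex_of G (flip G a)) | a. a \<in> halves G}\<^sup>*"
        using con v0 v(1) by (simp add: connected_graph_def)
      then have "t v \<in> pm.span (?f ` ?E)"
      proof induction
        case base
        then show ?case by (simp add: t_def pm.span_zero)
      next
        case (step v w)
        then obtain a where a: "a \<in> halves G" "v = vertex_of G a" "w = vertex_of G (flip G a)" by auto
        have inv: "flip G a \<in> halves G" "flip G (flip G a) = a" using G a(1) by (auto simp: labeled_graph_def)
        have "t w - t v \<in> pm.span (?f ` ?E)"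
        \<comment> \<open>An edge is represented by its smaller half-edge: traversing it from that
          end gives its boundary, from the other end the negative. A leaf does not leave the
          vertex.\<close>
        proof (cases a "flip G a" rule: linorder_cases)
          case less
          then have "a \<in> ?E" using a by (simp add: internal_edges_def)
          then have "?f a \<in> pm.span (?f ` ?E)" by (intro pm.span_base imageI)
          then show ?thesis by (simp add: t_def a)
        next
          case equal
          then have "w = v" using a by metis
          then show ?thesis by (simp add: pm.span_zero)
        next
          case greater
          then have "flip G a \<in> ?E" using inv by (simp add: internal_edges_def)
          then have "- ?f (flip G a) \<in> pm.span (?f ` ?E)" by (intro pm.span_neg pm.span_base imageI)
          then show ?thesis by (simp add: t_def a inv)
        qed
        from pm.span_add [OF step.IH this] show ?case by simp
      qed
      then show "c \<in> pm.span (?f ` ?E)" by (simp add: v)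
    qed
  qed
  finally have "pm.dim (edge_boundary G ` pm.span ?S) = card ?V"
    using pm.dim_span_eq_card_independent [OF ind] card_image [OF inj] by simp
  moreover have "card ?V + 1 = card (verts G)" using v0 finV by (simp add: card_Diff_singleton) (metis card_gt_0_iff empty_iff Suc_pred)
  moreover have "pm.dim {x \<in> pm.span ?S. edge_boundary G x = 0} + pm.dim (edge_boundary G ` pm.span ?S) = card ?S"
    using finE independent_singles [OF finE] linear_lin_ext unfolding edge_boundary_def
    by (intro rank_nullity) auto
  moreover have "card ?S = card ?E" by (rule card_image [OF inj_single_one])
  moreover have "rank_H1 G = pm.dim {x \<in> pm.span ?S. edge_boundary G x = 0}"
    unfolding rank_H1_def span_singles by simp
  ultimately show ?thesis by simp
qed


section \<open>Decorated graphs and involutions\<close>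

lemma invols_arb: "\<tau> \<in> invols A \<Longrightarrow> x \<notin> A \<Longrightarrow> \<tau> x = undefined"
  by (auto simp: invols_def intro: PiE_arb)

lemma length_idx: "length (idx ls w) = length (concat (map w ls))"
  by (induction ls) auto

lemma idx_nth:
  assumes "r < length ls" "k < length (w (ls ! r))"
  shows "idx ls w ! (length (concat (take r (map w ls))) + k) = (ls ! r, k)"
proof -
  have "ls = take r ls @ ls ! r # drop (Suc r) ls" using assms(1) by (rule id_take_nth_drop)
  then have "idx ls w = idx (take r ls) w @ map (Pair (ls ! r)) [0..<length (w (ls ! r))] @ idx (drop (Suc r) ls) w"
    by (metis idx_simps(2,3))
  moreover have "length (idx (take r ls) w) = length (concat (take r (map w ls)))"
    by (simp add: length_idx take_map)
  ultimately show ?thesis using assms(2) by (simp add: nth_append)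
qed

lemma length_concat_take_Suc:
  "r < length ws \<Longrightarrow> length (concat (take (Suc r) ws)) = length (concat (take r ws)) + length (ws ! r)"
  by (simp add: take_Suc_conv_app_nth)

text \<open>Links the two descriptions of the letters at a vertex: first component of the address,
  and the interval of positions that \<open>decorations\<close> prescribes.\<close>

lemma idx_block_iff:
  assumes "distinct ls" "r < length ls" "p < length (idx ls w)"
  shows "fst (idx ls w ! p) = ls ! r \<longleftrightarrow>
    p \<in> {length (concat (take r (map w ls))) ..< length (concat (take (Suc r) (map w ls)))}"
proof
  assume l: "fst (idx ls w ! p) = ls ! r"
  obtain k where k: "idx ls w ! p = (ls ! r, k)" using l by (metis prod.collapse)
  have "idx ls w ! p \<in> set (idx ls w)" using assms(3) by (rule nth_mem)
  then have "k < length (w (ls ! r))" by (simp add: k set_idx)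
  note k = k this
  let ?q = "length (concat (take r (map w ls))) + k"
  have "?q < length (idx ls w)"
  proof -
    have "length (concat (take (Suc r) (map w ls))) \<le> length (concat (map w ls))"
      by (metis append_take_drop_id concat_append le_add1 length_append)
    then show ?thesis using assms(2) k(2) by (simp add: length_idx length_concat_take_Suc del: take_Suc)
  qed
  moreover have "idx ls w ! ?q = idx ls w ! p" using idx_nth [OF assms(2)] k by simp
  ultimately have "p = ?q"
    using distinct_idx [OF assms(1), of w] assms(3) by (simp add: nth_eq_iff_index_eq)
  then show "p \<in> {length (concat (take r (map w ls))) ..< length (concat (take (Suc r) (map w ls)))}"
    using k(2) assms(2) by (simp add: length_concat_take_Suc)
next
  assume "p \<in> {length (concat (take r (map w ls))) ..< length (concat (take (Suc r) (map w ls)))}"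
  then obtain k where "p = length (concat (take r (map w ls))) + k" "k < length (w (ls ! r))"
    using assms(2) by (auto simp: length_concat_take_Suc dest: le_Suc_ex)
  then show "fst (idx ls w ! p) = ls ! r" using idx_nth [OF assms(2), of k w] by simp
qed

text \<open>The bijections prescribed vertex by vertex glue to one bijection from all half-edges
  onto all positions that respects vertices. In this form a decoration can transport the edge
  involution.\<close>

lemma decorations_iff:
  assumes ls: "distinct ls" and f: "bij_betw f {1..length ls} (verts G)" and G: "labeled_graph G"
  shows "\<phi> \<in> decorations G f (map w ls) \<longleftrightarrow> \<phi> \<in> extensional (halves G) \<and>
    bij_betw \<phi> (halves G) {..<length (idx ls w)} \<and>
    (\<forall>a\<in>halves G. \<forall>r<length ls. vertex_of G a = f (Suc r) \<longrightarrow> fst (idx ls w ! \<phi> a) = ls ! r)"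
    (is "_ \<longleftrightarrow> ?R")
proof -
  let ?L = "idx ls w"
  let ?I = "\<lambda>r. {length (concat (take r (map w ls))) ..< length (concat (take (Suc r) (map w ls)))}"
  have vert: "\<exists>r<length ls. vertex_of G a = f (Suc r)" if "a \<in> halves G" for a
  proof -
    have "vertex_of G a \<in> f ` {1..length ls}"
      using G f that by (auto simp: labeled_graph_def bij_betw_def)
    then obtain i where "i \<in> {1..length ls}" "vertex_of G a = f i" by auto
    then show ?thesis by (intro exI [of _ "i - 1"]) auto
  qed
  have block: "\<exists>r<length ls. p \<in> ?I r" if "p < length ?L" for p
  proof -
    have "?L ! p \<in> set ?L" using that by simp
    then have "fst (?L ! p) \<in> set ls" by (auto simp: set_idx)
    then obtain r where "r < length ls" "fst (?L ! p) = ls ! r" by (metis in_set_conv_nth)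
    then show ?thesis using idx_block_iff [OF ls _ that] by blast
  qed
  have bound: "p < length ?L" if "r < length ls" "p \<in> ?I r" for p r
  proof -
    have "length (concat (take (Suc r) (map w ls))) \<le> length (concat (map w ls))"
      by (metis append_take_drop_id concat_append le_add1 length_append)
    then show ?thesis using that(2) by (simp add: length_idx)
  qed
  have uniq: "r = r'" if "r < length ls" "r' < length ls" "ls ! r = ls ! r'" for r r'
    using that ls by (simp add: nth_eq_iff_index_eq)
  show ?thesis
  proof
    assume \<phi>: "\<phi> \<in> decorations G f (map w ls)"
    then have b: "bij_betw \<phi> (halves_at G (f (Suc r))) (?I r)" if "r < length ls" for r
      using that by (simp add: decorations_def)
    have in_block: "\<phi> a \<in> ?I r" if "a \<in> halves G" "r < length ls" "vertex_of G a = f (Suc r)" for a r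
      using bij_betwE [OF b [OF that(2)]] that by (simp add: halves_at_def)
    have fst: "fst (?L ! \<phi> a) = ls ! r" if "a \<in> halves G" "r < length ls" "vertex_of G a = f (Suc r)" for a r
      using in_block [OF that] idx_block_iff [OF ls that(2) bound [OF that(2) in_block [OF that]]] by blast
    have "bij_betw \<phi> (halves G) {..<length ?L}"
      unfolding bij_betw_def
    proof
      show "inj_on \<phi> (halves G)"
      proof (rule inj_onI)
        fix a a' assume a: "a \<in> halves G" "a' \<in> halves G" "\<phi> a = \<phi> a'"
        obtain r r' where r: "r < length ls" "vertex_of G a = f (Suc r)" "r' < length ls" "vertex_of G a' = f (Suc r')"
          using vert a by meson
        have "r = r'" using fst [OF a(1) r(1,2)] fst [OF a(2) r(3,4)] a(3) r uniq by simp
        then have "a \<in> halves_at G (f (Suc r))" "a' \<in> halves_at G (f (Suc r))"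
          using a r by (auto simp: halves_at_def)
        then show "a = a'" using b [OF r(1)] a(3) by (auto simp: bij_betw_def dest: inj_onD)
      qed
      show "\<phi> ` halves G = {..<length ?L}"
      proof (intro equalityI subsetI)
        fix p assume "p \<in> \<phi> ` halves G"
        then show "p \<in> {..<length ?L}" using vert in_block bound by blast
      next
        fix p assume "p \<in> {..<length ?L}"
        then obtain r where r: "r < length ls" "p \<in> ?I r" using block by auto
        then have "p \<in> \<phi> ` halves_at G (f (Suc r))" using b by (auto simp: bij_betw_def)
        then show "p \<in> \<phi> ` halves G" by (auto simp: halves_at_def)
      qed
    qed
    then show ?R using \<phi> fst by (auto simp: decorations_def)
  next
    assume R: ?R
    have "bij_betw \<phi> (halves_at G (f (Suc r))) (?I r)" if r: "r < length ls" for r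
      unfolding bij_betw_def
    proof
      show "inj_on \<phi> (halves_at G (f (Suc r)))"
        using R by (auto simp: bij_betw_def halves_at_def intro: inj_on_subset)
      show "\<phi> ` halves_at G (f (Suc r)) = ?I r"
      proof (intro equalityI subsetI)
        fix p assume "p \<in> \<phi> ` halves_at G (f (Suc r))"
        then obtain a where a: "a \<in> halves G" "vertex_of G a = f (Suc r)" "p = \<phi> a"
          by (auto simp: halves_at_def)
        then have "p < length ?L" using R by (auto dest: bij_betwE)
        then show "p \<in> ?I r" using R a r idx_block_iff [OF ls r] by blast
      next
        fix p assume p: "p \<in> ?I r"
        then have "p < length ?L" by (rule bound [OF r])
        then have "p \<in> \<phi> ` halves G" using R by (simp add: bij_betw_def)
        then obtain a where a: "a \<in> halves G" "p = \<phi> a" by blast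
        obtain r' where r': "r' < length ls" "vertex_of G a = f (Suc r')" using vert a(1) by meson
        then have "fst (?L ! p) = ls ! r'" using R a by blast
        moreover have "fst (?L ! p) = ls ! r"
          using idx_block_iff [OF ls r] bound [OF r p] p by blast
        ultimately have "r = r'" using r r' uniq by simp
        then show "p \<in> \<phi> ` halves_at G (f (Suc r))" using a r' by (auto simp: halves_at_def)
      qed
    qed
    then show "\<phi> \<in> decorations G f (map w ls)" using R by (simp add: decorations_def)
  qed
qed

text \<open>Modulo graded commutativity, the contraction attached to a decorated graph depends only
  on this involution of the letters.\<close>

definition push :: "('l \<times> nat) list \<Rightarrow> lgraph \<Rightarrow> (nat \<Rightarrow> nat) \<Rightarrow> 'l \<times> nat \<Rightarrow> 'l \<times> nat" where
  "push L G \<phi> = conj_invol (\<lambda>a. L ! \<phi> a) (halves G) (restrict (flip G) (halves G))"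

lemma flip_invol: "labeled_graph G \<Longrightarrow> restrict (flip G) (halves G) \<in> invols (halves G)"
  by (auto simp: invols_def labeled_graph_def)

locale decorated =
  fixes ls :: "'l list" and w :: "'l \<Rightarrow> 'x list" and G f \<phi>
  assumes ls: "distinct ls" and f: "bij_betw f {1..length ls} (verts G)" and G: "labeled_graph G"
    and \<phi>: "\<phi> \<in> decorations G f (map w ls)"
begin

abbreviation "L \<equiv> idx ls w"

lemma bij_dec: "bij_betw \<phi> (halves G) {..<length L}"
  and fst_dec: "a \<in> halves G \<Longrightarrow> r < length ls \<Longrightarrow> vertex_of G a = f (Suc r) \<Longrightarrow> fst (L ! \<phi> a) = ls ! r"
  and ext_dec: "\<phi> \<in> extensional (halves G)"
  using \<phi> decorations_iff [OF ls f G] by blast+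

lemma bij_pos_dec: "bij_betw (\<lambda>a. L ! \<phi> a) (halves G) (set L)"
  using bij_betw_trans [OF bij_dec bij_betw_nth [OF distinct_idx [OF ls, of w], of _ "set L"]]
  by (simp add: o_def)

lemma inj_pos_dec: "inj_on (\<lambda>a. L ! \<phi> a) (halves G)"
  and image_pos_dec: "(\<lambda>a. L ! \<phi> a) ` halves G = set L"
  using bij_pos_dec by (auto simp: bij_betw_def)

lemma flip: "a \<in> halves G \<Longrightarrow> flip G a \<in> halves G" "a \<in> halves G \<Longrightarrow> flip G (flip G a) = a"
  using G by (auto simp: labeled_graph_def)

lemma push_apply: "a \<in> halves G \<Longrightarrow> push L G \<phi> (L ! \<phi> a) = L ! \<phi> (flip G a)"
  unfolding push_def using conj_invol_apply [OF inj_pos_dec] by simp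

lemma push_invol: "push L G \<phi> \<in> invols (set L)"
  using bij_betwE [OF bij_conj_invol [OF inj_pos_dec]] flip_invol [OF G]
  unfolding push_def image_pos_dec by blast

lemma vert: "v \<in> verts G \<Longrightarrow> \<exists>r<length ls. v = f (Suc r)"
proof -
  assume "v \<in> verts G"
  then have "v \<in> f ` {1..length ls}" using f by (simp add: bij_betw_def)
  then obtain i where "i \<in> {1..length ls}" "v = f i" by blast
  then show ?thesis by (intro exI [of _ "i - 1"]) auto
qed

lemma vertex_of: "a \<in> halves G \<Longrightarrow> \<exists>r<length ls. vertex_of G a = f (Suc r)"
  using vert G by (auto simp: labeled_graph_def)

lemma card_halves: "card (halves G) = length L"
  using bij_betw_same_card [OF bij_dec] by simp

end

text \<open>An isomorphism is determined by its effect on half-edges, because the markings force it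
  on vertices. Pulling \<open>\<phi>'\<close> back along it gives a decoration that induces the same
  involution, and every such decoration arises by composing with the inverse of
  \<open>\<phi>'\<close>. For equal marked graphs this says that each fibre of \<open>push\<close>
  that is hit has as many elements as the automorphism group.\<close>

lemma graph_isos_decorations:
  assumes X: "decorated ls w G' f' \<phi>'" and f: "bij_betw f {1..length ls} (verts G)" and G: "labeled_graph G"
    and gen: "\<And>i. i \<in> {1..length ls} \<Longrightarrow> genus G (f i) = genus G' (f' i)"
  shows "bij_betw (\<lambda>(\<alpha>, \<psi>). restrict (\<lambda>a. \<phi>' (\<psi> a)) (halves G)) (graph_isos (length ls) (G, f) (G', f'))
    {\<phi> \<in> decorations G f (map w ls). push (idx ls w) G \<phi> = push (idx ls w) G' \<phi>'}"
    (is "bij_betw ?\<Theta> ?A ?B")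
proof -
  interpret X: decorated ls w G' f' \<phi>' by (rule X)
  let ?L = "idx ls w" and ?H = "halves G" and ?H' = "halves G'"
  have isoD: "\<alpha> \<in> extensional (verts G) \<and> bij_betw \<alpha> (verts G) (verts G') \<and>
     \<psi> \<in> extensional ?H \<and> bij_betw \<psi> ?H ?H' \<and>
     (\<forall>a\<in>?H. vertex_of G' (\<psi> a) = \<alpha> (vertex_of G a) \<and> flip G' (\<psi> a) = \<psi> (flip G a)) \<and>
     (\<forall>v\<in>verts G. genus G' (\<alpha> v) = genus G v) \<and> (\<forall>i\<in>{1..length ls}. \<alpha> (f i) = f' i)"
    if "(\<alpha>, \<psi>) \<in> ?A" for \<alpha> \<psi>
    using that by (auto simp: graph_isos_def)
  have verts: "verts G = f ` {1..length ls}" using f by (simp add: bij_betw_def)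
  have into: "?\<Theta> (\<alpha>, \<psi>) \<in> ?B" if i: "(\<alpha>, \<psi>) \<in> ?A" for \<alpha> \<psi>
  proof -
    note iso = isoD [OF i]
    let ?\<phi> = "restrict (\<lambda>a. \<phi>' (\<psi> a)) ?H"
    have b: "bij_betw \<psi> ?H ?H'" using iso by blast
    have "bij_betw ?\<phi> ?H {..<length ?L}"
      using bij_betw_trans [OF b X.bij_dec] by (simp add: o_def cong: bij_betw_cong)
    moreover have "fst (?L ! ?\<phi> a) = ls ! r" if "a \<in> ?H" "r < length ls" "vertex_of G a = f (Suc r)" for a r
    proof -
      have "vertex_of G' (\<psi> a) = f' (Suc r)" using iso that by auto
      moreover have "\<psi> a \<in> ?H'" using b that(1) by (auto dest: bij_betwE)
      ultimately show ?thesis using that by (simp add: X.fst_dec)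
    qed
    ultimately have dec: "?\<phi> \<in> decorations G f (map w ls)"
      unfolding decorations_iff [OF X.ls f G] by auto
    interpret Y: decorated ls w G f ?\<phi> using X.ls f G dec by unfold_locales
    have "push ?L G ?\<phi> = push ?L G' \<phi>'"
    proof
      fix x show "push ?L G ?\<phi> x = push ?L G' \<phi>' x"
      proof (cases "x \<in> set ?L")
        case True
        then obtain a where a: "a \<in> ?H" "x = ?L ! ?\<phi> a" using Y.image_pos_dec by blast
        have "push ?L G ?\<phi> x = ?L ! \<phi>' (\<psi> (flip G a))"
          using a Y.flip by (simp only: Y.push_apply) simp
        also have "\<dots> = ?L ! \<phi>' (flip G' (\<psi> a))" using iso a by simp
        also have "\<dots> = push ?L G' \<phi>' (?L ! \<phi>' (\<psi> a))"
          using b a by (intro X.push_apply [symmetric]) (auto dest: bij_betwE)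
        finally show ?thesis using a by simp
      next
        case False
        then show ?thesis using X.push_invol Y.push_invol by (simp add: invols_arb)
      qed
    qed
    then show ?thesis using dec by simp
  qed
  have inj: "inj_on ?\<Theta> ?A"
  proof (rule inj_onI)
    fix x y assume xy: "x \<in> ?A" "y \<in> ?A" "?\<Theta> x = ?\<Theta> y"
    obtain \<alpha> \<psi> \<alpha>2 \<psi>2 where e: "x = (\<alpha>, \<psi>)" "y = (\<alpha>2, \<psi>2)" by fastforce
    note i1 = isoD [OF xy(1) [unfolded e]] and i2 = isoD [OF xy(2) [unfolded e]]
    have "\<psi> = \<psi>2"
    proof (rule extensionalityI)
      fix a assume a: "a \<in> ?H"
      have "\<phi>' (\<psi> a) = \<phi>' (\<psi>2 a)" using fun_cong [OF xy(3) [unfolded e], of a] a by simp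
      moreover have "\<psi> a \<in> ?H'" "\<psi>2 a \<in> ?H'" using a i1 i2 by (auto dest: bij_betwE)
      ultimately show "\<psi> a = \<psi>2 a" using X.bij_dec by (auto simp: bij_betw_def dest: inj_onD)
    qed (use i1 i2 in auto)
    moreover have "\<alpha> = \<alpha>2"
    proof (rule extensionalityI)
      fix v assume "v \<in> verts G"
      then obtain i where "i \<in> {1..length ls}" "v = f i" unfolding verts by auto
      then show "\<alpha> v = \<alpha>2 v" using i1 i2 by auto
    qed (use i1 i2 in auto)
    ultimately show "x = y" by (simp add: e)
  qed
  have surj: "\<phi> \<in> ?\<Theta> ` ?A" if "\<phi> \<in> ?B" for \<phi>
  proof -
    interpret Y: decorated ls w G f \<phi> using X.ls f G that by unfold_locales auto
    have push: "push ?L G \<phi> = push ?L G' \<phi>'" using that by simp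
    \<comment> \<open>The only candidates: on half-edges the two decorations are compared, on
      vertices the two markings.\<close>
    define \<psi> where "\<psi> = restrict (\<lambda>a. inv_into ?H' \<phi>' (\<phi> a)) ?H"
    define \<alpha> where "\<alpha> = restrict (\<lambda>v. f' (inv_into {1..length ls} f v)) (verts G)"
    have b: "bij_betw \<psi> ?H ?H'"
      using bij_betw_trans [OF Y.bij_dec bij_betw_inv_into [OF X.bij_dec]]
      by (simp add: o_def \<psi>_def cong: bij_betw_cong)
    have \<psi>: "\<psi> a \<in> ?H'" "\<phi>' (\<psi> a) = \<phi> a" if "a \<in> ?H" for a
    proof -
      have "\<phi> a \<in> \<phi>' ` ?H'" using Y.bij_dec X.bij_dec that by (auto simp: bij_betw_def)
      then show "\<psi> a \<in> ?H'" "\<phi>' (\<psi> a) = \<phi> a"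
        using that by (simp_all add: \<psi>_def inv_into_into f_inv_into_f)
    qed
    have \<alpha>: "\<alpha> (f i) = f' i" if "i \<in> {1..length ls}" for i
      using that f by (simp add: \<alpha>_def verts bij_betw_def inv_into_f_f)
    have ba: "bij_betw \<alpha> (verts G) (verts G')"
      using bij_betw_trans [OF bij_betw_inv_into [OF f] X.f]
      by (simp add: o_def \<alpha>_def cong: bij_betw_cong)
    have "vertex_of G' (\<psi> a) = \<alpha> (vertex_of G a)" if a: "a \<in> ?H" for a
    proof -
      obtain r where r: "r < length ls" "vertex_of G a = f (Suc r)" using Y.vertex_of a by blast
      obtain r' where r': "r' < length ls" "vertex_of G' (\<psi> a) = f' (Suc r')" using X.vertex_of \<psi>(1) [OF a] by blast
      have "ls ! r = ls ! r'"
        using Y.fst_dec [OF a r] X.fst_dec [OF \<psi>(1) [OF a] r'] \<psi>(2) [OF a] by simp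
      then have "r = r'" using X.ls r r' by (simp add: nth_eq_iff_index_eq)
      then show ?thesis using r r' \<alpha> by simp
    qed
    moreover have "flip G' (\<psi> a) = \<psi> (flip G a)" if a: "a \<in> ?H" for a
    proof -
      have "?L ! \<phi>' (flip G' (\<psi> a)) = ?L ! \<phi>' (\<psi> (flip G a))"
        using X.push_apply [OF \<psi>(1) [OF a]] Y.push_apply [OF a] \<psi>(2) a Y.flip push by simp
      then show ?thesis using X.inj_pos_dec X.flip \<psi>(1) Y.flip a by (auto dest: inj_onD)
    qed
    moreover have "genus G' (\<alpha> v) = genus G v" if v: "v \<in> verts G" for v
    proof -
      obtain i where "i \<in> {1..length ls}" "v = f i" using v unfolding verts by auto
      then show ?thesis using gen \<alpha> by simp
    qed
    ultimately have "(\<alpha>, \<psi>) \<in> ?A"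
      using b ba \<alpha> by (auto simp: graph_isos_def) (auto simp: \<alpha>_def \<psi>_def)
    moreover have "\<phi> = ?\<Theta> (\<alpha>, \<psi>)"
      by (rule extensionalityI [of _ ?H]) (use Y.ext_dec \<psi> in auto)
    ultimately show ?thesis by blast
  qed
  show ?thesis unfolding bij_betw_def using inj into surj by auto
qed

lemma connected_via_image:
  assumes "connected_via v \<tau> A U"
  shows "connected_via (\<lambda>a. \<beta> (v a)) \<tau> A (\<beta> ` U)"
proof -
  have "(\<beta> a, \<beta> b) \<in> {(\<beta> (v a), \<beta> (v (\<tau> a))) | a. a \<in> A}\<^sup>*"
    if "(a, b) \<in> {(v a, v (\<tau> a)) | a. a \<in> A}\<^sup>*" for a b
    using that by induction (auto intro: rtrancl_into_rtrancl)
  then show ?thesis using assms by (auto simp: connected_via_def)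
qed

lemma nedges_flip:
  assumes "labeled_graph G"
  shows "nedges (restrict (flip G) (halves G)) (halves G) = card (internal_edges G)"
    and "card (halves G) = card (leaves G) + 2 * card (internal_edges G)"
proof -
  let ?E = "internal_edges G"
  have fin: "finite (halves G)" using assms by (simp add: labeled_graph_def)
  have inv: "flip G a \<in> halves G" "flip G (flip G a) = a" if "a \<in> halves G" for a
    using assms that by (auto simp: labeled_graph_def)
  have sub: "?E \<subseteq> halves G" by (auto simp: internal_edges_def)
  have inj: "inj_on (flip G) ?E" using inv sub by (intro inj_on_inverseI [of _ "flip G"]) auto
  have un: "{a \<in> halves G. flip G a \<noteq> a} = ?E \<union> flip G ` ?E"
  proof (intro equalityI subsetI)
    fix a assume a: "a \<in> {a \<in> halves G. flip G a \<noteq> a}"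
    show "a \<in> ?E \<union> flip G ` ?E"
    proof (cases "a < flip G a")
      case False
      then have "flip G a \<in> ?E" using a inv by (auto simp: internal_edges_def)
      then have "flip G (flip G a) \<in> flip G ` ?E" by (rule imageI)
      then show ?thesis using a inv by auto
    qed (use a in \<open>simp add: internal_edges_def\<close>)
  qed (use inv in \<open>auto simp: internal_edges_def\<close>)
  have "?E \<inter> flip G ` ?E = {}" using inv by (force simp: internal_edges_def)
  then have "card {a \<in> halves G. flip G a \<noteq> a} = card ?E + card (flip G ` ?E)"
    unfolding un using finite_subset [OF sub fin] by (intro card_Un_disjoint) auto
  then have c: "card {a \<in> halves G. flip G a \<noteq> a} = 2 * card ?E"
    using card_image [OF inj] by simp
  have "{a \<in> halves G. restrict (flip G) (halves G) a \<noteq> a} = {a \<in> halves G. flip G a \<noteq> a}" by auto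
  then show "nedges (restrict (flip G) (halves G)) (halves G) = card ?E" by (simp add: nedges_def c)
  have "halves G = leaves G \<union> {a \<in> halves G. flip G a \<noteq> a}" by (auto simp: leaves_def)
  moreover have "card (leaves G \<union> {a \<in> halves G. flip G a \<noteq> a}) = card (leaves G) + card {a \<in> halves G. flip G a \<noteq> a}"
    using fin by (intro card_Un_disjoint) (auto simp: leaves_def)
  ultimately show "card (halves G) = card (leaves G) + 2 * card ?E" using c by simp
qed

lemma (in decorated) nedges_push: "nedges (push L G \<phi>) (set L) = card (internal_edges G)"
  using nedges_conj [OF inj_pos_dec flip_invol [OF G]] nedges_flip(1) [OF G]
  by (simp add: push_def image_pos_dec)

text \<open>Matching the vertex marked r + 1 with \<open>ls ! r\<close> identifies the connectedness
  of the graph with that of the letters, and the rank formula rewrites the Betti number as a count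
  of two-cycles.\<close>

lemma push_matchings_iff:
  assumes X: "decorated ls (\<lambda>l. snd (z l)) G f \<phi>"
    and gen: "\<And>r. r < length ls \<Longrightarrow> genus G (f (Suc r)) = fst (z (ls ! r))"
  shows "(G, f) \<in> marked_graphs g n (length ls) \<longleftrightarrow>
    push (idx ls (\<lambda>l. snd (z l))) G \<phi> \<in> matchings ls z g \<and> card (leaves G) = n"
proof -
  interpret decorated ls "\<lambda>l. snd (z l)" G f \<phi> by (rule X)
  let ?H = "halves G" and ?\<rho> = "restrict (flip G) (halves G)" and ?\<tau> = "push L G \<phi>"
  define \<beta> where "\<beta> = (\<lambda>v. ls ! (inv_into {1..length ls} f v - 1))"
  \<comment> \<open>The inverse renaming of vertices. Connectedness is only known to pass to images,
    so the equivalence needs a map in each direction.\<close>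
  define \<beta>' where "\<beta>' = (\<lambda>l. f (Suc (pos ls l)))"
  have \<beta>: "\<beta> (f (Suc r)) = ls ! r" if "r < length ls" for r
    using f that by (simp add: \<beta>_def bij_betw_def inv_into_f_f)
  have \<beta>': "\<beta>' (\<beta> v) = v" "\<beta> v \<in> set ls" if v: "v \<in> verts G" for v
  proof -
    obtain r where "r < length ls" "v = f (Suc r)" using vert [OF v] by blast
    then show "\<beta>' (\<beta> v) = v" "\<beta> v \<in> set ls" using \<beta> ls by (simp_all add: \<beta>'_def pos_nth)
  qed
  have "\<beta> ` verts G = set ls"
  proof (intro equalityI subsetI)
    fix l assume "l \<in> set ls"
    then obtain r where r: "r < length ls" "l = ls ! r" by (metis in_set_conv_nth)
    then have "f (Suc r) \<in> verts G" using f by (auto simp: bij_betw_def)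
    then show "l \<in> \<beta> ` verts G" using \<beta> r by force
  qed (use \<beta>' in auto)
  moreover have "\<beta>' ` set ls = verts G"
    using \<beta>' calculation by (metis (no_types, lifting) image_cong image_ident image_image)
  ultimately have im: "\<beta> ` verts G = set ls" "\<beta>' ` set ls = verts G" by auto
  have fstL: "fst (L ! \<phi> a) = \<beta> (vertex_of G a)" if a: "a \<in> ?H" for a
  proof -
    obtain r where "r < length ls" "vertex_of G a = f (Suc r)" using vertex_of a by blast
    then show ?thesis using \<beta> fst_dec a by simp
  qed
  have vG: "vertex_of G a \<in> verts G" if "a \<in> ?H" for a using G that by (auto simp: labeled_graph_def)
  have "connected_graph G \<longleftrightarrow> connected_via (vertex_of G) (flip G) ?H (verts G)"
    by (simp add: connected_graph_def connected_via_def)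
  also have "\<dots> \<longleftrightarrow> connected_via (vertex_of G) ?\<rho> ?H (verts G)"
    by (rule connected_via_cong) auto
  also have "\<dots> \<longleftrightarrow> connected_via (\<lambda>a. \<beta> (vertex_of G a)) ?\<rho> ?H (set ls)"
  proof
    assume "connected_via (vertex_of G) ?\<rho> ?H (verts G)"
    from connected_via_image [OF this, of \<beta>]
    show "connected_via (\<lambda>a. \<beta> (vertex_of G a)) ?\<rho> ?H (set ls)" by (simp add: im)
  next
    assume "connected_via (\<lambda>a. \<beta> (vertex_of G a)) ?\<rho> ?H (set ls)"
    from connected_via_image [OF this, of \<beta>']
    have "connected_via (\<lambda>a. \<beta>' (\<beta> (vertex_of G a))) ?\<rho> ?H (verts G)" by (simp add: im)
    also have "connected_via (\<lambda>a. \<beta>' (\<beta> (vertex_of G a))) ?\<rho> ?H (verts G) =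
        connected_via (vertex_of G) ?\<rho> ?H (verts G)"
      by (rule connected_via_cong) (auto simp: \<beta>' vG flip)
    finally show "connected_via (vertex_of G) ?\<rho> ?H (verts G)" .
  qed
  also have "\<dots> \<longleftrightarrow> connected_via (\<lambda>a. fst (L ! \<phi> a)) ?\<rho> ?H (set ls)"
    by (rule connected_via_cong) (auto simp: fstL flip)
  also have "\<dots> \<longleftrightarrow> connected_via fst ?\<tau> (set L) (set ls)"
    unfolding push_def using connected_via_conj [OF inj_pos_dec, of fst ?\<rho> "set ls"]
    by (simp add: image_pos_dec)
  finally have con: "connected_graph G \<longleftrightarrow> connected_via fst ?\<tau> (set L) (set ls)" .
  note ne = nedges_push
  have "(\<Sum>v\<in>verts G. genus G v) = (\<Sum>r<length ls. fst (z (ls ! r)))"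
  proof -
    have "bij_betw (\<lambda>r. f (Suc r)) {..<length ls} (verts G)"
    proof -
      have "bij_betw Suc {..<length ls} {1..length ls}"
        by (rule bij_betwI [of _ _ _ "\<lambda>x. x - 1"]) auto
      from bij_betw_trans [OF this f] show ?thesis by (simp add: o_def)
    qed
    from sum.reindex_bij_betw [OF this, of "genus G"] show ?thesis using gen by simp
  qed
  also have "\<dots> = (\<Sum>l\<in>set ls. fst (z l))"
    using sum.reindex_bij_betw [OF bij_betw_nth [OF ls, of "{..<length ls}" "set ls"], of "\<lambda>l. fst (z l)"] by simp
  finally have gs: "(\<Sum>v\<in>verts G. genus G v) = (\<Sum>l\<in>set ls. fst (z l))" .
  have cv: "card (verts G) = length ls" using bij_betw_same_card [OF f] by simp
  \<comment> \<open>The rank formula requires a connected graph, but connectedness occurs on both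
    sides of the equivalence.\<close>
  have "betti G = g \<longleftrightarrow> (\<Sum>l\<in>set ls. fst (z l)) + nedges ?\<tau> (set L) + 1 = g + length ls"
    if "connected_graph G"
    using rank_H1_connected [OF G that] by (auto simp: betti_def gs ne cv)
  then show ?thesis
    using con push_invol G cv f by (auto simp: marked_graphs_def matchings_def)
qed

text \<open>The graph realizing a given involution. Half-edges have to be natural numbers, so
  letters are replaced by their positions; vertices are numbered from 1, so that the identity is a
  marking.\<close>

definition std_graph :: "'l list \<Rightarrow> ('l \<Rightarrow> nat \<times> 'x list) \<Rightarrow> ('l \<times> nat \<Rightarrow> 'l \<times> nat) \<Rightarrow> lgraph" where
  "std_graph ls z \<tau> = (let L = idx ls (\<lambda>l. snd (z l)) in
     \<lparr>verts = {1..length ls}, halves = {..<length L}, vertex_of = (\<lambda>p. Suc (pos ls (fst (L ! p)))),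
      flip = (\<lambda>p. pos L (\<tau> (L ! p))), genus = (\<lambda>v. fst (z (ls ! (v - 1))))\<rparr>)"

lemma std_graph:
  assumes ls: "distinct ls" and \<tau>: "\<tau> \<in> invols (set (idx ls (\<lambda>l. snd (z l))))"
  shows "decorated ls (\<lambda>l. snd (z l)) (std_graph ls z \<tau>) id (restrict id {..<length (idx ls (\<lambda>l. snd (z l)))})"
    and "push (idx ls (\<lambda>l. snd (z l))) (std_graph ls z \<tau>) (restrict id {..<length (idx ls (\<lambda>l. snd (z l)))}) = \<tau>"
    and "r < length ls \<Longrightarrow> genus (std_graph ls z \<tau>) (id (Suc r)) = fst (z (ls ! r))"
proof -
  let ?L = "idx ls (\<lambda>l. snd (z l))" and ?G = "std_graph ls z \<tau>"
  let ?\<phi> = "restrict id {..<length ?L}"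
  have dL: "distinct ?L" using ls by (rule distinct_idx)
  have sel: "verts ?G = {1..length ls}" "halves ?G = {..<length ?L}"
    "vertex_of ?G p = Suc (pos ls (fst (?L ! p)))" "flip ?G p = pos ?L (\<tau> (?L ! p))" for p
    by (simp_all add: std_graph_def Let_def)
  have inL: "?L ! p \<in> set ?L" "\<tau> (?L ! p) \<in> set ?L" "fst (?L ! p) \<in> set ls" if "p < length ?L" for p
  proof -
    show 1: "?L ! p \<in> set ?L" using that by simp
    then show "\<tau> (?L ! p) \<in> set ?L" by (rule invols_mem [OF \<tau>])
    show "fst (?L ! p) \<in> set ls" using 1 by (auto simp: set_idx)
  qed
  have G: "labeled_graph ?G"
  proof -
    have "vertex_of ?G p \<in> {1..length ls}" if "p < length ?L" for p
      using pos_less [OF inL(3) [OF that]] by (simp add: sel Suc_le_eq)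
    moreover have "pos ?L (\<tau> (?L ! p)) < length ?L \<and> pos ?L (\<tau> (?L ! pos ?L (\<tau> (?L ! p)))) = p"
      if "p < length ?L" for p
      using that inL [OF that] by (simp add: pos_less nth_pos invols_invol [OF \<tau>] pos_nth [OF dL])
    ultimately show ?thesis by (auto simp: labeled_graph_def sel)
  qed
  have f: "bij_betw id {1..length ls} (verts ?G)" by (simp add: sel)
  have dec: "?\<phi> \<in> decorations ?G id (map (\<lambda>l. snd (z l)) ls)"
    unfolding decorations_iff [OF ls f G]
  proof (intro conjI ballI allI impI)
    show "bij_betw ?\<phi> (halves ?G) {..<length ?L}"
      unfolding sel(2) by (auto simp: bij_betw_def inj_on_def)
    fix a r assume "a \<in> halves ?G" "r < length ls" "vertex_of ?G a = id (Suc r)"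
    then show "fst (?L ! ?\<phi> a) = ls ! r" using inL nth_pos by (fastforce simp: sel)
  qed (simp add: sel)
  show D: "decorated ls (\<lambda>l. snd (z l)) ?G id ?\<phi>" using ls f G dec by unfold_locales
  interpret decorated ls "\<lambda>l. snd (z l)" ?G id ?\<phi> by (rule D)
  show "push ?L ?G ?\<phi> = \<tau>"
  proof
    fix x show "push ?L ?G ?\<phi> x = \<tau> x"
    proof (cases "x \<in> set ?L")
      case True
      then have p: "pos ?L x < length ?L" "?L ! pos ?L x = x" by (simp_all add: pos_less nth_pos)
      then have "push ?L ?G ?\<phi> x = ?L ! ?\<phi> (flip ?G (pos ?L x))"
        using push_apply [of "pos ?L x"] by (simp add: sel)
      moreover have \<tau>x: "\<tau> x \<in> set ?L" using inL(2) [OF p(1)] p(2) by simp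
      ultimately show ?thesis using p pos_less [OF \<tau>x] nth_pos [OF \<tau>x] by (simp add: sel)
    next
      case False
      then show ?thesis using push_invol \<tau> by (simp add: invols_arb)
    qed
  qed
  show "genus ?G (id (Suc r)) = fst (z (ls ! r))" if "r < length ls"
    by (simp add: std_graph_def Let_def)
qed


section \<open>Graph sums as Wick sums\<close>

lemma mem_listset: "xs \<in> listset As \<longleftrightarrow> length xs = length As \<and> (\<forall>r<length As. xs ! r \<in> As ! r)"
proof (induction As arbitrary: xs)
  case (Cons A As)
  show ?case
    by (cases xs) (auto simp: set_Cons_def Cons.IH All_less_Suc2)
qed simp

lemma finite_decorations: "labeled_graph G \<Longrightarrow> distinct ls \<Longrightarrow> bij_betw f {1..length ls} (verts G) \<Longrightarrow>
    finite (decorations G f (map w ls))"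
proof -
  assume A: "labeled_graph G" "distinct ls" "bij_betw f {1..length ls} (verts G)"
  have "decorations G f (map w ls) \<subseteq> halves G \<rightarrow>\<^sub>E {..<length (idx ls w)}"
    using decorations_iff [OF A(2,3,1)] by (auto simp: PiE_def dest: bij_betwE)
  then show ?thesis using A(1) finite_PiE [of "halves G" "\<lambda>_. {..<length (idx ls w)}"]
    by (auto simp: labeled_graph_def intro: finite_subset)
qed

lemma decorations_nonempty:
  assumes ls: "distinct ls" and f: "bij_betw f {1..length ls} (verts G)" and G: "labeled_graph G"
    and len: "\<And>r. r < length ls \<Longrightarrow> length (w (ls ! r)) = card (halves_at G (f (Suc r)))"
  shows "decorations G f (map w ls) \<noteq> {}"
proof -
  let ?I = "\<lambda>r. {length (concat (take r (map w ls))) ..< length (concat (take (Suc r) (map w ls)))}"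
  have "\<exists>b. bij_betw b (halves_at G (f (Suc r))) (?I r)" if r: "r < length ls" for r
  proof (rule finite_same_card_bij)
    show "finite (halves_at G (f (Suc r)))" using G by (simp add: halves_at_def labeled_graph_def)
    show "card (halves_at G (f (Suc r))) = card (?I r)"
      using len [OF r] length_concat_take_Suc [of r "map w ls"] r by simp
  qed simp
  then obtain b where b: "\<And>r. r < length ls \<Longrightarrow> bij_betw (b r) (halves_at G (f (Suc r))) (?I r)" by metis
  define \<phi> where "\<phi> = restrict (\<lambda>a. b (inv_into {1..length ls} f (vertex_of G a) - 1) a) (halves G)"
  have "bij_betw \<phi> (halves_at G (f (Suc r))) (?I r)" if r: "r < length ls" for r
  proof -
    have inv: "inv_into {1..length ls} f (f (Suc r)) = Suc r"
      using f r by (intro inv_into_f_f) (auto simp: bij_betw_def)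
    have "\<phi> a = b r a" if "a \<in> halves_at G (f (Suc r))" for a
      using that inv by (simp add: \<phi>_def halves_at_def)
    then show ?thesis using b [OF r] by (simp cong: bij_betw_cong)
  qed
  then have "\<phi> \<in> decorations G f (map w ls)" by (simp add: decorations_def \<phi>_def)
  then show ?thesis by blast
qed

section \<open>Isomorphism classes of marked graphs and the involutions they induce\<close>

definition iso_rel :: "nat \<Rightarrow> nat \<Rightarrow> nat \<Rightarrow> ((lgraph \<times> (nat \<Rightarrow> nat)) \<times> (lgraph \<times> (nat \<Rightarrow> nat))) set" where
  "iso_rel g n m = {(X, Y). X \<in> marked_graphs g n m \<and> Y \<in> marked_graphs g n m \<and> graph_isos m X Y \<noteq> {}}"

lemma mem_graph_isos: "(\<alpha>, \<psi>) \<in> graph_isos m (G, f) (G', f') \<longleftrightarrow>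
     \<alpha> \<in> extensional (verts G) \<and> bij_betw \<alpha> (verts G) (verts G') \<and>
     \<psi> \<in> extensional (halves G) \<and> bij_betw \<psi> (halves G) (halves G') \<and>
     (\<forall>a\<in>halves G. vertex_of G' (\<psi> a) = \<alpha> (vertex_of G a) \<and> flip G' (\<psi> a) = \<psi> (flip G a)) \<and>
     (\<forall>v\<in>verts G. genus G' (\<alpha> v) = genus G v) \<and> (\<forall>i\<in>{1..m}. \<alpha> (f i) = f' i)"
  by (simp add: graph_isos_def)

lemma equiv_iso_rel: "equiv (marked_graphs g n m) (iso_rel g n m)"
proof (rule equivI)
  show "iso_rel g n m \<subseteq> marked_graphs g n m \<times> marked_graphs g n m" by (auto simp: iso_rel_def)
  show "refl_on (marked_graphs g n m) (iso_rel g n m)"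
  proof (rule refl_onI)
    fix X assume X: "X \<in> marked_graphs g n m"
    obtain G f where e: "X = (G, f)" by fastforce
    have G: "labeled_graph G" and f: "bij_betw f {1..m} (verts G)" using X e by (auto simp: marked_graphs_def)
    have "(restrict id (verts G), restrict id (halves G)) \<in> graph_isos m (G, f) (G, f)"
    proof -
      have "bij_betw (restrict id A) A A" for A :: "nat set" by (auto simp: bij_betw_def inj_on_def)
      then show ?thesis
        unfolding mem_graph_isos using G bij_betw_apply [OF f]
        by (simp add: labeled_graph_def image_subset_iff)
    qed
    then show "(X, X) \<in> iso_rel g n m" using X e by (auto simp: iso_rel_def)
  qed
  show "sym (iso_rel g n m)"
  proof (rule symI)
    fix X Y assume XY: "(X, Y) \<in> iso_rel g n m"
    obtain G f G' f' where e: "X = (G, f)" "Y = (G', f')" by fastforce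
    have G: "labeled_graph G" "labeled_graph G'" and f: "bij_betw f {1..m} (verts G)" "bij_betw f' {1..m} (verts G')"
      using XY e by (auto simp: marked_graphs_def iso_rel_def)
    obtain \<alpha> \<psi> where iso: "(\<alpha>, \<psi>) \<in> graph_isos m (G, f) (G', f')" using XY e by (auto simp: iso_rel_def)
    note i = iso [unfolded mem_graph_isos]
    define \<alpha>' where "\<alpha>' = restrict (inv_into (verts G) \<alpha>) (verts G')"
    define \<psi>' where "\<psi>' = restrict (inv_into (halves G) \<psi>) (halves G')"
    have b: "bij_betw \<alpha> (verts G) (verts G')" "bij_betw \<psi> (halves G) (halves G')" using i by auto
    have \<alpha>': "\<alpha>' (\<alpha> v) = v" if "v \<in> verts G" for v
      using b(1) that by (auto simp: \<alpha>'_def bij_betw_def)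
    have \<psi>': "\<psi>' (\<psi> a) = a" if "a \<in> halves G" for a
      using b(2) that by (auto simp: \<psi>'_def bij_betw_def)
    have v': "\<exists>v\<in>verts G. v' = \<alpha> v" if "v' \<in> verts G'" for v' using b(1) that by (auto simp: bij_betw_def)
    have a': "\<exists>a\<in>halves G. a' = \<psi> a" if "a' \<in> halves G'" for a' using b(2) that by (auto simp: bij_betw_def)
    have ver: "vertex_of G a \<in> verts G" "flip G a \<in> halves G" if "a \<in> halves G" for a
      using G(1) that by (auto simp: labeled_graph_def)
    have "bij_betw \<alpha>' (verts G') (verts G)"
      using bij_betw_inv_into [OF b(1)] by (simp add: \<alpha>'_def cong: bij_betw_cong)
    moreover have "bij_betw \<psi>' (halves G') (halves G)"
      using bij_betw_inv_into [OF b(2)] by (simp add: \<psi>'_def cong: bij_betw_cong)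
    moreover have "vertex_of G (\<psi>' a) = \<alpha>' (vertex_of G' a) \<and> flip G (\<psi>' a) = \<psi>' (flip G' a)"
      if "a \<in> halves G'" for a
      using a' [OF that] i ver by (auto simp: \<psi>' \<alpha>')
    moreover have "genus G (\<alpha>' v) = genus G' v" if "v \<in> verts G'" for v
      using v' [OF that] i by (auto simp: \<alpha>')
    moreover have "\<alpha>' (f' k) = f k" if k: "k \<in> {1..m}" for k
    proof -
      have "f k \<in> verts G" using f(1) k by (rule bij_betw_apply)
      moreover have "f' k = \<alpha> (f k)" using i k by simp
      ultimately show ?thesis using \<alpha>' by simp
    qed
    ultimately have "(\<alpha>', \<psi>') \<in> graph_isos m (G', f') (G, f)"
      unfolding mem_graph_isos by (auto simp: \<alpha>'_def \<psi>'_def)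
    then show "(Y, X) \<in> iso_rel g n m" using XY e by (auto simp: iso_rel_def)
  qed
  show "trans (iso_rel g n m)"
  proof (rule transI)
    fix X Y Z assume XY: "(X, Y) \<in> iso_rel g n m" and YZ: "(Y, Z) \<in> iso_rel g n m"
    obtain G f G' f' G'' f'' where e: "X = (G, f)" "Y = (G', f')" "Z = (G'', f'')" by (metis prod.collapse)
    have G: "labeled_graph G" and f: "bij_betw f {1..m} (verts G)"
      using XY e by (auto simp: marked_graphs_def iso_rel_def)
    obtain \<alpha> \<psi> where "(\<alpha>, \<psi>) \<in> graph_isos m (G, f) (G', f')" using XY e by (auto simp: iso_rel_def)
    note i = this [unfolded mem_graph_isos]
    obtain \<alpha>' \<psi>' where "(\<alpha>', \<psi>') \<in> graph_isos m (G', f') (G'', f'')" using YZ e by (auto simp: iso_rel_def)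
    note j = this [unfolded mem_graph_isos]
    have ver: "vertex_of G a \<in> verts G" "flip G a \<in> halves G" if "a \<in> halves G" for a
      using G that by (auto simp: labeled_graph_def)
    have mem: "\<alpha> v \<in> verts G'" if "v \<in> verts G" for v using i that by (auto dest: bij_betwE)
    have mem': "\<psi> a \<in> halves G'" if "a \<in> halves G" for a using i that by (auto dest: bij_betwE)
    have fv: "f k \<in> verts G" if "k \<in> {1..m}" for k using f that by (rule bij_betw_apply)
    have "bij_betw (compose (verts G) \<alpha>' \<alpha>) (verts G) (verts G'')" using i j by (intro bij_betw_compose) auto
    moreover have "bij_betw (compose (halves G) \<psi>' \<psi>) (halves G) (halves G'')" using i j by (intro bij_betw_compose) auto
    ultimately have "(compose (verts G) \<alpha>' \<alpha>, compose (halves G) \<psi>' \<psi>) \<in> graph_isos m (G, f) (G'', f'')"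
      unfolding mem_graph_isos using i j ver mem mem' fv by (simp add: compose_def)
    then show "(X, Z) \<in> iso_rel g n m" using XY YZ e by (auto simp: iso_rel_def)
  qed
qed

lemma graph_classes_eq: "graph_classes g n m = marked_graphs g n m // iso_rel g n m"
  by (simp add: graph_classes_def iso_rel_def)

lemma some_graph:
  assumes "\<Gamma> \<in> graph_classes g n m"
  shows "(SOME X. X \<in> \<Gamma>) \<in> \<Gamma>" "(SOME X. X \<in> \<Gamma>) \<in> marked_graphs g n m"
proof -
  have "\<Gamma> \<noteq> {}" "\<Gamma> \<subseteq> marked_graphs g n m"
    using assms in_quotient_imp_non_empty in_quotient_imp_subset equiv_iso_rel
    unfolding graph_classes_eq by metis+
  then show "(SOME X. X \<in> \<Gamma>) \<in> \<Gamma>" by (simp add: some_in_eq)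
  with \<open>\<Gamma> \<subseteq> marked_graphs g n m\<close> show "(SOME X. X \<in> \<Gamma>) \<in> marked_graphs g n m" by blast
qed

text \<open>Requiring the genera to be those of \<open>z\<close> makes the set empty for graphs that
  do not fit, so it can be summed over all graphs and all choices.\<close>

definition pushes :: "'l list \<Rightarrow> lgraph \<times> (nat \<Rightarrow> nat) \<Rightarrow> ('l \<Rightarrow> nat \<times> 'x list) \<Rightarrow> ('l \<times> nat \<Rightarrow> 'l \<times> nat) set" where
  "pushes ls = (\<lambda>(G, f) z. {push (idx ls (\<lambda>l. snd (z l))) G \<phi> | \<phi>. \<phi> \<in> decorations G f (map (\<lambda>l. snd (z l)) ls) \<and>
     (\<forall>r<length ls. genus G (f (Suc r)) = fst (z (ls ! r)))})"

lemma pushes_matchings: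
  assumes "distinct ls" "X \<in> marked_graphs g n (length ls)"
  shows "pushes ls X z \<subseteq> matchings ls z g"
proof
  fix \<tau> assume \<tau>: "\<tau> \<in> pushes ls X z"
  obtain G f where e: "X = (G, f)" by fastforce
  obtain \<phi> where \<phi>: "\<tau> = push (idx ls (\<lambda>l. snd (z l))) G \<phi>" "\<phi> \<in> decorations G f (map (\<lambda>l. snd (z l)) ls)"
    "\<forall>r<length ls. genus G (f (Suc r)) = fst (z (ls ! r))" using \<tau> by (auto simp: pushes_def e)
  have "decorated ls (\<lambda>l. snd (z l)) G f \<phi>"
    using assms \<phi> by unfold_locales (auto simp: e marked_graphs_def)
  from push_matchings_iff [OF this, of g n] \<phi> assms(2) show "\<tau> \<in> matchings ls z g" by (simp add: e)
qed

text \<open>A common involution is a decoration in the fibre described by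
  \<open>graph_isos_decorations\<close>, hence an isomorphism. The leaf numbers agree because both
  graphs have as many half-edges as there are letters and as many edges as the involution has
  two-cycles.\<close>

lemma pushes_isomorphic:
  assumes "distinct ls" "X \<in> marked_graphs g n (length ls)" "X' \<in> marked_graphs g n' (length ls)"
    "\<tau> \<in> pushes ls X z" "\<tau> \<in> pushes ls X' z"
  shows "graph_isos (length ls) X X' \<noteq> {}" "n = n'"
proof -
  obtain G f G' f' where e: "X = (G, f)" "X' = (G', f')" by (metis prod.collapse)
  let ?w = "\<lambda>l. snd (z l)"
  obtain \<phi> where \<phi>: "\<tau> = push (idx ls ?w) G \<phi>" "\<phi> \<in> decorations G f (map ?w ls)"
    "\<forall>r<length ls. genus G (f (Suc r)) = fst (z (ls ! r))" using assms(4) by (auto simp: pushes_def e)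
  obtain \<phi>' where \<phi>': "\<tau> = push (idx ls ?w) G' \<phi>'" "\<phi>' \<in> decorations G' f' (map ?w ls)"
    "\<forall>r<length ls. genus G' (f' (Suc r)) = fst (z (ls ! r))" using assms(5) by (auto simp: pushes_def e)
  have X: "labeled_graph G" "bij_betw f {1..length ls} (verts G)" "card (leaves G) = n"
    using assms(2) e by (auto simp: marked_graphs_def)
  have X': "labeled_graph G'" "bij_betw f' {1..length ls} (verts G')" "card (leaves G') = n'"
    using assms(3) e by (auto simp: marked_graphs_def)
  have D: "decorated ls ?w G f \<phi>" using assms(1) X \<phi> by unfold_locales auto
  have D': "decorated ls ?w G' f' \<phi>'" using assms(1) X' \<phi>' by unfold_locales auto
  have gen: "genus G (f i) = genus G' (f' i)" if "i \<in> {1..length ls}" for i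
  proof -
    have "i - 1 < length ls" "Suc (i - 1) = i" using that by auto
    then show ?thesis using \<phi>(3) \<phi>'(3) by metis
  qed
  have "bij_betw (\<lambda>(\<alpha>, \<psi>). restrict (\<lambda>a. \<phi>' (\<psi> a)) (halves G)) (graph_isos (length ls) (G, f) (G', f'))
    {\<phi> \<in> decorations G f (map ?w ls). push (idx ls ?w) G \<phi> = push (idx ls ?w) G' \<phi>'}"
    using D' X(2,1) gen by (rule graph_isos_decorations)
  moreover have "\<phi> \<in> {\<phi> \<in> decorations G f (map ?w ls). push (idx ls ?w) G \<phi> = push (idx ls ?w) G' \<phi>'}"
    using \<phi> \<phi>' by simp
  ultimately show "graph_isos (length ls) X X' \<noteq> {}" unfolding e by (auto simp: bij_betw_def)
  have "card (internal_edges G) = card (internal_edges G')"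
    using decorated.nedges_push [OF D] decorated.nedges_push [OF D'] \<phi>(1) \<phi>'(1) by simp
  then show "n = n'"
    using nedges_flip(2) [OF X(1)] nedges_flip(2) [OF X'(1)] decorated.card_halves [OF D]
      decorated.card_halves [OF D'] X(3) X'(3) by simp
qed

lemma graph_class_unique:
  assumes "distinct ls" "\<Gamma> \<in> graph_classes g n (length ls)" "\<Gamma>' \<in> graph_classes g n' (length ls)"
    "\<tau> \<in> pushes ls (SOME X. X \<in> \<Gamma>) z" "\<tau> \<in> pushes ls (SOME X. X \<in> \<Gamma>') z"
  shows "n = n' \<and> \<Gamma> = \<Gamma>'"
proof -
  note X = some_graph [OF assms(2)] and X' = some_graph [OF assms(3)]
  have "n = n'" and iso: "graph_isos (length ls) (SOME X. X \<in> \<Gamma>) (SOME X. X \<in> \<Gamma>') \<noteq> {}"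
    using pushes_isomorphic [OF assms(1) X(2) X'(2) assms(4,5)] by auto
  then have "((SOME X. X \<in> \<Gamma>), (SOME X. X \<in> \<Gamma>')) \<in> iso_rel g n (length ls)"
    using X X' by (auto simp: iso_rel_def)
  then have "\<Gamma> = \<Gamma>'"
    using quotient_eqI [OF equiv_iso_rel, of \<Gamma> g n "length ls" \<Gamma>'] assms(2,3) X(1) X'(1) \<open>n = n'\<close>
    by (simp add: graph_classes_eq)
  with \<open>n = n'\<close> show ?thesis by simp
qed

text \<open>Half-edges number n + 2 |E|, and the rank formula bounds |E| by g + m.\<close>

lemma marked_bounds:
  assumes "(G, f) \<in> marked_graphs g n m"
  shows "v \<in> verts G \<Longrightarrow> genus G v \<le> g" "card (halves G) \<le> n + 2 * (g + m)"
proof -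
  have G: "labeled_graph G" "connected_graph G" "betti G = g" "card (leaves G) = n" "card (verts G) = m"
    using assms by (auto simp: marked_graphs_def)
  show "genus G v \<le> g" if "v \<in> verts G"
    using member_le_sum [OF that, of "genus G"] G by (simp add: betti_def labeled_graph_def)
  show "card (halves G) \<le> n + 2 * (g + m)"
    using nedges_flip(2) [OF G(1)] rank_H1_connected [OF G(1,2)] G by (simp add: betti_def)
qed

text \<open>A sum over an infinite set would be zero by convention, so finiteness is essential. A
  class is encoded by the genera and valences of its representative and one involution induced by
  it. The encoding is injective by \<open>graph_class_unique\<close> and takes finitely many values
  by \<open>marked_bounds\<close>.\<close>

lemma finite_graph_classes: "finite (graph_classes g n m)"
proof -
  define ls where "ls = [0..<m]"
  have ls: "distinct ls" "length ls = m" by (auto simp: ls_def)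
  \<comment> \<open>Only the lengths of the words matter here, so all letters are taken from the
    one-element type.\<close>
  define z where "z = (\<lambda>\<Gamma>. case (SOME X. X \<in> \<Gamma>) of (G, f) \<Rightarrow>
     restrict (\<lambda>l. (genus G (f (Suc l)), replicate (card (halves_at G (f (Suc l)))) ())) (set ls))"
  define t where "t = (\<lambda>\<Gamma>. SOME \<tau>. \<tau> \<in> pushes ls (SOME X. X \<in> \<Gamma>) (z \<Gamma>))"
  let ?Z = "set ls \<rightarrow>\<^sub>E {..g} \<times> {u :: unit list. set u \<subseteq> UNIV \<and> length u \<le> n + 2 * (g + m)}"
  have key: "t \<Gamma> \<in> pushes ls (SOME X. X \<in> \<Gamma>) (z \<Gamma>)" "z \<Gamma> \<in> ?Z" if \<Gamma>: "\<Gamma> \<in> graph_classes g n m" for \<Gamma>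
  proof -
    obtain G f where e: "(SOME X. X \<in> \<Gamma>) = (G, f)" by fastforce
    have X: "(G, f) \<in> marked_graphs g n m" using some_graph [OF \<Gamma>] e by simp
    have zl: "z \<Gamma> l = (genus G (f (Suc l)), replicate (card (halves_at G (f (Suc l)))) ())" if "l < m" for l
      using that by (simp add: z_def e ls_def)
    have G: "labeled_graph G" "bij_betw f {1..length ls} (verts G)" using X by (auto simp: marked_graphs_def ls)
    have "decorations G f (map (\<lambda>l. snd (z \<Gamma> l)) ls) \<noteq> {}"
      using ls G by (intro decorations_nonempty) (simp_all add: zl, simp add: ls_def zl)
    then have "pushes ls (G, f) (z \<Gamma>) \<noteq> {}"
      by (auto simp: pushes_def ls) (auto simp: ls_def zl)
    then show "t \<Gamma> \<in> pushes ls (SOME X. X \<in> \<Gamma>) (z \<Gamma>)" unfolding t_def e by (simp add: some_in_eq)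
    have "card (halves_at G v) \<le> card (halves G)" for v
      using G by (intro card_mono) (auto simp: halves_at_def labeled_graph_def)
    then have "card (halves_at G v) \<le> n + 2 * (g + m)" for v
      using marked_bounds(2) [OF X] order_trans by blast
    moreover have "genus G (f (Suc l)) \<le> g" if "l < m" for l
    proof -
      have "f (Suc l) \<in> verts G" by (rule bij_betw_apply [OF G(2)]) (use that ls in auto)
      then show ?thesis by (rule marked_bounds(1) [OF X])
    qed
    ultimately show "z \<Gamma> \<in> ?Z"
      by (intro PiE_I) (auto simp: zl ls_def, auto simp: z_def e ls_def)
  qed
  have "inj_on (\<lambda>\<Gamma>. (z \<Gamma>, t \<Gamma>)) (graph_classes g n m)"
  proof (rule inj_onI)
    fix \<Gamma> \<Gamma>' assume \<Gamma>: "\<Gamma> \<in> graph_classes g n m" "\<Gamma>' \<in> graph_classes g n m" "(z \<Gamma>, t \<Gamma>) = (z \<Gamma>', t \<Gamma>')"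
    then have "t \<Gamma> \<in> pushes ls (SOME X. X \<in> \<Gamma>) (z \<Gamma>)" "t \<Gamma> \<in> pushes ls (SOME X. X \<in> \<Gamma>') (z \<Gamma>)"
      using key(1) [of \<Gamma>] key(1) [of \<Gamma>'] by auto
    then show "\<Gamma> = \<Gamma>'" using graph_class_unique [OF ls(1)] \<Gamma>(1,2) ls(2) by blast
  qed
  moreover have "(\<lambda>\<Gamma>. (z \<Gamma>, t \<Gamma>)) ` graph_classes g n m \<subseteq>
      (SIGMA z:?Z. invols (set (idx ls (\<lambda>l. snd (z l)))))"
  proof (rule image_subsetI)
    fix \<Gamma> assume \<Gamma>: "\<Gamma> \<in> graph_classes g n m"
    have "(SOME X. X \<in> \<Gamma>) \<in> marked_graphs g n (length ls)" using some_graph(2) [OF \<Gamma>] ls(2) by simp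
    then have "t \<Gamma> \<in> matchings ls (z \<Gamma>) g" using pushes_matchings [OF ls(1)] key(1) [OF \<Gamma>] by blast
    then have "t \<Gamma> \<in> invols (set (idx ls (\<lambda>l. snd (z \<Gamma> l))))" unfolding matchings_def by blast
    then show "(z \<Gamma>, t \<Gamma>) \<in> (SIGMA z:?Z. invols (set (idx ls (\<lambda>l. snd (z l)))))"
      by (rule SigmaI [OF key(2) [OF \<Gamma>]])
  qed
  moreover have "finite (SIGMA z:?Z. invols (set (idx ls (\<lambda>l. snd (z l)))))"
    by (intro finite_SigmaI finite_PiE finite_cartesian_product finite_lists_length_le finite_invols) auto
  ultimately show ?thesis using finite_imageD [OF finite_subset] by blast
qed

text \<open>The standard graph induces the given involution, and an isomorphism carries this over to
  the representative chosen in its class. The bound on the number of leaves later truncates the sum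
  over \<open>n\<close>.\<close>

lemma pushes_surj:
  assumes ls: "distinct ls" and \<tau>: "\<tau> \<in> matchings ls z g"
  shows "\<exists>n\<le>length (idx ls (\<lambda>l. snd (z l))). \<exists>\<Gamma>\<in>graph_classes g n (length ls). \<tau> \<in> pushes ls (SOME X. X \<in> \<Gamma>) z"
proof -
  let ?L = "idx ls (\<lambda>l. snd (z l))" and ?G = "std_graph ls z \<tau>"
  let ?\<phi> = "restrict id {..<length ?L}"
  have inv: "\<tau> \<in> invols (set ?L)" using \<tau> by (simp add: matchings_def)
  note std = std_graph [OF ls inv]
  define n where "n = card (leaves ?G)"
  have X0: "(?G, id) \<in> marked_graphs g n (length ls)"
    by (subst push_matchings_iff [OF std(1)]) (rule std(3), simp_all add: n_def std(2) \<tau>)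
  interpret D: decorated ls "\<lambda>l. snd (z l)" ?G id ?\<phi> by (rule std(1))
  have "n \<le> length ?L" using nedges_flip(2) [OF D.G] D.card_halves by (simp add: n_def)
  moreover define \<Gamma> where "\<Gamma> = iso_rel g n (length ls) `` {(?G, id)}"
  have \<Gamma>: "\<Gamma> \<in> graph_classes g n (length ls)" unfolding \<Gamma>_def graph_classes_eq using X0 by (rule quotientI)
  moreover have "\<tau> \<in> pushes ls (SOME X. X \<in> \<Gamma>) z"
  proof -
    obtain G f where e: "(SOME X. X \<in> \<Gamma>) = (G, f)" by fastforce
    have "((?G, id), (G, f)) \<in> iso_rel g n (length ls)" using some_graph(1) [OF \<Gamma>] e by (simp add: \<Gamma>_def)
    then have "((G, f), (?G, id)) \<in> iso_rel g n (length ls)"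
      using equiv_iso_rel by (meson equivE symD)
    then obtain \<alpha> \<psi> where iso: "(\<alpha>, \<psi>) \<in> graph_isos (length ls) (G, f) (?G, id)" by (auto simp: iso_rel_def)
    note i = iso [unfolded mem_graph_isos]
    have G: "labeled_graph G" "bij_betw f {1..length ls} (verts G)"
      using some_graph(2) [OF \<Gamma>] e by (auto simp: marked_graphs_def)
    have gen: "genus G (f k) = genus ?G (id k)" if k: "k \<in> {1..length ls}" for k
    proof -
      have "f k \<in> verts G" using G(2) k by (rule bij_betw_apply)
      then show ?thesis using i k by (metis)
    qed
    have b: "bij_betw (\<lambda>(\<alpha>, \<psi>). restrict (\<lambda>a. ?\<phi> (\<psi> a)) (halves G)) (graph_isos (length ls) (G, f) (?G, id))
      {\<phi> \<in> decorations G f (map (\<lambda>l. snd (z l)) ls). push ?L G \<phi> = push ?L ?G ?\<phi>}"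
      using std(1) G(2,1) gen by (rule graph_isos_decorations)
    have "restrict (\<lambda>a. ?\<phi> (\<psi> a)) (halves G) \<in> {\<phi> \<in> decorations G f (map (\<lambda>l. snd (z l)) ls). push ?L G \<phi> = push ?L ?G ?\<phi>}"
      using bij_betw_apply [OF b iso] by simp
    moreover have "genus G (f (Suc r)) = fst (z (ls ! r))" if "r < length ls" for r
      using gen [of "Suc r"] std(3) [OF that] that by simp
    ultimately show ?thesis unfolding e pushes_def using std(2) by auto
  qed
  ultimately show ?thesis by blast
qed

definition fits :: "'l list \<Rightarrow> lgraph \<times> (nat \<Rightarrow> nat) \<Rightarrow> ('l \<Rightarrow> nat \<times> 'x list) \<Rightarrow> bool" where
  "fits ls = (\<lambda>(G, f) z. \<forall>r<length ls. genus G (f (Suc r)) = fst (z (ls ! r)) \<and>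
     length (snd (z (ls ! r))) = card (halves_at G (f (Suc r))))"

lemma pushes_fits:
  assumes "distinct ls" "(G, f) \<in> marked_graphs g n (length ls)"
  shows "pushes ls (G, f) z = (if fits ls (G, f) z
    then push (idx ls (\<lambda>l. snd (z l))) G ` decorations G f (map (\<lambda>l. snd (z l)) ls) else {})"
proof -
  have "fits ls (G, f) z" if "\<phi> \<in> decorations G f (map (\<lambda>l. snd (z l)) ls)"
    "\<forall>r<length ls. genus G (f (Suc r)) = fst (z (ls ! r))" for \<phi>
    unfolding fits_def
  proof (clarify, intro conjI)
    fix r assume r: "r < length ls"
    then have "bij_betw \<phi> (halves_at G (f (Suc r))) {length (concat (take r (map (\<lambda>l. snd (z l)) ls))) ..<
        length (concat (take (Suc r) (map (\<lambda>l. snd (z l)) ls)))}"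
      using that(1) by (simp add: decorations_def)
    from bij_betw_same_card [OF this] show "length (snd (z (ls ! r))) = card (halves_at G (f (Suc r)))"
      using length_concat_take_Suc [of r "map (\<lambda>l. snd (z l)) ls"] r by simp
  qed (use that in simp)
  then show ?thesis by (auto simp: pushes_def fits_def)
qed

section \<open>From weighted sums over graphs to sums over involutions\<close>

context even_form
begin

text \<open>Both sides contract the same pairs, but \<open>contraction\<close> lists edges and
  leaves by the numbering of half-edges and \<open>wick\<close> by the positions of letters, hence a
  congruence. The sign of \<open>contraction\<close> refers to positions and is carried to letters
  along the enumeration \<open>L\<close>.\<close>

lemma contraction_wick:
  assumes ls: "distinct ls" and f: "bij_betw f {1..length ls} (verts G)" and G: "labeled_graph G"
    and w: "\<And>l. l \<in> set ls \<Longrightarrow> w l \<in> words"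
  shows "contraction deg h G f (map w ls) \<simeq>
    (\<Sum>\<phi>\<in>decorations G f (map w ls). wick (idx ls w) (letter w) (push (idx ls w) G \<phi>))"
  unfolding contraction_def Let_def
proof (rule scong_sum)
  fix \<phi> assume \<phi>: "\<phi> \<in> decorations G f (map w ls)"
  interpret decorated ls w G f \<phi> using ls f G \<phi> by unfold_locales
  let ?W = "concat (map w ls)" and ?es = "sorted_list_of_set (internal_edges G)"
    and ?lv = "sorted_list_of_set (leaves G)" and ?\<tau> = "push L G \<phi>"
  let ?\<chi> = "\<lambda>a. L ! \<phi> a"
  let ?Q = "concat (map (\<lambda>a. [a, flip G a]) ?es) @ ?lv"
  have fin: "finite (halves G)" using G by (simp add: labeled_graph_def)
  have sub: "internal_edges G \<subseteq> halves G" "leaves G \<subseteq> halves G" by (auto simp: internal_edges_def leaves_def)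
  have fin': "finite (internal_edges G)" "finite (leaves G)" using sub fin finite_subset by blast+
  have dL: "distinct L" using ls by (rule distinct_idx)
  have lt: "\<phi> a < length L" if "a \<in> halves G" for a using bij_dec that by (auto dest: bij_betwE)
  have W: "?W ! \<phi> a = letter w (?\<chi> a)" if "a \<in> halves G" for a
    using lt [OF that] unfolding map_letter_idx [symmetric] by simp
  have fl: "concat (map (\<lambda>a. [a, flip G a]) xs) = flat (map (\<lambda>a. (a, flip G a)) xs)" for xs
    by (simp add: flat_def o_def)
  have set_es: "set (flat (map (\<lambda>a. (a, flip G a)) ?es)) = internal_edges G \<union> flip G ` internal_edges G"
    using fin'(1) by (auto simp: set_flat image_image)
  have inj: "inj_on (flip G) (internal_edges G)"
    using flip sub by (intro inj_on_inverseI [of _ "flip G"]) auto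
  have disj: "internal_edges G \<inter> flip G ` internal_edges G = {}" using flip by (force simp: internal_edges_def)
  have dQ: "distinct ?Q"
    unfolding fl distinct_append set_es
    using fin' inj disj flip
    by (intro conjI distinct_flat_map) (auto simp: internal_edges_def leaves_def)
  have sQ: "set ?Q = halves G"
  proof -
    have "a \<in> internal_edges G \<union> flip G ` internal_edges G \<union> leaves G" if a: "a \<in> halves G" for a
    proof (cases a "flip G a" rule: linorder_cases)
      case greater
      then have "flip G a \<in> internal_edges G" using a flip by (simp add: internal_edges_def)
      then have "flip G (flip G a) \<in> flip G ` internal_edges G" by (rule imageI)
      then show ?thesis using a flip by simp
    qed (use a in \<open>auto simp: internal_edges_def leaves_def\<close>)
    moreover have "flip G ` internal_edges G \<subseteq> halves G" using sub flip by auto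
    ultimately show ?thesis unfolding fl set_append set_es using sub fin' by auto
  qed
  have ff: "flat (map (map_prod \<pi> \<pi>) es) = map \<pi> (flat es)" for \<pi> :: "nat \<Rightarrow> 'b \<times> nat" and es
    by (induction es) auto
  define E where "E = map (map_prod ?\<chi> ?\<chi>) (map (\<lambda>a. (a, flip G a)) ?es)"
  have FE: "flat E @ map ?\<chi> ?lv = map ?\<chi> ?Q" unfolding E_def ff fl by simp
  have en: "enumerates L ?\<tau> E (map ?\<chi> ?lv)"
    unfolding enumerates_def FE
  proof (intro conjI)
    show "distinct (map ?\<chi> ?Q)" unfolding distinct_map sQ using dQ inj_pos_dec by blast
    show "set (map ?\<chi> ?Q) = set L" unfolding set_map sQ by (rule image_pos_dec)
    show "\<forall>(a, b)\<in>set E. ?\<tau> a = b \<and> ?\<tau> b = a"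
      using fin' sub flip push_apply by (auto simp: E_def)
    show "\<forall>a\<in>set (map ?\<chi> ?lv). ?\<tau> a = a"
      using fin' push_apply by (auto simp: leaves_def)
  qed
  have gens: "letter w ` set L \<subseteq> gens V" using w by (rule letter_gens)
  have "lsign (\<lambda>a. deg (letter w a)) L (map ?\<chi> ?Q) = (koszul (\<lambda>r. deg (?W ! r)) (map \<phi> ?Q) :: 'k)"
  proof -
    have dps: "distinct (map \<phi> ?Q)" "set (map \<phi> ?Q) = {..<length L}"
      unfolding distinct_map set_map sQ using dQ bij_dec by (simp_all add: bij_betw_def)
    have "koszul (\<lambda>r. deg (?W ! r)) (map \<phi> ?Q) = (lsign (\<lambda>r. deg (?W ! r)) [0..<length L] (map \<phi> ?Q) :: 'k)"
      using dps by (intro koszul_eq_lsign) auto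
    also have "\<dots> = lsign (\<lambda>r. deg (letter w (L ! r))) [0..<length L] (map \<phi> ?Q)"
      unfolding map_letter_idx [symmetric] by (rule lsign_cong) simp
    also have "\<dots> = lsign (\<lambda>a. deg (letter w a)) (map ((!) L) [0..<length L]) (map ((!) L) (map \<phi> ?Q))"
      using dps(2) dL by (intro lsign_map [symmetric]) (auto simp: inj_on_def nth_eq_iff_index_eq)
    also have "map ((!) L) [0..<length L] = L" by (rule map_nth)
    finally show ?thesis by (simp add: o_def)
  qed
  moreover have "hprod (letter w) E = (\<Prod>a\<in>internal_edges G. h (?W ! \<phi> a) (?W ! \<phi> (flip G a)))"
  proof -
    have "hprod (letter w) E = (\<Prod>a\<leftarrow>?es. h (letter w (?\<chi> a)) (letter w (?\<chi> (flip G a))))"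
      by (simp add: hprod_def E_def o_def)
    also have "\<dots> = (\<Prod>a\<in>internal_edges G. h (letter w (?\<chi> a)) (letter w (?\<chi> (flip G a))))"
      using fin' by (simp add: prod.distinct_set_conv_list [symmetric])
    also have "\<dots> = (\<Prod>a\<in>internal_edges G. h (?W ! \<phi> a) (?W ! \<phi> (flip G a)))"
      using sub flip W by (intro prod.cong) auto
    finally show ?thesis .
  qed
  moreover have "map (\<lambda>a. ?W ! \<phi> a) ?lv = map (letter w) (map ?\<chi> ?lv)"
    using fin' sub W by auto
  ultimately have "single (map (\<lambda>a. ?W ! \<phi> a) ?lv)
      (koszul (\<lambda>r. deg (?W ! r)) (map \<phi> ?Q) * (\<Prod>a\<in>internal_edges G. h (?W ! \<phi> a) (?W ! \<phi> (flip G a)))) =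
    ev L (letter w) E (map ?\<chi> ?lv)"
    unfolding ev_def FE by (simp only:)
  also have "\<dots> \<simeq> wick L (letter w) ?\<tau>"
    using dL push_invol gens en by (intro scong_sym [OF wick_scong_ev])
  finally show "single (map (\<lambda>a. ?W ! \<phi> a) ?lv)
      (koszul (\<lambda>r. deg (?W ! r)) (map \<phi> ?Q) * (\<Prod>a\<in>internal_edges G. h (?W ! \<phi> a) (?W ! \<phi> (flip G a))))
    \<simeq> wick L (letter w) ?\<tau>" .
qed

text \<open>Lists of words are traded for functions on the vertices that also record the genus. This
  loses nothing because genera of the graph are at most \<open>g\<close>, hence below the bound
  \<open>B\<close>.\<close>

lemma graph_term_choices:
  assumes ls: "distinct ls" and X: "(G, f) \<in> marked_graphs g n (length ls)" and B: "g \<le> B"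
  shows "graph_term deg h (G, f) (map y ls) =
    (\<Sum>z\<in>{z \<in> choices B ls y. fits ls (G, f) z}.
      smul (coeff_of (set ls) y z) (contraction deg h G f (map (\<lambda>l. snd (z l)) ls)))"
proof -
  let ?m = "length ls"
  let ?As = "map (\<lambda>r. {w \<in> keys ((map y ls ! r) (genus G (f (Suc r)))). length w = card (halves_at G (f (Suc r)))})
      [0..<?m]"
  have f: "bij_betw f {1..?m} (verts G)" using X by (simp add: marked_graphs_def)
  have gB: "genus G (f (Suc r)) \<le> B" if "r < ?m" for r
  proof -
    have "f (Suc r) \<in> verts G" by (rule bij_betw_apply [OF f]) (use that in auto)
    then show ?thesis using marked_bounds(1) [OF X] B order_trans by blast
  qed
  have mem: "ws \<in> listset ?As \<longleftrightarrow> length ws = ?m \<and> (\<forall>r<?m. ws ! r \<in> keys (y (ls ! r) (genus G (f (Suc r)))) \<and>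
      length (ws ! r) = card (halves_at G (f (Suc r))))" for ws
    by (auto simp: mem_listset)
  have nthpos: "pos ls (ls ! r) = r" if "r < ?m" for r using ls that by (rule pos_nth)
  define bk where "bk = (\<lambda>ws :: 'x list list. restrict (\<lambda>l. (genus G (f (Suc (pos ls l))), ws ! pos ls l)) (set ls))"
  have "graph_term deg h (G, f) (map y ls) = (\<Sum>ws\<in>listset ?As.
       smul (\<Prod>r<?m. lookup (y (ls ! r) (genus G (f (Suc r)))) (ws ! r)) (contraction deg h G f ws))"
    by (simp add: graph_term_def Let_def)
  also have "\<dots> = (\<Sum>z\<in>{z \<in> choices B ls y. fits ls (G, f) z}.
      smul (coeff_of (set ls) y z) (contraction deg h G f (map (\<lambda>l. snd (z l)) ls)))"
  proof (rule sum.reindex_bij_witness [where i = "\<lambda>z. map (\<lambda>l. snd (z l)) ls" and j = bk])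
    fix ws assume ws: "ws \<in> listset ?As"
    then have len: "length ws = ?m" by (simp add: mem)
    show eq: "map (\<lambda>l. snd (bk ws l)) ls = ws"
      by (rule nth_equalityI) (simp_all add: bk_def len nthpos)
    have "bk ws l \<in> (SIGMA a:{..B}. keys (y l a))" if "l \<in> set ls" for l
    proof -
      have p: "pos ls l < ?m" "ls ! pos ls l = l" using that by (simp_all add: pos_less nth_pos)
      then have "ws ! pos ls l \<in> keys (y (ls ! pos ls l) (genus G (f (Suc (pos ls l)))))" using ws unfolding mem by blast
      then show ?thesis using gB [OF p(1)] p(2) that by (simp add: bk_def)
    qed
    then have "bk ws \<in> choices B ls y" by (auto simp: choices_def bk_def)
    moreover have "fits ls (G, f) (bk ws)"
      using ws by (auto simp: fits_def bk_def nthpos mem)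
    ultimately show "bk ws \<in> {z \<in> choices B ls y. fits ls (G, f) z}" by simp
    have "coeff_of (set ls) y (bk ws) = (\<Prod>r<?m. lookup (y (ls ! r) (fst (bk ws (ls ! r)))) (snd (bk ws (ls ! r))))"
      unfolding coeff_of_def
      using prod.reindex_bij_betw [OF bij_betw_nth [OF ls, of "{..<?m}" "set ls"], of "\<lambda>l. lookup (y l (fst (bk ws l))) (snd (bk ws l))"]
      by simp
    also have "\<dots> = (\<Prod>r<?m. lookup (y (ls ! r) (genus G (f (Suc r)))) (ws ! r))"
      by (rule prod.cong) (simp_all add: bk_def nthpos)
    finally show "smul (coeff_of (set ls) y (bk ws)) (contraction deg h G f (map (\<lambda>l. snd (bk ws l)) ls)) =
      smul (\<Prod>r<?m. lookup (y (ls ! r) (genus G (f (Suc r)))) (ws ! r)) (contraction deg h G f ws)"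
      by (simp add: eq)
  next
    fix z assume z: "z \<in> {z \<in> choices B ls y. fits ls (G, f) z}"
    have ext: "z \<in> extensional (set ls)" using z by (auto simp: choices_def PiE_def)
    have fit: "genus G (f (Suc (pos ls l))) = fst (z l)" if "l \<in> set ls" for l
      using z that pos_less [OF that] nth_pos [OF that] unfolding fits_def by force
    show "bk (map (\<lambda>l. snd (z l)) ls) = z"
      by (rule extensionalityI [OF _ ext]) (auto simp: bk_def fit pos_less nth_pos)
    have "z (ls ! r) \<in> (SIGMA a:{..B}. keys (y (ls ! r) a))" if "r < ?m" for r
      using z that by (auto simp: choices_def PiE_def Pi_def)
    then have "snd (z (ls ! r)) \<in> keys (y (ls ! r) (fst (z (ls ! r))))" if "r < ?m" for r
      using that by (metis SigmaE2 prod.collapse)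
    then show "map (\<lambda>l. snd (z l)) ls \<in> listset ?As"
      using z by (auto simp: mem fits_def)
  qed
  finally show ?thesis .
qed

lemma graph_class_term:
  assumes ls: "distinct ls" and y: "\<And>l. l \<in> set ls \<Longrightarrow> y l \<in> series V"
    and X: "X \<in> marked_graphs g n (length ls)" and B: "g \<le> B"
  shows "smul (1 / of_nat (card (graph_isos (length ls) X X))) (graph_term deg h X (map y ls)) \<simeq>
    (\<Sum>z\<in>choices B ls y. smul (coeff_of (set ls) y z)
      (\<Sum>\<tau>\<in>pushes ls X z. wick (idx ls (\<lambda>l. snd (z l))) (letter (\<lambda>l. snd (z l))) \<tau>))"
proof -
  obtain G f where e: "X = (G, f)" by fastforce
  let ?c = "card (graph_isos (length ls) (G, f) (G, f))"
  have G: "labeled_graph G" "bij_betw f {1..length ls} (verts G)" using X by (auto simp: e marked_graphs_def)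
  have "smul (1 / of_nat ?c) (contraction deg h G f (map (\<lambda>l. snd (z l)) ls)) \<simeq>
      (\<Sum>\<tau>\<in>pushes ls (G, f) z. wick (idx ls (\<lambda>l. snd (z l))) (letter (\<lambda>l. snd (z l))) \<tau>)"
    if z: "z \<in> choices B ls y" and fit: "fits ls (G, f) z" for z
  proof -
    let ?w = "\<lambda>l. snd (z l)"
    let ?L = "idx ls ?w" and ?Dec = "decorations G f (map ?w ls)"
    have "?w l \<in> words" if "l \<in> set ls" for l
      using y [OF that] z that by (fastforce simp: choices_def series_def PiE_def Pi_def)
    then have "contraction deg h G f (map ?w ls) \<simeq> (\<Sum>\<phi>\<in>?Dec. wick ?L (letter ?w) (push ?L G \<phi>))"
      by (rule contraction_wick [OF ls G(2,1)])
    also have "\<dots> = (\<Sum>\<tau>\<in>push ?L G ` ?Dec. \<Sum>\<phi>\<in>{\<phi> \<in> ?Dec. push ?L G \<phi> = \<tau>}. wick ?L (letter ?w) (push ?L G \<phi>))"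
      by (rule sum.image_gen [OF finite_decorations [OF G(1) ls G(2)]])
    \<comment> \<open>All decorations in one fibre of \<open>push\<close> give the same contraction,
      and each fibre has the size of the automorphism group.\<close>
    also have "\<dots> = (\<Sum>\<tau>\<in>push ?L G ` ?Dec. smul (of_nat ?c) (wick ?L (letter ?w) \<tau>))"
    proof (rule sum.cong [OF refl])
      fix \<tau> assume "\<tau> \<in> push ?L G ` ?Dec"
      then obtain \<phi>0 where \<phi>0: "\<phi>0 \<in> ?Dec" "\<tau> = push ?L G \<phi>0" by blast
      have "decorated ls ?w G f \<phi>0" using ls G \<phi>0 by unfold_locales
      from bij_betw_same_card [OF graph_isos_decorations [OF this G(2,1) refl]]
      have "card {\<phi> \<in> ?Dec. push ?L G \<phi> = \<tau>} = ?c" by (simp add: \<phi>0(2))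
      moreover have "(\<Sum>\<phi>\<in>A. p) = smul (of_nat (card A)) p" for p :: "'x list \<Rightarrow>\<^sub>0 'k" and A :: "(nat \<Rightarrow> nat) set"
        by (rule pm.sum_constant_scale)
      ultimately show "(\<Sum>\<phi>\<in>{\<phi> \<in> ?Dec. push ?L G \<phi> = \<tau>}. wick ?L (letter ?w) (push ?L G \<phi>)) =
          smul (of_nat ?c) (wick ?L (letter ?w) \<tau>)"
        by simp
    qed
    finally have "smul (1 / of_nat ?c) (contraction deg h G f (map ?w ls)) \<simeq>
        smul (1 / of_nat ?c) (\<Sum>\<tau>\<in>push ?L G ` ?Dec. smul (of_nat ?c) (wick ?L (letter ?w) \<tau>))"
      by (rule scong_smul)
    also have "\<dots> = (\<Sum>\<tau>\<in>push ?L G ` ?Dec. wick ?L (letter ?w) \<tau>)"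
    proof -
      \<comment> \<open>Needed to cancel the weight: the automorphism group has the size of a fibre
        of \<open>push\<close>, which is finite and non-empty.\<close>
      have "?c \<noteq> 0"
      proof -
        have "?Dec \<noteq> {}" using fit by (intro decorations_nonempty [OF ls G(2,1)]) (simp add: fits_def)
        then obtain \<phi>0 where \<phi>0: "\<phi>0 \<in> ?Dec" by blast
        have D: "decorated ls ?w G f \<phi>0" using ls G \<phi>0 by unfold_locales
        have "card {\<phi> \<in> ?Dec. push ?L G \<phi> = push ?L G \<phi>0} \<noteq> 0"
          using finite_decorations [OF G(1) ls G(2), of ?w] \<phi>0 by auto
        then show ?thesis using bij_betw_same_card [OF graph_isos_decorations [OF D G(2,1) refl]] by simp
      qed
      then show ?thesis by (simp add: pm.scale_sum_right)
    qed
    finally show ?thesis using pushes_fits [OF ls X [unfolded e], of z] fit by simp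
  qed
  then have "(\<Sum>z\<in>{z \<in> choices B ls y. fits ls (G, f) z}. smul (coeff_of (set ls) y z)
        (smul (1 / of_nat ?c) (contraction deg h G f (map (\<lambda>l. snd (z l)) ls)))) \<simeq>
     (\<Sum>z\<in>{z \<in> choices B ls y. fits ls (G, f) z}. smul (coeff_of (set ls) y z)
      (\<Sum>\<tau>\<in>pushes ls (G, f) z. wick (idx ls (\<lambda>l. snd (z l))) (letter (\<lambda>l. snd (z l))) \<tau>))"
    by (intro scong_sum scong_smul) auto
  also have "\<dots> = (\<Sum>z\<in>choices B ls y. smul (coeff_of (set ls) y z)
      (\<Sum>\<tau>\<in>pushes ls (G, f) z. wick (idx ls (\<lambda>l. snd (z l))) (letter (\<lambda>l. snd (z l))) \<tau>))"
  proof (rule sum.mono_neutral_left [OF finite_choices])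
    show "\<forall>z\<in>choices B ls y - {z \<in> choices B ls y. fits ls (G, f) z}. smul (coeff_of (set ls) y z)
      (\<Sum>\<tau>\<in>pushes ls (G, f) z. wick (idx ls (\<lambda>l. snd (z l))) (letter (\<lambda>l. snd (z l))) \<tau>) = 0"
    proof
      fix z assume "z \<in> choices B ls y - {z \<in> choices B ls y. fits ls (G, f) z}"
      then have "pushes ls (G, f) z = {}" using pushes_fits [OF ls X [unfolded e], of z] by simp
      then show "smul (coeff_of (set ls) y z)
        (\<Sum>\<tau>\<in>pushes ls (G, f) z. wick (idx ls (\<lambda>l. snd (z l))) (letter (\<lambda>l. snd (z l))) \<tau>) = 0" by simp
    qed
  qed blast
  finally show ?thesis
    unfolding e graph_term_choices [OF ls X [unfolded e] B] by (simp add: pm.scale_sum_right mult.commute)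
qed

text \<open>Every matching is induced by exactly one isomorphism class: existence is
  \<open>pushes_surj\<close>, uniqueness \<open>graph_class_unique\<close>. Summing over classes and
  over the involutions they induce is therefore summing over all matchings.\<close>

proposition graph_sum_total_sum:
  assumes ls: "distinct ls" and y: "\<And>l. l \<in> set ls \<Longrightarrow> y l \<in> series V" and B: "g \<le> B"
  shows "graph_sum deg h (map y ls) g \<simeq> total_sum B ls y g"
proof -
  let ?m = "length ls"
  define R :: "(lgraph \<times> (nat \<Rightarrow> nat)) set \<Rightarrow> _" where "R = (\<lambda>\<Gamma>. SOME X. X \<in> \<Gamma>)"
  define F where "F = (\<lambda>\<Gamma>. smul (1 / of_nat (card (graph_isos ?m (R \<Gamma>) (R \<Gamma>)))) (graph_term deg h (R \<Gamma>) (map y ls)))"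
  \<comment> \<open>No choice has more than \<open>M\<close> letters, and a graph with more leaves
    than letters has no decoration; so the sum over \<open>n\<close> stops at
    \<open>M\<close>.\<close>
  define M where "M = (\<Sum>z\<in>choices B ls y. length (idx ls (\<lambda>l. snd (z l))))"
  let ?I = "SIGMA n:{..M}. graph_classes g n ?m"
  let ?wick = "\<lambda>z. wick (idx ls (\<lambda>l. snd (z l))) (letter (\<lambda>l. snd (z l)))"
  have M: "length (idx ls (\<lambda>l. snd (z l))) \<le> M" if "z \<in> choices B ls y" for z
    unfolding M_def using that finite_choices by (intro member_le_sum) auto
  have R: "R \<Gamma> \<in> marked_graphs g n ?m" if "\<Gamma> \<in> graph_classes g n ?m" for \<Gamma> n
    using some_graph(2) [OF that] by (simp add: R_def)
  have zero: "F \<Gamma> = 0" if \<Gamma>: "\<Gamma> \<in> graph_classes g n ?m" and n: "n > M" for \<Gamma> n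
  proof -
    obtain G f where e: "R \<Gamma> = (G, f)" by fastforce
    have X: "(G, f) \<in> marked_graphs g n ?m" using R [OF \<Gamma>] e by simp
    then have G: "labeled_graph G" "bij_betw f {1..?m} (verts G)" "card (leaves G) = n" by (auto simp: marked_graphs_def)
    have "\<not> fits ls (G, f) z" if z: "z \<in> choices B ls y" for z
    proof
      assume fit: "fits ls (G, f) z"
      have "decorations G f (map (\<lambda>l. snd (z l)) ls) \<noteq> {}"
        using fit by (intro decorations_nonempty [OF ls G(2,1)]) (simp add: fits_def)
      then obtain \<phi> where \<phi>: "\<phi> \<in> decorations G f (map (\<lambda>l. snd (z l)) ls)" by blast
      have "decorated ls (\<lambda>l. snd (z l)) G f \<phi>" using ls G \<phi> by unfold_locales
      then show False
        using decorated.card_halves nedges_flip(2) [OF G(1)] G(3) M [OF z] n by fastforce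
    qed
    then have "{z \<in> choices B ls y. fits ls (G, f) z} = {}" by blast
    then show ?thesis unfolding F_def e graph_term_choices [OF ls X B] by (simp only: sum.empty pm.scale_zero_right)
  qed
  have "graph_sum deg h (map y ls) g = Sum_any (\<lambda>n. \<Sum>\<Gamma>\<in>graph_classes g n ?m. F \<Gamma>)"
    by (simp add: graph_sum_def F_def R_def Let_def)
  also have "\<dots> = (\<Sum>n\<le>M. \<Sum>\<Gamma>\<in>graph_classes g n ?m. F \<Gamma>)"
  proof (rule Sum_any.expand_superset)
    show "{n. (\<Sum>\<Gamma>\<in>graph_classes g n ?m. F \<Gamma>) \<noteq> 0} \<subseteq> {..M}"
    proof
      fix n assume "n \<in> {n. (\<Sum>\<Gamma>\<in>graph_classes g n ?m. F \<Gamma>) \<noteq> 0}"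
      then obtain \<Gamma> where "\<Gamma> \<in> graph_classes g n ?m" "F \<Gamma> \<noteq> 0" by (auto elim: sum.not_neutral_contains_not_neutral)
      then show "n \<in> {..M}" using zero by force
    qed
  qed simp
  also have "\<dots> = (\<Sum>(n, \<Gamma>)\<in>?I. F \<Gamma>)"
    by (rule sum.Sigma) (simp_all add: finite_graph_classes)
  also have "\<dots> \<simeq> (\<Sum>(n, \<Gamma>)\<in>?I. \<Sum>z\<in>choices B ls y. smul (coeff_of (set ls) y z) (\<Sum>\<tau>\<in>pushes ls (R \<Gamma>) z. ?wick z \<tau>))"
  proof (rule scong_sum)
    fix i assume i: "i \<in> ?I"
    obtain n \<Gamma> where e: "i = (n, \<Gamma>)" by fastforce
    have "\<Gamma> \<in> graph_classes g n ?m" using i e by simp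
    from graph_class_term [OF ls y R [OF this] B]
    show "(case i of (n, \<Gamma>) \<Rightarrow> F \<Gamma>) \<simeq> (case i of (n, \<Gamma>) \<Rightarrow>
        \<Sum>z\<in>choices B ls y. smul (coeff_of (set ls) y z) (\<Sum>\<tau>\<in>pushes ls (R \<Gamma>) z. ?wick z \<tau>))"
      by (simp add: e F_def)
  qed
  also have "\<dots> = (\<Sum>z\<in>choices B ls y. smul (coeff_of (set ls) y z) (\<Sum>i\<in>?I. \<Sum>\<tau>\<in>pushes ls (R (snd i)) z. ?wick z \<tau>))"
    unfolding case_prod_unfold by (subst sum.swap) (simp add: pm.scale_sum_right)
  also have "\<dots> = (\<Sum>z\<in>choices B ls y. smul (coeff_of (set ls) y z) (wick_sum ls z g))"
  proof (rule sum.cong [OF refl])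
    fix z assume z: "z \<in> choices B ls y"
    have sub: "pushes ls (R (snd i)) z \<subseteq> matchings ls z g" if "i \<in> ?I" for i
      using that R [of "snd i" "fst i"] pushes_matchings [OF ls, of "R (snd i)" g "fst i" z] by auto
    have "(\<Sum>i\<in>?I. \<Sum>\<tau>\<in>pushes ls (R (snd i)) z. ?wick z \<tau>) = (\<Sum>\<tau>\<in>(\<Union>i\<in>?I. pushes ls (R (snd i)) z). ?wick z \<tau>)"
    proof (rule sum.UNION_disjoint [symmetric])
      show "finite ?I" by (intro finite_SigmaI finite_graph_classes) simp
      show "\<forall>i\<in>?I. finite (pushes ls (R (snd i)) z)"
        using sub finite_matchings finite_subset by metis
      show "\<forall>i\<in>?I. \<forall>j\<in>?I. i \<noteq> j \<longrightarrow> pushes ls (R (snd i)) z \<inter> pushes ls (R (snd j)) z = {}"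
        using graph_class_unique [OF ls] unfolding R_def by fastforce
    qed
    also have "(\<Union>i\<in>?I. pushes ls (R (snd i)) z) = matchings ls z g"
    proof (intro equalityI subsetI)
      fix \<tau> assume "\<tau> \<in> matchings ls z g"
      from pushes_surj [OF ls this] obtain n \<Gamma> where
        "n \<le> length (idx ls (\<lambda>l. snd (z l)))" "\<Gamma> \<in> graph_classes g n ?m" "\<tau> \<in> pushes ls (R \<Gamma>) z"
        unfolding R_def by blast
      then have "(n, \<Gamma>) \<in> ?I" "\<tau> \<in> pushes ls (R (snd (n, \<Gamma>))) z" using M [OF z] by auto
      then show "\<tau> \<in> (\<Union>i\<in>?I. pushes ls (R (snd i)) z)" by blast
    qed (use sub in blast)
    finally show "smul (coeff_of (set ls) y z) (\<Sum>i\<in>?I. \<Sum>\<tau>\<in>pushes ls (R (snd i)) z. ?wick z \<tau>) =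
        smul (coeff_of (set ls) y z) (wick_sum ls z g)"
      by (simp add: wick_sum_def)
  qed
  finally show ?thesis by (simp add: total_sum_def)
qed

end


section \<open>Splitting a vertex\<close>

text \<open>A connected graph has at least |V| - 1 edges. The bound is read off from the rank
  formula for the standard graph of the involution.\<close>

lemma length_le_nedges:
  assumes ls: "distinct ls" and \<tau>: "\<tau> \<in> invols (set (idx ls w))"
    and con: "connected_via fst \<tau> (set (idx ls w)) (set ls)"
  shows "length ls \<le> nedges \<tau> (set (idx ls w)) + 1"
proof -
  let ?n = "nedges \<tau> (set (idx ls w))"
  define l0 where "l0 = hd ls"
  \<comment> \<open>Genus \<open>length ls\<close> at one vertex makes the Betti equation hold with
    value one more than the number of edges, so no lower bound on that number is
    presupposed.\<close>
  define z where "z = (\<lambda>l. (if l = l0 then length ls else 0, w l))"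
  have w: "(\<lambda>l. snd (z l)) = w" by (simp add: z_def)
  have "ls \<noteq> []" using con by (auto simp: connected_via_def)
  then have "(\<Sum>l\<in>set ls. fst (z l)) = length ls" by (simp add: z_def l0_def)
  then have m: "\<tau> \<in> matchings ls z (Suc ?n)" using \<tau> con by (simp add: matchings_def w)
  note std = std_graph [OF ls, of \<tau> z, unfolded w, OF \<tau>]
  interpret D: decorated ls w "std_graph ls z \<tau>" id "restrict id {..<length (idx ls w)}" by (rule std(1))
  have "(std_graph ls z \<tau>, id) \<in> marked_graphs (Suc ?n) (card (leaves (std_graph ls z \<tau>))) (length ls)"
    by (subst push_matchings_iff [of ls z, unfolded w, OF std(1)]) (rule std(3), simp_all add: std(2) m)
  then have "connected_graph (std_graph ls z \<tau>)" "card (verts (std_graph ls z \<tau>)) = length ls"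
    by (auto simp: marked_graphs_def)
  then show ?thesis using rank_H1_connected [OF D.G] D.nedges_push std(2) by simp
qed

text \<open>Makes the division by two in \<open>nedges\<close> exact, so that numbers of edges add
  up over components.\<close>

lemma even_card_moved:
  assumes "distinct L" "\<tau> \<in> invols (set L)"
  shows "even (card {a \<in> set L. \<tau> a \<noteq> a})"
proof -
  let ?es = "edge_list L \<tau>"
  have en: "enumerates L \<tau> ?es (filter (\<lambda>a. \<tau> a = a) L)" using assms by (rule enumerates_edge_list)
  then have "set (flat ?es) \<union> {a \<in> set L. \<tau> a = a} = set L" "set (flat ?es) \<inter> {a \<in> set L. \<tau> a = a} = {}"
    unfolding enumerates_def by auto
  then have "{a \<in> set L. \<tau> a \<noteq> a} = set (flat ?es)" by blast
  moreover have "card (set (flat ?es)) = length (flat ?es)"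
    using en by (intro distinct_card) (simp add: enumerates_def)
  moreover have "even (length (flat es))" for es :: "('a \<times> 'a) list" by (induction es) auto
  ultimately show ?thesis by simp
qed

section \<open>Components before and after the identification of two vertices\<close>

abbreviation linked :: "('i \<Rightarrow> 'v) \<Rightarrow> ('i \<Rightarrow> 'i) \<Rightarrow> 'i set \<Rightarrow> ('v \<times> 'v) set" where
  "linked v \<tau> A \<equiv> {(v a, v (\<tau> a)) | a. a \<in> A}"

lemma linkedI: "a \<in> A \<Longrightarrow> (v a, v (\<tau> a)) \<in> linked v \<tau> A" by blast

lemma sym_linked: "\<tau> \<in> invols A \<Longrightarrow> sym (linked v \<tau> A)"
proof (rule symI)
  fix x y assume t: "\<tau> \<in> invols A" "(x, y) \<in> linked v \<tau> A"
  then obtain a where a: "a \<in> A" "x = v a" "y = v (\<tau> a)" by blast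
  then have "(v (\<tau> a), v (\<tau> (\<tau> a))) \<in> linked v \<tau> A" using invols_mem [OF t(1)] by blast
  then show "(y, x) \<in> linked v \<tau> A" using a invols_invol [OF t(1)] by simp
qed

lemma connected_via_reach:
  assumes "sym (linked v \<tau> A)" "i \<in> U"
  shows "connected_via v \<tau> A U \<longleftrightarrow> (\<forall>s\<in>U. (i, s) \<in> (linked v \<tau> A)\<^sup>*)"
proof
  assume r: "\<forall>s\<in>U. (i, s) \<in> (linked v \<tau> A)\<^sup>*"
  have "sym ((linked v \<tau> A)\<^sup>*)" using assms(1) by (rule sym_rtrancl)
  then have "(a, b) \<in> (linked v \<tau> A)\<^sup>*" if "a \<in> U" "b \<in> U" for a b
    using r that by (meson rtrancl_trans symD)
  then show "connected_via v \<tau> A U" using assms(2) by (auto simp: connected_via_def)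
qed (use assms in \<open>auto simp: connected_via_def\<close>)

text \<open>A path in the quotient lifts to paths that may restart at \<open>i\<close> or at
  \<open>j\<close> whenever it meets the merged vertex. So everything is reachable there exactly if
  each vertex was reachable from \<open>i\<close> or from \<open>j\<close>.\<close>

lemma connected_via_merge:
  assumes \<tau>: "\<tau> \<in> invols A" and S: "v ` A \<subseteq> S" and ij: "i \<in> S" "j \<in> S" "i \<noteq> j"
  shows "connected_via (\<lambda>a. if v a = j then i else v a) \<tau> A (S - {j}) \<longleftrightarrow>
    (\<forall>s\<in>S. (i, s) \<in> (linked v \<tau> A)\<^sup>* \<or> (j, s) \<in> (linked v \<tau> A)\<^sup>*)"
proof -
  define q where "q = (\<lambda>l. if l = j then i else l)"
  let ?R = "linked v \<tau> A" and ?Q = "linked (\<lambda>a. q (v a)) \<tau> A"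
  have map: "(q a, q b) \<in> ?Q\<^sup>*" if "(a, b) \<in> ?R\<^sup>*" for a b
    using that by induction (auto intro: rtrancl_into_rtrancl)
  have "connected_via (\<lambda>a. q (v a)) \<tau> A (S - {j}) \<longleftrightarrow> (\<forall>s\<in>S - {j}. (i, s) \<in> ?Q\<^sup>*)"
    using ij sym_linked [OF \<tau>] by (intro connected_via_reach) auto
  also have "\<dots> \<longleftrightarrow> (\<forall>s\<in>S. (i, s) \<in> ?R\<^sup>* \<or> (j, s) \<in> ?R\<^sup>*)"
  proof
    assume r: "\<forall>s\<in>S - {j}. (i, s) \<in> ?Q\<^sup>*"
    have *: "\<forall>s. q s = t \<longrightarrow> (i, s) \<in> ?R\<^sup>* \<or> (j, s) \<in> ?R\<^sup>*" if "(i, t) \<in> ?Q\<^sup>*" for t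
      using that
    proof induction
      case base
      then show ?case by (auto simp: q_def split: if_splits)
    next
      case (step t t')
      then obtain a where a: "a \<in> A" "t = q (v a)" "t' = q (v (\<tau> a))" by blast
      then have "(i, v a) \<in> ?R\<^sup>* \<or> (j, v a) \<in> ?R\<^sup>*" using step.IH by blast
      then have "(i, v (\<tau> a)) \<in> ?R\<^sup>* \<or> (j, v (\<tau> a)) \<in> ?R\<^sup>*"
        using rtrancl_into_rtrancl [OF _ linkedI [OF a(1), of v \<tau>]] by blast
      then show ?case unfolding a(3) by (auto simp: q_def split: if_splits)
    qed
    show "\<forall>s\<in>S. (i, s) \<in> ?R\<^sup>* \<or> (j, s) \<in> ?R\<^sup>*"
    proof
      fix s assume "s \<in> S"
      then have "(i, q s) \<in> ?Q\<^sup>*" using r ij by (auto simp: q_def)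
      with * show "(i, s) \<in> ?R\<^sup>* \<or> (j, s) \<in> ?R\<^sup>*" by blast
    qed
  next
    assume r: "\<forall>s\<in>S. (i, s) \<in> ?R\<^sup>* \<or> (j, s) \<in> ?R\<^sup>*"
    show "\<forall>s\<in>S - {j}. (i, s) \<in> ?Q\<^sup>*"
    proof
      fix s assume "s \<in> S - {j}"
      then have "(i, s) \<in> ?R\<^sup>* \<or> (j, s) \<in> ?R\<^sup>*" "q s = s" using r by (auto simp: q_def)
      moreover have "q i = i" "q j = i" by (auto simp: q_def)
      ultimately show "(i, s) \<in> ?Q\<^sup>*" using map [of i s] map [of j s] by auto
    qed
  qed
  finally show ?thesis by (simp add: q_def)
qed

text \<open>For a partition of the vertices into \<open>L1\<close> and \<open>L2\<close>, these are
  the involutions whose graph has exactly these two components; preserving \<open>L1\<close> is then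
  the same as preserving its complement.\<close>

definition split_at :: "('i \<Rightarrow> 'v) \<Rightarrow> 'i set \<Rightarrow> 'v set \<Rightarrow> 'v set \<Rightarrow> ('i \<Rightarrow> 'i) set" where
  "split_at v A L1 L2 = {\<tau> \<in> invols A. (\<forall>a\<in>A. v a \<in> L1 \<longleftrightarrow> v (\<tau> a) \<in> L1) \<and>
     connected_via v \<tau> {a \<in> A. v a \<in> L1} L1 \<and> connected_via v \<tau> {a \<in> A. v a \<in> L2} L2}"

text \<open>The two parts are recovered from the involution as the sets reachable from
  \<open>i\<close> and \<open>j\<close>. Hence different bipartitions contribute disjoint sets of
  involutions.\<close>

lemma split_at_reach:
  assumes "\<tau> \<in> split_at v A L1 L2" "L1 \<inter> L2 = {}" "v ` A \<subseteq> L1 \<union> L2" "i \<in> L1" "j \<in> L2"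
  shows "L1 = (linked v \<tau> A)\<^sup>* `` {i}" "L2 = (linked v \<tau> A)\<^sup>* `` {j}"
proof -
  let ?R = "linked v \<tau> A"
  have t: "\<tau> \<in> invols A" "\<And>a. a \<in> A \<Longrightarrow> v a \<in> L1 \<longleftrightarrow> v (\<tau> a) \<in> L1"
    "connected_via v \<tau> {a \<in> A. v a \<in> L1} L1" "connected_via v \<tau> {a \<in> A. v a \<in> L2} L2"
    using assms(1) by (auto simp: split_at_def)
  have t2: "v a \<in> L2 \<longleftrightarrow> v (\<tau> a) \<in> L2" if "a \<in> A" for a
    using t(2) [OF that] assms(2,3) that invols_mem [OF t(1) that] by blast
  have s1: "s \<in> L1" if "(i, s) \<in> ?R\<^sup>*" for s using that by induction (use assms(4) t(2) in auto)
  have s2: "s \<in> L2" if "(j, s) \<in> ?R\<^sup>*" for s using that by induction (use assms(5) t2 in auto)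
  have sub: "linked v \<tau> {a \<in> A. v a \<in> L} \<subseteq> ?R" for L by blast
  have "(i, s) \<in> ?R\<^sup>*" if "s \<in> L1" for s
    using t(3) assms(4) that rtrancl_mono [OF sub [of L1]] by (auto simp: connected_via_def)
  with s1 show "L1 = ?R\<^sup>* `` {i}" by blast
  have "(j, s) \<in> ?R\<^sup>*" if "s \<in> L2" for s
    using t(4) assms(5) that rtrancl_mono [OF sub [of L2]] by (auto simp: connected_via_def)
  with s2 show "L2 = ?R\<^sup>* `` {j}" by blast
qed

lemma reach_split_at:
  assumes \<tau>: "\<tau> \<in> invols A" and dis: "(i, j) \<notin> (linked v \<tau> A)\<^sup>*"
  shows "\<tau> \<in> split_at v A ((linked v \<tau> A)\<^sup>* `` {i}) ((linked v \<tau> A)\<^sup>* `` {j})"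
proof -
  let ?R = "linked v \<tau> A"
  have sym: "sym ?R" by (rule sym_linked [OF \<tau>])
  have closed: "(k, v a) \<in> ?R\<^sup>* \<longleftrightarrow> (k, v (\<tau> a)) \<in> ?R\<^sup>*" if a: "a \<in> A" for k a
    using linkedI [OF a, of v \<tau>] symD [OF sym linkedI [OF a, of v \<tau>]] by (meson rtrancl_into_rtrancl)
  have con: "connected_via v \<tau> {a \<in> A. v a \<in> ?R\<^sup>* `` {k}} (?R\<^sup>* `` {k})" for k
  proof -
    let ?A = "{a \<in> A. v a \<in> ?R\<^sup>* `` {k}}"
    have "sym (linked v \<tau> ?A)"
    proof (rule symI)
      fix x y assume "(x, y) \<in> linked v \<tau> ?A"
      then obtain a where a: "a \<in> ?A" "x = v a" "y = v (\<tau> a)" by blast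
      then have "\<tau> a \<in> ?A" using closed [of a k] invols_mem [OF \<tau>] by auto
      then have "(v (\<tau> a), v (\<tau> (\<tau> a))) \<in> linked v \<tau> ?A" by (rule linkedI)
      then show "(y, x) \<in> linked v \<tau> ?A" using a invols_invol [OF \<tau>] by simp
    qed
    moreover have "(k, s) \<in> (linked v \<tau> ?A)\<^sup>*" if "(k, s) \<in> ?R\<^sup>*" for s
      using that
    proof induction
      case (step s t)
      then obtain a where a: "a \<in> A" "s = v a" "t = v (\<tau> a)" by blast
      then have "a \<in> ?A" using step.hyps(1) by simp
      then have "(s, t) \<in> linked v \<tau> ?A" unfolding a by (rule linkedI)
      with step.IH show ?case by (rule rtrancl_into_rtrancl)
    qed simp
    ultimately show ?thesis by (subst connected_via_reach [where i = k]) auto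
  qed
  show ?thesis unfolding split_at_def using \<tau> closed con by auto
qed

definition bipartitions :: "'v set \<Rightarrow> 'v \<Rightarrow> 'v \<Rightarrow> ('v set \<times> 'v set) set" where
  "bipartitions S i j = {(L1, L2). L1 \<union> L2 = S \<and> L1 \<inter> L2 = {} \<and> i \<in> L1 \<and> j \<in> L2}"

lemma finite_bipartitions: "finite S \<Longrightarrow> finite (bipartitions S i j)"
  by (rule finite_subset [of _ "Pow S \<times> Pow S"]) (auto simp: bipartitions_def)

text \<open>The two cases are told apart by whether \<open>j\<close> is reachable from
  \<open>i\<close>; in the second, the two reachability classes form the bipartition. The condition
  \<open>P\<close> will be the equation for the number of edges, which plays no part in the
  dichotomy.\<close>

lemma sum_merged:
  assumes A: "finite A" "v ` A \<subseteq> S" and S: "finite S" "i \<in> S" "j \<in> S" "i \<noteq> j"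
  shows "(\<Sum>\<tau>\<in>{\<tau> \<in> invols A. connected_via (\<lambda>a. if v a = j then i else v a) \<tau> A (S - {j}) \<and> P \<tau>}. F \<tau>) =
    (\<Sum>\<tau>\<in>{\<tau> \<in> invols A. connected_via v \<tau> A S \<and> P \<tau>}. F \<tau>) +
    (\<Sum>(L1, L2)\<in>bipartitions S i j. \<Sum>\<tau>\<in>{\<tau> \<in> split_at v A L1 L2. P \<tau>}. F \<tau> :: 'z::comm_monoid_add)"
proof -
  let ?M = "{\<tau> \<in> invols A. connected_via (\<lambda>a. if v a = j then i else v a) \<tau> A (S - {j}) \<and> P \<tau>}"
  let ?C = "{\<tau> \<in> invols A. connected_via v \<tau> A S \<and> P \<tau>}"
  let ?D = "\<lambda>p. {\<tau> \<in> split_at v A (fst p) (snd p). P \<tau>}"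
  have fin: "finite (invols A)" by (rule finite_invols [OF A(1)])
  have inv: "\<tau> \<in> invols A" if "\<tau> \<in> split_at v A L1 L2" for \<tau> L1 L2 using that by (simp add: split_at_def)
  have con: "connected_via v \<tau> A S \<longleftrightarrow> (\<forall>s\<in>S. (i, s) \<in> (linked v \<tau> A)\<^sup>*)" if "\<tau> \<in> invols A" for \<tau>
    by (rule connected_via_reach [OF sym_linked [OF that] S(2)])
  have reach: "L1 = (linked v \<tau> A)\<^sup>* `` {i}" "L2 = (linked v \<tau> A)\<^sup>* `` {j}"
    if "(L1, L2) \<in> bipartitions S i j" "\<tau> \<in> split_at v A L1 L2" for L1 L2 \<tau>
    using split_at_reach [OF that(2), of i j] that(1) A(2) by (auto simp: bipartitions_def)
  have "?M = ?C \<union> (\<Union>p\<in>bipartitions S i j. ?D p)"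
  proof (intro equalityI subsetI)
    fix \<tau> assume t: "\<tau> \<in> ?M"
    then have \<tau>: "\<tau> \<in> invols A" by simp
    let ?R = "linked v \<tau> A"
    have all: "\<forall>s\<in>S. (i, s) \<in> ?R\<^sup>* \<or> (j, s) \<in> ?R\<^sup>*"
      using t connected_via_merge [OF \<tau> A(2) S(2-4)] by simp
    show "\<tau> \<in> ?C \<union> (\<Union>p\<in>bipartitions S i j. ?D p)"
    proof (cases "(i, j) \<in> ?R\<^sup>*")
      case True
      then have "\<forall>s\<in>S. (i, s) \<in> ?R\<^sup>*" using all by (meson rtrancl_trans)
      then show ?thesis using t con [OF \<tau>] by simp
    next
      case False
      have sym: "sym (?R\<^sup>*)" by (rule sym_rtrancl [OF sym_linked [OF \<tau>]])
      have inS: "s \<in> S" if "(k, s) \<in> ?R\<^sup>*" "k \<in> S" for k s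
        using that by induction (use A(2) invols_mem [OF \<tau>] in auto)
      have "(?R\<^sup>* `` {i}, ?R\<^sup>* `` {j}) \<in> bipartitions S i j"
        using all inS S False sym unfolding bipartitions_def by (auto dest: symD) (meson rtrancl_trans symD)
      moreover have "\<tau> \<in> split_at v A (?R\<^sup>* `` {i}) (?R\<^sup>* `` {j})" using \<tau> False by (rule reach_split_at)
      ultimately show ?thesis using t by force
    qed
  next
    fix \<tau> assume "\<tau> \<in> ?C \<union> (\<Union>p\<in>bipartitions S i j. ?D p)"
    then consider "\<tau> \<in> ?C" | L1 L2 where "(L1, L2) \<in> bipartitions S i j" "\<tau> \<in> split_at v A L1 L2" "P \<tau>" by auto
    then show "\<tau> \<in> ?M"
    proof cases
      case 1
      then have \<tau>: "\<tau> \<in> invols A" by simp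
      show ?thesis using 1 unfolding con [OF \<tau>] mem_Collect_eq connected_via_merge [OF \<tau> A(2) S(2-4)] by blast
    next
      case 2
      then have "\<forall>s\<in>S. (i, s) \<in> (linked v \<tau> A)\<^sup>* \<or> (j, s) \<in> (linked v \<tau> A)\<^sup>*"
        using reach [OF 2(1,2)] by (auto simp: bipartitions_def)
      then show ?thesis using 2 inv connected_via_merge [OF inv [OF 2(2)] A(2) S(2-4)] by simp
    qed
  qed
  moreover have "?C \<inter> (\<Union>p\<in>bipartitions S i j. ?D p) = {}"
  proof -
    have False if "\<tau> \<in> ?C" "(L1, L2) \<in> bipartitions S i j" "\<tau> \<in> split_at v A L1 L2" for \<tau> L1 L2
      using that con [of \<tau>] reach(1) [OF that(2,3)] S(3) by (auto simp: bipartitions_def)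
    then show ?thesis by fastforce
  qed
  moreover have "finite ?C" "\<And>p. finite (?D p)"
    using fin inv by (auto intro: finite_subset [OF _ fin])
  ultimately have "sum F ?M = sum F ?C + sum F (\<Union>p\<in>bipartitions S i j. ?D p)"
    using finite_bipartitions [OF S(1)] by (simp add: sum.union_disjoint)
  also have "sum F (\<Union>p\<in>bipartitions S i j. ?D p) = (\<Sum>p\<in>bipartitions S i j. sum F (?D p))"
  proof (rule sum.UNION_disjoint [OF finite_bipartitions [OF S(1)]])
    show "\<forall>p\<in>bipartitions S i j. finite (?D p)" using \<open>\<And>p. finite (?D p)\<close> by blast
    show "\<forall>p\<in>bipartitions S i j. \<forall>p'\<in>bipartitions S i j. p \<noteq> p' \<longrightarrow> ?D p \<inter> ?D p' = {}"
    proof -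
      have "p = p'" if "p \<in> bipartitions S i j" "p' \<in> bipartitions S i j" "\<tau> \<in> ?D p" "\<tau> \<in> ?D p'" for p p' \<tau>
        using reach [of "fst p" "snd p" \<tau>] reach [of "fst p'" "snd p'" \<tau>] that by (simp add: prod_eq_iff)
      then show ?thesis by blast
    qed
  qed
  finally show ?thesis by (simp add: case_prod_unfold)
qed

text \<open>Letters inside a word keep their order, so only the order of the words matters and each
  word counts with the parity of its total degree. In this way signs between letters become signs
  that involve only \<open>p\<close>.\<close>

lemma lsign_blocks:
  assumes "distinct ls" "distinct ls'" "set ls = set ls'"
    "\<And>l. l \<in> set ls \<Longrightarrow> even ((\<Sum>k<length (w l). D (l, k)) - p l)"
  shows "lsign D (idx ls w) (idx ls' w) = (lsign p ls ls' :: 'k::comm_ring_1)"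
  using assms
proof (induction ls' arbitrary: ls)
  case (Cons l ls')
  then obtain us vs where ls: "ls = us @ l # vs" by (metis list.set_intros(1) split_list)
  have set: "set ls' = set us \<union> set vs" using Cons.prems(1-3) unfolding ls by auto
  let ?b = "map (Pair l) [0..<length (w l)]"
  have bl: "sum_list (map D (map (Pair l) [0..<n])) = (\<Sum>k<n. D (l, k))" for l n
    by (induction n) (simp_all add: o_def)
  have par: "even (sum_list (map D (idx xs w)) - sum_list (map p xs))" if "set xs \<subseteq> set ls" for xs
    using that
  proof (induction xs)
    case (Cons a xs)
    then have "even ((\<Sum>k<length (w a). D (a, k)) - p a)" using \<open>\<And>l. l \<in> set ls \<Longrightarrow> even ((\<Sum>k<length (w l). D (l, k)) - p l)\<close> by auto
    with Cons show ?case by (auto simp: bl simp del: map_map)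
  qed simp
  have "lsign D (idx us w @ ?b @ idx vs w) (?b @ idx ls' w) =
      psign (sum_list (map D (idx us w)) * sum_list (map D ?b)) * (lsign D (idx us w @ idx vs w) (idx ls' w) :: 'k)"
  proof (rule lsign_move_front)
    show "distinct (idx us w @ ?b @ idx vs w)" using distinct_idx [OF Cons.prems(1), of w] by (simp add: ls)
  qed (auto simp: set_idx set)
  also have "lsign D (idx us w @ idx vs w) (idx ls' w) = (lsign p (us @ vs) ls' :: 'k)"
    unfolding idx_simps(3) [symmetric] using Cons.prems ls set by (intro Cons.IH) auto
  also have "psign (sum_list (map D (idx us w)) * sum_list (map D ?b)) =
      (psign (sum_list (map p us) * sum_list (map p [l])) :: 'k)"
    using par [of us] par [of "[l]"] ls by (intro psign_cong) (auto simp: bl simp del: map_map)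
  also have "\<dots> * lsign p (us @ vs) ls' = lsign p (us @ [l] @ vs) ([l] @ ls')"
    using Cons.prems(1) ls set by (intro lsign_move_front [symmetric]) auto
  finally show ?case by (simp add: ls)
qed simp

lemma sum_PiE_Un:
  assumes "L1 \<inter> L2 = {}"
  shows "(\<Sum>z\<in>PiE (L1 \<union> L2) T. F (restrict z L1) (restrict z L2)) = (\<Sum>z1\<in>PiE L1 T. \<Sum>z2\<in>PiE L2 T. F z1 z2)"
proof -
  have "(\<Sum>z\<in>PiE (L1 \<union> L2) T. F (restrict z L1) (restrict z L2)) = (\<Sum>(z1, z2)\<in>PiE L1 T \<times> PiE L2 T. F z1 z2)"
  proof (rule sum.reindex_bij_witness [where j = "\<lambda>z. (restrict z L1, restrict z L2)"
        and i = "\<lambda>(z1, z2). restrict (\<lambda>l. if l \<in> L1 then z1 l else z2 l) (L1 \<union> L2)"])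
    fix b assume "b \<in> PiE L1 T \<times> PiE L2 T"
    then show "(\<lambda>z. (restrict z L1, restrict z L2)) ((\<lambda>(z1, z2). restrict (\<lambda>l. if l \<in> L1 then z1 l else z2 l) (L1 \<union> L2)) b) = b"
      using assms by (auto simp: fun_eq_iff restrict_def PiE_def extensional_def)
    show "(\<lambda>(z1, z2). restrict (\<lambda>l. if l \<in> L1 then z1 l else z2 l) (L1 \<union> L2)) b \<in> PiE (L1 \<union> L2) T"
      using \<open>b \<in> PiE L1 T \<times> PiE L2 T\<close> by (auto simp: PiE_mem)
  qed (auto simp: fun_eq_iff restrict_def PiE_def extensional_def)
  then show ?thesis by (simp add: sum.cartesian_product)
qed

section \<open>Contractions over merged and over split graphs\<close>

context even_form
begin

lemma wick_sum_cong:
  assumes "distinct ls" "\<And>l. l \<in> set ls \<Longrightarrow> z l = z' l"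
  shows "wick_sum ls z g = wick_sum ls z' g"
proof -
  have M: "matchings ls z g = matchings ls z' g" using assms(2) by (intro matchings_cong) auto
  have L: "idx ls (\<lambda>l. snd (z l)) = idx ls (\<lambda>l. snd (z' l))" using assms(2) by (intro idx_cong) auto
  show ?thesis
    unfolding wick_sum_def M L
  proof (rule sum.cong [OF refl], rule wick_cong)
    fix \<tau> assume "\<tau> \<in> matchings ls z' g"
    then show "\<tau> \<in> invols (set (idx ls (\<lambda>l. snd (z' l))))" by (simp add: matchings_def)
  qed (use assms in \<open>auto simp: distinct_idx set_idx letter_def\<close>)
qed

lemma sum_choices_Un:
  assumes "distinct ls1" "distinct ls2" "set ls1 \<inter> set ls2 = {}" "set ls = set ls1 \<union> set ls2"
  shows "(\<Sum>z\<in>choices B ls y. smul (coeff_of (set ls) y z) (concat_mult (wick_sum ls1 z a) (wick_sum ls2 z b))) =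
    concat_mult (total_sum B ls1 y a) (total_sum B ls2 y b)"
proof -
  let ?T = "\<lambda>l. SIGMA a:{..B}. keys (y l a)"
  have "(\<Sum>z\<in>choices B ls y. smul (coeff_of (set ls) y z) (concat_mult (wick_sum ls1 z a) (wick_sum ls2 z b))) =
    (\<Sum>z\<in>PiE (set ls1 \<union> set ls2) ?T. concat_mult
       (smul (coeff_of (set ls1) y (restrict z (set ls1))) (wick_sum ls1 (restrict z (set ls1)) a))
       (smul (coeff_of (set ls2) y (restrict z (set ls2))) (wick_sum ls2 (restrict z (set ls2)) b)))"
  proof (rule sum.cong)
    fix z
    have "coeff_of (set ls) y z = coeff_of (set ls1) y z * coeff_of (set ls2) y z"
      unfolding coeff_of_def assms(4) using assms(3) by (intro prod.union_disjoint) auto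
    moreover have "coeff_of S y (restrict z S) = coeff_of S y z" for S
      unfolding coeff_of_def by (intro prod.cong) auto
    moreover have "wick_sum ls1 (restrict z (set ls1)) a = wick_sum ls1 z a"
      using assms(1) by (intro wick_sum_cong) auto
    moreover have "wick_sum ls2 (restrict z (set ls2)) b = wick_sum ls2 z b"
      using assms(2) by (intro wick_sum_cong) auto
    ultimately show "smul (coeff_of (set ls) y z) (concat_mult (wick_sum ls1 z a) (wick_sum ls2 z b)) = concat_mult
       (smul (coeff_of (set ls1) y (restrict z (set ls1))) (wick_sum ls1 (restrict z (set ls1)) a))
       (smul (coeff_of (set ls2) y (restrict z (set ls2))) (wick_sum ls2 (restrict z (set ls2)) b))"
      by (simp add: concat_mult_smul)
  qed (simp add: choices_def assms(4))
  also have "\<dots> = (\<Sum>z1\<in>PiE (set ls1) ?T. \<Sum>z2\<in>PiE (set ls2) ?T. concat_mult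
       (smul (coeff_of (set ls1) y z1) (wick_sum ls1 z1 a)) (smul (coeff_of (set ls2) y z2) (wick_sum ls2 z2 b)))"
    by (rule sum_PiE_Un [OF assms(3)])
  also have "\<dots> = concat_mult (total_sum B ls1 y a) (total_sum B ls2 y b)"
    unfolding total_sum_def choices_def concat_mult_sum(1) unfolding concat_mult_sum(2) ..
  finally show ?thesis .
qed

text \<open>Evaluated on the letters of the separate vertices; only the connectedness test
  identifies \<open>j\<close> with \<open>i\<close>. The constant 2 is the 1 of the rank formula
  plus 1 for the vertex lost in the identification.\<close>

definition merged_sum :: "'l list \<Rightarrow> 'l \<Rightarrow> 'l \<Rightarrow> ('l \<Rightarrow> nat \<times> 'x list) \<Rightarrow> nat \<Rightarrow> ('x list \<Rightarrow>\<^sub>0 'k)" where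
  "merged_sum ls i j z g = (let w = (\<lambda>l. snd (z l)); A = set (idx ls w) in
     \<Sum>\<tau>\<in>{\<tau> \<in> invols A. connected_via (\<lambda>a. if fst a = j then i else fst a) \<tau> A (set ls - {j}) \<and>
       (\<Sum>l\<in>set ls. fst (z l)) + nedges \<tau> A + 2 = g + length ls}. wick (idx ls w) (letter w) \<tau>)"

text \<open>The concatenated word at \<open>i\<close> is cut into its two parts again. Vertices
  agree after \<open>j\<close> is identified with \<open>i\<close>, edges and total genus do not
  change, and by \<open>lsign_blocks\<close> the sign is that of putting \<open>i\<close> and
  \<open>j\<close> in front of the other vertices.\<close>

lemma wick_sum_merge:
  assumes ls: "distinct ls" "i \<in> set ls" "j \<in> set ls" "i \<noteq> j"
    and rest: "distinct (i # j # rest)" "set (i # j # rest) = set ls"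
    and z: "\<And>l. l \<in> set ls \<Longrightarrow> snd (z l) \<in> words"
    and par: "\<And>l. l \<in> set ls \<Longrightarrow> even (sum_list (map deg (snd (z l))) - p l)"
    and z': "\<And>l. l \<in> set rest \<Longrightarrow> z' l = z l" "z' i = (fst (z i) + fst (z j), snd (z i) @ snd (z j))"
  shows "wick_sum (i # rest) z' g \<simeq> smul (lsign p (i # j # rest) ls) (merged_sum ls i j z g)"
proof -
  define w where "w = (\<lambda>l. snd (z l))"
  define w' where "w' = (\<lambda>l. snd (z' l))"
  define n where "n = length (w i)"
  \<comment> \<open>Letters from place \<open>n\<close> on belong to the second word and are
    readdressed to the vertex \<open>j\<close>.\<close>
  define \<pi> where "\<pi> = (\<lambda>(l, k). if l = i \<and> n \<le> k then (j, k - n) else (l, k))"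
  let ?L = "idx (i # rest) w'" and ?L' = "idx ls w"
  have w': "w' l = w l" if "l \<in> set rest" for l using z'(1) [OF that] by (simp add: w_def w'_def)
  have w'i: "w' i = w i @ w j" by (simp add: w_def w'_def z'(2))
  have nin: "i \<notin> set rest" "j \<notin> set rest" using rest(1) by auto
  have map: "map \<pi> ?L = idx (i # j # rest) w"
  proof -
    have "[0..<length (w' i)] = [0..<n] @ [n..<n + length (w j)]"
      using upt_add_eq_append [of 0 n "length (w j)"] by (simp add: w'i n_def)
    moreover have "map \<pi> (map (Pair i) [0..<n]) = map (Pair i) [0..<n]" by (simp add: \<pi>_def)
    moreover have "map \<pi> (map (Pair i) [n..<n + length (w j)]) = map (Pair j) [0..<length (w j)]"
    proof -
      have "[n..<n + length (w j)] = map (\<lambda>k. k + n) [0..<length (w j)]"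
        by (simp add: map_add_upt add.commute)
      then show ?thesis by (simp add: \<pi>_def o_def)
    qed
    moreover have "map \<pi> (idx rest w') = idx rest w"
    proof -
      have "idx rest w' = idx rest w" using w' by (intro idx_cong) simp
      moreover have "map \<pi> (idx rest w) = idx rest w"
        using nin by (intro map_idI) (auto simp: set_idx \<pi>_def)
      ultimately show ?thesis by simp
    qed
    ultimately show ?thesis by (simp add: n_def)
  qed
  have dist: "distinct ?L" "distinct ?L'" "distinct (map \<pi> ?L)"
    unfolding map by (rule distinct_idx; use rest(1) ls(1) in simp)+
  then have inj: "inj_on \<pi> (set ?L)" unfolding distinct_map by blast
  have "set (map \<pi> ?L) = set ?L'" unfolding map set_idx using rest(2) by (simp only:)
  then have im: "\<pi> ` set ?L = set ?L'" by (simp only: set_map)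
  have W: "letter w (\<pi> a) = letter w' a" if "a \<in> set ?L" for a
    using that w' nin by (auto simp: set_idx letter_def \<pi>_def w'i n_def nth_append)
  have fst: "(if fst (\<pi> a) = j then i else fst (\<pi> a)) = fst a" if "a \<in> set ?L" for a
    using that nin ls(4) by (auto simp: set_idx \<pi>_def split: if_splits)
  have gens: "letter w' ` set ?L \<subseteq> gens V"
  proof (rule letter_gens)
    fix l assume "l \<in> set (i # rest)"
    then consider "l = i" | "l \<in> set rest" by auto
    then show "w' l \<in> words"
    proof cases
      case 1
      have "w i \<in> words" "w j \<in> words" unfolding w_def using z ls(2,3) by blast+
      then show ?thesis unfolding 1 w'i append_in_lists_conv by blast
    next
      case 2
      then have "l \<in> set ls" using rest(2) by auto
      then show ?thesis unfolding w' [OF 2] w_def by (rule z)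
    qed
  qed
  have sum: "(\<Sum>l\<in>set (i # rest). fst (z' l)) = (\<Sum>l\<in>set ls. fst (z l))"
  proof -
    have "(\<Sum>l\<in>set ls. fst (z l)) = fst (z i) + (fst (z j) + (\<Sum>l\<in>set rest. fst (z l)))"
      unfolding rest(2) [symmetric] using rest(1) by simp
    also have "(\<Sum>l\<in>set rest. fst (z l)) = (\<Sum>l\<in>set rest. fst (z' l))" using z'(1) by (intro sum.cong) auto
    finally show ?thesis using nin by (simp add: z'(2))
  qed
  have len: "length ls = length rest + 2"
    using distinct_card [OF ls(1)] distinct_card [OF rest(1)] rest(2) by simp
  have setm: "set ls - {j} = set (i # rest)" unfolding rest(2) [symmetric] using rest(1) by auto
  have "wick_sum (i # rest) z' g = (\<Sum>\<tau>\<in>{\<tau> \<in> invols (set ?L). connected_via fst \<tau> (set ?L) (set (i # rest)) \<and>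
     (\<Sum>l\<in>set (i # rest). fst (z' l)) + nedges \<tau> (set ?L) + 1 = g + length (i # rest)}. wick ?L (letter w') \<tau>)"
    unfolding wick_sum_def matchings_def w'_def ..
  also have "\<dots> \<simeq> smul (lsign (\<lambda>a. deg (letter w a)) (map \<pi> ?L) ?L')
     (\<Sum>\<tau>\<in>{\<tau> \<in> invols (\<pi> ` set ?L). connected_via (\<lambda>a. if fst a = j then i else fst a) \<tau> (\<pi> ` set ?L) (set ls - {j}) \<and>
       (\<Sum>l\<in>set ls. fst (z l)) + nedges \<tau> (\<pi> ` set ?L) + 2 = g + length ls}. wick ?L' (letter w) \<tau>)"
  proof (rule wick_sum_transport)
    fix \<tau> assume \<tau>: "\<tau> \<in> invols (set ?L)"
    have "connected_via (\<lambda>a. if fst a = j then i else fst a) (conj_invol \<pi> (set ?L) \<tau>) (\<pi> ` set ?L) (set ls - {j}) =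
      connected_via (\<lambda>a. if fst (\<pi> a) = j then i else fst (\<pi> a)) \<tau> (set ?L) (set (i # rest))"
      unfolding setm by (rule connected_via_conj [OF inj])
    also have "\<dots> = connected_via fst \<tau> (set ?L) (set (i # rest))"
      using invols_mem [OF \<tau>] by (intro connected_via_cong fst)
    finally show "(connected_via fst \<tau> (set ?L) (set (i # rest)) \<and>
        (\<Sum>l\<in>set (i # rest). fst (z' l)) + nedges \<tau> (set ?L) + 1 = g + length (i # rest)) =
      (connected_via (\<lambda>a. if fst a = j then i else fst a) (conj_invol \<pi> (set ?L) \<tau>) (\<pi> ` set ?L) (set ls - {j}) \<and>
        (\<Sum>l\<in>set ls. fst (z l)) + nedges (conj_invol \<pi> (set ?L) \<tau>) (\<pi> ` set ?L) + 2 = g + length ls)"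
      unfolding sum nedges_conj [OF inj \<tau>] by (simp add: len)
  qed (use inj dist im W gens in simp_all)
  also have "lsign (\<lambda>a. deg (letter w a)) (map \<pi> ?L) ?L' = (lsign p (i # j # rest) ls :: 'k)"
    unfolding map
  proof (rule lsign_blocks)
    fix l assume "l \<in> set (i # j # rest)"
    then have "l \<in> set ls" unfolding rest(2) .
    moreover have "(\<Sum>k<length (w l). deg (letter w (l, k))) = sum_list (map deg (w l))"
      by (simp add: letter_def sum_list_sum_nth atLeast0LessThan)
    ultimately show "even ((\<Sum>k<length (w l). deg (letter w (l, k))) - p l)" using par by (simp add: w_def)
  qed (use rest ls in auto)
  finally show ?thesis unfolding merged_sum_def Let_def im w_def .
qed

text \<open>An involution with components \<open>ls1\<close> and \<open>ls2\<close> is a pair of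
  involutions, one on each side. The edge equation is the sum of the two Betti equations, so the
  total \<open>g\<close> is distributed as \<open>a\<close> and \<open>g - a\<close>, as in the
  product of series.\<close>

lemma split_sum:
  fixes ls :: "'l list"
  assumes ls: "distinct ls" "distinct ls1" "distinct ls2" "set ls1 \<inter> set ls2 = {}" "set ls = set ls1 \<union> set ls2"
    and z: "\<And>l. l \<in> set ls \<Longrightarrow> snd (z l) \<in> words"
    and par: "\<And>l. l \<in> set ls \<Longrightarrow> even (sum_list (map deg (snd (z l))) - p l)"
  defines "w \<equiv> \<lambda>l. snd (z l)"
  shows "(\<Sum>\<tau>\<in>{\<tau> \<in> split_at fst (set (idx ls w)) (set ls1) (set ls2).
       (\<Sum>l\<in>set ls. fst (z l)) + nedges \<tau> (set (idx ls w)) + 2 = g + length ls}. wick (idx ls w) (letter w) \<tau>) \<simeq>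
    smul (lsign p ls (ls1 @ ls2)) (\<Sum>a\<le>g. concat_mult (wick_sum ls1 z a) (wick_sum ls2 z (g - a)))"
proof -
  let ?A = "set (idx ls w)" and ?A1 = "set (idx ls1 w)" and ?A2 = "set (idx ls2 w)"
  let ?W = "letter w"
  let ?S1 = "\<Sum>l\<in>set ls1. fst (z l)" and ?S2 = "\<Sum>l\<in>set ls2. fst (z l)"
  let ?X = "{\<tau> \<in> split_at fst ?A (set ls1) (set ls2). (\<Sum>l\<in>set ls. fst (z l)) + nedges \<tau> ?A + 2 = g + length ls}"
  let ?Y = "SIGMA a:{..g}. matchings ls1 z a \<times> matchings ls2 z (g - a)"
  define glue where "glue = (\<lambda>(\<tau>1 :: 'l \<times> nat \<Rightarrow> 'l \<times> nat) \<tau>2. restrict (\<lambda>a. if fst a \<in> set ls1 then \<tau>1 a else \<tau>2 a) ?A)"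
  \<comment> \<open>The first entry is the Betti number of the first component, by the rank
    formula.\<close>
  define code where "code = (\<lambda>\<tau>. (?S1 + nedges \<tau> ?A1 + 1 - length ls1, restrict \<tau> ?A1, restrict \<tau> ?A2))"
  have A: "?A = ?A1 \<union> ?A2" "?A1 \<inter> ?A2 = {}" using ls(4,5) by (auto simp: set_idx)
  have A1: "{a \<in> ?A. fst a \<in> set ls1} = ?A1" and A2: "{a \<in> ?A. fst a \<in> set ls2} = ?A2"
    using ls(4,5) by (auto simp: set_idx)
  have f1: "fst a \<in> set ls1" if "a \<in> ?A1" for a using that by (auto simp: set_idx)
  have f2: "fst a \<notin> set ls1" "fst a \<in> set ls2" if "a \<in> ?A2" for a using that ls(4) by (auto simp: set_idx)
  have len: "length ls = length ls1 + length ls2"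
    using distinct_card [OF ls(1)] distinct_card [OF ls(2)] distinct_card [OF ls(3)] ls(4,5)
    by (simp add: card_Un_disjoint)
  have S: "(\<Sum>l\<in>set ls. fst (z l)) = ?S1 + ?S2" unfolding ls(5) using ls(4) by (intro sum.union_disjoint) auto
  have ne: "nedges \<tau> ?A = nedges \<tau> ?A1 + nedges \<tau> ?A2"
    if "restrict \<tau> ?A1 \<in> invols ?A1" "restrict \<tau> ?A2 \<in> invols ?A2" for \<tau>
  proof -
    have mv: "{a \<in> X. restrict \<tau> X a \<noteq> a} = {a \<in> X. \<tau> a \<noteq> a}" for X by auto
    have ev: "even (card {a \<in> ?A1. \<tau> a \<noteq> a})" "even (card {a \<in> ?A2. \<tau> a \<noteq> a})"
      using even_card_moved [OF distinct_idx that(1)] even_card_moved [OF distinct_idx that(2)] ls(2,3)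
      unfolding mv by auto
    have "{a \<in> ?A. \<tau> a \<noteq> a} = {a \<in> ?A1. \<tau> a \<noteq> a} \<union> {a \<in> ?A2. \<tau> a \<noteq> a}" unfolding A(1) by blast
    then have "card {a \<in> ?A. \<tau> a \<noteq> a} = card {a \<in> ?A1. \<tau> a \<noteq> a} + card {a \<in> ?A2. \<tau> a \<noteq> a}"
      using A(2) by (simp add: card_Un_disjoint disjoint_iff)
    then show ?thesis using ev by (auto simp: nedges_def elim!: evenE)
  qed
  have ner: "nedges (restrict \<tau> X) X = nedges \<tau> X" for \<tau> X
  proof -
    have "{a \<in> X. restrict \<tau> X a \<noteq> a} = {a \<in> X. \<tau> a \<noteq> a}" by auto
    then show ?thesis by (simp add: nedges_def)
  qed
  have cr: "connected_via fst (restrict \<tau> X) X U = connected_via fst \<tau> X U" for \<tau> X U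
    by (rule connected_via_cong) auto
  have ri: "restrict \<tau> ?A1 \<in> invols ?A1" "restrict \<tau> ?A2 \<in> invols ?A2" if "\<tau> \<in> split_at fst ?A (set ls1) (set ls2)" for \<tau>
  proof -
    have \<tau>: "\<tau> \<in> invols ?A" "\<And>a. a \<in> ?A \<Longrightarrow> fst a \<in> set ls1 \<longleftrightarrow> fst (\<tau> a) \<in> set ls1"
      using that by (auto simp: split_at_def)
    have 1: "\<tau> a \<in> ?A1" if "a \<in> ?A1" for a
      using \<tau>(2) [of a] f1 [OF that] invols_mem [OF \<tau>(1), of a] that f2(1) unfolding A(1) by blast
    have 2: "\<tau> a \<in> ?A2" if "a \<in> ?A2" for a
      using \<tau>(2) [of a] f2(1) [OF that] invols_mem [OF \<tau>(1), of a] that f1 unfolding A(1) by blast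
    show "restrict \<tau> ?A1 \<in> invols ?A1" "restrict \<tau> ?A2 \<in> invols ?A2"
      using 1 2 invols_invol [OF \<tau>(1)] unfolding A(1) by (auto simp: invols_def)
  qed
  have gl: "glue \<tau>1 \<tau>2 \<in> invols ?A" "restrict (glue \<tau>1 \<tau>2) ?A1 = \<tau>1" "restrict (glue \<tau>1 \<tau>2) ?A2 = \<tau>2"
    "a \<in> ?A1 \<Longrightarrow> glue \<tau>1 \<tau>2 a = \<tau>1 a" "a \<in> ?A2 \<Longrightarrow> glue \<tau>1 \<tau>2 a = \<tau>2 a"
    if t: "\<tau>1 \<in> invols ?A1" "\<tau>2 \<in> invols ?A2" for \<tau>1 \<tau>2 a
  proof -
    have g1: "glue \<tau>1 \<tau>2 a = \<tau>1 a" if "a \<in> ?A1" for a using that f1 by (simp add: glue_def A(1))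
    have g2: "glue \<tau>1 \<tau>2 a = \<tau>2 a" if "a \<in> ?A2" for a using that f2 by (simp add: glue_def A(1))
    show "a \<in> ?A1 \<Longrightarrow> glue \<tau>1 \<tau>2 a = \<tau>1 a" "a \<in> ?A2 \<Longrightarrow> glue \<tau>1 \<tau>2 a = \<tau>2 a" by (fact g1, fact g2)
    show "restrict (glue \<tau>1 \<tau>2) ?A1 = \<tau>1" "restrict (glue \<tau>1 \<tau>2) ?A2 = \<tau>2"
      using g1 g2 t by (auto simp: fun_eq_iff invols_arb restrict_def)
    have "glue \<tau>1 \<tau>2 a \<in> ?A \<and> glue \<tau>1 \<tau>2 (glue \<tau>1 \<tau>2 a) = a" if "a \<in> ?A" for a
    proof (cases "a \<in> ?A1")
      case True
      then show ?thesis using invols_mem [OF t(1) True] invols_invol [OF t(1) True] by (simp add: g1 A(1))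
    next
      case False
      then have a: "a \<in> ?A2" using that A(1) by blast
      then show ?thesis using invols_mem [OF t(2) a] invols_invol [OF t(2) a] by (simp add: g2 A(1))
    qed
    note gg = this
    show "glue \<tau>1 \<tau>2 \<in> invols ?A"
      unfolding invols_def
    proof (intro CollectI conjI ballI PiE_I)
      show "glue \<tau>1 \<tau>2 a = undefined" if "a \<notin> ?A" for a using that by (simp add: glue_def)
    qed (use gg in blast)+
  qed
  have M1: "matchings ls1 z a = {\<tau> \<in> invols ?A1. connected_via fst \<tau> ?A1 (set ls1) \<and> ?S1 + nedges \<tau> ?A1 + 1 = a + length ls1}" for a
    by (simp add: matchings_def w_def)
  have M2: "matchings ls2 z a = {\<tau> \<in> invols ?A2. connected_via fst \<tau> ?A2 (set ls2) \<and> ?S2 + nedges \<tau> ?A2 + 1 = a + length ls2}" for a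
    by (simp add: matchings_def w_def)
  have "(\<Sum>\<tau>\<in>?X. wick (idx ls w) ?W \<tau>) = (\<Sum>(a, \<tau>1, \<tau>2)\<in>?Y. wick (idx ls w) ?W (glue \<tau>1 \<tau>2))"
  proof (rule sum.reindex_bij_witness [where i = "\<lambda>(a, \<tau>1, \<tau>2). glue \<tau>1 \<tau>2" and j = code])
    fix \<tau> assume X: "\<tau> \<in> ?X"
    then have sp: "\<tau> \<in> split_at fst ?A (set ls1) (set ls2)" and eq: "?S1 + ?S2 + nedges \<tau> ?A + 2 = g + length ls"
      using S by auto
    have \<tau>: "\<tau> \<in> invols ?A" "connected_via fst \<tau> ?A1 (set ls1)" "connected_via fst \<tau> ?A2 (set ls2)"
      using sp unfolding split_at_def A1 A2 by auto
    note r = ri [OF sp]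
    have "glue (restrict \<tau> ?A1) (restrict \<tau> ?A2) = \<tau>"
    proof
      fix a show "glue (restrict \<tau> ?A1) (restrict \<tau> ?A2) a = \<tau> a"
        using gl(4,5) [OF r, of a] invols_arb [OF \<tau>(1), of a] unfolding A(1) by (cases "a \<in> ?A") (auto simp: A(1) glue_def)
    qed
    then show g: "(case code \<tau> of (a, \<tau>1, \<tau>2) \<Rightarrow> glue \<tau>1 \<tau>2) = \<tau>" by (simp add: code_def)
    then show "(case code \<tau> of (a, \<tau>1, \<tau>2) \<Rightarrow> wick (idx ls w) ?W (glue \<tau>1 \<tau>2)) = wick (idx ls w) ?W \<tau>"
      by (simp add: case_prod_unfold)
    \<comment> \<open>Connected components have enough edges, so the subtraction in
      \<open>code\<close> is exact and both Betti numbers are natural numbers.\<close>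
    have "length ls1 \<le> nedges \<tau> ?A1 + 1" "length ls2 \<le> nedges \<tau> ?A2 + 1"
      using length_le_nedges [OF ls(2) r(1)] length_le_nedges [OF ls(3) r(2)] \<tau>(2,3) by (simp_all add: ner cr)
    then show "code \<tau> \<in> ?Y"
      using eq r \<tau>(2,3) ne [OF r] len unfolding code_def M1 M2 by (auto simp: ner cr)
  next
    fix x assume "x \<in> ?Y"
    then obtain a \<tau>1 \<tau>2 where x: "x = (a, \<tau>1, \<tau>2)" "a \<le> g" "\<tau>1 \<in> matchings ls1 z a" "\<tau>2 \<in> matchings ls2 z (g - a)"
      by auto
    then have t: "\<tau>1 \<in> invols ?A1" "\<tau>2 \<in> invols ?A2"
      and c: "connected_via fst \<tau>1 ?A1 (set ls1)" "connected_via fst \<tau>2 ?A2 (set ls2)"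
      and n: "?S1 + nedges \<tau>1 ?A1 + 1 = a + length ls1" "?S2 + nedges \<tau>2 ?A2 + 1 = g - a + length ls2"
      unfolding M1 M2 by auto
    note gl = gl [OF t]
    have n': "nedges (glue \<tau>1 \<tau>2) ?A1 = nedges \<tau>1 ?A1" "nedges (glue \<tau>1 \<tau>2) ?A2 = nedges \<tau>2 ?A2"
      using ner [of "glue \<tau>1 \<tau>2"] gl(2,3) by metis+
    show "code (case x of (a, \<tau>1, \<tau>2) \<Rightarrow> glue \<tau>1 \<tau>2) = x"
      using n n' gl(2,3) by (simp add: x code_def)
    have "nedges (glue \<tau>1 \<tau>2) ?A = nedges \<tau>1 ?A1 + nedges \<tau>2 ?A2"
      using ne [of "glue \<tau>1 \<tau>2"] gl(2,3) t n' by simp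
    then have "(\<Sum>l\<in>set ls. fst (z l)) + nedges (glue \<tau>1 \<tau>2) ?A + 2 = g + length ls"
      using n S len x(2) by simp
    moreover have "connected_via fst (glue \<tau>1 \<tau>2) ?A1 (set ls1)" "connected_via fst (glue \<tau>1 \<tau>2) ?A2 (set ls2)"
      using cr [of "glue \<tau>1 \<tau>2"] gl(2,3) c by metis+
    moreover have "fst a \<in> set ls1 \<longleftrightarrow> fst (glue \<tau>1 \<tau>2 a) \<in> set ls1" if "a \<in> ?A" for a
    proof (cases "a \<in> ?A1")
      case True
      then show ?thesis using f1 [OF True] f1 [OF invols_mem [OF t(1) True]] gl(4) by simp
    next
      case False
      then have a: "a \<in> ?A2" using that A(1) by blast
      then show ?thesis using f2(1) [OF a] f2(1) [OF invols_mem [OF t(2) a]] gl(5) by simp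
    qed
    ultimately show "(case x of (a, \<tau>1, \<tau>2) \<Rightarrow> glue \<tau>1 \<tau>2) \<in> ?X"
      using gl(1) unfolding x split_at_def A1 A2 by auto
  qed
  \<comment> \<open>First the letters are brought into the order of \<open>ls1 @ ls2\<close>, at the
    cost of the shuffle sign; in that order the contraction is a product by
    \<open>wick_append\<close>.\<close>
  also have "\<dots> \<simeq> (\<Sum>(a, \<tau>1, \<tau>2)\<in>?Y. smul (lsign p ls (ls1 @ ls2))
      (concat_mult (wick (idx ls1 w) ?W \<tau>1) (wick (idx ls2 w) ?W \<tau>2)))"
  proof (rule scong_sum)
    fix x assume "x \<in> ?Y"
    then obtain a \<tau>1 \<tau>2 where x: "x = (a, \<tau>1, \<tau>2)" "\<tau>1 \<in> matchings ls1 z a" "\<tau>2 \<in> matchings ls2 z (g - a)"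
      by auto
    then have t: "\<tau>1 \<in> invols ?A1" "\<tau>2 \<in> invols ?A2" unfolding M1 M2 by auto
    note gl = gl [OF t]
    have gens: "?W ` ?A \<subseteq> gens V" using z by (intro letter_gens) (auto simp: w_def)
    have sA: "set (idx (ls1 @ ls2) w) = ?A" by (simp add: A(1))
    have d12: "distinct (ls1 @ ls2)" using ls by auto
    have "wick (idx ls w) ?W (glue \<tau>1 \<tau>2) \<simeq>
      smul (lsign (\<lambda>a. deg (?W a)) (idx ls w) (idx (ls1 @ ls2) w)) (wick (idx (ls1 @ ls2) w) ?W (glue \<tau>1 \<tau>2))"
      using gl(1) gens ls(1) d12 sA by (intro wick_reorder distinct_idx) auto
    also have "lsign (\<lambda>a. deg (?W a)) (idx ls w) (idx (ls1 @ ls2) w) = (lsign p ls (ls1 @ ls2) :: 'k)"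
    proof (rule lsign_blocks)
      fix l assume "l \<in> set ls"
      moreover have "(\<Sum>k<length (w l). deg (?W (l, k))) = sum_list (map deg (w l))"
        by (simp add: letter_def sum_list_sum_nth atLeast0LessThan)
      ultimately show "even ((\<Sum>k<length (w l). deg (?W (l, k))) - p l)" using par by (simp add: w_def)
    qed (use ls d12 in auto)
    also have "smul (lsign p ls (ls1 @ ls2)) (wick (idx (ls1 @ ls2) w) ?W (glue \<tau>1 \<tau>2)) \<simeq>
        smul (lsign p ls (ls1 @ ls2)) (concat_mult (wick (idx ls1 w) ?W \<tau>1) (wick (idx ls2 w) ?W \<tau>2))"
      unfolding idx_simps(3)
      using ls A gens gl t by (intro scong_smul wick_append distinct_idx) auto
    finally show "(case x of (a, \<tau>1, \<tau>2) \<Rightarrow> wick (idx ls w) ?W (glue \<tau>1 \<tau>2)) \<simeq> (case x of (a, \<tau>1, \<tau>2) \<Rightarrow>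
        smul (lsign p ls (ls1 @ ls2)) (concat_mult (wick (idx ls1 w) ?W \<tau>1) (wick (idx ls2 w) ?W \<tau>2)))"
      by (simp add: x)
  qed
  also have "\<dots> = (\<Sum>a\<le>g. \<Sum>t\<in>matchings ls1 z a \<times> matchings ls2 z (g - a). smul (lsign p ls (ls1 @ ls2))
      (concat_mult (wick (idx ls1 w) ?W (fst t)) (wick (idx ls2 w) ?W (snd t))))"
    unfolding case_prod_unfold by (subst sum_Sigma_pair) (auto simp: finite_matchings)
  also have "\<dots> = smul (lsign p ls (ls1 @ ls2)) (\<Sum>a\<le>g. \<Sum>t\<in>matchings ls1 z a \<times> matchings ls2 z (g - a).
      concat_mult (wick (idx ls1 w) ?W (fst t)) (wick (idx ls2 w) ?W (snd t)))"
    by (simp only: pm.scale_sum_right)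
  also have "\<dots> = smul (lsign p ls (ls1 @ ls2)) (\<Sum>a\<le>g. concat_mult (wick_sum ls1 z a) (wick_sum ls2 z (g - a)))"
  proof -
    have "(\<Sum>t\<in>matchings ls1 z a \<times> matchings ls2 z b.
      concat_mult (wick (idx ls1 w) ?W (fst t)) (wick (idx ls2 w) ?W (snd t))) =
      concat_mult (wick_sum ls1 z a) (wick_sum ls2 z b)" for a b
    proof -
      have "concat_mult (wick_sum ls1 z a) (wick_sum ls2 z b) = (\<Sum>t1\<in>matchings ls1 z a. \<Sum>t2\<in>matchings ls2 z b.
        concat_mult (wick (idx ls1 w) ?W t1) (wick (idx ls2 w) ?W t2))"
      unfolding wick_sum_def w_def concat_mult_sum(1) unfolding concat_mult_sum(2) ..
      then show ?thesis by (simp add: sum.cartesian_product case_prod_unfold)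
    qed
    then show ?thesis by (simp only:)
  qed
  finally show ?thesis .
qed

text \<open>Provides the vanishing that lets the genera at \<open>i\<close> and \<open>j\<close> run
  over a square instead of a triangle in \<open>sum_triangle\<close>.\<close>

lemma merged_sum_bound:
  assumes "i \<in> set ls" "j \<in> set ls" "i \<noteq> j" "g + length ls < fst (z i) + fst (z j)"
  shows "merged_sum ls i j z g = 0"
proof -
  have "fst (z i) + fst (z j) = (\<Sum>l\<in>{i, j}. fst (z l))" using assms(3) by simp
  also have "\<dots> \<le> (\<Sum>l\<in>set ls. fst (z l))" using assms(1,2) by (intro sum_mono2) auto
  finally have "\<not> (\<Sum>l\<in>set ls. fst (z l)) + n + 2 = g + length ls" for n using assms(4) by simp
  then show ?thesis unfolding merged_sum_def Let_def by simp
qed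

text \<open>Combines the dichotomy with \<open>split_sum\<close> on each bipartition. The function
  \<open>sl\<close> fixes an order on every subset of vertices, which is what the shuffle signs
  refer to.\<close>

lemma merged_sum_split:
  assumes ls: "distinct ls" "i \<in> set ls" "j \<in> set ls" "i \<noteq> j"
    and sl: "\<And>L. L \<subseteq> set ls \<Longrightarrow> distinct (sl L) \<and> set (sl L) = L"
    and z: "\<And>l. l \<in> set ls \<Longrightarrow> snd (z l) \<in> words"
    and par: "\<And>l. l \<in> set ls \<Longrightarrow> even (sum_list (map deg (snd (z l))) - p l)"
  shows "merged_sum ls i j z g \<simeq> (if g = 0 then 0 else wick_sum ls z (g - 1)) +
    (\<Sum>(L1, L2)\<in>bipartitions (set ls) i j. smul (lsign p ls (sl L1 @ sl L2))
      (\<Sum>a\<le>g. concat_mult (wick_sum (sl L1) z a) (wick_sum (sl L2) z (g - a))))"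
proof -
  define w where "w = (\<lambda>l. snd (z l))"
  let ?A = "set (idx ls w)" and ?s = "\<Sum>l\<in>set ls. fst (z l)"
  have "merged_sum ls i j z g = (\<Sum>\<tau>\<in>{\<tau> \<in> invols ?A. connected_via fst \<tau> ?A (set ls) \<and> ?s + nedges \<tau> ?A + 2 = g + length ls}.
      wick (idx ls w) (letter w) \<tau>) +
    (\<Sum>(L1, L2)\<in>bipartitions (set ls) i j. \<Sum>\<tau>\<in>{\<tau> \<in> split_at fst ?A L1 L2. ?s + nedges \<tau> ?A + 2 = g + length ls}.
      wick (idx ls w) (letter w) \<tau>)"
    unfolding merged_sum_def Let_def w_def [symmetric]
    using ls by (intro sum_merged) (auto simp: set_idx)
  also have "\<dots> \<simeq> (if g = 0 then 0 else wick_sum ls z (g - 1)) +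
    (\<Sum>(L1, L2)\<in>bipartitions (set ls) i j. smul (lsign p ls (sl L1 @ sl L2))
      (\<Sum>a\<le>g. concat_mult (wick_sum (sl L1) z a) (wick_sum (sl L2) z (g - a))))"
  proof (rule scong_add)
    have "{\<tau> \<in> invols ?A. connected_via fst \<tau> ?A (set ls) \<and> ?s + nedges \<tau> ?A + 2 = g + length ls} =
      (if g = 0 then {} else matchings ls z (g - 1))"
    proof (cases "g = 0")
      case True
      \<comment> \<open>Too few edges for a connected graph: its Betti number would be -1.
        Accordingly the term with gamma has no constant coefficient.\<close>
      have "?s + nedges \<tau> ?A + 2 \<noteq> length ls" if "\<tau> \<in> invols ?A" "connected_via fst \<tau> ?A (set ls)" for \<tau>
        using length_le_nedges [OF ls(1) that] by simp
      then show ?thesis using True by auto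
    qed (auto simp: matchings_def w_def)
    then show "(\<Sum>\<tau>\<in>{\<tau> \<in> invols ?A. connected_via fst \<tau> ?A (set ls) \<and> ?s + nedges \<tau> ?A + 2 = g + length ls}.
      wick (idx ls w) (letter w) \<tau>) \<simeq> (if g = 0 then 0 else wick_sum ls z (g - 1))"
      by (simp add: wick_sum_def w_def)
    show "(\<Sum>(L1, L2)\<in>bipartitions (set ls) i j. \<Sum>\<tau>\<in>{\<tau> \<in> split_at fst ?A L1 L2. ?s + nedges \<tau> ?A + 2 = g + length ls}.
      wick (idx ls w) (letter w) \<tau>) \<simeq>
      (\<Sum>(L1, L2)\<in>bipartitions (set ls) i j. smul (lsign p ls (sl L1 @ sl L2))
      (\<Sum>a\<le>g. concat_mult (wick_sum (sl L1) z a) (wick_sum (sl L2) z (g - a))))"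
    proof (rule scong_sum)
      fix x assume "x \<in> bipartitions (set ls) i j"
      then obtain L1 L2 where x: "x = (L1, L2)" "L1 \<union> L2 = set ls" "L1 \<inter> L2 = {}" by (auto simp: bipartitions_def)
      have s1: "distinct (sl L1)" "set (sl L1) = L1" and s2: "distinct (sl L2)" "set (sl L2) = L2"
        using sl [of L1] sl [of L2] x(2) by auto
      show "(case x of (L1, L2) \<Rightarrow> \<Sum>\<tau>\<in>{\<tau> \<in> split_at fst ?A L1 L2. ?s + nedges \<tau> ?A + 2 = g + length ls}.
          wick (idx ls w) (letter w) \<tau>) \<simeq>
        (case x of (L1, L2) \<Rightarrow> smul (lsign p ls (sl L1 @ sl L2))
          (\<Sum>a\<le>g. concat_mult (wick_sum (sl L1) z a) (wick_sum (sl L2) z (g - a))))"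
        using split_sum [OF ls(1) s1(1) s2(1), of z p g] s1(2) s2(2) x z par by (simp add: w_def)
    qed
  qed
  finally show ?thesis .
qed

lemma lin_ext_concat_mult: "lin_ext F (concat_mult p q) =
    (\<Sum>u\<in>keys p. \<Sum>v\<in>keys q. smul (lookup p u * lookup q v) (F (u @ v)))"
  by (simp add: concat_mult_lin_ext lin_ext_comp) (simp add: lin_ext_def pm.scale_sum_right)

text \<open>Passes from independent genera \<open>a\<close> and \<open>b\<close>, as they occur at
  two vertices, to the total genus of the merged vertex.\<close>

lemma sum_triangle:
  fixes H :: "nat \<Rightarrow> nat \<Rightarrow> 'z::comm_monoid_add"
  assumes "\<And>a b. a + b > B \<Longrightarrow> H a b = 0"
  shows "(\<Sum>a\<le>B. \<Sum>b\<le>B. H a b) = (\<Sum>c\<le>B. \<Sum>a\<le>c. H a (c - a))"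
proof -
  have nz: "a + b \<le> B" if "H a b \<noteq> 0" for a b using assms that not_le by blast
  have "(\<Sum>a\<le>B. \<Sum>b\<le>B. H a b) = (\<Sum>(a, b)\<in>{..B} \<times> {..B}. H a b)" by (rule sum.cartesian_product)
  also have "\<dots> = (\<Sum>(a, b)\<in>{(a, b). a + b \<le> B}. H a b)"
    by (intro sum.mono_neutral_right) (auto dest: nz)
  also have "\<dots> = (\<Sum>c\<le>B. \<Sum>a\<le>c. H a (c - a))" by (rule sum.triangle_reindex_eq)
  finally show ?thesis .
qed

text \<open>The product formula for one coefficient of gamma on representatives. A word in the
  product series is a concatenation \<open>u @ v\<close> whose genera add up; merging is undone by
  \<open>wick_sum_merge\<close>, the result is decomposed by \<open>merged_sum_split\<close>, and
  sums over choices factor along each bipartition.\<close>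

proposition total_sum_product:
  assumes ls: "distinct ls" "i \<in> set ls" "j \<in> set ls" "i \<noteq> j"
    and rest: "distinct (i # j # rest)" "set (i # j # rest) = set ls"
    and y: "\<And>l. l \<in> set ls \<Longrightarrow> y l \<in> series V"
    and par: "\<And>l a u. l \<in> set ls \<Longrightarrow> u \<in> keys (y l a) \<Longrightarrow> even (sum_list (map deg u) - p l)"
    and sl: "\<And>L. L \<subseteq> set ls \<Longrightarrow> distinct (sl L) \<and> set (sl L) = L"
    and B: "g + length ls \<le> B"
  shows "smul (lsign p ls (i # j # rest)) (total_sum B (i # rest) (y(i := series_mult (y i) (y j))) g) \<simeq>
    (if g = 0 then 0 else total_sum B ls y (g - 1)) +
    (\<Sum>(L1, L2)\<in>bipartitions (set ls) i j. smul (lsign p ls (sl L1 @ sl L2))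
      (\<Sum>a\<le>g. concat_mult (total_sum B (sl L1) y a) (total_sum B (sl L2) y (g - a))))"
proof -
  let ?y = "y(i := series_mult (y i) (y j))" and ?R = "set rest"
  let ?T = "\<lambda>l. SIGMA a:{..B}. keys (y l a)"
  let ?Z = "PiE ?R ?T"
  let ?e = "lsign p (i # j # rest) ls :: 'k"
  define c where "c = (\<lambda>a b u v z. lookup (y i a) u * lookup (y j b) v * coeff_of ?R y z)"
  \<comment> \<open>\<open>G a b\<close> collects the choices with genera \<open>a\<close> and
    \<open>b\<close> at \<open>i\<close> and \<open>j\<close> in merged form, a single vertex
    carrying \<open>u @ v\<close>; \<open>H a b\<close> is the same contribution with the two
    vertices kept apart.\<close>
  define G where "G = (\<lambda>a b. \<Sum>u\<in>keys (y i a). \<Sum>v\<in>keys (y j b). \<Sum>z\<in>?Z.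
      smul (c a b u v z) (wick_sum (i # rest) (z(i := (a + b, u @ v))) g))"
  define H where "H = (\<lambda>a b. \<Sum>u\<in>keys (y i a). \<Sum>v\<in>keys (y j b). \<Sum>z\<in>?Z.
      smul (c a b u v z) (merged_sum ls i j (z(j := (b, v), i := (a, u))) g))"
  have nin: "i \<notin> ?R" "j \<notin> ?R" "i \<notin> insert j ?R" using rest(1) by auto
  have set: "set ls = insert i (insert j ?R)" using rest(2) by simp
  have word: "u \<in> words" if "l \<in> set ls" "u \<in> keys (y l a)" for l u a
    using y [OF that(1)] that(2) by (auto simp: series_def)
  have zR: "snd (z l) \<in> keys (y l (fst (z l)))" if "z \<in> PiE X ?T" "l \<in> X" for z l X
    using that by (auto simp: PiE_def Pi_def)
  have slot: "slot B (i # rest) ?y g i n u = (\<Sum>z\<in>?Z. smul (coeff_of ?R y z) (wick_sum (i # rest) (z(i := (n, u))) g))" for n u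
  proof -
    have "set (i # rest) - {i} = ?R" using nin by auto
    moreover have "(\<Pi>\<^sub>E l\<in>?R. SIGMA a:{..B}. keys (?y l a)) = ?Z" using nin by (intro PiE_cong) auto
    moreover have "coeff_of ?R ?y = coeff_of ?R y"
      unfolding coeff_of_def using nin by (intro ext prod.cong) auto
    ultimately show ?thesis unfolding slot_def by simp
  qed
  have "total_sum B (i # rest) ?y g = (\<Sum>n\<le>B. \<Sum>a\<le>n. G a (n - a))"
  proof -
    have "total_sum B (i # rest) ?y g = (\<Sum>n\<le>B. lin_ext (slot B (i # rest) ?y g i n) (?y i n))"
      by (rule total_sum_slot) simp
    also have "\<dots> = (\<Sum>n\<le>B. \<Sum>a\<le>n. G a (n - a))"
    proof (intro sum.cong refl)
      fix n
      have "lin_ext (slot B (i # rest) ?y g i n) (?y i n) =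
        (\<Sum>a\<le>n. lin_ext (slot B (i # rest) ?y g i n) (concat_mult (y i a) (y j (n - a))))"
        by (simp add: series_mult_def lin_ext_sum)
      also have "\<dots> = (\<Sum>a\<le>n. G a (n - a))"
      proof (intro sum.cong refl)
        fix a assume "a \<in> {..n}"
        then show "lin_ext (slot B (i # rest) ?y g i n) (concat_mult (y i a) (y j (n - a))) = G a (n - a)"
          unfolding lin_ext_concat_mult slot G_def c_def by (simp add: pm.scale_sum_right)
      qed
      finally show "lin_ext (slot B (i # rest) ?y g i n) (?y i n) = (\<Sum>a\<le>n. G a (n - a))" .
    qed
    finally show ?thesis .
  qed
  also have "\<dots> \<simeq> (\<Sum>n\<le>B. \<Sum>a\<le>n. smul ?e (H a (n - a)))"
  proof (intro scong_sum)
    fix a b :: nat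
    have "wick_sum (i # rest) (z(i := (a + b, u @ v))) g \<simeq>
        smul ?e (merged_sum ls i j (z(j := (b, v), i := (a, u))) g)"
      if u: "u \<in> keys (y i a)" and v: "v \<in> keys (y j b)" and z: "z \<in> ?Z" for a b u v z
    proof (rule wick_sum_merge [OF ls rest])
      fix l assume l: "l \<in> set ls"
      have "snd ((z(j := (b, v), i := (a, u))) l) \<in> keys (y l (fst ((z(j := (b, v), i := (a, u))) l)))"
        using l u v zR [OF z] ls(4) unfolding set by auto
      then show "snd ((z(j := (b, v), i := (a, u))) l) \<in> words"
        "even (sum_list (map deg (snd ((z(j := (b, v), i := (a, u))) l))) - p l)"
        using word [OF l] par [OF l] by blast+
    qed (use nin ls(4) in auto)
    then have "G a b \<simeq> (\<Sum>u\<in>keys (y i a). \<Sum>v\<in>keys (y j b). \<Sum>z\<in>?Z.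
      smul (c a b u v z) (smul ?e (merged_sum ls i j (z(j := (b, v), i := (a, u))) g)))" for a b
      unfolding G_def by (intro scong_sum scong_smul) blast
    moreover have "(\<Sum>u\<in>keys (y i a). \<Sum>v\<in>keys (y j b). \<Sum>z\<in>?Z.
      smul (c a b u v z) (smul ?e (merged_sum ls i j (z(j := (b, v), i := (a, u))) g))) = smul ?e (H a b)" for a b
      unfolding H_def by (simp add: pm.scale_sum_right mult.commute)
    ultimately show "G a (n - a) \<simeq> smul ?e (H a (n - a))" for n by simp
  qed
  also have "\<dots> = smul ?e (\<Sum>a\<le>B. \<Sum>b\<le>B. H a b)"
  proof -
    have "H a b = 0" if "a + b > B" for a b
      unfolding H_def using that B ls by (intro sum.neutral ballI) (simp add: merged_sum_bound)
    from sum_triangle [of B H, OF this] show ?thesis by (simp add: pm.scale_sum_right)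
  qed
  also have "(\<Sum>a\<le>B. \<Sum>b\<le>B. H a b) = (\<Sum>z\<in>choices B ls y. smul (coeff_of (set ls) y z) (merged_sum ls i j z g))"
  proof -
    have co: "coeff_of (set ls) y (z(j := (b, v), i := (a, u))) = c a b u v z" for a b u v z
    proof -
      have "coeff_of ?R y (z(j := (b, v), i := (a, u))) = coeff_of ?R y z"
        unfolding coeff_of_def using nin by (intro prod.cong) auto
      then show ?thesis unfolding set using nin ls(4) by (simp add: coeff_of_def c_def)
    qed
    have "(\<Sum>z\<in>choices B ls y. smul (coeff_of (set ls) y z) (merged_sum ls i j z g)) =
      (\<Sum>t\<in>?T i. \<Sum>t'\<in>?T j. \<Sum>z\<in>?Z. smul (coeff_of (set ls) y (z(j := t', i := t))) (merged_sum ls i j (z(j := t', i := t)) g))"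
      unfolding choices_def by (subst set, subst sum_PiE_insert [OF nin(3)], subst sum_PiE_insert [OF nin(2)]) (rule refl)
    also have "\<dots> = (\<Sum>a\<le>B. \<Sum>u\<in>keys (y i a). \<Sum>b\<le>B. \<Sum>v\<in>keys (y j b). \<Sum>z\<in>?Z.
        smul (c a b u v z) (merged_sum ls i j (z(j := (b, v), i := (a, u))) g))"
      by (simp only: sum_Sigma_pair finite_atMost finite_keys co)
    also have "\<dots> = (\<Sum>a\<le>B. \<Sum>b\<le>B. H a b)"
      unfolding H_def by (intro sum.cong refl sum.swap)
    finally show ?thesis ..
  qed
  finally have "total_sum B (i # rest) ?y g \<simeq>
      smul ?e (\<Sum>z\<in>choices B ls y. smul (coeff_of (set ls) y z) (merged_sum ls i j z g))" .
  from scong_smul [OF this, of "lsign p ls (i # j # rest)"]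
  have "smul (lsign p ls (i # j # rest)) (total_sum B (i # rest) ?y g) \<simeq>
      (\<Sum>z\<in>choices B ls y. smul (coeff_of (set ls) y z) (merged_sum ls i j z g))"
  proof -
    \<comment> \<open>Going to the order i, j, rest and back costs nothing, so the sign on the left
      cancels the one from merging.\<close>
    have "lsign p ls (i # j # rest) * lsign p (i # j # rest) ls = (lsign p ls ls :: 'k)"
      using rest(2) by (intro lsign_trans) auto
    then show ?thesis using \<open>smul _ (total_sum _ _ _ _) \<simeq> smul _ (smul _ _)\<close> by simp
  qed
  also have "\<dots> \<simeq> (\<Sum>z\<in>choices B ls y. smul (coeff_of (set ls) y z)
    ((if g = 0 then 0 else wick_sum ls z (g - 1)) +
    (\<Sum>(L1, L2)\<in>bipartitions (set ls) i j. smul (lsign p ls (sl L1 @ sl L2))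
      (\<Sum>a\<le>g. concat_mult (wick_sum (sl L1) z a) (wick_sum (sl L2) z (g - a))))))"
  proof (intro scong_sum scong_smul)
    fix z assume z: "z \<in> choices B ls y"
    show "merged_sum ls i j z g \<simeq> (if g = 0 then 0 else wick_sum ls z (g - 1)) +
      (\<Sum>(L1, L2)\<in>bipartitions (set ls) i j. smul (lsign p ls (sl L1 @ sl L2))
        (\<Sum>a\<le>g. concat_mult (wick_sum (sl L1) z a) (wick_sum (sl L2) z (g - a))))"
      using zR [OF z [unfolded choices_def]] word par by (intro merged_sum_split [OF ls sl]) blast+
  qed
  also have "\<dots> = (\<Sum>z\<in>choices B ls y. smul (coeff_of (set ls) y z) (if g = 0 then 0 else wick_sum ls z (g - 1))) +
    (\<Sum>(L1, L2)\<in>bipartitions (set ls) i j. smul (lsign p ls (sl L1 @ sl L2))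
      (\<Sum>a\<le>g. \<Sum>z\<in>choices B ls y. smul (coeff_of (set ls) y z)
        (concat_mult (wick_sum (sl L1) z a) (wick_sum (sl L2) z (g - a)))))"
  proof -
    have "(\<Sum>z\<in>choices B ls y. smul (coeff_of (set ls) y z)
      (\<Sum>(L1, L2)\<in>bipartitions (set ls) i j. smul (lsign p ls (sl L1 @ sl L2))
        (\<Sum>a\<le>g. concat_mult (wick_sum (sl L1) z a) (wick_sum (sl L2) z (g - a))))) =
      (\<Sum>z\<in>choices B ls y. \<Sum>(L1, L2)\<in>bipartitions (set ls) i j. smul (lsign p ls (sl L1 @ sl L2))
        (\<Sum>a\<le>g. smul (coeff_of (set ls) y z) (concat_mult (wick_sum (sl L1) z a) (wick_sum (sl L2) z (g - a)))))"
      by (simp add: pm.scale_sum_right case_prod_unfold mult.commute)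
    also have "\<dots> = (\<Sum>(L1, L2)\<in>bipartitions (set ls) i j. smul (lsign p ls (sl L1 @ sl L2))
      (\<Sum>a\<le>g. \<Sum>z\<in>choices B ls y. smul (coeff_of (set ls) y z)
        (concat_mult (wick_sum (sl L1) z a) (wick_sum (sl L2) z (g - a)))))"
      unfolding case_prod_unfold
      by (subst sum.swap) (simp only: pm.scale_sum_right sum.swap [of _ "choices B ls y" "{..g}"])
    finally show ?thesis by (simp add: pm.scale_right_distrib sum.distrib)
  qed
  also have "\<dots> = (if g = 0 then 0 else total_sum B ls y (g - 1)) +
    (\<Sum>(L1, L2)\<in>bipartitions (set ls) i j. smul (lsign p ls (sl L1 @ sl L2))
      (\<Sum>a\<le>g. concat_mult (total_sum B (sl L1) y a) (total_sum B (sl L2) y (g - a))))"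
  proof (rule arg_cong2 [where f = "(+)"])
    show "(\<Sum>z\<in>choices B ls y. smul (coeff_of (set ls) y z) (if g = 0 then 0 else wick_sum ls z (g - 1))) =
        (if g = 0 then 0 else total_sum B ls y (g - 1))"
      by (simp add: total_sum_def)
    show "(\<Sum>(L1, L2)\<in>bipartitions (set ls) i j. smul (lsign p ls (sl L1 @ sl L2))
      (\<Sum>a\<le>g. \<Sum>z\<in>choices B ls y. smul (coeff_of (set ls) y z)
        (concat_mult (wick_sum (sl L1) z a) (wick_sum (sl L2) z (g - a))))) =
      (\<Sum>(L1, L2)\<in>bipartitions (set ls) i j. smul (lsign p ls (sl L1 @ sl L2))
      (\<Sum>a\<le>g. concat_mult (total_sum B (sl L1) y a) (total_sum B (sl L2) y (g - a))))"
    proof (rule sum.cong [OF refl])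
      fix x assume "x \<in> bipartitions (set ls) i j"
      then obtain L1 L2 where x: "x = (L1, L2)" "L1 \<union> L2 = set ls" "L1 \<inter> L2 = {}" by (auto simp: bipartitions_def)
      have s1: "distinct (sl L1)" "set (sl L1) = L1" and s2: "distinct (sl L2)" "set (sl L2) = L2"
        using sl [of L1] sl [of L2] x(2) by auto
      have "(\<Sum>z\<in>choices B ls y. smul (coeff_of (set ls) y z)
          (concat_mult (wick_sum (sl L1) z a) (wick_sum (sl L2) z b))) =
          concat_mult (total_sum B (sl L1) y a) (total_sum B (sl L2) y b)" for a b
        using s1 s2 x by (intro sum_choices_Un) auto
      then show "(case x of (L1, L2) \<Rightarrow> smul (lsign p ls (sl L1 @ sl L2))
        (\<Sum>a\<le>g. \<Sum>z\<in>choices B ls y. smul (coeff_of (set ls) y z)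
          (concat_mult (wick_sum (sl L1) z a) (wick_sum (sl L2) z (g - a))))) =
        (case x of (L1, L2) \<Rightarrow> smul (lsign p ls (sl L1 @ sl L2))
          (\<Sum>a\<le>g. concat_mult (total_sum B (sl L1) y a) (total_sum B (sl L2) y (g - a))))"
        by (simp add: x)
    qed
  qed
  finally show ?thesis .
qed

end


section \<open>The product formula in the quotient algebra\<close>

context presentation
begin

lemma series_relD: "(y, z) \<in> series_rel V \<Longrightarrow> y \<in> series V" "(y, z) \<in> series_rel V \<Longrightarrow> z \<in> series V"
  "(y, z) \<in> series_rel V \<Longrightarrow> y g \<simeq> z g"
  by (auto simp: series_rel_def scong_def)

lemma series_relI: "y \<in> series V \<Longrightarrow> z \<in> series V \<Longrightarrow> (\<And>g. y g \<simeq> z g) \<Longrightarrow> (y, z) \<in> series_rel V"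
  by (auto simp: series_rel_def scong_def)

lemma equiv_series_rel: "equiv (series V) (series_rel V)"
proof (rule equivI)
  show "refl_on (series V) (series_rel V)" by (rule refl_onI) (auto intro: series_relI)
  show "sym (series_rel V)" by (rule symI) (blast intro: series_relI scong_sym dest: series_relD)
  show "trans (series_rel V)" by (rule transI) (blast intro: series_relI scong_trans dest: series_relD)
qed (auto dest: series_relD)

lemma mem_cls: "z \<in> cls V y \<longleftrightarrow> (y, z) \<in> series_rel V"
  by (simp add: cls_def)

lemma cls_eqI: "(y, z) \<in> series_rel V \<Longrightarrow> cls V y = cls V z"
  unfolding cls_def by (rule equiv_class_eq [OF equiv_series_rel])

lemma cls_self: "y \<in> series V \<Longrightarrow> y \<in> cls V y"
  by (simp add: mem_cls series_relI)

lemma carrier_sym_series: "Y \<in> carrier (sym_series V) \<longleftrightarrow> (\<exists>y\<in>series V. Y = cls V y)"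
  by (auto simp: sym_series_def cls_def quotient_def)

lemma cls_carrier: "y \<in> series V \<Longrightarrow> cls V y \<in> carrier (sym_series V)"
  by (auto simp: carrier_sym_series)

lemma cls_of_mem:
  assumes "Y \<in> carrier (sym_series V)" "y \<in> Y"
  shows "y \<in> series V" "Y = cls V y"
proof -
  obtain a where a: "Y = cls V a" using assms(1) by (auto simp: carrier_sym_series)
  then have "(a, y) \<in> series_rel V" using assms(2) by (simp add: mem_cls)
  then show "y \<in> series V" "Y = cls V y" unfolding a by (rule series_relD, rule cls_eqI)
qed

text \<open>Operations on classes are defined as unions over all representatives. If the result does
  not depend on the representative, the union over the non-empty class is a single value.\<close>

lemma UN_cls:
  assumes "a \<in> series V" "\<And>y. (a, y) \<in> series_rel V \<Longrightarrow> F y = Y"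
  shows "(\<Union>y\<in>cls V a. F y) = Y"
proof -
  have "(\<Union>y\<in>cls V a. F y) = (\<Union>y\<in>cls V a. Y)" using assms(2) by (intro SUP_cong) (simp_all add: mem_cls)
  then show ?thesis using cls_self [OF assms(1)] by auto
qed

lemma seriesI: "(\<And>g. keys (y g) \<subseteq> words) \<Longrightarrow> y \<in> series V"
  by (simp add: series_def)

lemma seriesD: "y \<in> series V \<Longrightarrow> keys (y g) \<subseteq> words"
  by (simp add: series_def)

lemma series_add: "y \<in> series V \<Longrightarrow> z \<in> series V \<Longrightarrow> (\<lambda>g. y g + z g) \<in> series V"
  by (rule seriesI, rule order_trans [OF Poly_Mapping.keys_add], rule Un_least) (erule seriesD)+

lemma series_smul: "y \<in> series V \<Longrightarrow> (\<lambda>g. smul c (y g)) \<in> series V"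
  by (rule seriesI, rule order_trans [OF keys_smul], erule seriesD)

lemma series_sum: "(\<And>i. i \<in> A \<Longrightarrow> y i \<in> series V) \<Longrightarrow> (\<lambda>g. \<Sum>i\<in>A. y i g) \<in> series V"
  by (rule seriesI, rule keys_sum_subset, rule seriesD)

lemma series_mult_closed:
  assumes "y \<in> series V" "z \<in> series V"
  shows "series_mult y z \<in> series V"
  unfolding series_mult_def
proof (intro seriesI keys_sum_subset order_trans [OF keys_concat_mult] subsetI)
  fix g i w assume "w \<in> {u @ v | u v. u \<in> keys (y i) \<and> v \<in> keys (z (g - i))}"
  then obtain u v where "w = u @ v" "u \<in> keys (y i)" "v \<in> keys (z (g - i))" by blast
  then show "w \<in> words" using seriesD [OF assms(1)] seriesD [OF assms(2)] by (metis append_in_lists_conv subsetD)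
qed

lemma add_cls:
  assumes "y \<in> series V" "z \<in> series V"
  shows "cls V y \<oplus>\<^bsub>sym_series V\<^esub> cls V z = cls V (\<lambda>g. y g + z g)"
proof -
  have "cls V (\<lambda>g. y' g + z' g) = cls V (\<lambda>g. y g + z g)"
    if "(y, y') \<in> series_rel V" "(z, z') \<in> series_rel V" for y' z'
    using that by (intro cls_eqI series_relI series_add scong_add) (auto dest: series_relD intro: scong_sym)
  then have "(\<Union>y\<in>cls V y. \<Union>z\<in>cls V z. cls V (\<lambda>g. y g + z g)) = cls V (\<lambda>g. y g + z g)"
    using assms by (intro UN_cls)
  then show ?thesis by (simp add: sym_series_def)
qed

lemma smult_cls:
  assumes "y \<in> series V"
  shows "c \<odot>\<^bsub>sym_series V\<^esub> cls V y = cls V (\<lambda>g. smul c (y g))"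
proof -
  have "cls V (\<lambda>g. smul c (y' g)) = cls V (\<lambda>g. smul c (y g))" if "(y, y') \<in> series_rel V" for y'
    using that by (intro cls_eqI series_relI series_smul scong_smul) (auto dest: series_relD intro: scong_sym)
  then have "(\<Union>y\<in>cls V y. cls V (\<lambda>g. smul c (y g))) = cls V (\<lambda>g. smul c (y g))"
    using assms by (intro UN_cls)
  then show ?thesis by (simp add: sym_series_def)
qed

lemma mult_cls:
  assumes "y \<in> series V" "z \<in> series V"
  shows "cls V y \<otimes>\<^bsub>sym_series V\<^esub> cls V z = cls V (series_mult y z)"
proof -
  have "cls V (series_mult y' z') = cls V (series_mult y z)"
    if yz: "(y, y') \<in> series_rel V" "(z, z') \<in> series_rel V" for y' z'
  proof (intro cls_eqI series_relI series_mult_closed)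
    fix g
    show "series_mult y' z' g \<simeq> series_mult y z g"
      unfolding series_mult_def using series_relD [OF yz(1)] series_relD [OF yz(2)]
      by (intro scong_sum scong_concat_mult) (auto simp: series_def intro: scong_sym)
  qed (use yz in \<open>auto dest: series_relD\<close>)
  then have "(\<Union>y\<in>cls V y. \<Union>z\<in>cls V z. cls V (series_mult y z)) = cls V (series_mult y z)"
    using assms by (intro UN_cls)
  then show ?thesis by (simp add: sym_series_def)
qed

lemma zero_cls: "\<zero>\<^bsub>sym_series V\<^esub> = cls V (\<lambda>g. 0)"
  by (simp add: sym_series_def)

lemma zero_series: "(\<lambda>g. 0) \<in> series V"
  by (simp add: series_def)

lemma abelian_monoid_sym_series: "abelian_monoid (sym_series V)"
proof (rule abelian_monoidI)
  show "\<zero>\<^bsub>sym_series V\<^esub> \<in> carrier (sym_series V)" by (simp add: zero_cls cls_carrier zero_series)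
  fix X Y assume "X \<in> carrier (sym_series V)" "Y \<in> carrier (sym_series V)"
  then obtain x y where e: "X = cls V x" "x \<in> series V" "Y = cls V y" "y \<in> series V"
    by (auto simp: carrier_sym_series)
  show "X \<oplus>\<^bsub>sym_series V\<^esub> Y \<in> carrier (sym_series V)" using e by (simp add: add_cls cls_carrier series_add)
  show "X \<oplus>\<^bsub>sym_series V\<^esub> Y = Y \<oplus>\<^bsub>sym_series V\<^esub> X" using e by (simp add: add_cls add.commute)
  show "\<zero>\<^bsub>sym_series V\<^esub> \<oplus>\<^bsub>sym_series V\<^esub> X = X" using e by (simp add: zero_cls add_cls zero_series)
  fix Z assume "Z \<in> carrier (sym_series V)"
  then obtain z where "Z = cls V z" "z \<in> series V" by (auto simp: carrier_sym_series)
  then show "X \<oplus>\<^bsub>sym_series V\<^esub> Y \<oplus>\<^bsub>sym_series V\<^esub> Z = X \<oplus>\<^bsub>sym_series V\<^esub> (Y \<oplus>\<^bsub>sym_series V\<^esub> Z)"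
    using e by (simp add: add_cls series_add add.assoc)
qed

lemma finsum_cls:
  assumes "finite A" "\<And>i. i \<in> A \<Longrightarrow> F i \<in> series V"
  shows "finsum (sym_series V) (\<lambda>i. cls V (F i)) A = cls V (\<lambda>g. \<Sum>i\<in>A. F i g)"
  using assms
proof (induction A)
  case empty
  interpret abelian_monoid "sym_series V" by (rule abelian_monoid_sym_series)
  show ?case by (simp add: zero_cls)
next
  case (insert a A)
  interpret abelian_monoid "sym_series V" by (rule abelian_monoid_sym_series)
  have "finsum (sym_series V) (\<lambda>i. cls V (F i)) (insert a A) =
      cls V (F a) \<oplus>\<^bsub>sym_series V\<^esub> finsum (sym_series V) (\<lambda>i. cls V (F i)) A"
    using insert by (intro finsum_insert) (auto simp: cls_carrier)
  also have "\<dots> = cls V (\<lambda>g. F a g + (\<Sum>i\<in>A. F i g))"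
    using insert by (simp add: add_cls series_sum)
  finally show ?case using insert by simp
qed

lemma series_mult_gamma:
  "series_mult (\<lambda>g. if g = 1 then single [] 1 else 0) y g = (if g = 0 then 0 else y (g - 1))"
proof (cases "g = 0")
  case False
  have "series_mult (\<lambda>g. if g = 1 then single [] 1 else 0) y g =
      (\<Sum>i\<le>g. if i = 1 then y (g - 1) else 0)"
    unfolding series_mult_def by (intro sum.cong) auto
  also have "\<dots> = y (g - 1)" using False by simp
  finally show ?thesis using False by simp
qed (simp add: series_mult_def)

end

lemma keys_contraction:
  assumes "distinct ls" "(G, f) \<in> marked_graphs g n (length ls)" "\<And>l. l \<in> set ls \<Longrightarrow> w l \<in> lists X"
  shows "keys (contraction D h G f (map w ls)) \<subseteq> lists X"
  unfolding contraction_def Let_def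
proof (rule keys_sum_subset)
  fix \<phi> assume \<phi>: "\<phi> \<in> decorations G f (map w ls)"
  have G: "labeled_graph G" "bij_betw f {1..length ls} (verts G)" using assms(2) by (auto simp: marked_graphs_def)
  interpret decorated ls w G f \<phi> using assms(1) G \<phi> by unfold_locales
  have "concat (map w ls) ! \<phi> a \<in> X" if "a \<in> leaves G" for a
  proof -
    have "\<phi> a < length (concat (map w ls))"
      using bij_betwE [OF bij_dec] that by (auto simp: leaves_def length_idx)
    then have "concat (map w ls) ! \<phi> a \<in> set (concat (map w ls))" by (rule nth_mem)
    then show ?thesis using assms(3) by auto
  qed
  moreover have "finite (leaves G)" using G by (simp add: leaves_def labeled_graph_def)
  ultimately show "keys (single (map (\<lambda>a. concat (map w ls) ! \<phi> a) (sorted_list_of_set (leaves G))) c) \<subseteq> lists X" for c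
    by auto
qed

section \<open>Graph sums on classes of series\<close>

context even_form
begin

lemma keys_graph_sum:
  assumes ls: "distinct ls" and y: "\<And>l. l \<in> set ls \<Longrightarrow> y l \<in> series V"
  shows "keys (graph_sum deg h (map y ls) g) \<subseteq> words"
proof -
  have gt: "keys (graph_term deg h (SOME X. X \<in> \<Gamma>) (map y ls)) \<subseteq> words"
    if "\<Gamma> \<in> graph_classes g n (length ls)" for \<Gamma> n
  proof -
    obtain G f where e: "(SOME X. X \<in> \<Gamma>) = (G, f)" by fastforce
    have X: "(G, f) \<in> marked_graphs g n (length ls)" using some_graph(2) [OF that] e by simp
    show ?thesis
      unfolding e graph_term_choices [OF ls X order_refl]
    proof (intro keys_sum_subset order_trans [OF keys_smul] keys_contraction [OF ls X])
      fix z l assume "z \<in> {z \<in> choices g ls y. fits ls (G, f) z}" "l \<in> set ls"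
      then show "snd (z l) \<in> words"
        using y [of l] by (fastforce simp: choices_def series_def PiE_def Pi_def)
    qed
  qed
  show ?thesis
    unfolding graph_sum_def Sum_any.expand_set length_map Let_def
    by (intro keys_sum_subset order_trans [OF keys_smul] gt)
qed

text \<open>Graph sums are well defined on classes: each representative gives a sum over matchings,
  and \<open>total_sum_scong\<close> compares these. The bound on genera grows with the coefficient
  \<open>g\<close>, as every coefficient needs its own.\<close>

lemma graph_sum_cls:
  assumes ls: "distinct ls" and X: "\<And>l. l \<in> set ls \<Longrightarrow> X l \<in> carrier (sym_series V)"
    and y: "\<And>l. l \<in> set ls \<Longrightarrow> y l \<in> X l"
  shows "(\<Union>ys\<in>listset (map X ls). cls V (graph_sum deg h ys)) = cls V (\<lambda>g. total_sum (g + length ls) ls y g)"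
    and "(\<lambda>g. total_sum (g + length ls) ls y g) \<in> series V"
proof -
  have ys: "y l \<in> series V" if "l \<in> set ls" for l using cls_of_mem(1) [OF X y] that by blast
  show S: "(\<lambda>g. total_sum (g + length ls) ls y g) \<in> series V"
    by (intro seriesI keys_total_sum ys)
  have "cls V (graph_sum deg h vs) = cls V (\<lambda>g. total_sum (g + length ls) ls y g)"
    if vs: "vs \<in> listset (map X ls)" for vs
  proof -
    define y' where "y' = (\<lambda>l. vs ! pos ls l)"
    have len: "length vs = length ls" and mem: "\<And>r. r < length ls \<Longrightarrow> vs ! r \<in> X (ls ! r)"
      using vs by (auto simp: mem_listset)
    have e: "vs = map y' ls"
      by (rule nth_equalityI) (simp_all add: len y'_def pos_nth [OF ls])
    have yX: "y' l \<in> X l" if "l \<in> set ls" for l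
      using mem [OF pos_less [OF that]] nth_pos [OF that] by (simp add: y'_def)
    have ys': "y' l \<in> series V" if "l \<in> set ls" for l using cls_of_mem(1) [OF X yX] that by blast
    have rel: "(y' l, y l) \<in> series_rel V" if "l \<in> set ls" for l
      using cls_of_mem(2) [OF X yX, of l] y [of l] that mem_cls by blast
    show ?thesis
      unfolding e
    proof (intro cls_eqI series_relI S)
      show "graph_sum deg h (map y' ls) \<in> series V"
        by (intro seriesI keys_graph_sum ls ys')
      fix g
      have "graph_sum deg h (map y' ls) g \<simeq> total_sum (g + length ls) ls y' g"
        using ls ys' by (intro graph_sum_total_sum) auto
      also have "\<dots> \<simeq> total_sum (g + length ls) ls y g"
        using ls rel by (rule total_sum_scong)
      finally show "graph_sum deg h (map y' ls) g \<simeq> total_sum (g + length ls) ls y g" .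
    qed
  qed
  moreover have "map y ls \<in> listset (map X ls)" using y by (simp add: mem_listset)
  ultimately show "(\<Union>ys\<in>listset (map X ls). cls V (graph_sum deg h ys)) = cls V (\<lambda>g. total_sum (g + length ls) ls y g)"
    by blast
qed

text \<open>Assembles the congruences of \<open>total_sum_product\<close> over all coefficients into
  one equation between classes. The degrees \<open>p\<close> only have to be correct modulo
  2.\<close>

proposition graph_sum_product:
  fixes X :: "nat \<Rightarrow> (nat \<Rightarrow> 'x list \<Rightarrow>\<^sub>0 'k) set" and p :: "nat \<Rightarrow> int"
  defines "K \<equiv> \<lambda>Xs. \<Union>ys\<in>listset Xs. cls V (graph_sum deg h ys)"
  assumes X: "\<And>l. l \<in> {1..m} \<Longrightarrow> X l \<in> carrier (sym_series V)"
    and par: "\<And>l. l \<in> {1..m} \<Longrightarrow> \<exists>y\<in>X l. \<forall>g. \<forall>w\<in>keys (y g). even (sum_list (map deg w) - p l)"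
    and ij: "i \<in> {1..m}" "j \<in> {1..m}" "i \<noteq> j"
  defines "rest \<equiv> filter (\<lambda>l. l \<noteq> i \<and> l \<noteq> j) [1..<Suc m]"
  shows "koszul p (i # j # rest) \<odot>\<^bsub>sym_series V\<^esub> K ((X i \<otimes>\<^bsub>sym_series V\<^esub> X j) # map X rest)
     = (cls V (\<lambda>g. if g = 1 then single [] 1 else 0) \<otimes>\<^bsub>sym_series V\<^esub> K (map X [1..<Suc m]))
       \<oplus>\<^bsub>sym_series V\<^esub>
       finsum (sym_series V)
         (\<lambda>(L1, L2). koszul p (sorted_list_of_set L1 @ sorted_list_of_set L2) \<odot>\<^bsub>sym_series V\<^esub>
            (K (map X (sorted_list_of_set L1)) \<otimes>\<^bsub>sym_series V\<^esub> K (map X (sorted_list_of_set L2))))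
         (bipartitions {1..m} i j)"
proof -
  define ls where "ls = [1..<Suc m]"
  \<comment> \<open>Representatives with words of the prescribed parity are fixed once; all classes
    involved are then computed from them.\<close>
  obtain y where yX: "\<And>l. l \<in> {1..m} \<Longrightarrow> y l \<in> X l"
    and ypar: "\<And>l g w. l \<in> {1..m} \<Longrightarrow> w \<in> keys (y l g) \<Longrightarrow> even (sum_list (map deg w) - p l)"
    using par by metis
  have ls: "distinct ls" "set ls = {1..m}" "length ls = m" "sorted_wrt (<) ls" by (auto simp: ls_def simp del: upt_Suc)
  have y: "y l \<in> series V" "X l = cls V (y l)" if "l \<in> {1..m}" for l
    using cls_of_mem [OF X yX] that by blast+
  have rest: "distinct (i # j # rest)" "set (i # j # rest) = set ls"
    using ij by (auto simp: rest_def ls(2))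
  have len: "length (i # rest) = m - 1" "m \<ge> 1"
    using distinct_card [OF rest(1)] distinct_card [OF ls(1)] rest(2) ls(3) by auto
  have kos: "koszul p ps = (lsign p ls ps :: 'k)" if "distinct ps" "set ps = {1..m}" for ps
    using that ls by (intro koszul_eq_lsign) auto
  define t where "t = (\<lambda>L g. total_sum (g + length L) L y g)"
  have K: "K (map X L) = cls V (t L)" "t L \<in> series V" if "distinct L" "set L \<subseteq> {1..m}" for L
    unfolding t_def K_def using graph_sum_cls [OF that(1), of X y] that(2) X yX by blast+
  let ?y = "y(i := series_mult (y i) (y j))" and ?X = "X(i := X i \<otimes>\<^bsub>sym_series V\<^esub> X j)"
  define t' where "t' = (\<lambda>g. total_sum (g + length (i # rest)) (i # rest) ?y g)"
  have prod: "X i \<otimes>\<^bsub>sym_series V\<^esub> X j = cls V (series_mult (y i) (y j))"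
    using y ij by (simp add: mult_cls)
  have ym: "series_mult (y i) (y j) \<in> series V" using y ij by (simp add: series_mult_closed)
  have eqm: "(X i \<otimes>\<^bsub>sym_series V\<^esub> X j) # map X rest = map ?X (i # rest)" using rest(1) by auto
  have Kt: "K (map ?X (i # rest)) = cls V t'" and t': "t' \<in> series V"
  proof -
    have "?X l \<in> carrier (sym_series V)" "?y l \<in> ?X l" if "l \<in> set (i # rest)" for l
      using that X yX prod ym cls_carrier cls_self rest(2) ls(2) by auto
    then show "K (map ?X (i # rest)) = cls V t'" "t' \<in> series V"
      unfolding t'_def K_def using graph_sum_cls [of "i # rest" ?X ?y] rest(1) by auto
  qed
  have lhs: "koszul p (i # j # rest) \<odot>\<^bsub>sym_series V\<^esub> K ((X i \<otimes>\<^bsub>sym_series V\<^esub> X j) # map X rest)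
      = cls V (\<lambda>g. smul (lsign p ls (i # j # rest)) (t' g))"
    using rest(2) ls(2) unfolding eqm Kt by (simp only: kos [OF rest(1)] smult_cls [OF t'])
  let ?\<gamma> = "\<lambda>g. if g = 1 then single [] 1 else 0 :: 'x list \<Rightarrow>\<^sub>0 'k"
  have \<gamma>: "?\<gamma> \<in> series V" by (auto simp: series_def)
  have tl: "t ls \<in> series V" using K(2) ls by simp
  define F where "F = (\<lambda>(L1, L2) g. smul (lsign p ls (sorted_list_of_set L1 @ sorted_list_of_set L2))
      (series_mult (t (sorted_list_of_set L1)) (t (sorted_list_of_set L2)) g))"
  have sl: "distinct (sorted_list_of_set L) \<and> set (sorted_list_of_set L) = L" if "L \<subseteq> set ls" for L
    using finite_subset [OF that] by simp
  have F: "F x \<in> series V" "(case x of (L1, L2) \<Rightarrow> koszul p (sorted_list_of_set L1 @ sorted_list_of_set L2) \<odot>\<^bsub>sym_series V\<^esub>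
            (K (map X (sorted_list_of_set L1)) \<otimes>\<^bsub>sym_series V\<^esub> K (map X (sorted_list_of_set L2)))) = cls V (F x)"
    if xb: "x \<in> bipartitions {1..m} i j" for x
  proof -
    obtain L1 L2 where x: "x = (L1, L2)" "L1 \<union> L2 = set ls" "L1 \<inter> L2 = {}"
      using xb ls(2) by (auto simp: bipartitions_def)
    have s: "distinct (sorted_list_of_set L1)" "set (sorted_list_of_set L1) = L1"
      "distinct (sorted_list_of_set L2)" "set (sorted_list_of_set L2) = L2"
      using sl [of L1] sl [of L2] x(2) by auto
    have sub: "L1 \<subseteq> {1..m}" "L2 \<subseteq> {1..m}" using x(2) ls(2) by auto
    have ks: "koszul p (sorted_list_of_set L1 @ sorted_list_of_set L2) =
        (lsign p ls (sorted_list_of_set L1 @ sorted_list_of_set L2) :: 'k)"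
      using s x ls(2) by (intro kos) auto
    note K1 = K [OF s(1)] and K2 = K [OF s(3)]
    show "F x \<in> series V"
      unfolding F_def x using K1(2) K2(2) s sub by (simp add: series_smul series_mult_closed)
    show "(case x of (L1, L2) \<Rightarrow> koszul p (sorted_list_of_set L1 @ sorted_list_of_set L2) \<odot>\<^bsub>sym_series V\<^esub>
            (K (map X (sorted_list_of_set L1)) \<otimes>\<^bsub>sym_series V\<^esub> K (map X (sorted_list_of_set L2)))) = cls V (F x)"
      unfolding F_def x using K1 K2 s sub by (simp add: ks mult_cls smult_cls series_mult_closed)
  qed
  have fin: "finite (bipartitions {1..m} i j)" by (rule finite_bipartitions) simp
  interpret AM: abelian_monoid "sym_series V" by (rule abelian_monoid_sym_series)
  have "finsum (sym_series V)
         (\<lambda>(L1, L2). koszul p (sorted_list_of_set L1 @ sorted_list_of_set L2) \<odot>\<^bsub>sym_series V\<^esub>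
            (K (map X (sorted_list_of_set L1)) \<otimes>\<^bsub>sym_series V\<^esub> K (map X (sorted_list_of_set L2))))
         (bipartitions {1..m} i j) = finsum (sym_series V) (\<lambda>x. cls V (F x)) (bipartitions {1..m} i j)"
    using F by (intro AM.finsum_cong') (auto simp: cls_carrier)
  also have "\<dots> = cls V (\<lambda>g. \<Sum>x\<in>bipartitions {1..m} i j. F x g)"
    using fin F(1) by (rule finsum_cls)
  finally have fs: "finsum (sym_series V)
         (\<lambda>(L1, L2). koszul p (sorted_list_of_set L1 @ sorted_list_of_set L2) \<odot>\<^bsub>sym_series V\<^esub>
            (K (map X (sorted_list_of_set L1)) \<otimes>\<^bsub>sym_series V\<^esub> K (map X (sorted_list_of_set L2))))
         (bipartitions {1..m} i j) = cls V (\<lambda>g. \<Sum>x\<in>bipartitions {1..m} i j. F x g)" .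
  have Fs: "(\<lambda>g. \<Sum>x\<in>bipartitions {1..m} i j. F x g) \<in> series V" using F(1) by (rule series_sum)
  have "cls V (\<lambda>g. smul (lsign p ls (i # j # rest)) (t' g)) =
      cls V (\<lambda>g. series_mult ?\<gamma> (t ls) g + (\<Sum>x\<in>bipartitions {1..m} i j. F x g))"
  proof (intro cls_eqI series_relI series_smul series_add t' Fs)
    show "series_mult ?\<gamma> (t ls) \<in> series V" using \<gamma> tl by (rule series_mult_closed)
    fix g
    \<comment> \<open>One bound that is large enough for every graph sum in the coefficient
      \<open>g\<close>, so \<open>total_sum_bound\<close> makes all terms comparable.\<close>
    let ?B = "g + m"
    have tB: "t L a = total_sum ?B L y a" if "length L \<le> m" "a \<le> g" for L a
      unfolding t_def using that by (intro total_sum_bound) auto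
    have "t' g = total_sum ?B (i # rest) ?y g"
      unfolding t'_def using len by (intro total_sum_bound) auto
    then have "smul (lsign p ls (i # j # rest)) (t' g) =
        smul (lsign p ls (i # j # rest)) (total_sum ?B (i # rest) ?y g)" by simp
    also have "\<dots> \<simeq> (if g = 0 then 0 else total_sum ?B ls y (g - 1)) +
      (\<Sum>(L1, L2)\<in>bipartitions (set ls) i j. smul (lsign p ls (sorted_list_of_set L1 @ sorted_list_of_set L2))
      (\<Sum>a\<le>g. concat_mult (total_sum ?B (sorted_list_of_set L1) y a) (total_sum ?B (sorted_list_of_set L2) y (g - a))))"
      using ls ij y ypar by (intro total_sum_product rest sl) auto
    also have "\<dots> = series_mult ?\<gamma> (t ls) g + (\<Sum>x\<in>bipartitions {1..m} i j. F x g)"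
    proof (rule arg_cong2 [where f = "(+)"])
      show "(if g = 0 then 0 else total_sum ?B ls y (g - 1)) = series_mult ?\<gamma> (t ls) g"
        unfolding series_mult_gamma using tB [of ls "g - 1"] ls(3) by simp
      show "(\<Sum>(L1, L2)\<in>bipartitions (set ls) i j. smul (lsign p ls (sorted_list_of_set L1 @ sorted_list_of_set L2))
        (\<Sum>a\<le>g. concat_mult (total_sum ?B (sorted_list_of_set L1) y a) (total_sum ?B (sorted_list_of_set L2) y (g - a)))) =
        (\<Sum>x\<in>bipartitions {1..m} i j. F x g)"
      proof (rule sum.cong)
        fix x assume "x \<in> bipartitions {1..m} i j"
        then obtain L1 L2 where x: "x = (L1, L2)" "L1 \<union> L2 = {1..m}" by (auto simp: bipartitions_def)
        have "card L1 \<le> m" "card L2 \<le> m" using card_mono [of "{1..m}" L1] card_mono [of "{1..m}" L2] x(2) by auto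
        then show "(case x of (L1, L2) \<Rightarrow> smul (lsign p ls (sorted_list_of_set L1 @ sorted_list_of_set L2))
          (\<Sum>a\<le>g. concat_mult (total_sum ?B (sorted_list_of_set L1) y a) (total_sum ?B (sorted_list_of_set L2) y (g - a)))) = F x g"
          by (simp add: F_def x series_mult_def tB)
      qed (simp add: ls(2))
    qed
    finally show "smul (lsign p ls (i # j # rest)) (t' g) \<simeq> series_mult ?\<gamma> (t ls) g + (\<Sum>x\<in>bipartitions {1..m} i j. F x g)" .
  qed
  moreover have "K (map X [1..<Suc m]) = cls V (t ls)" using K(1) [OF ls(1)] ls(2) by (simp add: ls_def)
  ultimately show ?thesis
    unfolding lhs fs using \<gamma> tl Fs by (simp add: mult_cls add_cls series_mult_closed)
qed

end


section \<open>The Mukai pairing on words\<close>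

definition lfun :: "('x \<Rightarrow> 'k::field) \<Rightarrow> ('x \<Rightarrow>\<^sub>0 'k) \<Rightarrow> 'k" where
  "lfun f p = (\<Sum>x\<in>keys p. lookup p x * f x)"

text \<open>Scalars are identified with the free vector space on one point, so that linearity is
  inherited from \<open>lin_ext\<close>.\<close>

lemma lfun_lin_ext: "lfun f p = lookup (lin_ext (\<lambda>x. single () (f x)) p) ()"
  by (simp add: lfun_def lin_ext_def lookup_sum)

lemma lfun_add: "lfun f (p + q) = lfun f p + lfun f q"
  by (simp add: lfun_lin_ext lin_ext_add lookup_add)

lemma lfun_smul: "lfun f (smul c p) = c * lfun f p"
  by (simp add: lfun_lin_ext lin_ext_smul lookup_smul)

lemma lfun_0 [simp]: "lfun f 0 = 0"
  by (simp add: lfun_def)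

lemma lfun_diff: "lfun f (p - q) = lfun f p - lfun f q"
  by (simp add: lfun_lin_ext lin_ext_diff lookup_minus)

lemma lfun_single [simp]: "lfun f (single x c) = c * f x"
  by (simp add: lfun_lin_ext)

lemma lfun_comp: "lfun f (lin_ext g p) = lfun (\<lambda>x. lfun f (g x)) p"
proof -
  have "single () (lfun f q) = lin_ext (\<lambda>x. single () (f x)) q" for q
    by (rule poly_mapping_eqI) (simp add: lfun_lin_ext)
  then show ?thesis by (simp add: lfun_lin_ext lin_ext_comp)
qed

lemma lfun_cong: "(\<And>x. x \<in> keys p \<Longrightarrow> f x = g x) \<Longrightarrow> lfun f p = lfun g p"
  unfolding lfun_def by (intro sum.cong) auto

lemma lfun_fun_add: "lfun (\<lambda>x. f x + g x) p = lfun f p + lfun g p"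
  by (simp add: lfun_def distrib_left sum.distrib)

lemma lfun_fun_mult: "lfun (\<lambda>x. c * f x) p = c * lfun f p"
  by (simp add: lfun_def sum_distrib_left mult_ac)

lemma bilin_ext_lfun: "bilin_ext f p q = lfun (\<lambda>x. lfun (f x) q) p"
  by (simp add: bilin_ext_def lfun_def sum_distrib_left mult.assoc)

text \<open>The part of \<open>mpath\<close> that makes sense for empty lists and is local, so that
  it splits along concatenations.\<close>

fun path_ok :: "('k, 'o, 'v) ainf \<Rightarrow> ('o, 'v) hmor list \<Rightarrow> 'o \<Rightarrow> bool" where
  "path_ok C [] \<tau> \<longleftrightarrow> True"
| "path_ok C (a # as) \<tau> \<longleftrightarrow> src a \<in> Obj C \<and> vct a \<in> Hom C (src a) (hd (map src as @ [\<tau>])) (dg a) \<and> path_ok C as \<tau>"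

lemma mpath_iff: "mpath C as \<tau> \<longleftrightarrow> as \<noteq> [] \<and> \<tau> \<in> Obj C \<and> path_ok C as \<tau>"
proof -
  have "(\<forall>r<length as. src (as ! r) \<in> Obj C \<and>
     vct (as ! r) \<in> Hom C (src (as ! r)) ((map src as @ [\<tau>]) ! Suc r) (dg (as ! r))) \<longleftrightarrow> path_ok C as \<tau>"
  proof (induction as)
    case (Cons a as)
    have "hd (map src as @ [\<tau>]) = (map src as @ [\<tau>]) ! 0" by (rule hd_conv_nth) simp
    then show ?case using Cons.IH by (auto simp: All_less_Suc2)
  qed simp
  then show ?thesis by (simp add: mpath_def)
qed

text \<open>The object at which a path with target \<open>\<tau>\<close> begins; for the empty path
  this is \<open>\<tau>\<close> itself.\<close>

abbreviation nxt :: "('o, 'v) hmor list \<Rightarrow> 'o \<Rightarrow> 'o" where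
  "nxt as \<tau> \<equiv> hd (map src as @ [\<tau>])"

lemma path_ok_append: "path_ok C (as @ bs) \<tau> \<longleftrightarrow> path_ok C as (nxt bs \<tau>) \<and> path_ok C bs \<tau>"
  by (induction as) (auto simp: hd_append)

lemma nxt_append: "nxt (as @ bs) \<tau> = nxt as (nxt bs \<tau>)"
  by (simp add: hd_append)

lemma nxt_obj: "path_ok C as \<tau> \<Longrightarrow> \<tau> \<in> Obj C \<Longrightarrow> nxt as \<tau> \<in> Obj C"
  by (cases as) auto

lemma sdeg_append: "sdeg (as @ bs) = sdeg as + sdeg bs"
  by (simp add: sdeg_def)

lemma sdeg_Cons: "sdeg (a # as) = dg a - 1 + sdeg as"
  by (simp add: sdeg_def)

lemma sdeg_Nil [simp]: "sdeg [] = 0"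
  by (simp add: sdeg_def)

lemma split_three: "i < j \<Longrightarrow> a = take (Suc i) a @ drop (Suc i) (take j a) @ drop j a"
proof -
  assume "i < j"
  then have "take (Suc i) a = take (Suc i) (take j a)" by (simp add: min_def)
  then show ?thesis by (metis append.assoc append_take_drop_id)
qed

lemma nxt_drop: "j \<le> length a \<Longrightarrow> a \<noteq> [] \<Longrightarrow> src (a ! (j mod length a)) = nxt (drop j a) (src (hd a))"
  by (cases "j = length a") (auto simp: hd_conv_nth hd_drop_conv_nth hd_append hd_map)

text \<open>A marked letter of the cyclic word lies either in the outer arc, which runs through the
  end back to the start, or in the inner arc. The surroundings \<open>U\<close>, \<open>W\<close>,
  \<open>X\<close> do not depend on the letter, which is what linearity requires. The last clause
  says that a letter other than the first has company in the outer arc, namely the first letter;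
  this serves the vanishing on units.\<close>

lemma rotation_split:
  assumes "i < j" "j \<le> Suc (length us + length vs)"
  shows "(\<exists>U W X. (\<forall>z. drop j (us @ z # vs) @ take (Suc i) (us @ z # vs) = U @ z # W \<and>
       drop (Suc i) (take j (us @ z # vs)) = X) \<and> (us \<noteq> [] \<longrightarrow> U \<noteq> [] \<or> W \<noteq> [])) \<or>
    (\<exists>U W X. \<forall>z. drop j (us @ z # vs) @ take (Suc i) (us @ z # vs) = X \<and>
       drop (Suc i) (take j (us @ z # vs)) = U @ z # W)"
proof -
  let ?n = "length us"
  consider "?n \<le> i" | "j \<le> ?n" | "i < ?n" "?n < j" by linarith
  then show ?thesis
  proof cases
    case 1
    then have "drop j (us @ z # vs) @ take (Suc i) (us @ z # vs) = (drop (j - Suc ?n) vs @ us) @ z # take (i - ?n) vs \<and>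
       drop (Suc i) (take j (us @ z # vs)) = drop (i - ?n) (take (j - Suc ?n) vs)" for z
      using assms by (auto simp: drop_Cons' take_Cons' Suc_diff_le)
    then show ?thesis by blast
  next
    case 2
    then have "drop j (us @ z # vs) @ take (Suc i) (us @ z # vs) = drop j us @ z # (vs @ take (Suc i) us) \<and>
       drop (Suc i) (take j (us @ z # vs)) = drop (Suc i) (take j us)" for z
      using assms by auto
    moreover have "us \<noteq> [] \<longrightarrow> drop j us \<noteq> [] \<or> vs @ take (Suc i) us \<noteq> []" by simp
    ultimately show ?thesis by blast
  next
    case 3
    then have "drop j (us @ z # vs) @ take (Suc i) (us @ z # vs) = drop (j - Suc ?n) vs @ take (Suc i) us \<and>
       drop (Suc i) (take j (us @ z # vs)) = drop (Suc i) us @ z # take (j - Suc ?n) vs" for z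
      using assms by (auto simp: drop_Cons' take_Cons')
    then show ?thesis by blast
  qed
qed

section \<open>Linearity and unitality of nested operations\<close>

locale ainf_category =
  fixes C :: "('k::field, 'o, 'v::ab_group_add) ainf"
  assumes ainf: "A_infinity_category C"
begin

sublocale vs: vector_space "scl C"
  using ainf by (simp add: A_infinity_category_def)

lemma Hom_subspace: "\<kappa> \<in> Obj C \<Longrightarrow> \<mu> \<in> Obj C \<Longrightarrow> vs.subspace (Hom C \<kappa> \<mu> e)"
  using ainf by (simp add: A_infinity_category_def)

lemma op_mem: "mpath C as \<tau> \<Longrightarrow> op_of C as \<tau> \<in> Hom C (src (hd as)) \<tau> (sdeg as + 2)"
  using ainf unfolding A_infinity_category_def by (elim conjE) blast

lemma op_add: "mpath C (us @ Mor \<kappa> e x # vs) \<tau> \<Longrightarrow> mpath C (us @ Mor \<kappa> e y # vs) \<tau> \<Longrightarrow>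
    op_of C (us @ Mor \<kappa> e (x + y) # vs) \<tau> = op_of C (us @ Mor \<kappa> e x # vs) \<tau> + op_of C (us @ Mor \<kappa> e y # vs) \<tau>"
  using ainf unfolding A_infinity_category_def by (elim conjE) blast

lemma op_scale: "mpath C (us @ Mor \<kappa> e x # vs) \<tau> \<Longrightarrow>
    op_of C (us @ Mor \<kappa> e (scl C c x) # vs) \<tau> = scl C c (op_of C (us @ Mor \<kappa> e x # vs) \<tau>)"
  using ainf unfolding A_infinity_category_def by (elim conjE) blast

lemma op_ident: "mpath C (us @ ident_mor C \<kappa> # vs) \<tau> \<Longrightarrow> length us + length vs \<ge> 2 \<Longrightarrow>
    op_of C (us @ ident_mor C \<kappa> # vs) \<tau> = 0"
  using ainf unfolding A_infinity_category_def by (elim conjE) (simp only: )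

lemma mpath_lin:
  assumes "mpath C (us @ Mor \<kappa> e x # vs) \<tau>" "mpath C (us @ Mor \<kappa> e y # vs) \<tau>"
  shows "mpath C (us @ Mor \<kappa> e (scl C \<alpha> x + scl C \<beta> y) # vs) \<tau>"
proof -
  have ob: "\<kappa> \<in> Obj C" "nxt vs \<tau> \<in> Obj C" using assms(1) by (auto simp: mpath_iff path_ok_append intro: nxt_obj)
  have "scl C \<alpha> x + scl C \<beta> y \<in> Hom C \<kappa> (nxt vs \<tau>) e"
    using assms Hom_subspace [OF ob] by (auto simp: mpath_iff path_ok_append intro!: vs.subspace_add vs.subspace_scale)
  then show ?thesis using assms by (simp add: mpath_iff path_ok_append)
qed

lemma mpath_scale:
  assumes "mpath C (us @ Mor \<kappa> e x # vs) \<tau>"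
  shows "mpath C (us @ Mor \<kappa> e (scl C \<alpha> x) # vs) \<tau>"
  using mpath_lin [OF assms assms, of \<alpha> 0] by simp

lemma op_lin:
  assumes "mpath C (us @ Mor \<kappa> e x # vs) \<tau>" "mpath C (us @ Mor \<kappa> e y # vs) \<tau>"
  shows "op_of C (us @ Mor \<kappa> e (scl C \<alpha> x + scl C \<beta> y) # vs) \<tau> =
    scl C \<alpha> (op_of C (us @ Mor \<kappa> e x # vs) \<tau>) + scl C \<beta> (op_of C (us @ Mor \<kappa> e y # vs) \<tau>)"
  using assms by (simp add: op_add mpath_scale op_scale)

lemma op_zero:
  assumes "mpath C (us @ Mor \<kappa> e x # vs) \<tau>"
  shows "op_of C (us @ Mor \<kappa> e 0 # vs) \<tau> = 0"
  using op_scale [OF assms, of 0] by simp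

text \<open>In the Mukai pairing the four pieces are a_j ... a_p a_0 ... a_i, then a_(i+1) ...
  a_(j-1), then b_l ... b_q b_0 ... b_t, and b_(t+1) ... b_(l-1).\<close>

definition nested_op :: "('o, 'v) hmor list \<Rightarrow> ('o, 'v) hmor list \<Rightarrow> ('o, 'v) hmor list \<Rightarrow> ('o, 'v) hmor list \<Rightarrow>
    'o \<Rightarrow> 'o \<Rightarrow> ('o, 'v) hmor \<Rightarrow> 'v" where
  "nested_op A1 A2 B1 B2 \<tau> \<mu> c = op_of C (A1 @ [mop C (A2 @ [c] @ B1) \<tau>] @ B2) \<mu>"

definition nested_path :: "('o, 'v) hmor list \<Rightarrow> ('o, 'v) hmor list \<Rightarrow> ('o, 'v) hmor list \<Rightarrow> ('o, 'v) hmor list \<Rightarrow>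
    'o \<Rightarrow> 'o \<Rightarrow> ('o, 'v) hmor \<Rightarrow> bool" where
  "nested_path A1 A2 B1 B2 \<tau> \<mu> c \<longleftrightarrow> mpath C (A2 @ [c] @ B1) \<tau> \<and> mpath C (A1 @ [mop C (A2 @ [c] @ B1) \<tau>] @ B2) \<mu>"

lemma mop_slot: "mop C (us @ Mor \<kappa> e x # vs) \<tau> =
    Mor (nxt us \<kappa>) (sdeg us + e + sdeg vs + 1) (op_of C (us @ Mor \<kappa> e x # vs) \<tau>)"
  by (cases us) (simp_all add: mop_def sdeg_append sdeg_Cons)

text \<open>In the outer pieces this is linearity of one operation. In the inner pieces it is
  applied twice: the inner result is linear in the letter, and its source and degree do not depend
  on the letter, so the outer operation is linear in it.\<close>

lemma nested_op_lin:
  fixes \<alpha> \<beta> x y \<kappa> e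
  defines "Z0 \<equiv> Mor \<kappa> e (scl C \<alpha> x + scl C \<beta> y)" and "Z1 \<equiv> Mor \<kappa> e x" and "Z2 \<equiv> Mor \<kappa> e y"
  shows "nested_path (U @ Z1 # W) A2 B1 B2 \<tau> \<mu> c \<Longrightarrow> nested_path (U @ Z2 # W) A2 B1 B2 \<tau> \<mu> c \<Longrightarrow>
      nested_op (U @ Z0 # W) A2 B1 B2 \<tau> \<mu> c = scl C \<alpha> (nested_op (U @ Z1 # W) A2 B1 B2 \<tau> \<mu> c) + scl C \<beta> (nested_op (U @ Z2 # W) A2 B1 B2 \<tau> \<mu> c)"
    and "nested_path A1 A2 B1 (U @ Z1 # W) \<tau> \<mu> c \<Longrightarrow> nested_path A1 A2 B1 (U @ Z2 # W) \<tau> \<mu> c \<Longrightarrow>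
      nested_op A1 A2 B1 (U @ Z0 # W) \<tau> \<mu> c = scl C \<alpha> (nested_op A1 A2 B1 (U @ Z1 # W) \<tau> \<mu> c) + scl C \<beta> (nested_op A1 A2 B1 (U @ Z2 # W) \<tau> \<mu> c)"
    and "nested_path A1 (U @ Z1 # W) B1 B2 \<tau> \<mu> c \<Longrightarrow> nested_path A1 (U @ Z2 # W) B1 B2 \<tau> \<mu> c \<Longrightarrow>
      nested_op A1 (U @ Z0 # W) B1 B2 \<tau> \<mu> c = scl C \<alpha> (nested_op A1 (U @ Z1 # W) B1 B2 \<tau> \<mu> c) + scl C \<beta> (nested_op A1 (U @ Z2 # W) B1 B2 \<tau> \<mu> c)"
    and "nested_path A1 A2 (U @ Z1 # W) B2 \<tau> \<mu> c \<Longrightarrow> nested_path A1 A2 (U @ Z2 # W) B2 \<tau> \<mu> c \<Longrightarrow>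
      nested_op A1 A2 (U @ Z0 # W) B2 \<tau> \<mu> c = scl C \<alpha> (nested_op A1 A2 (U @ Z1 # W) B2 \<tau> \<mu> c) + scl C \<beta> (nested_op A1 A2 (U @ Z2 # W) B2 \<tau> \<mu> c)"
proof -
  show "nested_path (U @ Z1 # W) A2 B1 B2 \<tau> \<mu> c \<Longrightarrow> nested_path (U @ Z2 # W) A2 B1 B2 \<tau> \<mu> c \<Longrightarrow>
      nested_op (U @ Z0 # W) A2 B1 B2 \<tau> \<mu> c = scl C \<alpha> (nested_op (U @ Z1 # W) A2 B1 B2 \<tau> \<mu> c) + scl C \<beta> (nested_op (U @ Z2 # W) A2 B1 B2 \<tau> \<mu> c)"
    unfolding nested_op_def nested_path_def Z0_def Z1_def Z2_def append.assoc append_Cons by (elim conjE) (rule op_lin)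
  show "nested_path A1 A2 B1 (U @ Z1 # W) \<tau> \<mu> c \<Longrightarrow> nested_path A1 A2 B1 (U @ Z2 # W) \<tau> \<mu> c \<Longrightarrow>
      nested_op A1 A2 B1 (U @ Z0 # W) \<tau> \<mu> c = scl C \<alpha> (nested_op A1 A2 B1 (U @ Z1 # W) \<tau> \<mu> c) + scl C \<beta> (nested_op A1 A2 B1 (U @ Z2 # W) \<tau> \<mu> c)"
    using op_lin [of "A1 @ [mop C (A2 @ [c] @ B1) \<tau>] @ U" \<kappa> e x W \<mu> y \<alpha> \<beta>]
    unfolding nested_op_def nested_path_def Z0_def Z1_def Z2_def by simp
  have inner: "op_of C (A1 @ [mop C (U @ Z0 # W) \<tau>] @ B2) \<mu> =
      scl C \<alpha> (op_of C (A1 @ [mop C (U @ Z1 # W) \<tau>] @ B2) \<mu>) + scl C \<beta> (op_of C (A1 @ [mop C (U @ Z2 # W) \<tau>] @ B2) \<mu>)"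
    if "mpath C (U @ Z1 # W) \<tau>" "mpath C (A1 @ [mop C (U @ Z1 # W) \<tau>] @ B2) \<mu>"
      "mpath C (U @ Z2 # W) \<tau>" "mpath C (A1 @ [mop C (U @ Z2 # W) \<tau>] @ B2) \<mu>" for U W
    using that op_lin [of U \<kappa> e x W \<tau> y \<alpha> \<beta>] op_lin [of A1 "nxt U \<kappa>" "sdeg U + e + sdeg W + 1" _ B2 \<mu>]
    unfolding Z0_def Z1_def Z2_def mop_slot by simp
  show "nested_path A1 (U @ Z1 # W) B1 B2 \<tau> \<mu> c \<Longrightarrow> nested_path A1 (U @ Z2 # W) B1 B2 \<tau> \<mu> c \<Longrightarrow>
      nested_op A1 (U @ Z0 # W) B1 B2 \<tau> \<mu> c = scl C \<alpha> (nested_op A1 (U @ Z1 # W) B1 B2 \<tau> \<mu> c) + scl C \<beta> (nested_op A1 (U @ Z2 # W) B1 B2 \<tau> \<mu> c)"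
    using inner [of U "W @ [c] @ B1"] unfolding nested_op_def nested_path_def by simp
  show "nested_path A1 A2 (U @ Z1 # W) B2 \<tau> \<mu> c \<Longrightarrow> nested_path A1 A2 (U @ Z2 # W) B2 \<tau> \<mu> c \<Longrightarrow>
      nested_op A1 A2 (U @ Z0 # W) B2 \<tau> \<mu> c = scl C \<alpha> (nested_op A1 A2 (U @ Z1 # W) B2 \<tau> \<mu> c) + scl C \<beta> (nested_op A1 A2 (U @ Z2 # W) B2 \<tau> \<mu> c)"
    using inner [of "A2 @ [c] @ U" W] unfolding nested_op_def nested_path_def by simp
qed

lemma nested_op_inner_zero:
  assumes "nested_path A1 A2 B1 B2 \<tau> \<mu> c" "op_of C (A2 @ [c] @ B1) \<tau> = 0"
  shows "nested_op A1 A2 B1 B2 \<tau> \<mu> c = 0"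
  using assms op_zero [of A1 "src (hd (A2 @ [c] @ B1))" "sdeg (A2 @ [c] @ B1) + 2" 0 B2 \<mu>]
  by (simp add: nested_op_def nested_path_def mop_def)

text \<open>Operations with at least three inputs vanish on units. Besides the unit there is always
  the inner result in the outer operation, or \<open>c\<close> in the inner one; the side conditions
  supply the third input.\<close>

lemma nested_op_ident:
  fixes \<kappa>
  defines "Z \<equiv> ident_mor C \<kappa>"
  shows "nested_path (U @ Z # W) A2 B1 B2 \<tau> \<mu> c \<Longrightarrow> U \<noteq> [] \<or> W \<noteq> [] \<Longrightarrow> nested_op (U @ Z # W) A2 B1 B2 \<tau> \<mu> c = 0"
    and "nested_path A1 A2 B1 (U @ Z # W) \<tau> \<mu> c \<Longrightarrow> A1 \<noteq> [] \<Longrightarrow> nested_op A1 A2 B1 (U @ Z # W) \<tau> \<mu> c = 0"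
    and "nested_path A1 (U @ Z # W) B1 B2 \<tau> \<mu> c \<Longrightarrow> B1 \<noteq> [] \<Longrightarrow> nested_op A1 (U @ Z # W) B1 B2 \<tau> \<mu> c = 0"
    and "nested_path A1 A2 (U @ Z # W) B2 \<tau> \<mu> c \<Longrightarrow> U \<noteq> [] \<or> W \<noteq> [] \<Longrightarrow> nested_op A1 A2 (U @ Z # W) B2 \<tau> \<mu> c = 0"
proof -
  have len: "length X \<ge> 1" if "X \<noteq> []" for X :: "('o, 'v) hmor list" using that by (cases X) auto
  show "nested_path (U @ Z # W) A2 B1 B2 \<tau> \<mu> c \<Longrightarrow> U \<noteq> [] \<or> W \<noteq> [] \<Longrightarrow> nested_op (U @ Z # W) A2 B1 B2 \<tau> \<mu> c = 0"
    using op_ident [of U \<kappa> "W @ [mop C (A2 @ [c] @ B1) \<tau>] @ B2" \<mu>] len [of U] len [of W]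
    unfolding nested_op_def nested_path_def Z_def by auto
  show "nested_path A1 A2 B1 (U @ Z # W) \<tau> \<mu> c \<Longrightarrow> A1 \<noteq> [] \<Longrightarrow> nested_op A1 A2 B1 (U @ Z # W) \<tau> \<mu> c = 0"
    using op_ident [of "A1 @ [mop C (A2 @ [c] @ B1) \<tau>] @ U" \<kappa> W \<mu>] len [of A1]
    unfolding nested_op_def nested_path_def Z_def by auto
  show "nested_path A1 (U @ Z # W) B1 B2 \<tau> \<mu> c \<Longrightarrow> B1 \<noteq> [] \<Longrightarrow> nested_op A1 (U @ Z # W) B1 B2 \<tau> \<mu> c = 0"
    using op_ident [of U \<kappa> "W @ [c] @ B1" \<tau>] len [of B1]
    by (intro nested_op_inner_zero) (auto simp: nested_path_def Z_def)
  show "nested_path A1 A2 (U @ Z # W) B2 \<tau> \<mu> c \<Longrightarrow> U \<noteq> [] \<or> W \<noteq> [] \<Longrightarrow> nested_op A1 A2 (U @ Z # W) B2 \<tau> \<mu> c = 0"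
    using op_ident [of "A2 @ [c] @ U" \<kappa> W \<tau>] len [of U] len [of W]
    by (intro nested_op_inner_zero) (auto simp: nested_path_def Z_def)
qed

section \<open>Traces and supertraces on graded Hom spaces\<close>

lemma trace_on_lin:
  assumes V: "vs.subspace V" and fg: "\<And>v. v \<in> V \<Longrightarrow> g v \<in> V" "\<And>v. v \<in> V \<Longrightarrow> h v \<in> V"
    and f: "\<And>v. v \<in> V \<Longrightarrow> f v = scl C \<alpha> (g v) + scl C \<beta> (h v)"
  shows "trace_on (scl C) V f = \<alpha> * trace_on (scl C) V g + \<beta> * trace_on (scl C) V h"
proof -
  define E where "E = (SOME E. \<not> vs.dependent E \<and> vs.span E = V)"
  \<comment> \<open>The existence of a basis ensures that the choice in \<open>trace_on\<close>
    denotes one.\<close>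
  obtain B where B: "B \<subseteq> V" "vs.independent B" "V \<subseteq> vs.span B" using vs.maximal_independent_subset by blast
  then have "\<not> vs.dependent B \<and> vs.span B = V" using vs.span_minimal [OF B(1) V] by auto
  then have E: "\<not> vs.dependent E" "vs.span E = V" unfolding E_def by (metis (mono_tags, lifting) someI)+
  have "vs.representation E (f b) b = \<alpha> * vs.representation E (g b) b + \<beta> * vs.representation E (h b) b"
    if "b \<in> E" for b
  proof -
    have b: "b \<in> V" using that E(2) vs.span_superset by blast
    then have "g b \<in> vs.span E" "h b \<in> vs.span E" using fg E(2) by auto
    then show ?thesis
      by (simp add: f [OF b] vs.representation_add [OF E(1)] vs.representation_scale [OF E(1)] vs.span_scale)
  qed
  then show ?thesis
    unfolding trace_on_def Let_def E_def [symmetric] by (simp add: sum.distrib sum_distrib_left)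
qed

lemma trace_on_zero: "vs.subspace V \<Longrightarrow> (\<And>v. v \<in> V \<Longrightarrow> f v = 0) \<Longrightarrow> trace_on (scl C) V f = 0"
  using trace_on_lin [of V "\<lambda>_. 0" "\<lambda>_. 0" f 0 0] by (simp add: vs.subspace_0)

text \<open>The three operators share the degree function \<open>D\<close>, so the cut-off to the
  degree preserving part acts on them alike and the trace can be compared degree by degree.\<close>

lemma supertrace_lin:
  assumes ob: "\<kappa> \<in> Obj C" "\<mu> \<in> Obj C"
    and dg: "\<And>e x. x \<in> Hom C \<kappa> \<mu> e \<Longrightarrow> dg (P (Mor \<kappa> e x)) = D e \<and> dg (P1 (Mor \<kappa> e x)) = D e \<and> dg (P2 (Mor \<kappa> e x)) = D e"
    and mem: "\<And>e x. x \<in> Hom C \<kappa> \<mu> e \<Longrightarrow> vct (P1 (Mor \<kappa> e x)) \<in> Hom C \<kappa> \<mu> (D e) \<and> vct (P2 (Mor \<kappa> e x)) \<in> Hom C \<kappa> \<mu> (D e)"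
    and lin: "\<And>e x. x \<in> Hom C \<kappa> \<mu> e \<Longrightarrow> vct (P (Mor \<kappa> e x)) = scl C \<alpha> (vct (P1 (Mor \<kappa> e x))) + scl C \<beta> (vct (P2 (Mor \<kappa> e x)))"
  shows "supertrace C \<kappa> \<mu> P = \<alpha> * supertrace C \<kappa> \<mu> P1 + \<beta> * supertrace C \<kappa> \<mu> P2"
proof -
  let ?f = "\<lambda>P e x. if dg (P (Mor \<kappa> e x)) = e then vct (P (Mor \<kappa> e x)) else 0"
  have sub: "vs.subspace (Hom C \<kappa> \<mu> e)" for e by (rule Hom_subspace [OF ob])
  have "trace_on (scl C) (Hom C \<kappa> \<mu> e) (?f P e) =
      \<alpha> * trace_on (scl C) (Hom C \<kappa> \<mu> e) (?f P1 e) + \<beta> * trace_on (scl C) (Hom C \<kappa> \<mu> e) (?f P2 e)" for e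
  proof (rule trace_on_lin [OF sub])
    fix x assume x: "x \<in> Hom C \<kappa> \<mu> e"
    show "?f P1 e x \<in> Hom C \<kappa> \<mu> e" "?f P2 e x \<in> Hom C \<kappa> \<mu> e"
      using dg [OF x] mem [OF x] vs.subspace_0 [OF sub] by auto
    show "?f P e x = scl C \<alpha> (?f P1 e x) + scl C \<beta> (?f P2 e x)" using dg [OF x] lin [OF x] by simp
  qed
  then show ?thesis unfolding supertrace_def by (simp add: sum.distrib sum_distrib_left algebra_simps)
qed

lemma supertrace_zero:
  assumes ob: "\<kappa> \<in> Obj C" "\<mu> \<in> Obj C"
    and "\<And>e x. x \<in> Hom C \<kappa> \<mu> e \<Longrightarrow> dg (P (Mor \<kappa> e x)) \<noteq> e \<or> vct (P (Mor \<kappa> e x)) = 0"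
  shows "supertrace C \<kappa> \<mu> P = 0"
proof -
  have "trace_on (scl C) (Hom C \<kappa> \<mu> e)
      (\<lambda>x. if dg (P (Mor \<kappa> e x)) = e then vct (P (Mor \<kappa> e x)) else 0) = 0" for e
    by (rule trace_on_zero [OF Hom_subspace [OF ob]]) (use assms(3) in auto)
  then show ?thesis by (simp add: supertrace_def)
qed

section \<open>The single terms of the Mukai pairing\<close>

definition mukai_nested :: "('o, 'v) hmor list \<Rightarrow> ('o, 'v) hmor list \<Rightarrow> nat \<Rightarrow> nat \<Rightarrow> nat \<Rightarrow> nat \<Rightarrow> ('o, 'v) hmor \<Rightarrow> 'v" where
  "mukai_nested a b i j t l = nested_op (drop j a @ take (Suc i) a) (drop (Suc i) (take j a)) (drop l b @ take (Suc t) b)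
     (drop (Suc t) (take l b)) (src (b ! (Suc t mod length b))) (src (b ! (l mod length b)))"

definition mukai_sign :: "('o, 'v) hmor list \<Rightarrow> ('o, 'v) hmor list \<Rightarrow> nat \<Rightarrow> nat \<Rightarrow> nat \<Rightarrow> 'k" where
  "mukai_sign a b i j l = psign (rot_exp j a + rot_exp l b + sdeg (drop j a @ take (Suc i) a) + 1)"

text \<open>The degree is written in closed form: \<open>c\<close> contributes
  \<open>dg c - 1\<close>, the inner operation adds 1 to the shifted degree, and the outer one adds
  2 because its result is measured without shift.\<close>

definition mukai_operator :: "('o, 'v) hmor list \<Rightarrow> ('o, 'v) hmor list \<Rightarrow> nat \<Rightarrow> nat \<Rightarrow> nat \<Rightarrow> nat \<Rightarrow> ('o, 'v) hmor \<Rightarrow> ('o, 'v) hmor" where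
  "mukai_operator a b i j t l = (\<lambda>c. Mor (src (hd (drop j a @ take (Suc i) a @ [c]))) (sdeg a + sdeg b + dg c + 2)
     (scl C (psign (dg c * sdeg a)) (mukai_nested a b i j t l c)))"

lemma mukai_word_eq:
  assumes "a \<noteq> []" "b \<noteq> []"
  shows "mukai_word C a b = (\<Sum>(i, j)\<in>{(i, j). i < j \<and> j \<le> length a}. \<Sum>(t, l)\<in>{(t, l). t < l \<and> l \<le> length b}.
     mukai_sign a b i j l * supertrace C (src (a ! (j mod length a))) (src (b ! (l mod length b))) (mukai_operator a b i j t l))"
  unfolding mukai_word_def Let_def
proof (rule sum.cong [OF refl], clarify, rule sum.cong [OF refl], clarify)
  fix i j t l :: nat
  assume ij: "i < j" "j \<le> length a" "t < l" "l \<le> length b"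
  have sa: "sdeg a = sdeg (take (Suc i) a) + sdeg (drop (Suc i) (take j a)) + sdeg (drop j a)"
    by (subst split_three [OF ij(1), of a]) (simp only: sdeg_append add.assoc)
  have sb: "sdeg b = sdeg (take (Suc t) b) + sdeg (drop (Suc t) (take l b)) + sdeg (drop l b)"
    by (subst split_three [OF ij(3), of b]) (simp only: sdeg_append add.assoc)
  have hd: "hd (drop j a @ take (Suc i) a @ xs) = hd (drop j a @ take (Suc i) a @ ys)" for xs ys
    using assms(1) by (cases a) (auto simp: hd_append)
  show "psign (rot_exp j a + rot_exp l b + sdeg (drop j a @ take (Suc i) a) + 1) *
      supertrace C (src (a ! (j mod length a))) (src (b ! (l mod length b))) (\<lambda>c.
        Mor (src (mop C (drop j a @ take (Suc i) a @ [mop C (drop (Suc i) (take j a) @ [c] @ drop l b @ take (Suc t) b)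
             (src (b ! (Suc t mod length b)))] @ drop (Suc t) (take l b)) (src (b ! (l mod length b)))))
          (dg (mop C (drop j a @ take (Suc i) a @ [mop C (drop (Suc i) (take j a) @ [c] @ drop l b @ take (Suc t) b)
             (src (b ! (Suc t mod length b)))] @ drop (Suc t) (take l b)) (src (b ! (l mod length b)))))
          (scl C (psign (dg c * sdeg a)) (vct (mop C (drop j a @ take (Suc i) a @
             [mop C (drop (Suc i) (take j a) @ [c] @ drop l b @ take (Suc t) b)
             (src (b ! (Suc t mod length b)))] @ drop (Suc t) (take l b)) (src (b ! (l mod length b))))))) =
    mukai_sign a b i j l * supertrace C (src (a ! (j mod length a))) (src (b ! (l mod length b))) (mukai_operator a b i j t l)"
    unfolding mukai_sign_def mukai_operator_def mukai_nested_def nested_op_def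
    by (intro arg_cong2 [where f = "(*)"] refl arg_cong [where f = "supertrace C _ _"] ext)
      (auto simp: mop_def sdeg_append sdeg_Cons sa sb intro!: arg_cong [where f = src] hd)
qed

lemma mukai_valid:
  assumes a: "a \<in> hwords C" and b: "b \<in> hwords C" and ij: "i < j" "j \<le> length a" "t < l" "l \<le> length b"
  defines "\<kappa> \<equiv> src (a ! (j mod length a))" and "\<mu> \<equiv> src (b ! (l mod length b))"
  shows "\<kappa> \<in> Obj C" "\<mu> \<in> Obj C"
    and "x \<in> Hom C \<kappa> \<mu> e \<Longrightarrow> nested_path (drop j a @ take (Suc i) a) (drop (Suc i) (take j a)) (drop l b @ take (Suc t) b)
     (drop (Suc t) (take l b)) (src (b ! (Suc t mod length b))) \<mu> (Mor \<kappa> e x)"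
    and "x \<in> Hom C \<kappa> \<mu> e \<Longrightarrow> vct (mukai_operator a b i j t l (Mor \<kappa> e x)) \<in> Hom C \<kappa> \<mu> (sdeg a + sdeg b + e + 2)"
proof -
  have ne: "a \<noteq> []" "b \<noteq> []" using a b by (auto simp: hwords_def mpath_iff)
  let ?s = "src (hd a)" and ?r = "src (hd b)"
  let ?P = "take (Suc i) a" and ?A2 = "drop (Suc i) (take j a)" and ?R = "drop j a"
  let ?P' = "take (Suc t) b" and ?B2 = "drop (Suc t) (take l b)" and ?R' = "drop l b"
  let ?\<tau> = "src (b ! (Suc t mod length b))"
  \<comment> \<open>For \<open>j = length a\<close> the arc beyond \<open>j\<close> is empty; the
    index modulo the length and \<open>nxt\<close> then both give the source of the first
    letter.\<close>
  have \<kappa>: "\<kappa> = nxt ?R ?s" unfolding \<kappa>_def using ij ne by (intro nxt_drop)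
  have \<mu>: "\<mu> = nxt ?R' ?r" unfolding \<mu>_def using ij ne by (intro nxt_drop)
  have "path_ok C (?P @ ?A2 @ ?R) ?s" "?s \<in> Obj C"
    using a by (simp_all add: split_three [OF ij(1), of a, symmetric] hwords_def mpath_iff)
  then have okA: "path_ok C ?P (nxt ?A2 \<kappa>)" "path_ok C ?A2 \<kappa>" "path_ok C ?R ?s" and s: "?s \<in> Obj C"
    unfolding path_ok_append nxt_append \<kappa> by auto
  have "path_ok C (?P' @ ?B2 @ ?R') ?r" "?r \<in> Obj C"
    using b by (simp_all add: split_three [OF ij(3), of b, symmetric] hwords_def mpath_iff)
  then have okB: "path_ok C ?P' (nxt ?B2 \<mu>)" "path_ok C ?B2 \<mu>" "path_ok C ?R' ?r" and r: "?r \<in> Obj C"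
    unfolding path_ok_append nxt_append \<mu> by auto
  show ob: "\<kappa> \<in> Obj C" "\<mu> \<in> Obj C" unfolding \<kappa> \<mu> using okA okB s r by (auto intro!: nxt_obj)
  have \<tau>: "?\<tau> = nxt ?B2 \<mu>"
  proof -
    have "?\<tau> = nxt (drop (Suc t) b) ?r" using ij ne by (intro nxt_drop) auto
    also have "drop (Suc t) b = ?B2 @ ?R'"
    proof -
      have "drop (Suc t) b = drop (Suc t) (?P' @ ?B2 @ ?R')" using split_three [OF ij(3), of b] by simp
      then show ?thesis using ij by simp
    qed
    finally show ?thesis unfolding nxt_append \<mu> .
  qed
  have hP: "nxt ?P u = ?s" "nxt ?P' u = ?r" for u using ne by (cases a; cases b; simp)+
  have \<tau>o: "?\<tau> \<in> Obj C" unfolding \<tau> using okB ob by (intro nxt_obj)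
  show val: "nested_path (?R @ ?P) ?A2 (?R' @ ?P') ?B2 ?\<tau> \<mu> (Mor \<kappa> e x)" if x: "x \<in> Hom C \<kappa> \<mu> e"
  proof -
    let ?in = "?A2 @ [Mor \<kappa> e x] @ ?R' @ ?P'"
    have m: "mpath C ?in ?\<tau>"
      unfolding mpath_iff path_ok_append path_ok.simps nxt_append hP
      using okA okB ob x \<tau>o \<tau> \<mu> by simp
    have "op_of C ?in ?\<tau> \<in> Hom C (src (hd ?in)) ?\<tau> (sdeg ?in + 2)" by (rule op_mem [OF m])
    moreover have "src (hd ?in) = nxt ?A2 \<kappa>" by (cases ?A2) auto
    moreover have "nxt ?A2 \<kappa> \<in> Obj C" using okA ob by (intro nxt_obj)
    ultimately have "mpath C ((?R @ ?P) @ [mop C ?in ?\<tau>] @ ?B2) \<mu>"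
      unfolding mpath_iff path_ok_append path_ok.simps nxt_append hP mop_def
      using okA okB ob \<tau> by simp
    with m show ?thesis by (simp add: nested_path_def)
  qed
  show "vct (mukai_operator a b i j t l (Mor \<kappa> e x)) \<in> Hom C \<kappa> \<mu> (sdeg a + sdeg b + e + 2)" if x: "x \<in> Hom C \<kappa> \<mu> e"
  proof -
    let ?in = "?A2 @ [Mor \<kappa> e x] @ ?R' @ ?P'"
    let ?out = "(?R @ ?P) @ [mop C ?in ?\<tau>] @ ?B2"
    have "op_of C ?out \<mu> \<in> Hom C (src (hd ?out)) \<mu> (sdeg ?out + 2)"
      using val [OF x] by (intro op_mem) (simp add: nested_path_def)
    moreover have "src (hd ?out) = \<kappa>"
    proof -
      have "src (hd ?out) = nxt ?R (nxt ?P \<mu>)" using ne by (cases ?R; cases a; simp)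
      then show ?thesis unfolding hP \<kappa> .
    qed
    moreover have "sdeg ?out + 2 = sdeg a + sdeg b + e + 2"
    proof -
      have "sdeg a = sdeg ?P + sdeg ?A2 + sdeg ?R"
        by (subst split_three [OF ij(1), of a]) (simp only: sdeg_append add.assoc)
      moreover have "sdeg b = sdeg ?P' + sdeg ?B2 + sdeg ?R'"
        by (subst split_three [OF ij(3), of b]) (simp only: sdeg_append add.assoc)
      ultimately show ?thesis by (simp add: sdeg_append sdeg_Cons mop_def)
    qed
    ultimately show ?thesis
      using vs.subspace_scale [OF Hom_subspace [OF ob]] by (simp add: mukai_operator_def mukai_nested_def nested_op_def \<mu>_def)
  qed
qed

text \<open>The operator under the supertrace shifts degrees by \<open>sdeg a + sdeg b + 2\<close>,
  which is \<open>- (hdeg a + hdeg b)\<close>, and an operator of non-zero degree has no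
  trace.\<close>

lemma mukai_word_degree:
  assumes a: "a \<in> hwords C" and b: "b \<in> hwords C" and "hdeg a + hdeg b \<noteq> 0"
  shows "mukai_word C a b = 0"
proof -
  have ne: "a \<noteq> []" "b \<noteq> []" using a b by (auto simp: hwords_def mpath_iff)
  have "supertrace C (src (a ! (j mod length a))) (src (b ! (l mod length b))) (mukai_operator a b i j t l) = 0"
    if "i < j" "j \<le> length a" "t < l" "l \<le> length b" for i j t l
    using assms(3) by (intro supertrace_zero mukai_valid(1,2) [OF a b that]) (simp add: mukai_operator_def hdeg_def)
  then show ?thesis unfolding mukai_word_eq [OF ne] by (simp add: sum.neutral case_prod_unfold)
qed

lemma hwords_slot:
  "us @ Mor \<kappa> e x # vs \<in> hwords C \<longleftrightarrow> mpath C (us @ Mor \<kappa> e x # vs) (nxt us \<kappa>)"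
  by (cases us) (simp_all add: hwords_def)

lemma src_nth_slot: "src ((us @ Mor \<kappa> e x # vs) ! n) = src ((us @ Mor \<kappa> e y # vs) ! n)"
  by (simp add: nth_append nth_Cons split: nat.split)

lemma sdeg_slot: "sdeg (us @ Mor \<kappa> e x # vs) = sdeg (us @ Mor \<kappa> e y # vs)"
  by (simp add: sdeg_append sdeg_Cons)

lemma sdeg_take_slot: "sdeg (take n (us @ Mor \<kappa> e x # vs)) = sdeg (take n (us @ Mor \<kappa> e y # vs))"
  by (cases "n \<le> length us") (auto simp: sdeg_append sdeg_Cons take_Cons')

lemma sdeg_drop_slot: "sdeg (drop n (us @ Mor \<kappa> e x # vs)) = sdeg (drop n (us @ Mor \<kappa> e y # vs))"
  by (cases "n \<le> length us") (auto simp: sdeg_append sdeg_Cons drop_Cons')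

lemma mukai_sign_slot:
  "mukai_sign (us @ Mor \<kappa> e x # vs) b i j l = mukai_sign (us @ Mor \<kappa> e y # vs) b i j l"
  "mukai_sign b (us @ Mor \<kappa> e x # vs) i j l = mukai_sign b (us @ Mor \<kappa> e y # vs) i j l"
  unfolding mukai_sign_def rot_exp_def sdeg_append [of "drop _ _"]
  by (simp_all only: sdeg_take_slot [of _ us \<kappa> e x vs y] sdeg_drop_slot [of _ us \<kappa> e x vs y])

text \<open>Holds term by term: sign, source objects and degrees do not see the vector of the
  letter, and \<open>rotation_split\<close> decides which case of \<open>nested_op_lin\<close>
  applies. Two coefficients cover additivity and homogeneity at once.\<close>

lemma mukai_word_lin_left:
  fixes \<kappa> e x y \<alpha> \<beta> us vs
  defines "w0 \<equiv> us @ Mor \<kappa> e (scl C \<alpha> x + scl C \<beta> y) # vs" and "w1 \<equiv> us @ Mor \<kappa> e x # vs" and "w2 \<equiv> us @ Mor \<kappa> e y # vs"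
  assumes w1: "w1 \<in> hwords C" and w2: "w2 \<in> hwords C" and b: "b \<in> hwords C"
  shows "mukai_word C w0 b = \<alpha> * mukai_word C w1 b + \<beta> * mukai_word C w2 b"
proof -
  have ne: "w0 \<noteq> []" "w1 \<noteq> []" "w2 \<noteq> []" "b \<noteq> []" using b by (auto simp: w0_def w1_def w2_def hwords_def mpath_iff)
  have len: "length w0 = length w1" "length w2 = length w1" "length w1 = Suc (length us + length vs)"
    by (simp_all add: w0_def w1_def w2_def)
  have "mukai_sign w0 b i j l * supertrace C (src (w0 ! (j mod length w0))) (src (b ! (l mod length b))) (mukai_operator w0 b i j t l) =
    \<alpha> * (mukai_sign w1 b i j l * supertrace C (src (w1 ! (j mod length w1))) (src (b ! (l mod length b))) (mukai_operator w1 b i j t l)) +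
    \<beta> * (mukai_sign w2 b i j l * supertrace C (src (w2 ! (j mod length w2))) (src (b ! (l mod length b))) (mukai_operator w2 b i j t l))"
    if ij: "i < j" "j \<le> length w1" "t < l" "l \<le> length b" for i j t l
  proof -
    have mc: "mukai_sign w0 b i j l = mukai_sign w1 b i j l" "mukai_sign w2 b i j l = mukai_sign w1 b i j l"
      unfolding w0_def w1_def w2_def by (rule mukai_sign_slot)+
    have sr: "src (w0 ! n) = src (w1 ! n)" "src (w2 ! n) = src (w1 ! n)" for n
      unfolding w0_def w1_def w2_def by (rule src_nth_slot)+
    have sd: "sdeg w0 = sdeg w1" "sdeg w2 = sdeg w1" unfolding w0_def w1_def w2_def by (rule sdeg_slot)+
    let ?\<kappa> = "src (w1 ! (j mod length w1))" and ?\<mu> = "src (b ! (l mod length b))"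
    note v1 = mukai_valid [OF w1 b ij]
    have "j \<le> length w2" using ij(2) len by simp
    note v2 = mukai_valid [OF w2 b ij(1) this ij(3,4), unfolded len(2) sr]
    have nested_op: "mukai_nested w0 b i j t l (Mor ?\<kappa> e' z) = scl C \<alpha> (mukai_nested w1 b i j t l (Mor ?\<kappa> e' z)) + scl C \<beta> (mukai_nested w2 b i j t l (Mor ?\<kappa> e' z))"
      if z: "z \<in> Hom C ?\<kappa> ?\<mu> e'" for e' z
      using rotation_split [OF ij(1) ij(2) [unfolded len(3)]]
    proof (elim disjE exE conjE)
      fix U W X
      assume "\<forall>z. drop j (us @ z # vs) @ take (Suc i) (us @ z # vs) = U @ z # W \<and> drop (Suc i) (take j (us @ z # vs)) = X"
      then have e: "\<And>z. drop j (us @ z # vs) @ take (Suc i) (us @ z # vs) = U @ z # W"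
        "\<And>z. drop (Suc i) (take j (us @ z # vs)) = X" by auto
      show ?thesis
        using v1(3) [OF z] v2(3) [OF z]
        unfolding mukai_nested_def w0_def w1_def w2_def e by (rule nested_op_lin(1))
    next
      fix U W X
      assume "\<forall>z. drop j (us @ z # vs) @ take (Suc i) (us @ z # vs) = X \<and> drop (Suc i) (take j (us @ z # vs)) = U @ z # W"
      then have e: "\<And>z. drop j (us @ z # vs) @ take (Suc i) (us @ z # vs) = X"
        "\<And>z. drop (Suc i) (take j (us @ z # vs)) = U @ z # W" by auto
      show ?thesis
        using v1(3) [OF z] v2(3) [OF z]
        unfolding mukai_nested_def w0_def w1_def w2_def e by (rule nested_op_lin(3))
    qed
    have "supertrace C ?\<kappa> ?\<mu> (mukai_operator w0 b i j t l) =
        \<alpha> * supertrace C ?\<kappa> ?\<mu> (mukai_operator w1 b i j t l) + \<beta> * supertrace C ?\<kappa> ?\<mu> (mukai_operator w2 b i j t l)"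
    proof (rule supertrace_lin [OF v1(1,2), where D = "\<lambda>e. sdeg w1 + sdeg b + e + 2"])
      fix e' z assume z: "z \<in> Hom C ?\<kappa> ?\<mu> e'"
      show "dg (mukai_operator w0 b i j t l (Mor ?\<kappa> e' z)) = sdeg w1 + sdeg b + e' + 2 \<and>
        dg (mukai_operator w1 b i j t l (Mor ?\<kappa> e' z)) = sdeg w1 + sdeg b + e' + 2 \<and>
        dg (mukai_operator w2 b i j t l (Mor ?\<kappa> e' z)) = sdeg w1 + sdeg b + e' + 2"
        by (simp add: mukai_operator_def sd)
      show "vct (mukai_operator w1 b i j t l (Mor ?\<kappa> e' z)) \<in> Hom C ?\<kappa> ?\<mu> (sdeg w1 + sdeg b + e' + 2) \<and>
        vct (mukai_operator w2 b i j t l (Mor ?\<kappa> e' z)) \<in> Hom C ?\<kappa> ?\<mu> (sdeg w1 + sdeg b + e' + 2)"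
        using v1(4) [OF z] v2(4) [OF z] by (simp add: sd)
      show "vct (mukai_operator w0 b i j t l (Mor ?\<kappa> e' z)) = scl C \<alpha> (vct (mukai_operator w1 b i j t l (Mor ?\<kappa> e' z))) +
        scl C \<beta> (vct (mukai_operator w2 b i j t l (Mor ?\<kappa> e' z)))"
        by (simp add: mukai_operator_def nested_op [OF z] sd vs.scale_right_distrib mult.commute)
    qed
    then show ?thesis unfolding len(1,2) sr mc by (simp add: algebra_simps)
  qed
  then show ?thesis
    unfolding mukai_word_eq [OF ne(1,4)] mukai_word_eq [OF ne(2,4)] mukai_word_eq [OF ne(3,4)] len(1,2)
    by (simp add: case_prod_unfold sum_distrib_left sum.distrib [symmetric])
qed

lemma mukai_word_lin_right:
  fixes \<kappa> e x y \<alpha> \<beta> us vs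
  defines "w0 \<equiv> us @ Mor \<kappa> e (scl C \<alpha> x + scl C \<beta> y) # vs" and "w1 \<equiv> us @ Mor \<kappa> e x # vs" and "w2 \<equiv> us @ Mor \<kappa> e y # vs"
  assumes w1: "w1 \<in> hwords C" and w2: "w2 \<in> hwords C" and a: "a \<in> hwords C"
  shows "mukai_word C a w0 = \<alpha> * mukai_word C a w1 + \<beta> * mukai_word C a w2"
proof -
  have ne: "w0 \<noteq> []" "w1 \<noteq> []" "w2 \<noteq> []" "a \<noteq> []" using a by (auto simp: w0_def w1_def w2_def hwords_def mpath_iff)
  have len: "length w0 = length w1" "length w2 = length w1" "length w1 = Suc (length us + length vs)"
    by (simp_all add: w0_def w1_def w2_def)
  have "mukai_sign a w0 i j l * supertrace C (src (a ! (j mod length a))) (src (w0 ! (l mod length w0))) (mukai_operator a w0 i j t l) =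
    \<alpha> * (mukai_sign a w1 i j l * supertrace C (src (a ! (j mod length a))) (src (w1 ! (l mod length w1))) (mukai_operator a w1 i j t l)) +
    \<beta> * (mukai_sign a w2 i j l * supertrace C (src (a ! (j mod length a))) (src (w2 ! (l mod length w2))) (mukai_operator a w2 i j t l))"
    if ij: "i < j" "j \<le> length a" "t < l" "l \<le> length w1" for i j t l
  proof -
    have mc: "mukai_sign a w0 i j l = mukai_sign a w1 i j l" "mukai_sign a w2 i j l = mukai_sign a w1 i j l"
      unfolding w0_def w1_def w2_def by (rule mukai_sign_slot)+
    have sr: "src (w0 ! n) = src (w1 ! n)" "src (w2 ! n) = src (w1 ! n)" for n
      unfolding w0_def w1_def w2_def by (rule src_nth_slot)+
    have sd: "sdeg w0 = sdeg w1" "sdeg w2 = sdeg w1" unfolding w0_def w1_def w2_def by (rule sdeg_slot)+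
    let ?\<kappa> = "src (a ! (j mod length a))" and ?\<mu> = "src (w1 ! (l mod length w1))"
    note v1 = mukai_valid [OF a w1 ij]
    have "l \<le> length w2" using ij(4) len by simp
    note v2 = mukai_valid [OF a w2 ij(1,2,3) this, unfolded len(2) sr]
    have nested_op: "mukai_nested a w0 i j t l (Mor ?\<kappa> e' z) = scl C \<alpha> (mukai_nested a w1 i j t l (Mor ?\<kappa> e' z)) + scl C \<beta> (mukai_nested a w2 i j t l (Mor ?\<kappa> e' z))"
      if z: "z \<in> Hom C ?\<kappa> ?\<mu> e'" for e' z
      using rotation_split [OF ij(3) ij(4) [unfolded len(3)]]
    proof (elim disjE exE conjE)
      fix U W X
      assume "\<forall>z. drop l (us @ z # vs) @ take (Suc t) (us @ z # vs) = U @ z # W \<and> drop (Suc t) (take l (us @ z # vs)) = X"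
      then have e: "\<And>z. drop l (us @ z # vs) @ take (Suc t) (us @ z # vs) = U @ z # W"
        "\<And>z. drop (Suc t) (take l (us @ z # vs)) = X" by auto
      show ?thesis
        using v1(3) [OF z] v2(3) [OF z]
        unfolding mukai_nested_def len(1,2) sr unfolding w0_def w1_def w2_def e by (rule nested_op_lin(4))
    next
      fix U W X
      assume "\<forall>z. drop l (us @ z # vs) @ take (Suc t) (us @ z # vs) = X \<and> drop (Suc t) (take l (us @ z # vs)) = U @ z # W"
      then have e: "\<And>z. drop l (us @ z # vs) @ take (Suc t) (us @ z # vs) = X"
        "\<And>z. drop (Suc t) (take l (us @ z # vs)) = U @ z # W" by auto
      show ?thesis
        using v1(3) [OF z] v2(3) [OF z]
        unfolding mukai_nested_def len(1,2) sr unfolding w0_def w1_def w2_def e by (rule nested_op_lin(2))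
    qed
    have "supertrace C ?\<kappa> ?\<mu> (mukai_operator a w0 i j t l) =
        \<alpha> * supertrace C ?\<kappa> ?\<mu> (mukai_operator a w1 i j t l) + \<beta> * supertrace C ?\<kappa> ?\<mu> (mukai_operator a w2 i j t l)"
    proof (rule supertrace_lin [OF v1(1,2), where D = "\<lambda>e. sdeg a + sdeg w1 + e + 2"])
      fix e' z assume z: "z \<in> Hom C ?\<kappa> ?\<mu> e'"
      show "dg (mukai_operator a w0 i j t l (Mor ?\<kappa> e' z)) = sdeg a + sdeg w1 + e' + 2 \<and>
        dg (mukai_operator a w1 i j t l (Mor ?\<kappa> e' z)) = sdeg a + sdeg w1 + e' + 2 \<and>
        dg (mukai_operator a w2 i j t l (Mor ?\<kappa> e' z)) = sdeg a + sdeg w1 + e' + 2"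
        by (simp add: mukai_operator_def sd)
      show "vct (mukai_operator a w1 i j t l (Mor ?\<kappa> e' z)) \<in> Hom C ?\<kappa> ?\<mu> (sdeg a + sdeg w1 + e' + 2) \<and>
        vct (mukai_operator a w2 i j t l (Mor ?\<kappa> e' z)) \<in> Hom C ?\<kappa> ?\<mu> (sdeg a + sdeg w1 + e' + 2)"
        using v1(4) [OF z] v2(4) [OF z] by (simp add: sd)
      show "vct (mukai_operator a w0 i j t l (Mor ?\<kappa> e' z)) = scl C \<alpha> (vct (mukai_operator a w1 i j t l (Mor ?\<kappa> e' z))) +
        scl C \<beta> (vct (mukai_operator a w2 i j t l (Mor ?\<kappa> e' z)))"
        by (simp add: mukai_operator_def nested_op [OF z] vs.scale_right_distrib mult.commute)
    qed
    then show ?thesis unfolding len(1,2) sr mc by (simp add: algebra_simps)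
  qed
  then show ?thesis
    unfolding mukai_word_eq [OF ne(4,1)] mukai_word_eq [OF ne(4,2)] mukai_word_eq [OF ne(4,3)] len(1,2)
    by (simp add: case_prod_unfold sum_distrib_left sum.distrib [symmetric])
qed

text \<open>The unit is not the first letter of its word. In the outer arc it is accompanied by that
  first letter, in the inner arc by the first letter of \<open>b\<close>, so one of the two
  operations has a unit among at least three inputs.\<close>

lemma mukai_word_ident_left:
  assumes us: "us \<noteq> []" and w: "us @ ident_mor C \<kappa> # vs \<in> hwords C" and b: "b \<in> hwords C"
  shows "mukai_word C (us @ ident_mor C \<kappa> # vs) b = 0"
proof -
  let ?w = "us @ ident_mor C \<kappa> # vs"
  have ne: "?w \<noteq> []" "b \<noteq> []" using b by (auto simp: hwords_def mpath_iff)
  have "supertrace C (src (?w ! (j mod length ?w))) (src (b ! (l mod length b))) (mukai_operator ?w b i j t l) = 0"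
    if ij: "i < j" "j \<le> length ?w" "t < l" "l \<le> length b" for i j t l
  proof (intro supertrace_zero mukai_valid(1,2) [OF w b ij] disjI2)
    fix e z assume z: "z \<in> Hom C (src (?w ! (j mod length ?w))) (src (b ! (l mod length b))) e"
    note v = mukai_valid(3) [OF w b ij z]
    have "j \<le> Suc (length us + length vs)" using ij(2) by simp
    from rotation_split [OF ij(1) this]
    have "mukai_nested ?w b i j t l (Mor (src (?w ! (j mod length ?w))) e z) = 0"
    proof (elim disjE exE conjE)
      fix U W X
      assume e': "\<forall>z. drop j (us @ z # vs) @ take (Suc i) (us @ z # vs) = U @ z # W \<and> drop (Suc i) (take j (us @ z # vs)) = X"
        and "us \<noteq> [] \<longrightarrow> U \<noteq> [] \<or> W \<noteq> []"
      then have UW: "U \<noteq> [] \<or> W \<noteq> []" using us by simp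
      have e: "\<And>z. drop j (us @ z # vs) @ take (Suc i) (us @ z # vs) = U @ z # W"
        "\<And>z. drop (Suc i) (take j (us @ z # vs)) = X" using e' by auto
      show ?thesis using v UW unfolding mukai_nested_def e by (rule nested_op_ident(1))
    next
      fix U W X
      assume "\<forall>z. drop j (us @ z # vs) @ take (Suc i) (us @ z # vs) = X \<and> drop (Suc i) (take j (us @ z # vs)) = U @ z # W"
      then have e: "\<And>z. drop j (us @ z # vs) @ take (Suc i) (us @ z # vs) = X"
        "\<And>z. drop (Suc i) (take j (us @ z # vs)) = U @ z # W" by auto
      have "drop l b @ take (Suc t) b \<noteq> []" using ne by simp
      with v show ?thesis unfolding mukai_nested_def e by (rule nested_op_ident(3))
    qed
    then show "vct (mukai_operator ?w b i j t l (Mor (src (?w ! (j mod length ?w))) e z)) = 0" by (simp add: mukai_operator_def)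
  qed
  then show ?thesis unfolding mukai_word_eq [OF ne] by (simp add: sum.neutral case_prod_unfold)
qed

text \<open>As on the left, with the roles of the arcs exchanged: the outer arc of the second word
  enters the inner operation, while its inner arc enters the outer operation, where the first letter
  of \<open>a\<close> keeps it company.\<close>

lemma mukai_word_ident_right:
  assumes us: "us \<noteq> []" and w: "us @ ident_mor C \<kappa> # vs \<in> hwords C" and a: "a \<in> hwords C"
  shows "mukai_word C a (us @ ident_mor C \<kappa> # vs) = 0"
proof -
  let ?w = "us @ ident_mor C \<kappa> # vs"
  have ne: "?w \<noteq> []" "a \<noteq> []" using a by (auto simp: hwords_def mpath_iff)
  have "supertrace C (src (a ! (j mod length a))) (src (?w ! (l mod length ?w))) (mukai_operator a ?w i j t l) = 0"
    if ij: "i < j" "j \<le> length a" "t < l" "l \<le> length ?w" for i j t l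
  proof (intro supertrace_zero mukai_valid(1,2) [OF a w ij] disjI2)
    fix e z assume z: "z \<in> Hom C (src (a ! (j mod length a))) (src (?w ! (l mod length ?w))) e"
    note v = mukai_valid(3) [OF a w ij z]
    have "l \<le> Suc (length us + length vs)" using ij(4) by simp
    from rotation_split [OF ij(3) this]
    have "mukai_nested a ?w i j t l (Mor (src (a ! (j mod length a))) e z) = 0"
    proof (elim disjE exE conjE)
      fix U W X
      assume e': "\<forall>z. drop l (us @ z # vs) @ take (Suc t) (us @ z # vs) = U @ z # W \<and> drop (Suc t) (take l (us @ z # vs)) = X"
        and "us \<noteq> [] \<longrightarrow> U \<noteq> [] \<or> W \<noteq> []"
      then have UW: "U \<noteq> [] \<or> W \<noteq> []" using us by simp
      have e: "\<And>z. drop l (us @ z # vs) @ take (Suc t) (us @ z # vs) = U @ z # W"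
        "\<And>z. drop (Suc t) (take l (us @ z # vs)) = X" using e' by auto
      show ?thesis using v UW unfolding mukai_nested_def e by (rule nested_op_ident(4))
    next
      fix U W X
      assume "\<forall>z. drop l (us @ z # vs) @ take (Suc t) (us @ z # vs) = X \<and> drop (Suc t) (take l (us @ z # vs)) = U @ z # W"
      then have e: "\<And>z. drop l (us @ z # vs) @ take (Suc t) (us @ z # vs) = X"
        "\<And>z. drop (Suc t) (take l (us @ z # vs)) = U @ z # W" by auto
      have "drop j a @ take (Suc i) a \<noteq> []" using ne by simp
      with v show ?thesis unfolding mukai_nested_def e by (rule nested_op_ident(2))
    qed
    then show "vct (mukai_operator a ?w i j t l (Mor (src (a ! (j mod length a))) e z)) = 0" by (simp add: mukai_operator_def)
  qed
  then show ?thesis unfolding mukai_word_eq [OF ne(2,1)] by (simp add: sum.neutral case_prod_unfold)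
qed

end


section \<open>The form of a splitting\<close>

definition part :: "('x \<Rightarrow> bool) \<Rightarrow> ('x \<Rightarrow>\<^sub>0 'k::field) \<Rightarrow> ('x \<Rightarrow>\<^sub>0 'k)" where
  "part P p = lin_ext (\<lambda>x. if P x then single x 1 else 0) p"

lemma lookup_part: "lookup (part P p) x = (if P x then lookup p x else 0)"
proof -
  have "lookup (part P p) x = (\<Sum>y\<in>keys p. if y = x then if P x then lookup p x else 0 else 0)"
    unfolding part_def lin_ext_def lookup_sum lookup_smul
    by (intro sum.cong) (auto simp: lookup_single when_def)
  then show ?thesis by (simp add: in_keys_iff)
qed

lemma keys_part: "keys (part P p) = {x \<in> keys p. P x}"
  by (auto simp: in_keys_iff lookup_part split: if_splits)

lemma part_0 [simp]: "part P 0 = 0"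
  by (simp add: part_def)

lemma part_add: "part P (p + q) = part P p + part P q"
  by (rule poly_mapping_eqI) (simp add: lookup_part lookup_add)

lemma part_smul: "part P (smul c p) = smul c (part P p)"
  by (rule poly_mapping_eqI) (simp add: lookup_part lookup_smul)

lemma part_split: "p = part P p + part (\<lambda>x. \<not> P x) p"
  by (rule poly_mapping_eqI) (simp add: lookup_part lookup_add)

lemma subspace_keys: "pm.subspace {c :: 'x \<Rightarrow>\<^sub>0 'k::field. keys c \<subseteq> A}"
proof -
  have "keys (p + q) \<subseteq> A" if "keys p \<subseteq> A" "keys q \<subseteq> A" for p q :: "'x \<Rightarrow>\<^sub>0 'k"
    using that Poly_Mapping.keys_add [of p q] by blast
  moreover have "keys (smul a p) \<subseteq> A" if "keys p \<subseteq> A" for a and p :: "'x \<Rightarrow>\<^sub>0 'k"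
    using that keys_smul [of a p] by blast
  ultimately show ?thesis by (auto simp: pm.subspace_def)
qed

lemma linear_expand:
  fixes F :: "('x \<Rightarrow>\<^sub>0 'k::field) \<Rightarrow> ('y \<Rightarrow>\<^sub>0 'k)"
  assumes add: "\<And>p q. F (p + q) = F p + F q" and smul: "\<And>a p. F (smul a p) = smul a (F p)"
  shows "F p = lin_ext (\<lambda>w. F (single w 1)) p"
proof -
  have F0: "F 0 = 0" using add [of 0 0] by simp
  have sum: "F (sum f A) = (\<Sum>x\<in>A. F (f x))" for f :: "'x \<Rightarrow> 'x \<Rightarrow>\<^sub>0 'k" and A
    by (induction A rule: infinite_finite_induct) (simp_all add: F0 add)
  have "F p = F (lin_ext (\<lambda>x. single x 1) p)" by (simp only: lin_ext_ident)
  also have "\<dots> = lin_ext (\<lambda>w. F (single w 1)) p" unfolding lin_ext_def sum smul ..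
  finally show ?thesis .
qed

lemma lfun_swap: "lfun (\<lambda>w. lfun (\<lambda>x. f x w) p) q = lfun (\<lambda>x. lfun (f x) q) p"
  unfolding lfun_def sum_distrib_left by (subst sum.swap) (simp add: mult_ac)

section \<open>Homogeneous chains and null chains\<close>

context ainf_category
begin

definition homog :: "int \<Rightarrow> (('o, 'v) hmor list \<Rightarrow>\<^sub>0 'k) set" where
  "homog n = {c. keys c \<subseteq> {w \<in> hwords C. hdeg w = n}}"

lemma subspace_homog: "pm.subspace (homog n)"
  unfolding homog_def by (rule subspace_keys)

lemma single_homog: "w \<in> hwords C \<Longrightarrow> hdeg w = n \<Longrightarrow> single w a \<in> homog n"
  by (auto simp: homog_def)

lemma hwords_lin:
  assumes "us @ Mor \<kappa> e x # vs \<in> hwords C" "us @ Mor \<kappa> e y # vs \<in> hwords C"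
  shows "us @ Mor \<kappa> e (scl C \<alpha> x + scl C \<beta> y) # vs \<in> hwords C"
  using assms unfolding hwords_slot by (rule mpath_lin)

lemma subspace_null_chains: "pm.subspace (null_chains C)"
  unfolding null_chains_def by (rule pm.subspace_span)

lemma null_chains_subset:
  assumes "pm.subspace S"
    and "\<And>us vs \<kappa> e x y. us @ Mor \<kappa> e x # vs \<in> hwords C \<Longrightarrow> us @ Mor \<kappa> e y # vs \<in> hwords C \<Longrightarrow>
      single (us @ Mor \<kappa> e (x + y) # vs) 1 - single (us @ Mor \<kappa> e x # vs) 1 - single (us @ Mor \<kappa> e y # vs) 1 \<in> S"
    and "\<And>us vs \<kappa> e c x. us @ Mor \<kappa> e x # vs \<in> hwords C \<Longrightarrow>
      single (us @ Mor \<kappa> e (scl C c x) # vs) 1 - single (us @ Mor \<kappa> e x # vs) c \<in> S"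
    and "\<And>us vs \<kappa>. us \<noteq> [] \<Longrightarrow> us @ ident_mor C \<kappa> # vs \<in> hwords C \<Longrightarrow>
      single (us @ ident_mor C \<kappa> # vs) 1 \<in> S"
  shows "null_chains C \<subseteq> S"
  unfolding null_chains_def using assms(2-4) by (intro pm.span_minimal assms(1)) blast

text \<open>Each generating relation is homogeneous, so a linear condition on null chains may be
  tested on homogeneous ones. There signs that depend on the degree are constant.\<close>

lemma null_chains_homog_subset:
  assumes S: "pm.subspace S" and hom: "\<And>n b. b \<in> null_chains C \<Longrightarrow> b \<in> homog n \<Longrightarrow> b \<in> S"
  shows "null_chains C \<subseteq> S"
proof (rule null_chains_subset [OF S])
  fix us vs \<kappa> e x y assume w: "us @ Mor \<kappa> e x # vs \<in> hwords C" "us @ Mor \<kappa> e y # vs \<in> hwords C"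
  show "single (us @ Mor \<kappa> e (x + y) # vs) 1 - single (us @ Mor \<kappa> e x # vs) 1 - single (us @ Mor \<kappa> e y # vs) 1 \<in> S"
  proof (rule hom)
    show "single (us @ Mor \<kappa> e (x + y) # vs) 1 - single (us @ Mor \<kappa> e x # vs) 1 - single (us @ Mor \<kappa> e y # vs) 1 \<in> null_chains C"
      unfolding null_chains_def using w by (intro pm.span_base) blast
    have "us @ Mor \<kappa> e (x + y) # vs \<in> hwords C" using hwords_lin [OF w, of 1 1] by simp
    then show "single (us @ Mor \<kappa> e (x + y) # vs) 1 - single (us @ Mor \<kappa> e x # vs) 1 - single (us @ Mor \<kappa> e y # vs) 1
        \<in> homog (hdeg (us @ Mor \<kappa> e x # vs))"
      using w by (intro pm.subspace_diff subspace_homog single_homog) (simp_all add: hdeg_def sdeg_append sdeg_Cons)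
  qed
next
  fix us vs \<kappa> e c x assume w: "us @ Mor \<kappa> e x # vs \<in> hwords C"
  show "single (us @ Mor \<kappa> e (scl C c x) # vs) 1 - single (us @ Mor \<kappa> e x # vs) c \<in> S"
  proof (rule hom)
    show "single (us @ Mor \<kappa> e (scl C c x) # vs) 1 - single (us @ Mor \<kappa> e x # vs) c \<in> null_chains C"
      unfolding null_chains_def using w by (intro pm.span_base) blast
    have "us @ Mor \<kappa> e (scl C c x) # vs \<in> hwords C" using hwords_lin [OF w w, of c 0] by simp
    then show "single (us @ Mor \<kappa> e (scl C c x) # vs) 1 - single (us @ Mor \<kappa> e x # vs) c \<in> homog (hdeg (us @ Mor \<kappa> e x # vs))"
      using w by (intro pm.subspace_diff subspace_homog single_homog) (simp_all add: hdeg_def sdeg_append sdeg_Cons)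
  qed
next
  fix us vs \<kappa> assume w: "us \<noteq> []" "us @ ident_mor C \<kappa> # vs \<in> hwords C"
  show "single (us @ ident_mor C \<kappa> # vs) 1 \<in> S"
  proof (rule hom)
    show "single (us @ ident_mor C \<kappa> # vs) 1 \<in> null_chains C"
      unfolding null_chains_def using w by (intro pm.span_base) blast
    show "single (us @ ident_mor C \<kappa> # vs) 1 \<in> homog (hdeg (us @ ident_mor C \<kappa> # vs))"
      using w by (intro single_homog) simp_all
  qed
qed

lemma null_chains_hoch: "null_chains C \<subseteq> hoch_chains C"
proof (rule null_chains_homog_subset)
  show "pm.subspace (hoch_chains C)" unfolding hoch_chains_def by (rule subspace_keys)
qed (auto simp: homog_def hoch_chains_def)

text \<open>Null chains form a graded subspace. This yields the decomposition of relations by parity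
  demanded by \<open>even_form\<close>.\<close>

lemma part_null:
  assumes "c \<in> null_chains C"
  shows "part (\<lambda>w. P (hdeg w)) c \<in> null_chains C"
proof -
  let ?S = "{c. part (\<lambda>w. P (hdeg w)) c \<in> null_chains C}"
  have "null_chains C \<subseteq> ?S"
  proof (rule null_chains_homog_subset)
    show "pm.subspace ?S"
      using subspace_null_chains by (auto simp: pm.subspace_def part_add part_smul)
    fix n b assume b: "b \<in> null_chains C" "b \<in> homog n"
    have "part (\<lambda>w. P (hdeg w)) b = (if P n then b else 0)"
    proof (rule poly_mapping_eqI)
      fix w
      have "lookup b w = 0 \<or> hdeg w = n" using b(2) by (auto simp: homog_def in_keys_iff)
      then show "lookup (part (\<lambda>w. P (hdeg w)) b) w = lookup (if P n then b else 0) w"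
        by (auto simp: lookup_part)
    qed
    then show "b \<in> ?S" using b(1) pm.subspace_0 [OF subspace_null_chains] by simp
  qed
  then show ?thesis using assms by blast
qed

lemma mukai_lfun: "mukai C p q = lfun (\<lambda>a. lfun (mukai_word C a) q) p"
  by (simp add: mukai_def bilin_ext_lfun)

lemma mukai_homog:
  assumes p: "p \<in> homog n" and q: "q \<in> homog n'" and n: "n + n' \<noteq> 0"
  shows "mukai C p q = 0"
proof -
  have "mukai_word C a b = 0" if "a \<in> keys p" "b \<in> keys q" for a b
    using that p q n by (intro mukai_word_degree) (auto simp: homog_def)
  then show ?thesis unfolding mukai_lfun lfun_def by (simp add: sum.neutral)
qed

lemma mukai_null_left:
  assumes p: "p \<in> null_chains C" and q: "q \<in> hoch_chains C"
  shows "mukai C p q = 0"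
proof -
  have b: "b \<in> hwords C" if "b \<in> keys q" for b using that q by (auto simp: hoch_chains_def)
  let ?S = "{p. mukai C p q = 0}"
  have "null_chains C \<subseteq> ?S"
  proof (rule null_chains_subset)
    show "pm.subspace ?S" by (auto simp: pm.subspace_def mukai_lfun lfun_add lfun_smul)
    fix us vs \<kappa> e x y assume w: "us @ Mor \<kappa> e x # vs \<in> hwords C" "us @ Mor \<kappa> e y # vs \<in> hwords C"
    have "lfun (mukai_word C (us @ Mor \<kappa> e (x + y) # vs)) q =
        lfun (\<lambda>b. mukai_word C (us @ Mor \<kappa> e x # vs) b + mukai_word C (us @ Mor \<kappa> e y # vs) b) q"
      using mukai_word_lin_left [OF w b, of _ 1 1] by (intro lfun_cong) simp
    then show "single (us @ Mor \<kappa> e (x + y) # vs) 1 - single (us @ Mor \<kappa> e x # vs) 1 - single (us @ Mor \<kappa> e y # vs) 1 \<in> ?S"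
      by (simp add: mukai_lfun lfun_diff lfun_fun_add)
  next
    fix us vs \<kappa> e c x assume w: "us @ Mor \<kappa> e x # vs \<in> hwords C"
    have "lfun (mukai_word C (us @ Mor \<kappa> e (scl C c x) # vs)) q =
        lfun (\<lambda>b. c * mukai_word C (us @ Mor \<kappa> e x # vs) b) q"
      using mukai_word_lin_left [OF w w b, of _ c 0] by (intro lfun_cong) simp
    then show "single (us @ Mor \<kappa> e (scl C c x) # vs) 1 - single (us @ Mor \<kappa> e x # vs) c \<in> ?S"
      by (simp add: mukai_lfun lfun_diff lfun_fun_mult)
  next
    fix us vs \<kappa> assume w: "us \<noteq> []" "us @ ident_mor C \<kappa> # vs \<in> hwords C"
    then show "single (us @ ident_mor C \<kappa> # vs) 1 \<in> ?S"
      using mukai_word_ident_left [OF w b] by (simp add: mukai_lfun lfun_def sum.neutral)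
  qed
  then show ?thesis using p by blast
qed

lemma mukai_null_right:
  assumes p: "p \<in> hoch_chains C" and q: "q \<in> null_chains C"
  shows "mukai C p q = 0"
proof -
  have "lfun (mukai_word C a) q = 0" if "a \<in> keys p" for a
  proof -
    have a: "a \<in> hwords C" using that p by (auto simp: hoch_chains_def)
    let ?S = "{q. lfun (mukai_word C a) q = 0}"
    have "null_chains C \<subseteq> ?S"
    proof (rule null_chains_subset)
      show "pm.subspace ?S" by (auto simp: pm.subspace_def lfun_add lfun_smul)
      fix us vs \<kappa> e x y assume w: "us @ Mor \<kappa> e x # vs \<in> hwords C" "us @ Mor \<kappa> e y # vs \<in> hwords C"
      show "single (us @ Mor \<kappa> e (x + y) # vs) 1 - single (us @ Mor \<kappa> e x # vs) 1 - single (us @ Mor \<kappa> e y # vs) 1 \<in> ?S"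
        using mukai_word_lin_right [OF w a, of 1 1] by (simp add: lfun_diff)
    next
      fix us vs \<kappa> e c x assume w: "us @ Mor \<kappa> e x # vs \<in> hwords C"
      show "single (us @ Mor \<kappa> e (scl C c x) # vs) 1 - single (us @ Mor \<kappa> e x # vs) c \<in> ?S"
        using mukai_word_lin_right [OF w w a, of c 0] by (simp add: lfun_diff)
    next
      fix us vs \<kappa> assume w: "us \<noteq> []" "us @ ident_mor C \<kappa> # vs \<in> hwords C"
      show "single (us @ ident_mor C \<kappa> # vs) 1 \<in> ?S"
        using mukai_word_ident_right [OF w a] by simp
    qed
    then show ?thesis using q by blast
  qed
  then show ?thesis unfolding mukai_lfun lfun_def [of _ p] by (simp add: sum.neutral)
qed

end

section \<open>Coefficients of a splitting and the bilinear form built from them\<close>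

locale split_category = ainf_category C for C :: "('k::field_char_0, 'o, 'v::ab_group_add) ainf" +
  fixes s :: "nat \<Rightarrow> (('o, 'v) hmor list \<Rightarrow>\<^sub>0 'k) \<Rightarrow> (('o, 'v) hmor list \<Rightarrow>\<^sub>0 'k)"
  assumes split: "splitting C s"
begin

lemma s_linear: "s n (p + q) = s n p + s n q" "s n (smul a p) = smul a (s n p)"
proof -
  have "Vector_Spaces.linear smul smul (s n)" using split by (simp add: splitting_def)
  then interpret Vector_Spaces.linear smul smul "s n" .
  show "s n (p + q) = s n p + s n q" "s n (smul a p) = smul a (s n p)" by (rule add scale)+
qed

lemma s_null: "c \<in> null_chains C \<Longrightarrow> s n c \<in> null_chains C"
  using split by (simp add: splitting_def)

lemma s_homog:
  assumes "c \<in> homog k"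
  shows "s n c \<in> homog (k + 2 * int n)"
proof -
  have "s n c = lin_ext (\<lambda>w. s n (single w 1)) c" by (rule linear_expand) (rule s_linear)+
  also have "\<dots> \<in> homog (k + 2 * int n)"
    unfolding lin_ext_def
  proof (intro pm.subspace_sum pm.subspace_scale subspace_homog)
    fix w assume "w \<in> keys c"
    then have "w \<in> hwords C" "hdeg w = k" using assms by (auto simp: homog_def)
    then show "s n (single w 1) \<in> homog (k + 2 * int n)"
      using split by (auto simp: splitting_def homog_def)
  qed
  finally show ?thesis .
qed

lemma inv_coeff_add: "inv_coeff s n (p + q) = inv_coeff s n p + inv_coeff s n q"
proof (induction n rule: less_induct)
  case (less n)
  show ?case
  proof (cases n)
    case (Suc m)
    have "s l (inv_coeff s (Suc m - l) (p + q)) = s l (inv_coeff s (Suc m - l) p) + s l (inv_coeff s (Suc m - l) q)"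
      if "l \<in> {1..Suc m}" for l
      using less.IH [of "Suc m - l"] that Suc by (simp add: s_linear)
    then have "(\<Sum>l\<in>{1..Suc m}. s l (inv_coeff s (Suc m - l) (p + q))) =
        (\<Sum>l\<in>{1..Suc m}. s l (inv_coeff s (Suc m - l) p)) + (\<Sum>l\<in>{1..Suc m}. s l (inv_coeff s (Suc m - l) q))"
      unfolding sum.distrib [symmetric] by (intro sum.cong refl)
    then show ?thesis unfolding Suc inv_coeff.simps by (simp only: minus_add_distrib)
  qed simp
qed

lemma inv_coeff_smul: "inv_coeff s n (smul a p) = smul a (inv_coeff s n p)"
proof (induction n rule: less_induct)
  case (less n)
  show ?case
  proof (cases n)
    case (Suc m)
    have "s l (inv_coeff s (Suc m - l) (smul a p)) = smul a (s l (inv_coeff s (Suc m - l) p))"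
      if "l \<in> {1..Suc m}" for l
      using less.IH [of "Suc m - l"] that Suc by (simp add: s_linear)
    then show ?thesis
      unfolding Suc inv_coeff.simps pm.scale_minus_right pm.scale_sum_right
      by (intro arg_cong [where f = uminus] sum.cong refl)
  qed simp
qed

lemma inv_coeff_null: "c \<in> null_chains C \<Longrightarrow> inv_coeff s n c \<in> null_chains C"
proof (induction n rule: less_induct)
  case (less n)
  show ?case
  proof (cases n)
    case (Suc m)
    have "s l (inv_coeff s (Suc m - l) c) \<in> null_chains C" if "l \<in> {1..Suc m}" for l
      using less.IH [of "Suc m - l"] less.prems that Suc by (intro s_null) simp
    then show ?thesis
      unfolding Suc inv_coeff.simps by (intro pm.subspace_neg pm.subspace_sum subspace_null_chains)
  qed (use less.prems in simp)
qed

lemma inv_coeff_homog: "c \<in> homog k \<Longrightarrow> inv_coeff s n c \<in> homog (k + 2 * int n)"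
proof (induction n rule: less_induct)
  case (less n)
  show ?case
  proof (cases n)
    case (Suc m)
    have "s l (inv_coeff s (Suc m - l) c) \<in> homog (k + 2 * int n)" if "l \<in> {1..Suc m}" for l
    proof -
      have "k + 2 * int n = k + 2 * int (Suc m - l) + 2 * int l" using that Suc by simp
      moreover have "s l (inv_coeff s (Suc m - l) c) \<in> homog (k + 2 * int (Suc m - l) + 2 * int l)"
        using less.IH [of "Suc m - l"] less.prems that Suc by (intro s_homog) simp
      ultimately show ?thesis by (simp only: )
    qed
    then have "- (\<Sum>l\<in>{1..Suc m}. s l (inv_coeff s (Suc m - l) c)) \<in> homog (k + 2 * int n)"
      by (intro pm.subspace_neg pm.subspace_sum subspace_homog)
    then show ?thesis using Suc by simp
  qed (use less.prems in simp)
qed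

text \<open>The operator inside the form \<open>H\<close>. Isolating it reduces questions about
  \<open>H\<close> to the Mukai pairing and to the fact that this operator preserves null chains and
  is homogeneous.\<close>

definition transfer_map :: "nat \<Rightarrow> nat \<Rightarrow> (('o, 'v) hmor list \<Rightarrow>\<^sub>0 'k) \<Rightarrow> (('o, 'v) hmor list \<Rightarrow>\<^sub>0 'k)" where
  "transfer_map i j c = (\<Sum>l\<le>j. s l (inv_coeff s (i + j + 1 - l) c))"

lemma transfer_map_expand: "transfer_map i j c = lin_ext (\<lambda>w. transfer_map i j (single w 1)) c"
proof (rule linear_expand)
  show "transfer_map i j (p + q) = transfer_map i j p + transfer_map i j q" for p q
    unfolding transfer_map_def inv_coeff_add s_linear sum.distrib ..
  show "transfer_map i j (smul a p) = smul a (transfer_map i j p)" for a p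
    unfolding transfer_map_def inv_coeff_smul s_linear pm.scale_sum_right ..
qed

lemma transfer_map_null: "c \<in> null_chains C \<Longrightarrow> transfer_map i j c \<in> null_chains C"
  unfolding transfer_map_def by (intro pm.subspace_sum subspace_null_chains s_null inv_coeff_null)

lemma transfer_map_homog:
  assumes "c \<in> homog k"
  shows "transfer_map i j c \<in> homog (k + 2 * int (i + j + 1))"
  unfolding transfer_map_def
proof (intro pm.subspace_sum subspace_homog)
  fix l assume "l \<in> {..j}"
  then have eq: "k + 2 * int (i + j + 1) = k + 2 * int (i + j + 1 - l) + 2 * int l" by auto
  show "s l (inv_coeff s (i + j + 1 - l) c) \<in> homog (k + 2 * int (i + j + 1))"
    unfolding eq by (rule s_homog [OF inv_coeff_homog [OF assms]])
qed

lemma H_form_transfer: "H_form C d s (\<alpha>, i) (\<beta>, j) =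
    psign (d * hdeg \<alpha> + int j) * mukai C (transfer_map i j (single \<alpha> 1)) (single \<beta> 1)"
  by (simp add: H_form_def transfer_map_def)

text \<open>The operator raises the homological degree by 2 (i + j + 1), so a non-zero value forces
  \<open>hdeg \<alpha> + hdeg \<beta>\<close> to be -2 (i + j + 1). Inserted in the degrees 2 - d -
  \<open>hdeg\<close> - 2i of the algebra this gives 6 - 2d, an even number.\<close>

lemma H_form_degree:
  assumes "x \<in> gens (H_space C d)" "y \<in> gens (H_space C d)" "H_form C d s x y \<noteq> 0"
  shows "gdeg (H_space C d) x + gdeg (H_space C d) y = 6 - 2 * d"
proof -
  obtain \<alpha> i \<beta> j where xy: "x = (\<alpha>, i)" "y = (\<beta>, j)" by (cases x; cases y)
  have w: "\<alpha> \<in> hwords C" "\<beta> \<in> hwords C" using assms(1,2) xy by (auto simp: H_space_def)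
  have "transfer_map i j (single \<alpha> 1) \<in> homog (hdeg \<alpha> + 2 * int (i + j + 1))"
    by (intro transfer_map_homog single_homog w refl)
  moreover have "single \<beta> 1 \<in> homog (hdeg \<beta>)" by (intro single_homog w refl)
  moreover have "mukai C (transfer_map i j (single \<alpha> 1)) (single \<beta> 1) \<noteq> 0"
    using assms(3) unfolding xy H_form_transfer by auto
  ultimately have "hdeg \<alpha> + 2 * int (i + j + 1) + hdeg \<beta> = 0" using mukai_homog by blast
  then show ?thesis by (simp add: xy H_space_def)
qed

text \<open>Both halves of the symmetrization vanish, one because the null chain enters the first
  argument of the Mukai pairing through \<open>transfer_map\<close>, the other because it enters the
  second argument directly.\<close>

lemma H_sym_null:
  assumes c: "c \<in> null_chains C" and \<beta>: "\<beta> \<in> hwords C"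
  shows "lfun (\<lambda>w. H_sym C d s (w, i) (\<beta>, j)) c = 0"
proof -
  let ?\<phi> = "\<lambda>w. H_sym C d s (w, i) (\<beta>, j)"
  let ?S = "{c. lfun ?\<phi> c = 0}"
  have "null_chains C \<subseteq> ?S"
  proof (rule null_chains_homog_subset)
    show "pm.subspace ?S" by (auto simp: pm.subspace_def lfun_add lfun_smul)
    fix n b assume b: "b \<in> null_chains C" "b \<in> homog n"
    have left: "lfun (\<lambda>w. mukai C (transfer_map i j (single w 1)) (single \<beta> 1)) b = 0"
    proof -
      have "lfun (\<lambda>w. mukai C (transfer_map i j (single w 1)) (single \<beta> 1)) b = mukai C (transfer_map i j b) (single \<beta> 1)"
        unfolding transfer_map_expand [of i j b] mukai_lfun lfun_comp ..
      also have "\<dots> = 0"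
        by (rule mukai_null_left) (use b \<beta> transfer_map_null in \<open>auto simp: hoch_chains_def\<close>)
      finally show ?thesis .
    qed
    have right: "lfun (\<lambda>w. mukai C (transfer_map j i (single \<beta> 1)) (single w 1)) b = 0"
    proof -
      have "lfun (\<lambda>w. mukai C (transfer_map j i (single \<beta> 1)) (single w 1)) b = mukai C (transfer_map j i (single \<beta> 1)) b"
        unfolding mukai_lfun lfun_single mult_1_left by (rule lfun_swap)
      also have "\<dots> = 0"
      proof (rule mukai_null_right [OF _ b(1)])
        have "transfer_map j i (single \<beta> 1) \<in> homog (hdeg \<beta> + 2 * int (j + i + 1))"
          by (intro transfer_map_homog single_homog \<beta> refl)
        then show "transfer_map j i (single \<beta> 1) \<in> hoch_chains C" by (auto simp: homog_def hoch_chains_def)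
      qed
      finally show ?thesis .
    qed
    \<comment> \<open>On a homogeneous null chain the sign factors of the two halves are constants
      and can be taken out of the sum.\<close>
    define A B :: 'k where "A = psign (d * n + int j) / 2"
      and "B = psign ((2 - d - n - 2 * int i) * (2 - d - hdeg \<beta> - 2 * int j)) * psign (d * hdeg \<beta> + int i) / 2"
    have "lfun ?\<phi> b = lfun (\<lambda>w. A * mukai C (transfer_map i j (single w 1)) (single \<beta> 1) +
        B * mukai C (transfer_map j i (single \<beta> 1)) (single w 1)) b"
    proof (rule lfun_cong)
      fix w assume "w \<in> keys b"
      then have n: "hdeg w = n" using b(2) by (auto simp: homog_def)
      show "?\<phi> w = A * mukai C (transfer_map i j (single w 1)) (single \<beta> 1) +
          B * mukai C (transfer_map j i (single \<beta> 1)) (single w 1)"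
        unfolding H_sym_def H_form_transfer by (simp add: H_space_def n A_def B_def add_divide_distrib)
    qed
    then show "b \<in> ?S" unfolding lfun_fun_add lfun_fun_mult left right by simp
  qed
  then show ?thesis using c by blast
qed

lemma H_sym_even_form: "even_form (H_space C d) (H_sym C d s)"
proof
  fix x y
  have "psign n * psign n = (1 :: 'k)" for n by (simp add: psign_def)
  then have "psign n * (psign n * z) = z" for n and z :: 'k by (metis mult.assoc mult_1_left)
  then show "H_sym C d s x y = psign (gdeg (H_space C d) x * gdeg (H_space C d) y) * H_sym C d s y x"
    by (simp add: H_sym_def mult.commute distrib_left)
next
  fix x y assume xy: "x \<in> gens (H_space C d)" "y \<in> gens (H_space C d)" and "H_sym C d s x y \<noteq> 0"
  then have "H_form C d s x y \<noteq> 0 \<or> H_form C d s y x \<noteq> 0" by (auto simp: H_sym_def)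
  then have "gdeg (H_space C d) x + gdeg (H_space C d) y = 6 - 2 * d"
    using H_form_degree [OF xy] H_form_degree [OF xy(2,1)] by (auto simp: add.commute)
  then show "even (gdeg (H_space C d) x + gdeg (H_space C d) y)" by simp
next
  fix r y assume "r \<in> rels (H_space C d)" "y \<in> gens (H_space C d)"
  then obtain c i \<beta> j where r: "r = lin_ext (\<lambda>w. single (w, i) 1) c" "c \<in> null_chains C"
    and y: "y = (\<beta>, j)" "\<beta> \<in> hwords C" by (auto simp: H_space_def)
  have "(\<Sum>x\<in>keys r. lookup r x * H_sym C d s x y) = lfun (\<lambda>x. H_sym C d s x y) r" by (simp add: lfun_def)
  also have "\<dots> = lfun (\<lambda>w. H_sym C d s (w, i) (\<beta>, j)) c" by (simp add: r(1) y(1) lfun_comp)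
  also have "\<dots> = 0" by (rule H_sym_null [OF r(2) y(2)])
  finally show "(\<Sum>x\<in>keys r. lookup r x * H_sym C d s x y) = 0" .
next
  have keys: "keys (lin_ext (\<lambda>w. single (w, i) 1) c) \<subseteq> (\<lambda>w. (w, i)) ` keys c" for c and i :: nat
    using keys_lin_ext [of "\<lambda>w. single (w, i) 1" c] by auto
  fix r assume "r \<in> rels (H_space C d)"
  then obtain c i where r: "r = lin_ext (\<lambda>w. single (w, i) 1) c" "c \<in> null_chains C"
    by (auto simp: H_space_def)
  have "keys c \<subseteq> hwords C" using r(2) null_chains_hoch by (auto simp: hoch_chains_def)
  then show "keys r \<subseteq> gens (H_space C d)" using keys [of i c] r(1) by (auto simp: H_space_def)
  \<comment> \<open>The parity of the degree of (w, i) in the algebra, as a function of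
    \<open>hdeg w\<close>; splitting the null chain by it keeps both parts null.\<close>
  let ?P = "\<lambda>n. even (2 - d - n - 2 * int i)"
  define c0 c1 where "c0 = part (\<lambda>w. ?P (hdeg w)) c" and "c1 = part (\<lambda>w. \<not> ?P (hdeg w)) c"
  have c: "c0 \<in> null_chains C" "c1 \<in> null_chains C"
    unfolding c0_def c1_def using part_null [OF r(2), of ?P] part_null [OF r(2), of "\<lambda>n. \<not> ?P n"] by auto
  show "\<exists>r0\<in>rels (H_space C d). \<exists>r1\<in>rels (H_space C d). r = r0 + r1 \<and>
      (\<forall>x\<in>keys r0. even (gdeg (H_space C d) x)) \<and> (\<forall>x\<in>keys r1. odd (gdeg (H_space C d) x))"
  proof (intro bexI conjI ballI)
    have "c = c0 + c1" unfolding c0_def c1_def by (rule part_split)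
    then show "r = lin_ext (\<lambda>w. single (w, i) 1) c0 + lin_ext (\<lambda>w. single (w, i) 1) c1"
      unfolding r(1) lin_ext_add [symmetric] by simp
    show "even (gdeg (H_space C d) x)" if "x \<in> keys (lin_ext (\<lambda>w. single (w, i) 1) c0)" for x
      using that keys [of i c0] by (auto simp: H_space_def c0_def keys_part)
    show "odd (gdeg (H_space C d) x)" if "x \<in> keys (lin_ext (\<lambda>w. single (w, i) 1) c1)" for x
      using that keys [of i c1] by (auto simp: H_space_def c1_def keys_part)
    show "lin_ext (\<lambda>w. single (w, i) 1) c0 \<in> rels (H_space C d)"
      "lin_ext (\<lambda>w. single (w, i) 1) c1 \<in> rels (H_space C d)"
      using c by (auto simp: H_space_def)
  qed
qed

end

theorem theorem5p2p1:
  fixes C :: "('k::field_char_0, 'o, 'v::ab_group_add) ainf"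
    and pr :: "('o, 'v) hmor \<Rightarrow> ('o, 'v) hmor \<Rightarrow> 'k"
    and d :: int
    and s :: "nat \<Rightarrow> (('o, 'v) hmor list \<Rightarrow>\<^sub>0 'k) \<Rightarrow> (('o, 'v) hmor list \<Rightarrow>\<^sub>0 'k)"
    and x :: "nat \<Rightarrow> (nat \<Rightarrow> (('o, 'v) hmor list \<times> nat) list \<Rightarrow>\<^sub>0 'k) set"
    and p :: "nat \<Rightarrow> int"
    and m i j :: nat
  assumes "cyclic_A_infinity_category C pr d"
    and "splitting C s"
    and "m > 1"
    and "\<And>l. l \<in> {1..m} \<Longrightarrow> x l \<in> Fock_parity C d (p l)"
    and "i \<in> {1..m}" and "j \<in> {1..m}" and "i \<noteq> j"
  shows
    "koszul p (i # j # filter (\<lambda>l. l \<noteq> i \<and> l \<noteq> j) [1..<Suc m]) \<odot>\<^bsub>Fock C d\<^esub>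
       K_map C d s ((x i \<otimes>\<^bsub>Fock C d\<^esub> x j) # map x (filter (\<lambda>l. l \<noteq> i \<and> l \<noteq> j) [1..<Suc m]))
     = (gamma_elt C d \<otimes>\<^bsub>Fock C d\<^esub> K_map C d s (map x [1..<Suc m])) \<oplus>\<^bsub>Fock C d\<^esub>
       finsum (Fock C d)
         (\<lambda>(L1, L2).
            koszul p (sorted_list_of_set L1 @ sorted_list_of_set L2) \<odot>\<^bsub>Fock C d\<^esub>
              (K_map C d s (map x (sorted_list_of_set L1)) \<otimes>\<^bsub>Fock C d\<^esub>
               K_map C d s (map x (sorted_list_of_set L2))))
         {(L1, L2). L1 \<union> L2 = {1..m} \<and> L1 \<inter> L2 = {} \<and> i \<in> L1 \<and> j \<in> L2}"
proof -
  interpret split_category C s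
    using assms(1,2) by unfold_locales (simp_all add: cyclic_A_infinity_category_def)
  interpret even_form "H_space C d" "H_sym C d s" by (rule H_sym_even_form)
  have X: "x l \<in> carrier (sym_series (H_space C d))" if "l \<in> {1..m}" for l
    using assms(4) [OF that] by (simp add: Fock_parity_def Fock_def)
  have par: "\<exists>y\<in>x l. \<forall>g. \<forall>w\<in>keys (y g). even (sum_list (map deg w) - p l)" if l: "l \<in> {1..m}" for l
  proof -
    obtain y where "y \<in> x l"
      and y: "\<And>g w. w \<in> keys (y g) \<Longrightarrow> even (sum_list (map deg w) + int g * (6 - 2 * d) - p l)"
      using assms(4) [OF l] by (auto simp: Fock_parity_def)
    \<comment> \<open>Since gamma has even degree, its powers do not affect the parity of a
      word.\<close>
    moreover have "even (sum_list (map deg w) - p l)" if "w \<in> keys (y g)" for g w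
      using y [OF that] by simp
    ultimately show ?thesis by blast
  qed
  show ?thesis
    using graph_sum_product [OF X par assms(5-7)]
    unfolding Fock_def gamma_elt_def K_map_def bipartitions_def .
qed

end
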